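(* Assume that the following is given: (i) a rooted forest straight-line program (f-SLP) $\mathcal{F}=(V,E,\lambda)$ over $\Sigma$ with height $h(\mathcal{F})=\Theta(\log N_{\mathcal{F}})$, together with the type $\tau(B)$, the leaf size $s(B)$ and the left size $\ell(B)$ (the latter only if $\tau(B)=1$) for all $B\in V$; (ii) the preorder number $k$ of a vertex $v$ of the forest $[\![\mathcal{F}]\!]$; (iii) a symbol $a\in\Sigma$. Then one can compute in time $\mathcal{O}(\log N_{\mathcal{F}})$ a rooted $\tilde V$-extension $\mathcal{F}'$ of $\mathcal{F}$ (for some set $\tilde V$ of new vertices) such that - $[\![\mathcal{F}']\!]=\mathrm{relabel}([\![\mathcal{F}]\!],v,a)$, - $h(\mathcal{F}')=h(\mathcal{F})=\Theta(\log N_{\mathcal{F}})$, and - $|\tilde V|=\mathcal{O}(\log N_{\mathcal{F}})$. If in addition the enumeration data structure for $\mathcal{F}$ and some deterministic bottom-up tree automaton (dBUTA) $\mathcal{B}$ with state set $Q$ is given, then one can also compute the enumeration data structure for $\mathcal{F}'$ and $\mathcal{B}$ in time $\mathcal{O}(|Q|^2\cdot\log N_{\mathcal{F}})$.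
   Context: Forests and forest algebra. $\Sigma$ is a finite alphabet; a forest is a finite ordered sequence of finite rooted ordered unranked $\Sigma$-labelled trees; preorder numbers start at $0$ (depth-first, left-to-right). $\mathrm{relabel}(F,v,a)$ is $F$ with the label of $v$ changed to $a$. Let $\ast\notin\Sigma$. A forest context is a forest over $\Sigma\cup\{\ast\}$ with exactly one $\ast$, at a leaf. $F_1\ominus F_2$ (defined if at most one is a context) concatenates the sequences of trees; $F_1\odot F_2$ (defined if $F_1$ is a context) replaces $\ast$ in $F_1$ by $F_2$. $a_\ast$ is the context $a(\ast)$. A forest algebra expression is a binary tree with inner labels $\ominus,\odot$ and leaf labels $a,a_\ast$ ($a\in\Sigma$); it is valid if all operations are defined; its type is $0$ (value a forest) or $1$ (value a context). f-SLPs. A binary DAG $(V,E,\lambda)$ is a vertex-labelled acyclic directed graph with $E\subseteq V\times\{\ell,r\}\times V$ where each vertex either is a leaf or has exactly one outgoing $\ell$-edge (to its left child) and exactly one outgoing $r$-edge (to its right child). $\mathrm{unfold}(A)$ is the binary tree of all paths starting in $A$, each labelled with the label of its terminal vertex. An f-SLP is a binary DAG such that every $\mathrm{unfold}(A)$ is a valid forest algebra expression; $[\![A]\!]$ is its value and $\tau(A)$ its type. A rooted f-SLP $\mathcal F$ has in addition a distinguished root vertex $S$; $[\![\mathcal{F}]\!]=[\![S]\!]$ is the represented forest, $N_{\mathcal{F}}$ its number of vertices, and $h(\mathcal{F})$ is the maximal length of a path from $S$ to a leaf. In the given $\mathcal F$ all vertices are reachable from $S$. Leaf size: $s(B)$ is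 the number of vertices of $[\![B]\!]$ not counting $\ast$. Left size: if $\tau(B)=1$, $\ell(B)$ is the preorder number of $\ast$ in $[\![B]\!]$. For $\tilde V\cap V=\emptyset$, a $\tilde V$-extension of $(V,E,\lambda)$ is an f-SLP $(V\cup\tilde V,E',\lambda')$ with $E'\cap(V\times\{\ell,r\}\times V)=E$ and $\lambda'=\lambda$ on $V$ (so old vertices keep their labels and outgoing edges); a rooted extension may have a new root. The RAM has register length $\mathcal{O}(|\mathcal{F}|)$, where $|\mathcal{F}|=|V|+|E|$. dBUTA. $\mathcal{B}=(Q,\Sigma_0\times\{0,1\},\Sigma_2,\delta_0,\delta_2,Q_f)$ with $\Sigma_0=\{a,a_\ast:a\in\Sigma\}$, $\Sigma_2=\{\ominus,\odot\}$, $\delta_0:\Sigma_0\times\{0,1\}\to Q$, $\delta_2:Q\times Q\times\Sigma_2\to Q$, $Q_f\subseteq Q$. For a binary tree $T$ with leaf labels in $\Sigma_0$ and inner labels in $\Sigma_2$ and a set $S$ of leaves of $T$, $\mathcal{B}(T,S)$ is the state reached at the root when leaves with label $c$ get state $\delta_0(c,1)$ if in $S$ and $\delta_0(c,0)$ otherwise, and an inner $f$-labelled vertex gets $\delta_2(q_1,q_2,f)$ for the states $q_1,q_2$ of its left and right child. Enumeration data structure for $\mathcal{F}$ and $\mathcal{B}$. It consists of the following data (1)-(4). (1) The sets $\mathrm{Conf}^x(\mathcal{F})\subseteq V\times Q$, $x\in\{a,u,\emptyset\}$: $(v,q)\in\mathrm{Conf}^\emptyset$ iff $q=\mathcal{B}(\mathrm{unfold}(v),\emptyset)$;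 $(v,q)\in\mathrm{Conf}^a$ iff $q=\mathcal{B}(\mathrm{unfold}(v),S)$ for some nonempty set $S$ of leaves of $\mathrm{unfold}(v)$; $(v,q)\in\mathrm{Conf}^u$ iff such an $S$ exists that, in addition, contains a leaf below each child of the root of $\mathrm{unfold}(v)$. (2) For each $(v,q)\in\mathrm{Conf}^u$ with $v$ inner, labelled $f$, with left child $v_1$ and right child $v_2$: a linear order on $\{(v_1,q_1,v_2,q_2):(v_1,q_1),(v_2,q_2)\in\mathrm{Conf}^a,\ \delta_2(q_1,q_2,f)=q\}$. (3) The preorder effect $f_e$ of every edge $e$, where for a vertex $u$ with left child $v_1$ and right child $v_2$ the effects of the left / right edge are: label $\ominus$, types $(\tau(v_1),\tau(v_2))=(0,0)$: $x\mapsto x$ / $x\mapsto x+s(v_1)$; $\ominus$, $(0,1)$: $(x,y)\mapsto x$ / $(x,y)\mapsto(x+s(v_1),y)$; $\ominus$, $(1,0)$: $(x,y)\mapsto(x,y)$ / $(x,y)\mapsto x+s(v_1)+y$; $\odot$, $(1,0)$: $x\mapsto(x,s(v_2))$ / $x\mapsto x+\ell(v_1)$; $\odot$, $(1,1)$: $(x,y)\mapsto(x,y+s(v_2))$ / $(x,y)\mapsto(x+\ell(v_1),y)$. (4) The binary DAG $(\mathcal{F}\otimes\mathcal{B})_b$ together with $\omega_r[v],\gamma_r[v]$ for all its vertices $v$. Here $\mathcal{F}\otimes\mathcal{B}$ has vertex set $\mathrm{Conf}^a$ and an edge $((u,p),d,(v,q))$, decorated with $f_{(u,d,v)}$, iff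 for some $(v',q')\in\mathrm{Conf}^\emptyset$, with $f$ the label of $u$, either $d=\ell$, $(u,\ell,v),(u,r,v')\in E$, $\delta_2(q,q',f)=p$, or $d=r$, $(u,r,v),(u,\ell,v')\in E$, $\delta_2(q',q,f)=p$. With target set $V_0=\mathrm{Conf}^u$, the DAG $(\mathcal{F}\otimes\mathcal{B})_b$ arises as follows. (a) Repeatedly remove outdegree-$0$ vertices not in $V_0$. (b) For each $v\in V_0$ with an outgoing edge add a new sink $v'$ and an edge $v\to v'$ decorated with the identity, and replace $v$ by $v'$ in $V_0$. (c) Redirect each edge leading to a vertex $u$ of outdegree $1$ to the first vertex of outdegree $\neq1$ on the unique path from $u$, composing decorations along the way; then remove outdegree-$1$ vertices, storing them with their decorated outgoing edges in a table. (d) For each vertex $u_1$ with $d\ge3$ outgoing edges to $v_1,\dots,v_d$ add vertices $u_2,\dots,u_{d-1}$, right edges $u_k\to u_{k+1}$ ($1\le k\le d-2$) decorated with the identity, left edges $u_k\to v_k$ ($1\le k\le d-1$) and a right edge $u_{d-1}\to v_d$ with the original decorations; the two outgoing edges of a vertex of outdegree $2$ are its left and right edge. Finally, $\omega_r[v]$ is the leaf reached from $v$ by following right edges only, and $\gamma_r[v]$ is the composition of the decorations along this path. *)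

theory Defs
  imports Complex_Main
begin

section \<open>Forests and forest algebra\<close>

datatype 'b rose = Node 'b "'b rose list"

type_synonym 'b forest = "'b rose list"

primrec root_label :: "'b rose \<Rightarrow> 'b" where
  "root_label (Node b ts) = b"

primrec children :: "'b rose \<Rightarrow> 'b forest" where
  "children (Node b ts) = ts"

text \<open>A vertex of a forest is a nonempty list of positions: \<open>[i]\<close> is the root of the
  \<open>i\<close>-th tree, and \<open>i # p\<close> is the vertex \<open>p\<close> of the forest of children of that root.
  The preorder number of a vertex is its index in \<open>preorder F\<close>.\<close>

type_synonym vertex = "nat list"

fun shift :: "vertex \<Rightarrow> vertex" where
  "shift [] = []"
| "shift (i # p) = Suc i # p"

fun preorder :: "'b forest \<Rightarrow> vertex list" where
  "preorder [] = []"
| "preorder (Node b ts # us) = [0] # map ((#) 0) (preorder ts) @ map shift (preorder us)"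

definition vertices :: "'b forest \<Rightarrow> vertex set" where
  "vertices F = set (preorder F)"

definition is_preorder_number :: "'b forest \<Rightarrow> vertex \<Rightarrow> nat \<Rightarrow> bool" where
  "is_preorder_number F v k \<longleftrightarrow> k < length (preorder F) \<and> preorder F ! k = v"

fun tree_at :: "'b forest \<Rightarrow> vertex \<Rightarrow> 'b rose" where
  "tree_at F [] = undefined"
| "tree_at F [i] = F ! i"
| "tree_at F (i # p) = tree_at (children (F ! i)) p"

definition label_at :: "'b forest \<Rightarrow> vertex \<Rightarrow> 'b" where
  "label_at F v = root_label (tree_at F v)"

fun relabel :: "'b forest \<Rightarrow> vertex \<Rightarrow> 'b \<Rightarrow> 'b forest" where
  "relabel F [] a = F"
| "relabel F [i] a = F[i := Node a (children (F ! i))]"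
| "relabel F (i # p) a = F[i := Node (root_label (F ! i)) (relabel (children (F ! i)) p a)]"

text \<open>Forests and forest contexts over \<open>\<Sigma>\<close> are forests over \<open>\<Sigma> \<union> {*}\<close>; here \<open>\<Sigma>\<close> is
  the type \<open>'a\<close>, a letter \<open>a\<close> is \<open>Some a\<close>, and \<open>*\<close> is \<open>None\<close>.\<close>

definition is_forest :: "'a option forest \<Rightarrow> bool" where
  "is_forest F \<longleftrightarrow> (\<forall>v \<in> vertices F. label_at F v \<noteq> None)"

definition is_context :: "'a option forest \<Rightarrow> bool" where
  "is_context F \<longleftrightarrow>
     (\<exists>!v. v \<in> vertices F \<and> label_at F v = None) \<and>
     (\<forall>v \<in> vertices F. label_at F v = None \<longrightarrow> children (tree_at F v) = [])"

fun plug :: "'a option forest \<Rightarrow> 'a option forest \<Rightarrow> 'a option forest" where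
  "plug [] G = []"
| "plug (Node None ts # us) G = G @ plug us G"
| "plug (Node (Some a) ts # us) G = Node (Some a) (plug ts G) # plug us G"

definition hcat :: "'a option forest \<Rightarrow> 'a option forest \<Rightarrow> 'a option forest option" where
  "hcat F G = (if is_context F \<and> is_context G then None else Some (F @ G))"

definition vcomp :: "'a option forest \<Rightarrow> 'a option forest \<Rightarrow> 'a option forest option" where
  "vcomp F G = (if is_context F then Some (plug F G) else None)"

text \<open>The labels \<open>a\<close>, \<open>a\<^sub>*\<close>, \<open>\<ominus>\<close> (\<open>HCat\<close>) and \<open>\<odot>\<close> (\<open>VComp\<close>).\<close>

datatype 'a label = Sym 'a | SymStar 'a | HCat | VComp

definition Sigma0 :: "'a label set" where
  "Sigma0 = range Sym \<union> range SymStar"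

definition Sigma2 :: "'a label set" where
  "Sigma2 = {HCat, VComp}"

datatype 'l btree = BLeaf 'l | BNode 'l "'l btree" "'l btree"

text \<open>The value of a forest algebra expression; it is \<open>None\<close> iff the tree is not a valid
  expression.\<close>

fun eval_expr :: "'a label btree \<Rightarrow> 'a option forest option" where
  "eval_expr (BLeaf (Sym a)) = Some [Node (Some a) []]"
| "eval_expr (BLeaf (SymStar a)) = Some [Node (Some a) [Node None []]]"
| "eval_expr (BNode HCat s t) =
     Option.bind (eval_expr s) (\<lambda>F. Option.bind (eval_expr t) (\<lambda>G. hcat F G))"
| "eval_expr (BNode VComp s t) =
     Option.bind (eval_expr s) (\<lambda>F. Option.bind (eval_expr t) (\<lambda>G. vcomp F G))"
| "eval_expr _ = None"


section \<open>Binary DAGs and f-SLPs\<close>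

datatype dir = L | R

primrec opp :: "dir \<Rightarrow> dir" where
  "opp L = R"
| "opp R = L"

record ('v, 'l) bdag =
  verts :: "'v set"
  edges :: "('v \<times> dir \<times> 'v) set"
  label :: "'v \<Rightarrow> 'l"

record ('v, 'l) rooted_bdag = "('v, 'l) bdag" +
  root_vertex :: 'v

definition adj :: "('v, 'l, 'z) bdag_scheme \<Rightarrow> ('v \<times> 'v) set" where
  "adj D = {(u, v). \<exists>d. (u, d, v) \<in> edges D}"

definition is_leaf :: "('v, 'l, 'z) bdag_scheme \<Rightarrow> 'v \<Rightarrow> bool" where
  "is_leaf D v \<longleftrightarrow> (\<forall>d w. (v, d, w) \<notin> edges D)"

definition child :: "('v, 'l, 'z) bdag_scheme \<Rightarrow> 'v \<Rightarrow> dir \<Rightarrow> 'v" where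
  "child D v d = (THE w. (v, d, w) \<in> edges D)"

definition binary_dag :: "('v, 'l, 'z) bdag_scheme \<Rightarrow> bool" where
  "binary_dag D \<longleftrightarrow>
     finite (verts D) \<and>
     edges D \<subseteq> verts D \<times> UNIV \<times> verts D \<and>
     acyclic (adj D) \<and>
     (\<forall>v \<in> verts D. is_leaf D v \<or> (\<forall>d. \<exists>!w. (v, d, w) \<in> edges D))"

inductive unfolds :: "('v, 'l, 'z) bdag_scheme \<Rightarrow> 'v \<Rightarrow> 'l btree \<Rightarrow> bool" for D where
  leaf: "v \<in> verts D \<Longrightarrow> is_leaf D v \<Longrightarrow> unfolds D v (BLeaf (label D v))"
| inner: "(v, L, v1) \<in> edges D \<Longrightarrow> (v, R, v2) \<in> edges D \<Longrightarrow>
    unfolds D v1 t1 \<Longrightarrow> unfolds D v2 t2 \<Longrightarrow> unfolds D v (BNode (label D v) t1 t2)"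

definition unfold :: "('v, 'l, 'z) bdag_scheme \<Rightarrow> 'v \<Rightarrow> 'l btree" where
  "unfold D v = (THE t. unfolds D v t)"

definition f_slp :: "('v, 'a label, 'z) bdag_scheme \<Rightarrow> bool" where
  "f_slp D \<longleftrightarrow> binary_dag D \<and> (\<forall>v \<in> verts D. eval_expr (unfold D v) \<noteq> None)"

definition sem :: "('v, 'a label, 'z) bdag_scheme \<Rightarrow> 'v \<Rightarrow> 'a option forest" where
  "sem D v = the (eval_expr (unfold D v))"

definition vtype :: "('v, 'a label, 'z) bdag_scheme \<Rightarrow> 'v \<Rightarrow> nat" where
  "vtype D v = (if is_context (sem D v) then 1 else 0)"

definition leaf_size :: "('v, 'a label, 'z) bdag_scheme \<Rightarrow> 'v \<Rightarrow> nat" where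
  "leaf_size D v = card {p \<in> vertices (sem D v). label_at (sem D v) p \<noteq> None}"

definition left_size :: "('v, 'a label, 'z) bdag_scheme \<Rightarrow> 'v \<Rightarrow> nat" where
  "left_size D v =
     (THE k. \<exists>p. is_preorder_number (sem D v) p k \<and> label_at (sem D v) p = None)"

text \<open>The root has type \<open>0\<close>, since it represents a forest.\<close>

definition rooted_f_slp :: "('v, 'a label, 'z) rooted_bdag_scheme \<Rightarrow> bool" where
  "rooted_f_slp D \<longleftrightarrow> f_slp D \<and> root_vertex D \<in> verts D \<and> is_forest (sem D (root_vertex D))"

definition all_reachable :: "('v, 'l, 'z) rooted_bdag_scheme \<Rightarrow> bool" where
  "all_reachable D \<longleftrightarrow> (\<forall>v \<in> verts D. (root_vertex D, v) \<in> (adj D)\<^sup>*)"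

definition height :: "('v, 'l, 'z) rooted_bdag_scheme \<Rightarrow> nat" where
  "height D = Max {n. \<exists>v \<in> verts D. is_leaf D v \<and> (root_vertex D, v) \<in> adj D ^^ n}"

definition slp_size :: "('v, 'l, 'z) bdag_scheme \<Rightarrow> nat" where
  "slp_size D = card (verts D) + card (edges D)"

definition is_extension ::
  "('v, 'a label, 'z) bdag_scheme \<Rightarrow> 'v set \<Rightarrow> ('v, 'a label, 'z) bdag_scheme \<Rightarrow> bool" where
  "is_extension D W D' \<longleftrightarrow>
     W \<inter> verts D = {} \<and> f_slp D' \<and> verts D' = verts D \<union> W \<and>
     edges D' \<inter> (verts D \<times> UNIV \<times> verts D) = edges D \<and>
     (\<forall>v \<in> verts D. label D' v = label D v)"

text \<open>For fixed constants \<open>c1, c2\<close>, the class of all \<open>\<F>\<close> whose height \<open>h\<close> is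
  \<open>\<Theta>(log N)\<close> with these constants.\<close>

definition log_height :: "real \<Rightarrow> real \<Rightarrow> nat \<Rightarrow> nat \<Rightarrow> bool" where
  "log_height c1 c2 h N \<longleftrightarrow> c1 * log 2 (real N) \<le> real h \<and> real h \<le> c2 * log 2 (real N)"


section \<open>Deterministic bottom-up tree automata\<close>

record ('q, 'l) dbuta =
  states :: "'q set"
  delta0 :: "'l \<Rightarrow> bool \<Rightarrow> 'q"
  delta2 :: "'q \<Rightarrow> 'q \<Rightarrow> 'l \<Rightarrow> 'q"
  finals :: "'q set"

definition is_dbuta :: "('q, 'a label) dbuta \<Rightarrow> bool" where
  "is_dbuta B \<longleftrightarrow>
     finite (states B) \<and> finals B \<subseteq> states B \<and>
     (\<forall>c \<in> Sigma0. \<forall>b. delta0 B c b \<in> states B) \<and>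
     (\<forall>f \<in> Sigma2. \<forall>p \<in> states B. \<forall>q \<in> states B. delta2 B p q f \<in> states B)"

text \<open>Leaves of a binary tree are given by the direction sequences leading to them.\<close>

primrec leaves :: "'l btree \<Rightarrow> dir list set" where
  "leaves (BLeaf c) = {[]}"
| "leaves (BNode f s t) = (#) L ` leaves s \<union> (#) R ` leaves t"

primrec run :: "('q, 'l) dbuta \<Rightarrow> 'l btree \<Rightarrow> dir list set \<Rightarrow> 'q" where
  "run B (BLeaf c) S = delta0 B c ([] \<in> S)"
| "run B (BNode f s t) S = delta2 B (run B s {p. L # p \<in> S}) (run B t {p. R # p \<in> S}) f"


section \<open>The enumeration data structure\<close>

subsection \<open>Configurations\<close>

definition conf_empty ::
  "('v, 'a label, 'z) bdag_scheme \<Rightarrow> ('q, 'a label) dbuta \<Rightarrow> ('v \<times> 'q) set" where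
  "conf_empty D B = {(v, q). v \<in> verts D \<and> q = run B (unfold D v) {}}"

definition conf_a ::
  "('v, 'a label, 'z) bdag_scheme \<Rightarrow> ('q, 'a label) dbuta \<Rightarrow> ('v \<times> 'q) set" where
  "conf_a D B = {(v, q). v \<in> verts D \<and>
     (\<exists>S. S \<subseteq> leaves (unfold D v) \<and> S \<noteq> {} \<and> q = run B (unfold D v) S)}"

definition conf_u ::
  "('v, 'a label, 'z) bdag_scheme \<Rightarrow> ('q, 'a label) dbuta \<Rightarrow> ('v \<times> 'q) set" where
  "conf_u D B = {(v, q). v \<in> verts D \<and>
     (\<exists>S. S \<subseteq> leaves (unfold D v) \<and> S \<noteq> {} \<and> q = run B (unfold D v) S \<and>
        (\<not> is_leaf D v \<longrightarrow> (\<forall>d. \<exists>p. d # p \<in> S)))}"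

definition quads ::
  "('v, 'a label, 'z) bdag_scheme \<Rightarrow> ('q, 'a label) dbuta \<Rightarrow> 'v \<Rightarrow> 'q \<Rightarrow>
   ('v \<times> 'q \<times> 'v \<times> 'q) set" where
  "quads D B v q = {(v1, q1, v2, q2). v1 = child D v L \<and> v2 = child D v R \<and>
     (v1, q1) \<in> conf_a D B \<and> (v2, q2) \<in> conf_a D B \<and> delta2 B q1 q2 (label D v) = q}"

subsection \<open>Preorder effects\<close>

text \<open>The argument of an effect is \<open>One x\<close> at a vertex of type \<open>0\<close> and \<open>Two x y\<close> at a vertex
  of type \<open>1\<close>; on arguments of the wrong shape effects are left unspecified.\<close>

datatype place = One nat | Two nat nat

primrec place_type :: "place \<Rightarrow> nat" where
  "place_type (One x) = 0"
| "place_type (Two x y) = 1"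

type_synonym effect = "place \<Rightarrow> place"

text \<open>\<open>effect f t1 t2 s1 s2 l1 d\<close> is the effect of the \<open>d\<close>-edge of a vertex labelled \<open>f\<close>;
  \<open>t1, s1, l1\<close> are the type, leaf size and left size of its left child, and \<open>t2, s2\<close> are the
  type and leaf size of its right child.\<close>

definition on_one :: "(nat \<Rightarrow> place) \<Rightarrow> effect" where
  "on_one g p = (case p of One x \<Rightarrow> g x | Two x y \<Rightarrow> undefined)"

definition on_two :: "(nat \<Rightarrow> nat \<Rightarrow> place) \<Rightarrow> effect" where
  "on_two g p = (case p of One x \<Rightarrow> undefined | Two x y \<Rightarrow> g x y)"

definition effect :: "'a label \<Rightarrow> nat \<Rightarrow> nat \<Rightarrow> nat \<Rightarrow> nat \<Rightarrow> nat \<Rightarrow> dir \<Rightarrow> effect" where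
  "effect f t1 t2 s1 s2 l1 d =
     (if (f, t1, t2) = (HCat, 0, 0) then
        (case d of L \<Rightarrow> on_one (\<lambda>x. One x) | R \<Rightarrow> on_one (\<lambda>x. One (x + s1)))
      else if (f, t1, t2) = (HCat, 0, 1) then
        (case d of L \<Rightarrow> on_two (\<lambda>x y. One x) | R \<Rightarrow> on_two (\<lambda>x y. Two (x + s1) y))
      else if (f, t1, t2) = (HCat, 1, 0) then
        (case d of L \<Rightarrow> on_two (\<lambda>x y. Two x y) | R \<Rightarrow> on_two (\<lambda>x y. One (x + s1 + y)))
      else if (f, t1, t2) = (VComp, 1, 0) then
        (case d of L \<Rightarrow> on_one (\<lambda>x. Two x s2) | R \<Rightarrow> on_one (\<lambda>x. One (x + l1)))
      else if (f, t1, t2) = (VComp, 1, 1) then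
        (case d of L \<Rightarrow> on_two (\<lambda>x y. Two x (y + s2)) | R \<Rightarrow> on_two (\<lambda>x y. Two (x + l1) y))
      else undefined)"

definition edge_effect :: "('v, 'a label, 'z) bdag_scheme \<Rightarrow> 'v \<Rightarrow> dir \<Rightarrow> effect" where
  "edge_effect D u d = (let v1 = child D u L; v2 = child D u R in
     effect (label D u) (vtype D v1) (vtype D v2)
       (leaf_size D v1) (leaf_size D v2) (left_size D v1) d)"

subsection \<open>The product DAG and its transformation\<close>

text \<open>\<open>Conf v q\<close> is a vertex of \<open>\<F> \<otimes> \<B>\<close>, \<open>Sink v q\<close> is the sink that is added below it if it
  is a target vertex with an outgoing edge, and \<open>Aux v q k\<close> is the vertex \<open>u\<^sub>k\<close> that is added when
  the outgoing edges of \<open>u\<^sub>1 = Conf v q\<close> are replaced by a binary comb.\<close>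

datatype ('v, 'q) pnode = Conf 'v 'q | Sink 'v 'q | Aux 'v 'q nat

text \<open>Decorated multigraphs. An edge is a tuple (source, identifier, target, decoration).
  The identifier separates edges that become parallel in \<open>contract\<close>: it is
  \<open>Some (d, v, q)\<close> for the edge \<open>((u, p), d, (v, q))\<close> of \<open>\<F> \<otimes> \<B>\<close> and \<open>None\<close> for an edge
  to a sink.\<close>

type_synonym ('v, 'q) pedge =
  "('v, 'q) pnode \<times> (dir \<times> 'v \<times> 'q) option \<times> ('v, 'q) pnode \<times> effect"

type_synonym ('v, 'q) pgraph = "('v, 'q) pnode set \<times> ('v, 'q) pedge set"

definition out :: "('v, 'q) pedge set \<Rightarrow> ('v, 'q) pnode \<Rightarrow> ('v, 'q) pedge set" where
  "out E u = {e \<in> E. fst e = u}"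

definition outdeg :: "('v, 'q) pedge set \<Rightarrow> ('v, 'q) pnode \<Rightarrow> nat" where
  "outdeg E u = card (out E u)"

definition product_graph ::
  "('v, 'a label, 'z) bdag_scheme \<Rightarrow> ('q, 'a label) dbuta \<Rightarrow> ('v, 'q) pgraph" where
  "product_graph D B =
     ({Conf v q | v q. (v, q) \<in> conf_a D B},
      {(Conf u p, Some (d, v, q), Conf v q, edge_effect D u d) | u p d v q.
         (u, p) \<in> conf_a D B \<and> (v, q) \<in> conf_a D B \<and>
         (\<exists>v' q'. (v', q') \<in> conf_empty D B \<and>
            (u, d, v) \<in> edges D \<and> (u, opp d, v') \<in> edges D \<and>
            (case d of L \<Rightarrow> delta2 B q q' (label D u) = p
                     | R \<Rightarrow> delta2 B q' q (label D u) = p))})"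

definition target_set ::
  "('v, 'a label, 'z) bdag_scheme \<Rightarrow> ('q, 'a label) dbuta \<Rightarrow> ('v, 'q) pnode set" where
  "target_set D B = {Conf v q | v q. (v, q) \<in> conf_u D B}"

text \<open>The vertices that are eventually removed when vertices of outdegree \<open>0\<close> outside \<open>V0\<close>
  are removed repeatedly form the least set containing each
  vertex outside \<open>V0\<close> all of whose out-neighbours are removed.\<close>

inductive_set removed :: "('v, 'q) pnode set \<Rightarrow> ('v, 'q) pgraph \<Rightarrow> ('v, 'q) pnode set"
  for V0 G where
  "u \<in> fst G \<Longrightarrow> u \<notin> V0 \<Longrightarrow> (\<And>i w f. (u, i, w, f) \<in> snd G \<Longrightarrow> w \<in> removed V0 G) \<Longrightarrow>
     u \<in> removed V0 G"

definition trim :: "('v, 'q) pnode set \<Rightarrow> ('v, 'q) pgraph \<Rightarrow> ('v, 'q) pgraph" where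
  "trim V0 G =
     (fst G - removed V0 G,
      {(u, i, w, f). (u, i, w, f) \<in> snd G \<and> u \<notin> removed V0 G \<and> w \<notin> removed V0 G})"

text \<open>The target set in which each \<open>Conf v q\<close> is replaced by its sink is not used later on and
  therefore not returned.\<close>

definition add_sinks :: "('v, 'q) pnode set \<Rightarrow> ('v, 'q) pgraph \<Rightarrow> ('v, 'q) pgraph" where
  "add_sinks V0 G =
     (fst G \<union> {Sink v q | v q. Conf v q \<in> V0 \<and> out (snd G) (Conf v q) \<noteq> {}},
      snd G \<union> {(Conf v q, None, Sink v q, id) | v q.
        Conf v q \<in> V0 \<and> out (snd G) (Conf v q) \<noteq> {}})"

text \<open>\<open>follow E u z f\<close>: \<open>z\<close> is the first vertex of outdegree different from \<open>1\<close> on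
  the unique path from \<open>u\<close>, and \<open>f\<close> is the composition of the decorations along this path.
  Effects map data of the source of an edge to data of its target, so the decoration of the
  first edge is applied first.\<close>

inductive follow ::
  "('v, 'q) pedge set \<Rightarrow> ('v, 'q) pnode \<Rightarrow> ('v, 'q) pnode \<Rightarrow> effect \<Rightarrow> bool" for E where
  stop: "outdeg E u \<noteq> 1 \<Longrightarrow> follow E u u id"
| move: "outdeg E u = 1 \<Longrightarrow> (u, i, w, g) \<in> E \<Longrightarrow> follow E w z f \<Longrightarrow> follow E u z (f \<circ> g)"

definition redirect :: "('v, 'q) pedge set \<Rightarrow> ('v, 'q) pedge set" where
  "redirect E = {(u, i, z, f \<circ> g) | u i z f g. \<exists>w. (u, i, w, g) \<in> E \<and> follow E w z f}"

definition contract :: "('v, 'q) pgraph \<Rightarrow> ('v, 'q) pgraph" where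
  "contract G =
     ({u \<in> fst G. outdeg (snd G) u \<noteq> 1},
      {(u, i, z, f). (u, i, z, f) \<in> redirect (snd G) \<and> outdeg (snd G) u \<noteq> 1})"

definition contract_table ::
  "('v, 'q) pgraph \<Rightarrow> (('v, 'q) pnode \<times> ('v, 'q) pnode \<times> effect) set" where
  "contract_table G =
     {(u, z, f). \<exists>i. (u, i, z, f) \<in> redirect (snd G) \<and> outdeg (snd G) u = 1}"

text \<open>\<open>out_order u\<close> lists the outgoing edges of \<open>u\<close> in the order in which they lead
  to \<open>v\<^sub>1, \<dots>, v\<^sub>d\<close>; edge number \<open>k\<close> is \<open>out_order u ! (k - 1)\<close>. For \<open>d = 2\<close> no vertices are
  added, and the two edges become the left and the right edge of \<open>u\<close>.\<close>

type_synonym ('v, 'q) dedge = "('v, 'q) pnode \<times> dir \<times> ('v, 'q) pnode \<times> effect"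

fun aux :: "('v, 'q) pnode \<Rightarrow> nat \<Rightarrow> ('v, 'q) pnode" where
  "aux (Conf v q) k = (if k = 1 then Conf v q else Aux v q k)"
| "aux u k = u"

definition is_out_order ::
  "('v, 'q) pgraph \<Rightarrow> (('v, 'q) pnode \<Rightarrow> ('v, 'q) pedge list) \<Rightarrow> bool" where
  "is_out_order G out_order \<longleftrightarrow>
     (\<forall>u \<in> fst G. distinct (out_order u) \<and> set (out_order u) = out (snd G) u)"

definition binarize_nodes ::
  "('v, 'q) pgraph \<Rightarrow> (('v, 'q) pnode \<Rightarrow> ('v, 'q) pedge list) \<Rightarrow> ('v, 'q) pnode set" where
  "binarize_nodes G out_order =
     fst G \<union> {aux u k | u k. u \<in> fst G \<and> 2 \<le> k \<and> k \<le> length (out_order u) - 1}"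

definition binarize_edges ::
  "('v, 'q) pgraph \<Rightarrow> (('v, 'q) pnode \<Rightarrow> ('v, 'q) pedge list) \<Rightarrow> ('v, 'q) dedge set" where
  "binarize_edges G out_order =
     {(aux u k, L, z, f) | u k z f. u \<in> fst G \<and> 1 \<le> k \<and> k \<le> length (out_order u) - 1 \<and>
        (\<exists>i. out_order u ! (k - 1) = (u, i, z, f))} \<union>
     {(aux u k, R, aux u (k + 1), id) | u k. u \<in> fst G \<and> 1 \<le> k \<and>
        k + 2 \<le> length (out_order u)} \<union>
     {(aux u (length (out_order u) - 1), R, z, f) | u z f. u \<in> fst G \<and>
        2 \<le> length (out_order u) \<and> (\<exists>i. last (out_order u) = (u, i, z, f))}"

text \<open>\<open>right_path E u z f\<close>: \<open>z\<close> is the leaf reached from \<open>u\<close> by following right edges only,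
  and \<open>f\<close> is the composition of the decorations along this path.\<close>

inductive right_path ::
  "('v, 'q) dedge set \<Rightarrow> ('v, 'q) pnode \<Rightarrow> ('v, 'q) pnode \<Rightarrow> effect \<Rightarrow> bool" for E where
  stop: "(\<And>d w f. (u, d, w, f) \<notin> E) \<Longrightarrow> right_path E u u id"
| move: "(u, R, w, g) \<in> E \<Longrightarrow> right_path E w z f \<Longrightarrow> right_path E u z (f \<circ> g)"

subsection \<open>The complete data structure\<close>

record ('v, 'q) enum_ds =
  ds_conf_empty :: "('v \<times> 'q) set"
  ds_conf_a :: "('v \<times> 'q) set"
  ds_conf_u :: "('v \<times> 'q) set"
  ds_order :: "'v \<Rightarrow> 'q \<Rightarrow> (('v \<times> 'q \<times> 'v \<times> 'q) \<times> ('v \<times> 'q \<times> 'v \<times> 'q)) set"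
  ds_effect :: "'v \<Rightarrow> dir \<Rightarrow> effect"
  ds_nodes :: "('v, 'q) pnode set"
  ds_edges :: "('v, 'q) dedge set"
  ds_table :: "(('v, 'q) pnode \<times> ('v, 'q) pnode \<times> effect) set"
  ds_omega :: "('v, 'q) pnode \<Rightarrow> ('v, 'q) pnode"
  ds_gamma :: "('v, 'q) pnode \<Rightarrow> effect"

text \<open>The data structure is unique up to the linear orders and the order of the outgoing edges in
  the binarization.\<close>

definition is_enum_ds ::
  "('v, 'a label, 'z) bdag_scheme \<Rightarrow> ('q, 'a label) dbuta \<Rightarrow> ('v, 'q) enum_ds \<Rightarrow> bool" where
  "is_enum_ds D B X \<longleftrightarrow>
     ds_conf_empty X = conf_empty D B \<and>
     ds_conf_a X = conf_a D B \<and>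
     ds_conf_u X = conf_u D B \<and>
     (\<forall>(v, q) \<in> conf_u D B. \<not> is_leaf D v \<longrightarrow>
        linear_order_on (quads D B v q) (ds_order X v q)) \<and>
     (\<forall>(u, d, v) \<in> edges D. ds_effect X u d = edge_effect D u d) \<and>
     (let Gb = add_sinks (target_set D B) (trim (target_set D B) (product_graph D B));
          Gc = contract Gb in
        ds_table X = contract_table Gb \<and>
        (\<exists>out_order. is_out_order Gc out_order \<and>
           ds_nodes X = binarize_nodes Gc out_order \<and>
           ds_edges X = binarize_edges Gc out_order)) \<and>
     (\<forall>u \<in> ds_nodes X. right_path (ds_edges X) u (ds_omega X u) (ds_gamma X u))"


section \<open>The RAM\<close>

text \<open>Programs for a unit-cost RAM. The memory is divided into named arrays of natural numbers
  (a program uses only finitely many of them, so that they can be interleaved in one memory); a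
  register is an array that is only used at index \<open>0\<close>. Every arithmetic operation, comparison,
  memory access, assignment and test takes one time unit. In \<open>exec W c m t m'\<close> the
  number \<open>W\<close> is a strict upper bound on all numbers occurring in the execution, addresses and
  intermediate results included: \<open>W = 2 ^ w\<close> for a RAM with registers of length \<open>w\<close>. An
  execution that exceeds this bound is stuck.\<close>

type_synonym mem = "string \<Rightarrow> nat \<Rightarrow> nat"

datatype aexp = Num nat | Cell string aexp | Add aexp aexp | Sub aexp aexp | Mul aexp aexp

datatype bexp = Less aexp aexp | Eq aexp aexp | Neg bexp | Conj bexp bexp

datatype com =
    Skip
  | Assign string aexp aexp  \<comment> \<open>array, index, value\<close>
  | Seq com com
  | Cond bexp com com
  | While bexp com

primrec aval :: "aexp \<Rightarrow> mem \<Rightarrow> nat" where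
  "aval (Num n) m = n"
| "aval (Cell x i) m = m x (aval i m)"
| "aval (Add e1 e2) m = aval e1 m + aval e2 m"
| "aval (Sub e1 e2) m = aval e1 m - aval e2 m"
| "aval (Mul e1 e2) m = aval e1 m * aval e2 m"

primrec acost :: "aexp \<Rightarrow> nat" where
  "acost (Num n) = 1"
| "acost (Cell x i) = 1 + acost i"
| "acost (Add e1 e2) = 1 + acost e1 + acost e2"
| "acost (Sub e1 e2) = 1 + acost e1 + acost e2"
| "acost (Mul e1 e2) = 1 + acost e1 + acost e2"

primrec afits :: "nat \<Rightarrow> aexp \<Rightarrow> mem \<Rightarrow> bool" where
  "afits W (Num n) m \<longleftrightarrow> n < W"
| "afits W (Cell x i) m \<longleftrightarrow> afits W i m \<and> m x (aval i m) < W"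
| "afits W (Add e1 e2) m \<longleftrightarrow> afits W e1 m \<and> afits W e2 m \<and> aval e1 m + aval e2 m < W"
| "afits W (Sub e1 e2) m \<longleftrightarrow> afits W e1 m \<and> afits W e2 m"
| "afits W (Mul e1 e2) m \<longleftrightarrow> afits W e1 m \<and> afits W e2 m \<and> aval e1 m * aval e2 m < W"

primrec bval :: "bexp \<Rightarrow> mem \<Rightarrow> bool" where
  "bval (Less e1 e2) m \<longleftrightarrow> aval e1 m < aval e2 m"
| "bval (Eq e1 e2) m \<longleftrightarrow> aval e1 m = aval e2 m"
| "bval (Neg b) m \<longleftrightarrow> \<not> bval b m"
| "bval (Conj b1 b2) m \<longleftrightarrow> bval b1 m \<and> bval b2 m"

primrec bcost :: "bexp \<Rightarrow> nat" where
  "bcost (Less e1 e2) = 1 + acost e1 + acost e2"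
| "bcost (Eq e1 e2) = 1 + acost e1 + acost e2"
| "bcost (Neg b) = 1 + bcost b"
| "bcost (Conj b1 b2) = 1 + bcost b1 + bcost b2"

primrec bfits :: "nat \<Rightarrow> bexp \<Rightarrow> mem \<Rightarrow> bool" where
  "bfits W (Less e1 e2) m \<longleftrightarrow> afits W e1 m \<and> afits W e2 m"
| "bfits W (Eq e1 e2) m \<longleftrightarrow> afits W e1 m \<and> afits W e2 m"
| "bfits W (Neg b) m \<longleftrightarrow> bfits W b m"
| "bfits W (Conj b1 b2) m \<longleftrightarrow> bfits W b1 m \<and> bfits W b2 m"

inductive exec :: "nat \<Rightarrow> com \<Rightarrow> mem \<Rightarrow> nat \<Rightarrow> mem \<Rightarrow> bool" for W where
  Skip: "exec W Skip m 1 m"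
| Assign: "afits W i m \<Longrightarrow> afits W e m \<Longrightarrow>
    exec W (Assign x i e) m (1 + acost i + acost e) (m(x := (m x)(aval i m := aval e m)))"
| Seq: "exec W c1 m t1 m1 \<Longrightarrow> exec W c2 m1 t2 m2 \<Longrightarrow> exec W (Seq c1 c2) m (t1 + t2) m2"
| CondTrue: "bfits W b m \<Longrightarrow> bval b m \<Longrightarrow> exec W c1 m t m1 \<Longrightarrow>
    exec W (Cond b c1 c2) m (1 + bcost b + t) m1"
| CondFalse: "bfits W b m \<Longrightarrow> \<not> bval b m \<Longrightarrow> exec W c2 m t m1 \<Longrightarrow>
    exec W (Cond b c1 c2) m (1 + bcost b + t) m1"
| WhileFalse: "bfits W b m \<Longrightarrow> \<not> bval b m \<Longrightarrow> exec W (While b c) m (1 + bcost b) m"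
| WhileTrue: "bfits W b m \<Longrightarrow> bval b m \<Longrightarrow> exec W c m t1 m1 \<Longrightarrow>
    exec W (While b c) m1 t2 m2 \<Longrightarrow> exec W (While b c) m (1 + bcost b + t1 + t2) m2"


section \<open>Representation in memory\<close>

text \<open>Vertices of an f-SLP are the numbers below \<open>N\<close>, states of an automaton the numbers below
  \<open>|Q|\<close>, and \<open>code\<close> is the numbering of the alphabet.\<close>

definition rep_slp ::
  "('a \<Rightarrow> nat) \<Rightarrow> (nat, 'a label, 'z) rooted_bdag_scheme \<Rightarrow> mem \<Rightarrow> bool" where
  "rep_slp code D m \<longleftrightarrow>
     verts D = {..<m ''N'' 0} \<and> root_vertex D = m ''root'' 0 \<and>
     (\<forall>v \<in> verts D.
        case label D v of
          Sym a \<Rightarrow> m ''kind'' v = 0 \<and> m ''sym'' v = code a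
        | SymStar a \<Rightarrow> m ''kind'' v = 1 \<and> m ''sym'' v = code a
        | HCat \<Rightarrow> m ''kind'' v = 2 \<and>
            (v, L, m ''left'' v) \<in> edges D \<and> (v, R, m ''right'' v) \<in> edges D
        | VComp \<Rightarrow> m ''kind'' v = 3 \<and>
            (v, L, m ''left'' v) \<in> edges D \<and> (v, R, m ''right'' v) \<in> edges D)"

definition rep_sizes :: "(nat, 'a label, 'z) bdag_scheme \<Rightarrow> mem \<Rightarrow> bool" where
  "rep_sizes D m \<longleftrightarrow>
     (\<forall>v \<in> verts D. m ''type'' v = vtype D v \<and> m ''size'' v = leaf_size D v \<and>
        (vtype D v = 1 \<longrightarrow> m ''lsize'' v = left_size D v))"

definition rep_dbuta :: "('a \<Rightarrow> nat) \<Rightarrow> (nat, 'a label) dbuta \<Rightarrow> mem \<Rightarrow> bool" where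
  "rep_dbuta code B m \<longleftrightarrow> (let n = m ''Q'' 0 in
     states B = {..<n} \<and>
     (\<forall>a b. m ''delta0'' (4 * code a + of_bool b) = delta0 B (Sym a) b \<and>
            m ''delta0'' (4 * code a + 2 + of_bool b) = delta0 B (SymStar a) b) \<and>
     (\<forall>p < n. \<forall>q < n. m ''delta2'' (2 * (p * n + q)) = delta2 B p q HCat \<and>
                     m ''delta2'' (2 * (p * n + q) + 1) = delta2 B p q VComp) \<and>
     (\<forall>q < n. m ''final'' q = of_bool (q \<in> finals B)))"

text \<open>Every effect in the data structure is determined by the types of source and target and a
  formula \<open>x + b y + c\<close> for the first and \<open>b' y + c'\<close> for the second component of the result,
  where \<open>b, b' \<in> {0, 1}\<close> and \<open>y = 0\<close> if the source has type \<open>0\<close>. It is stored in five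
  consecutive cells: target type, \<open>b\<close>, \<open>c\<close>, \<open>b'\<close>, \<open>c'\<close>. Inapplicable coefficients are \<open>0\<close>.\<close>

fun affine :: "nat \<Rightarrow> nat \<Rightarrow> nat \<Rightarrow> nat \<Rightarrow> nat \<Rightarrow> effect" where
  "affine T b c b' c' (One x) = (if T = 0 then One (x + c) else Two (x + c) c')"
| "affine T b c b' c' (Two x y) =
     (if T = 0 then One (x + b * y + c) else Two (x + b * y + c) (b' * y + c'))"

definition rep_effect :: "(nat \<Rightarrow> nat) \<Rightarrow> nat \<Rightarrow> nat \<Rightarrow> effect \<Rightarrow> bool" where
  "rep_effect A i t f \<longleftrightarrow>
     (let T = A (5 * i); b = A (5 * i + 1); c = A (5 * i + 2);
          b' = A (5 * i + 3); c' = A (5 * i + 4) in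
        T \<le> 1 \<and> b \<le> 1 \<and> b' \<le> 1 \<and>
        (t = 0 \<longrightarrow> b = 0 \<and> b' = 0) \<and> (T = 0 \<longrightarrow> b' = 0 \<and> c' = 0) \<and>
        (\<forall>p. place_type p = t \<longrightarrow> f p = affine T b c b' c' p))"

primrec dir_num :: "dir \<Rightarrow> nat" where
  "dir_num L = 0"
| "dir_num R = 1"

text \<open>The possible vertices of \<open>(\<F> \<otimes> \<B>)\<^sub>b\<close> are \<open>pnode v q k\<close> with \<open>k \<le> 2 |Q|\<close>: a vertex has at most \<open>2 |Q| + 1\<close> outgoing edges, so that \<open>Aux v q k\<close> only occurs for
  \<open>2 \<le> k \<le> 2 |Q|\<close>. The data of \<open>pnode v q k\<close> is stored at index \<open>pnode_index n v q k\<close>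
  where \<open>n = |Q|\<close>.\<close>

definition pnode :: "'v \<Rightarrow> 'q \<Rightarrow> nat \<Rightarrow> ('v, 'q) pnode" where
  "pnode v q k = (if k = 0 then Sink v q else if k = 1 then Conf v q else Aux v q k)"

definition pnode_index :: "nat \<Rightarrow> nat \<Rightarrow> nat \<Rightarrow> nat \<Rightarrow> nat" where
  "pnode_index n v q k = (v * n + q) * (2 * n + 1) + k"

definition rep_enum_ds ::
  "(nat, 'a label, 'z) bdag_scheme \<Rightarrow> (nat, 'a label) dbuta \<Rightarrow> (nat, nat) enum_ds \<Rightarrow>
   mem \<Rightarrow> bool" where
  "rep_enum_ds D B X m \<longleftrightarrow> (let n = card (states B) in
     (\<forall>v \<in> verts D. \<forall>q < n.
        m ''confE'' (v * n + q) = of_bool ((v, q) \<in> ds_conf_empty X) \<and>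
        m ''confA'' (v * n + q) = of_bool ((v, q) \<in> ds_conf_a X) \<and>
        m ''confU'' (v * n + q) = of_bool ((v, q) \<in> ds_conf_u X)) \<and>
     \<comment> \<open>the states of the quadruples are listed in increasing order\<close>
     (\<forall>(v, q) \<in> ds_conf_u X. \<not> is_leaf D v \<longrightarrow>
        (\<exists>xs. distinct xs \<and> set xs = quads D B v q \<and>
           sorted_wrt (\<lambda>x y. (x, y) \<in> ds_order X v q) xs \<and>
           m ''ordlen'' (v * n + q) = length xs \<and>
           (\<forall>i < length xs. \<exists>v1 v2.
              xs ! i = (v1, m ''ordq1'' ((v * n + q) * (n * n) + i),
                        v2, m ''ordq2'' ((v * n + q) * (n * n) + i))))) \<and>
     (\<forall>(u, d, v) \<in> edges D.
        rep_effect (m ''effect'') (2 * u + dir_num d) (vtype D u) (ds_effect X u d)) \<and>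
     \<comment> \<open>status of a possible vertex: 1 = leaf, 2 = inner vertex,
         3 = contracted and stored in the table, 0 = otherwise\<close>
     (\<forall>v \<in> verts D. \<forall>q < n. \<forall>k \<le> 2 * n. let x = pnode v q k in
        m ''status'' (pnode_index n v q k) =
          (if x \<in> ds_nodes X then (if \<exists>d y f. (x, d, y, f) \<in> ds_edges X then 2 else 1)
           else if \<exists>y f. (x, y, f) \<in> ds_table X then 3 else 0)) \<and>
     (\<forall>v \<in> verts D. \<forall>q < n. \<forall>k \<le> 2 * n. let x = pnode v q k; i = pnode_index n v q k in
        (\<forall>d y f. (x, d, y, f) \<in> ds_edges X \<longrightarrow> (let j = 2 * i + dir_num d in
           y = pnode (m ''tgtv'' j) (m ''tgtq'' j) (m ''tgtk'' j) \<and>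
           rep_effect (m ''dec'') j (vtype D v) f)) \<and>
        (\<forall>y f. (x, y, f) \<in> ds_table X \<longrightarrow>
           y = pnode (m ''tgtv'' (2 * i)) (m ''tgtq'' (2 * i)) (m ''tgtk'' (2 * i)) \<and>
           rep_effect (m ''dec'') (2 * i) (vtype D v) f) \<and>
        (x \<in> ds_nodes X \<longrightarrow>
           ds_omega X x = pnode (m ''omegav'' i) (m ''omegaq'' i) (m ''omegak'' i) \<and>
           rep_effect (m ''gamma'') i (vtype D v) (ds_gamma X x))))"

end

theory Submission
  imports Defs
begin

text \<open>
  Following the preorder number down from the root gives a path to the leaf of the f-SLP that produces
  the vertex \<open>v\<close>: at each vertex the stored sizes decide whether to go left or right. Copying this path
  (and changing the label of the last copy) yields the extension; its length is at most the height, and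
  the unfolding of the new root has the same shape as before.

  The enumeration data structure is local. The configurations of a vertex depend only on those of its
  children, and the product DAG is only entered at the outgoing edges of a configuration. Let
  \<open>resolve\<close> map a configuration to itself unless it is contracted, and otherwise to the end of its
  contracted path with the composed effect. Then the outgoing edges of \<open>(v, q)\<close> after contraction are
  those to the resolved configurations of the children, plus an identity edge to the sink if
  \<open>(v, q)\<close> is a target; if there is exactly one, \<open>(v, q)\<close> is contracted itself. At most
  \<open>2 |Q| + 1\<close> edges leave \<open>(v, q)\<close>, so a new vertex costs \<open>O(|Q|\<^sup>2)\<close> once its children are done,
  and old vertices keep their data. The children of a path vertex are old or the next path vertex, so the
  path is processed from its end.
\<close>

section \<open>Preorder label sequences\<close>

text \<open>Vertices are positions, while the f-SLP knows only sizes, so all reasoning about values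
  passes through the sequence of labels in preorder. At the vertices of an f-SLP, type, size and
  position of \<open>*\<close> depend only on which entries of that sequence are
  \<open>None\<close>. Relabelling a proper vertex leaves this pattern alone, so a copied vertex
  inherits the stored numbers of its original. In the product DAG the pruning step removes nothing,
  because a configuration that is no target always has a successor. The obstacle on the RAM side is
  that effects composed along long paths must still fit into five cells, with coefficients 0 or 1
  and constants below the word bound. The invariant \<open>b * b' = 0\<close> keeps the coefficients
  small, and the constants are charged to the drop of \<open>rank\<close>, so they are at most
  \<open>rank D v\<close> times the largest leaf size. New vertices are numbered consecutively along
  the path, so each child of a new vertex is old or has a larger number. All stored numbers stay
  below a fixed bound \<open>M\<close>, while intermediate results of one expression may reach a
  power of \<open>M\<close>.\<close>

fun labs :: "'b forest \<Rightarrow> 'b list" where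
  "labs [] = []"
| "labs (Node b ts # us) = b # labs ts @ labs us"

text \<open>Relabelling addressed by preorder number: under concatenation and plugging, numbers
  change only by an offset, whereas positions given as lists change in their inner structure. A
  number beyond the end changes nothing.\<close>

fun relabel_nth :: "'b forest \<Rightarrow> nat \<Rightarrow> 'b \<Rightarrow> 'b forest" where
  "relabel_nth [] k a = []"
| "relabel_nth (Node b ts # us) k a =
     (if k = 0 then Node a ts # us
      else if k \<le> length (labs ts) then Node b (relabel_nth ts (k - 1) a) # us
      else Node b ts # relabel_nth us (k - 1 - length (labs ts)) a)"

text \<open>The leaf condition of \<open>is_context\<close> without the uniqueness of
  \<open>*\<close>. Forests and contexts both satisfy it, and it splits over concatenation. Since
  \<open>plug\<close> discards the children of a \<open>*\<close>, plugging acts as substitution on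
  label sequences only under this condition.\<close>

fun stars_ok :: "'a option forest \<Rightarrow> bool" where
  "stars_ok [] \<longleftrightarrow> True"
| "stars_ok (Node b ts # us) \<longleftrightarrow> (b = None \<longrightarrow> ts = []) \<and> stars_ok ts \<and> stars_ok us"

lemma labs_append [simp]: "labs (F @ G) = labs F @ labs G"
  by (induction F rule: labs.induct) auto

lemma length_preorder: "length (preorder F) = length (labs F)"
  by (induction F rule: labs.induct) auto

lemma preorder_nonempty: "p \<in> set (preorder F) \<Longrightarrow> p \<noteq> []"
proof (induction F arbitrary: p rule: labs.induct)
  case (2 b ts us)
  then show ?case by (auto) (metis list.distinct(1) neq_Nil_conv shift.simps(2))
qed auto

lemma tree_at_Cons_0: "p \<noteq> [] \<Longrightarrow> tree_at (t # us) (0 # p) = tree_at (children t) p"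
  by (cases p) auto

lemma tree_at_shift: "p \<noteq> [] \<Longrightarrow> tree_at (t # us) (shift p) = tree_at us p"
  by (cases p; cases "tl p") auto

text \<open>The bridge between the two views: quantifiers over vertices and their labels become
  statements about the entries of \<open>labs\<close>.\<close>

lemma map_label_at_preorder: "map (label_at F) (preorder F) = labs F"
proof (induction F rule: labs.induct)
  case (2 b ts us)
  have "map (label_at (Node b ts # us)) (map ((#) 0) (preorder ts)) = map (label_at ts) (preorder ts)"
    by (auto simp: label_at_def tree_at_Cons_0 dest!: preorder_nonempty)
  moreover have "map (label_at (Node b ts # us)) (map shift (preorder us)) = map (label_at us) (preorder us)"
    by (auto simp: label_at_def tree_at_shift dest!: preorder_nonempty)
  moreover have "label_at (Node b ts # us) [0] = b" by (simp add: label_at_def)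
  ultimately show ?case using 2 by (simp del: map_map)
qed auto

text \<open>A root, the vertices below it and the vertices of later trees are told apart by length
  and first index. Distinctness is what turns cardinalities over vertices into multiplicities in
  \<open>labs\<close>.\<close>

lemma distinct_preorder: "distinct (preorder F)"
proof (induction F rule: labs.induct)
  case (2 b ts us)
  have "inj_on shift (set (preorder us))"
    by (rule inj_onI, drule preorder_nonempty, drule preorder_nonempty) (auto simp: neq_Nil_conv)
  moreover have z: "0 # p \<noteq> shift q" for p q by (cases q) auto
  then have "0 # p \<notin> shift ` set (preorder us)" for p by blast
  moreover have "[0] \<notin> (#) 0 ` set (preorder ts)" by (auto dest: preorder_nonempty)
  ultimately show ?case using 2 by (auto simp: distinct_map)
qed auto

lemma relabel_Cons_0: "p \<noteq> [] \<Longrightarrow>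
  relabel (Node b ts # us) (0 # p) a = Node b (relabel ts p a) # us"
  by (cases p) auto

lemma relabel_shift: "p \<noteq> [] \<Longrightarrow> relabel (t # us) (shift p) a = t # relabel us p a"
  by (cases p; cases "tl p") auto

text \<open>Links the vertex-based \<open>relabel\<close> of the specification to the number-based
  version, in which all intermediate results are stated.\<close>

lemma relabel_preorder: "k < length (labs F) \<Longrightarrow> relabel F (preorder F ! k) a = relabel_nth F k a"
proof (induction F k a rule: relabel_nth.induct)
  case (2 b ts us k a)
  consider "k = 0" | "0 < k" "k \<le> length (labs ts)" | "k > length (labs ts)" by linarith
  then show ?case
  proof cases
    case 2
    then obtain j where "k = Suc j" "j < length (labs ts)" by (cases k) auto
    then have "preorder (Node b ts # us) ! k = 0 # (preorder ts ! (k - 1))"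
      by (simp add: nth_append length_preorder)
    moreover have "preorder ts ! (k - 1) \<noteq> []"
      using 2 by (intro preorder_nonempty[of _ ts]) (simp add: length_preorder)
    ultimately show ?thesis using 2 "2.IH"(1) by (simp add: relabel_Cons_0)
  next
    case 3
    then obtain j where "k = Suc j" "j \<ge> length (labs ts)" by (cases k) auto
    then have "preorder (Node b ts # us) ! k = shift (preorder us ! (k - 1 - length (labs ts)))"
      using "2.prems" by (simp add: nth_append length_preorder)
    moreover have "preorder us ! (k - 1 - length (labs ts)) \<noteq> []"
      using 3 "2.prems" by (intro preorder_nonempty[of _ us]) (simp add: length_preorder)
    ultimately show ?thesis using 3 "2.IH"(2) "2.prems" by (simp add: relabel_shift)
  qed simp
qed simp

lemma count_list_eq_card:
  assumes "distinct ps"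
  shows "card {p \<in> set ps. f p = x} = count_list (map f ps) x"
proof -
  have "card {p \<in> set ps. f p = x} = length (filter (\<lambda>p. f p = x) ps)"
    using assms by (metis distinct_card distinct_filter set_filter)
  also have "\<dots> = count_list (map f ps) x" by (induction ps) auto
  finally show ?thesis .
qed

lemma ex1_iff_count_list:
  assumes "distinct ps"
  shows "(\<exists>!p. p \<in> set ps \<and> f p = x) \<longleftrightarrow> count_list (map f ps) x = 1"
proof -
  have "(\<exists>!p. p \<in> set ps \<and> f p = x) \<longleftrightarrow> (\<exists>p. {p \<in> set ps. f p = x} = {p})"
    unfolding Ex1_def by (rule iff_exI) blast
  also have "\<dots> \<longleftrightarrow> card {p \<in> set ps. f p = x} = 1" by (simp add: card_1_singleton_iff)
  finally show ?thesis unfolding count_list_eq_card[OF assms] .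
qed

lemma is_forest_iff: "is_forest F \<longleftrightarrow> None \<notin> set (labs F)"
  unfolding is_forest_def vertices_def map_label_at_preorder[symmetric] set_map image_iff
  by metis

lemma stars_ok_iff:
  "stars_ok F \<longleftrightarrow> (\<forall>p \<in> set (preorder F). label_at F p = None \<longrightarrow> children (tree_at F p) = [])"
proof (induction F rule: stars_ok.induct)
  case (2 b ts us)
  have "(\<forall>p\<in>set (preorder ts). label_at (Node b ts # us) (0 # p) = None \<longrightarrow> children (tree_at (Node b ts # us) (0 # p)) = [])
     \<longleftrightarrow> stars_ok ts"
    unfolding 2(1) by (intro ball_cong) (auto simp: label_at_def tree_at_Cons_0 dest!: preorder_nonempty)
  moreover have "(\<forall>p\<in>set (preorder us). label_at (Node b ts # us) (shift p) = None \<longrightarrow> children (tree_at (Node b ts # us) (shift p)) = [])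
     \<longleftrightarrow> stars_ok us"
    unfolding 2(2) by (intro ball_cong) (auto simp: label_at_def tree_at_shift dest!: preorder_nonempty)
  ultimately show ?case by (auto simp: ball_Un label_at_def)
qed simp

text \<open>Uniqueness of the star vertex is a multiplicity and its leaf condition a recursion, so
  contexts can be handled by counting and by induction on forests.\<close>

lemma is_context_iff: "is_context F \<longleftrightarrow> count_list (labs F) None = 1 \<and> stars_ok F"
  unfolding is_context_def vertices_def stars_ok_iff
  using ex1_iff_count_list[OF distinct_preorder, of F "label_at F" None]
  by (auto simp: map_label_at_preorder)

lemma card_labelled: "card {p \<in> vertices F. label_at F p \<noteq> None} = length (filter (\<lambda>x. x \<noteq> None) (labs F))"
proof -
  have "card {p \<in> vertices F. label_at F p \<noteq> None} = length (filter (\<lambda>p. label_at F p \<noteq> None) (preorder F))"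
    unfolding vertices_def set_filter[symmetric] by (intro distinct_card distinct_filter distinct_preorder)
  also have "\<dots> = length (filter (\<lambda>x. x \<noteq> None) (map (label_at F) (preorder F)))"
    by (simp add: filter_map o_def)
  finally show ?thesis by (simp only: map_label_at_preorder)
qed

lemma split_star:
  assumes "count_list xs x = 1"
  obtains ys zs where "xs = ys @ x # zs" "x \<notin> set ys" "x \<notin> set zs"
proof -
  have "x \<in> set xs" using assms by (metis count_list_0_iff zero_neq_one)
  then obtain ys zs where *: "xs = ys @ x # zs" "x \<notin> set ys" using split_list_first by fast
  then have "x \<notin> set zs" using assms by (simp add: count_list_0_iff)
  with * that show ?thesis by blast
qed

text \<open>Evaluates the description operator in \<open>left_size\<close>: the part of the label
  sequence in front of \<open>*\<close> has that length.\<close>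

lemma star_index:
  assumes "labs F = ys @ None # zs" "None \<notin> set ys" "None \<notin> set zs"
  shows "(THE k. \<exists>p. is_preorder_number F p k \<and> label_at F p = None) = length ys"
proof -
  have "(\<exists>p. is_preorder_number F p k \<and> label_at F p = None) \<longleftrightarrow> k < length (labs F) \<and> labs F ! k = None" for k
    unfolding is_preorder_number_def
    by (auto simp: map_label_at_preorder[symmetric])
  moreover have "k < length (labs F) \<and> labs F ! k = None \<longleftrightarrow> k = length ys" for k
  proof -
    have "ys ! k \<noteq> None" if "k < length ys" using that assms(2) nth_mem by metis
    moreover have "labs F ! k \<noteq> None" if "length ys < k" "k < length (labs F)"
    proof -
      have "zs ! (k - Suc (length ys)) \<in> set zs" using that assms(1) by (intro nth_mem) auto
      then have "zs ! (k - Suc (length ys)) \<noteq> None" using assms(3) by metis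
      then show ?thesis using that assms(1) by (simp add: nth_append nth_Cons')
    qed
    ultimately show ?thesis using assms(1)
      by (cases k "length ys" rule: linorder_cases) (auto simp: nth_append)
  qed
  ultimately show ?thesis by simp
qed

text \<open>On label sequences, plugging is the substitution of a word for a letter; with a single
  \<open>*\<close> it becomes an insertion at one place, as in
  \<open>labs_plug_split\<close>.\<close>

lemma labs_plug: "stars_ok F \<Longrightarrow> labs (plug F G) = concat (map (\<lambda>x. if x = None then labs G else [x]) (labs F))"
  by (induction F G rule: plug.induct) auto

lemma concat_map_no_star: "None \<notin> set xs \<Longrightarrow> concat (map (\<lambda>x. if x = None then ys else [x]) xs) = xs"
  by (induction xs) auto

lemma labs_plug_split:
  assumes "stars_ok F" "labs F = ys @ None # zs" "None \<notin> set ys" "None \<notin> set zs"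
  shows "labs (plug F G) = ys @ labs G @ zs"
  using assms by (simp add: labs_plug concat_map_no_star)

lemma stars_ok_append [simp]: "stars_ok (F @ G) \<longleftrightarrow> stars_ok F \<and> stars_ok G"
  by (induction F rule: stars_ok.induct) auto

lemma stars_ok_plug: "stars_ok F \<Longrightarrow> stars_ok G \<Longrightarrow> stars_ok (plug F G)"
  by (induction F G rule: plug.induct) auto

lemma plug_no_star: "None \<notin> set (labs F) \<Longrightarrow> plug F G = F"
  by (induction F G rule: plug.induct) auto

section \<open>Relabelling under concatenation and plugging\<close>

lemma labs_relabel_nth: "labs (relabel_nth F k a) = (labs F)[k := a]"
proof (induction F k a rule: relabel_nth.induct)
  case (2 b ts us k a)
  consider "k = 0" | j where "k = Suc j" "j < length (labs ts)" | j where "k = Suc j" "j \<ge> length (labs ts)"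
    by (metis not0_implies_Suc not_less)
  then show ?case
  proof cases
    case 2 then show ?thesis using "2.IH"(1) by (simp add: list_update_append)
  next
    case 3 then show ?thesis using "2.IH"(2) by (simp add: list_update_append)
  qed simp
qed simp

lemma stars_ok_relabel_nth: "stars_ok F \<Longrightarrow> stars_ok (relabel_nth F k (Some a))"
proof (induction F k "Some a" rule: relabel_nth.induct)
  case (2 b ts us k)
  consider "k = 0" | "k \<noteq> 0" "k \<le> length (labs ts)" | "k \<noteq> 0" "\<not> k \<le> length (labs ts)" by blast
  then show ?case
  proof cases
    case 2 then show ?thesis using "2.hyps"(1) "2.prems" by (cases ts) auto
  next
    case 3 then show ?thesis using "2.hyps"(2) "2.prems" by simp
  qed (use "2.prems" in simp)
qed simp

lemma relabel_nth_append:
  "relabel_nth (F @ G) k a =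
     (if k < length (labs F) then relabel_nth F k a @ G else F @ relabel_nth G (k - length (labs F)) a)"
proof (induction F k a rule: relabel_nth.induct)
  case (2 b ts us k a)
  show ?case
  proof (cases "k \<le> length (labs ts)")
    case False
    then have "k - 1 - length (labs ts) < length (labs us) \<longleftrightarrow> k < length (labs (Node b ts # us))"
      "k - 1 - length (labs ts) - length (labs us) = k - length (labs (Node b ts # us))" by auto
    with False "2.IH"(2) show ?thesis by simp
  qed simp
qed simp

text \<open>The sequence of \<open>plug F G\<close> is that of \<open>F\<close> with
  \<open>*\<close> replaced by that of \<open>G\<close>, so a number falls in front of, inside or
  behind the inserted part. Behind it, \<open>length (labs G)\<close> entries stand for the one
  entry \<open>*\<close> of \<open>F\<close>, hence the number
  \<open>k + 1 - length (labs G)\<close>. The induction follows the first tree of \<open>F\<close>;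
  the \<open>*\<close> is its root, lies below it, or lies in a later tree.\<close>

lemma relabel_nth_plug:
  assumes "stars_ok F" "labs F = ys @ None # zs" "None \<notin> set ys" "None \<notin> set zs"
  shows "relabel_nth (plug F G) k (Some a) =
    (if k < length ys then plug (relabel_nth F k (Some a)) G
     else if k < length ys + length (labs G) then plug F (relabel_nth G (k - length ys) (Some a))
     else plug (relabel_nth F (k + 1 - length (labs G)) (Some a)) G)"
  using assms
proof (induction F G arbitrary: ys zs k rule: plug.induct)
  case (2 ts us G)
  then have [simp]: "ts = []" and ys: "ys = []" and zs: "zs = labs us"
    by (auto simp: append_eq_Cons_conv Cons_eq_append_conv)
  with 2 have "None \<notin> set (labs us)" by simp
  then have "None \<notin> set (labs us)" and "None \<notin> set (labs (relabel_nth us j (Some a)))" for j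
    using set_update_subset_insert[of "labs us" j "Some a"] by (auto simp: labs_relabel_nth)
  \<comment> \<open>Here \<open>*\<close> is the first entry of \<open>F\<close>, so a number behind
    the inserted part addresses a later tree, shifted by the one place of \<open>*\<close>.\<close>
  moreover have "k + 1 - length (labs G) \<noteq> 0" "k + 1 - length (labs G) - 1 = k - length (labs G)"
    if "\<not> k < length (labs G)" using that by auto
  ultimately show ?case by (auto simp: ys zs relabel_nth_append plug_no_star)
next
  case (3 b ts us G)
  from "3.prems"(2,3) obtain ys' where ys: "ys = Some b # ys'" and e: "labs ts @ labs us = ys' @ None # zs"
    by (auto simp: Cons_eq_append_conv)
  \<comment> \<open>In case \<open>l\<close> the \<open>*\<close> lies below the first root, in case
    \<open>r\<close> in a later tree.\<close>
  from e consider (l) zs' where "labs ts = ys' @ None # zs'" "zs = zs' @ labs us"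
    | (r) ys'' where "labs us = ys'' @ None # zs" "ys' = labs ts @ ys''"
    by (auto simp: append_eq_append_conv2 append_eq_Cons_conv Cons_eq_append_conv)
  then show ?case
  proof cases
    case l
    have n: "None \<notin> set (labs us)" "None \<notin> set ys'" "None \<notin> set zs'" using l "3.prems" ys by auto
    have so: "stars_ok ts" using "3.prems" by simp
    note IH = "3.IH"(1)[OF so l(1) n(2,3)]
    have lp: "labs (plug ts G) = ys' @ labs G @ zs'" by (rule labs_plug_split[OF so l(1) n(2,3)])
    have *: "k + 1 - length (labs G) - 1 = k - 1 + 1 - length (labs G)" if "k \<noteq> 0" using that by simp
    have **: "k + 1 - length (labs G) - 1 - length (labs ts) = k - 1 - length (labs (plug ts G))"
      if "k > length (labs (plug ts G))" using that l(1) by (simp add: lp)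
    have le: "k + 1 - length (labs G) \<noteq> 0 \<and> (k + 1 - length (labs G) \<le> length (labs ts) \<longleftrightarrow> k \<le> length (labs (plug ts G)))"
      if "\<not> k < length ys + length (labs G)" using that by (auto simp: lp l(1) ys)
    \<comment> \<open>The part without \<open>*\<close> is unchanged by \<open>plug\<close>, also
      after relabelling, because only \<open>Some\<close> labels are written.\<close>
    have "None \<notin> set (labs (relabel_nth us j (Some a)))" for j
      using n(1) set_update_subset_insert[of "labs us" j "Some a"] by (auto simp: labs_relabel_nth)
    note pl = plug_no_star[OF this] plug_no_star[OF n(1)]
    consider "k = 0" | "k \<noteq> 0" "k < length ys" | "k \<noteq> 0" "\<not> k < length ys" "k < length ys + length (labs G)"
      | "k \<noteq> 0" "\<not> k < length ys + length (labs G)" "k \<le> length (labs (plug ts G))"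
      | "k > length (labs (plug ts G))" by linarith
    then show ?thesis
    proof cases
      case 1 then show ?thesis by (simp add: ys)
    next
      case 2 then show ?thesis using IH[of "k - 1"] by (simp add: ys lp l(1) pl less_diff_conv2)
    next
      case 3
      then have "k - 1 - length ys' = k - length ys" by (simp add: ys)
      with 3 show ?thesis using IH[of "k - 1"] by (auto simp: ys lp l(1) pl)
    next
      case 4 then show ?thesis using IH[of "k - 1"] le * by (auto simp: ys lp l(1) pl)
    next
      case 5
      then have k: "k \<noteq> 0" "\<not> k < length ys + length (labs G)" by (auto simp: lp ys)
      with 5 show ?thesis using le ** by (simp add: ys pl)
    qed
  next
    case r
    have n: "None \<notin> set (labs ts)" "None \<notin> set ys''" using r "3.prems" ys by auto
    have so: "stars_ok us" using "3.prems" by simp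
    note IH = "3.IH"(2)[OF so r(1) n(2) "3.prems"(4), of "k - 1 - length (labs ts)"]
    have "None \<notin> set (labs (relabel_nth ts j (Some a)))" for j
      using n(1) set_update_subset_insert[of "labs ts" j "Some a"] by (auto simp: labs_relabel_nth)
    note pl = plug_no_star[OF this] plug_no_star[OF n(1)]
    consider "k = 0" | "k \<noteq> 0" "k \<le> length (labs ts)"
      | "k > length (labs ts)" "k < length ys" | "\<not> k < length ys" "k < length ys + length (labs G)"
      | "\<not> k < length ys + length (labs G)" by linarith
    then show ?thesis
    proof cases
      case 1 then show ?thesis by (simp add: ys)
    next
      case 2 then show ?thesis by (simp add: ys pl r(2))
    next
      case 3 then have "k - 1 - length (labs ts) < length ys''" by (auto simp: ys r(2))
      then show ?thesis using IH 3 by (simp add: ys r(2) pl)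
    next
      case 4
      then have "\<not> k - 1 - length (labs ts) < length ys''" "k - 1 - length (labs ts) < length ys'' + length (labs G)"
         "\<not> k \<le> length (labs ts)" "k - 1 - length (labs ts) - length ys'' = k - length ys" by (auto simp: ys r(2))
      then show ?thesis using IH 4 by (simp add: pl)
    next
      case 5
      then have "\<not> k - 1 - length (labs ts) < length ys''" "\<not> k - 1 - length (labs ts) < length ys'' + length (labs G)"
         "\<not> k \<le> length (labs ts)" "k - 1 - length (labs ts) + 1 - length (labs G) = k + 1 - length (labs G) - 1 - length (labs ts)"
         "\<not> k + 1 - length (labs G) \<le> length (labs ts)" "k + 1 - length (labs G) \<noteq> 0"
         by (auto simp: ys r(2))
      then show ?thesis using IH 5 by (simp add: pl)
    qed
  qed
qed simp

section \<open>Unfolding binary DAGs\<close>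

text \<open>The whole set of leaf depths: \<open>height\<close> is the maximum of such a set, and
  membership of a single depth is what bounds the length of the copied path.\<close>

primrec depths :: "'l btree \<Rightarrow> nat set" where
  "depths (BLeaf c) = {0}"
| "depths (BNode f s t) = Suc ` (depths s \<union> depths t)"

text \<open>The number of proper descendants. It decreases along every edge and is below the number
  of vertices; it serves as termination measure and later pays for the constants in composed
  effects.\<close>

definition rank :: "('v, 'l, 'z) bdag_scheme \<Rightarrow> 'v \<Rightarrow> nat" where
  "rank D v = card ((adj D)\<^sup>+ `` {v})"

lemma ex_dir: "(\<exists>d. P d) \<longleftrightarrow> P L \<or> P R"
  by (metis (full_types) dir.exhaust)

lemma all_dir: "(\<forall>d. P d) \<longleftrightarrow> P L \<and> P R"
  by (metis (full_types) dir.exhaust)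

locale bdag =
  fixes D :: "('v, 'l, 'z) bdag_scheme"
  assumes binary: "binary_dag D"
begin

lemma finite_verts: "finite (verts D)"
  using binary by (simp add: binary_dag_def)

lemma edge_verts: "(v, d, w) \<in> edges D \<Longrightarrow> v \<in> verts D \<and> w \<in> verts D"
  using binary by (auto simp: binary_dag_def)

lemma adj_verts: "(v, w) \<in> adj D \<Longrightarrow> v \<in> verts D \<and> w \<in> verts D"
  by (auto simp: adj_def dest: edge_verts)

lemma finite_adj: "finite (adj D)"
  by (rule finite_subset[of _ "verts D \<times> verts D"]) (auto simp: finite_verts dest: adj_verts)

lemma acyclic_adj: "acyclic (adj D)"
  using binary by (simp add: binary_dag_def)

lemma wf_adj: "wf ((adj D)\<inverse>)"
  by (rule finite_acyclic_wf_converse[OF finite_adj acyclic_adj])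

lemma edge_unique:
  assumes "(v, d, w) \<in> edges D" "(v, d, w') \<in> edges D"
  shows "w = w'"
proof -
  have "v \<in> verts D" "\<not> is_leaf D v" using assms edge_verts by (auto simp: is_leaf_def)
  then have "\<exists>!w. (v, d, w) \<in> edges D" using binary unfolding binary_dag_def by blast
  with assms show ?thesis by auto
qed

lemma child_eq: "(v, d, w) \<in> edges D \<Longrightarrow> child D v d = w"
  unfolding child_def using edge_unique by (intro the_equality) auto

lemma child_edge:
  assumes "v \<in> verts D" "\<not> is_leaf D v"
  shows "(v, d, child D v d) \<in> edges D"
proof -
  obtain w where "(v, d, w) \<in> edges D"
    using assms binary unfolding binary_dag_def by blast
  with child_eq show ?thesis by metis
qed

lemma edge_iff: "(v, d, w) \<in> edges D \<longleftrightarrow> v \<in> verts D \<and> \<not> is_leaf D v \<and> w = child D v d"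
  using child_edge child_eq edge_verts by (auto simp: is_leaf_def)

lemma child_verts: "v \<in> verts D \<Longrightarrow> \<not> is_leaf D v \<Longrightarrow> child D v d \<in> verts D"
  using child_edge edge_verts by blast

lemma adj_iff: "(v, w) \<in> adj D \<longleftrightarrow> v \<in> verts D \<and> \<not> is_leaf D v \<and> (w = child D v L \<or> w = child D v R)"
  unfolding adj_def edge_iff by (auto simp: ex_dir)

lemma dag_induct [consumes 1, case_names leaf inner]:
  assumes "v \<in> verts D"
    and "\<And>v. v \<in> verts D \<Longrightarrow> is_leaf D v \<Longrightarrow> P v"
    and "\<And>v. v \<in> verts D \<Longrightarrow> \<not> is_leaf D v \<Longrightarrow> P (child D v L) \<Longrightarrow> P (child D v R) \<Longrightarrow> P v"
  shows "P v"
  using assms(1)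
proof (induction v rule: wf_induct_rule[OF wf_adj])
  case (1 v)
  show ?case
  proof (cases "is_leaf D v")
    case False
    have "P (child D v d)" for d
      using False 1 child_edge[of v d] by (intro 1(1)) (auto simp: adj_def child_verts)
    with False show ?thesis using assms(3) 1(2) by blast
  qed (use 1(2) assms(2) in blast)
qed

lemma unfolds_unique: "unfolds D v s \<Longrightarrow> unfolds D v t \<Longrightarrow> s = t"
proof (induction arbitrary: t rule: unfolds.induct)
  case (leaf v)
  from leaf(3) show ?case by cases (use leaf in \<open>auto simp: is_leaf_def\<close>)
next
  case (inner v v1 v2 t1 t2)
  from inner.prems show ?case
  proof cases
    case leaf then show ?thesis using inner(1) by (auto simp: is_leaf_def)
  next
    case (inner w1 w2 s1 s2)
    then show ?thesis using inner.IH inner.hyps edge_unique by metis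
  qed
qed

lemma unfolds_exists: "v \<in> verts D \<Longrightarrow> \<exists>t. unfolds D v t"
proof (induction v rule: dag_induct)
  case (inner v)
  then show ?case using unfolds.inner child_edge by metis
qed (auto intro: unfolds.leaf)

lemma unfolds_unfold: "v \<in> verts D \<Longrightarrow> unfolds D v (unfold D v)"
  unfolding unfold_def using unfolds_exists unfolds_unique by (metis theI)

lemma unfold_eq: "unfolds D v t \<Longrightarrow> unfold D v = t"
  unfolding unfold_def using unfolds_unique by blast

lemma unfold_leaf: "v \<in> verts D \<Longrightarrow> is_leaf D v \<Longrightarrow> unfold D v = BLeaf (label D v)"
  by (intro unfold_eq unfolds.leaf)

lemma unfold_inner: "v \<in> verts D \<Longrightarrow> \<not> is_leaf D v \<Longrightarrow>
  unfold D v = BNode (label D v) (unfold D (child D v L)) (unfold D (child D v R))"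
  by (intro unfold_eq unfolds.inner[OF child_edge child_edge] unfolds_unfold child_verts)

text \<open>Splitting off the first edge of a path matches the recursion of \<open>depths\<close>.
  Hence the height depends only on the shape of the unfolding of the root.\<close>

lemma leaf_distances:
  "v \<in> verts D \<Longrightarrow> {n. \<exists>w \<in> verts D. is_leaf D w \<and> (v, w) \<in> adj D ^^ n} = depths (unfold D v)"
proof (induction v rule: dag_induct)
  case (leaf v)
  have "(v, w) \<in> adj D ^^ n \<longleftrightarrow> n = 0 \<and> v = w" for n w
  proof (cases n)
    case (Suc m)
    then show ?thesis using leaf by (metis adj_iff nat.distinct(1) relpow_Suc_D2)
  qed auto
  with leaf show ?case by (auto simp: unfold_leaf)
next
  case (inner v)
  have "(\<exists>w \<in> verts D. is_leaf D w \<and> (v, w) \<in> adj D ^^ n) \<longleftrightarrow>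
        (\<exists>m. n = Suc m \<and> (m \<in> depths (unfold D (child D v L)) \<or> m \<in> depths (unfold D (child D v R))))" for n
  proof (cases n)
    case 0
    then show ?thesis using inner by auto
  next
    case (Suc m)
    have "(v, w) \<in> adj D ^^ n \<longleftrightarrow> (child D v L, w) \<in> adj D ^^ m \<or> (child D v R, w) \<in> adj D ^^ m" for w
      unfolding Suc relpow.simps(2) relpow_commute[symmetric] using inner(1,2) by (auto simp: adj_iff)
    then have "(\<exists>w \<in> verts D. is_leaf D w \<and> (v, w) \<in> adj D ^^ n) \<longleftrightarrow>
      m \<in> {n. \<exists>w \<in> verts D. is_leaf D w \<and> (child D v L, w) \<in> adj D ^^ n} \<or>
      m \<in> {n. \<exists>w \<in> verts D. is_leaf D w \<and> (child D v R, w) \<in> adj D ^^ n}" by blast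
    then show ?thesis unfolding inner(3,4) Suc by simp
  qed
  then show ?case using inner(1,2) by (simp add: unfold_inner) blast
qed

lemma finite_depths [simp]: "finite (depths t)" and depths_nonempty [simp]: "depths t \<noteq> {}"
  by (induction t) auto

text \<open>The target of an edge is a descendant of the source but, by acyclicity, not of itself,
  so the inclusion of the descendant sets is strict.\<close>

lemma rank_less:
  assumes "(v, w) \<in> adj D"
  shows "rank D w < rank D v"
proof -
  have "(adj D)\<^sup>+ `` {w} \<subset> (adj D)\<^sup>+ `` {v}"
  proof
    show "(adj D)\<^sup>+ `` {w} \<subseteq> (adj D)\<^sup>+ `` {v}" using assms by (auto intro: trancl_into_trancl2)
    have "w \<in> (adj D)\<^sup>+ `` {v}" using assms by auto
    moreover have "w \<notin> (adj D)\<^sup>+ `` {w}" using acyclic_adj by (auto simp: acyclic_def)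
    ultimately show "(adj D)\<^sup>+ `` {w} \<noteq> (adj D)\<^sup>+ `` {v}" by blast
  qed
  moreover have "finite ((adj D)\<^sup>+ `` {v})"
    by (rule finite_subset[OF _ finite_verts]) (auto dest: tranclD2 adj_verts)
  ultimately show ?thesis unfolding rank_def by (rule psubset_card_mono[rotated])
qed

lemma rank_less_card:
  assumes "v \<in> verts D"
  shows "rank D v < card (verts D)"
  unfolding rank_def
proof (rule psubset_card_mono[OF finite_verts])
  have "v \<notin> (adj D)\<^sup>+ `` {v}" using acyclic_adj by (auto simp: acyclic_def)
  moreover have "(adj D)\<^sup>+ `` {v} \<subseteq> verts D" by (auto dest: tranclD2 adj_verts)
  ultimately show "(adj D)\<^sup>+ `` {v} \<subset> verts D" using assms by auto
qed

lemma rank_child_less: "v \<in> verts D \<Longrightarrow> \<not> is_leaf D v \<Longrightarrow> rank D (child D v d) < rank D v"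
  using child_edge by (intro rank_less) (auto simp: adj_def)

end

section \<open>Values of the vertices of an f-SLP\<close>

text \<open>Counts \<open>*\<close> as well, unlike \<open>leaf_size\<close>, because preorder
  numbers in a context do. By \<open>vlen_eq\<close> it is the sum of stored size and stored
  type.\<close>

definition vlen :: "('v, 'a label, 'z) bdag_scheme \<Rightarrow> 'v \<Rightarrow> nat" where
  "vlen D v = length (labs (sem D v))"

locale fslp = bdag D for D :: "('v, 'a label, 'z) bdag_scheme" +
  assumes valid: "v \<in> verts D \<Longrightarrow> eval_expr (unfold D v) \<noteq> None"
begin

lemma eval_sem: "v \<in> verts D \<Longrightarrow> eval_expr (unfold D v) = Some (sem D v)"
  using valid by (auto simp: sem_def)

lemma leaf_label: "v \<in> verts D \<Longrightarrow> is_leaf D v \<Longrightarrow> (\<exists>a. label D v = Sym a \<or> label D v = SymStar a)"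
  using valid[of v] by (cases "label D v") (auto simp: unfold_leaf)

lemma inner_label: "v \<in> verts D \<Longrightarrow> \<not> is_leaf D v \<Longrightarrow> label D v = HCat \<or> label D v = VComp"
  using valid[of v] by (cases "label D v") (auto simp: unfold_inner)

text \<open>Validity ties labels to shape: an operation at a leaf, or a symbol at an inner vertex,
  would evaluate to \<open>None\<close>.\<close>

lemma leaf_iff: "v \<in> verts D \<Longrightarrow> is_leaf D v \<longleftrightarrow> label D v \<noteq> HCat \<and> label D v \<noteq> VComp"
  using leaf_label inner_label by fastforce

lemma sem_Sym: "v \<in> verts D \<Longrightarrow> label D v = Sym a \<Longrightarrow> sem D v = [Node (Some a) []]"
  using eval_sem[of v] by (auto simp: unfold_leaf leaf_iff)

lemma sem_SymStar: "v \<in> verts D \<Longrightarrow> label D v = SymStar a \<Longrightarrow> sem D v = [Node (Some a) [Node None []]]"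
  using eval_sem[of v] by (auto simp: unfold_leaf leaf_iff)

lemma sem_HCat: "v \<in> verts D \<Longrightarrow> label D v = HCat \<Longrightarrow>
  sem D v = sem D (child D v L) @ sem D (child D v R) \<and>
  \<not> (is_context (sem D (child D v L)) \<and> is_context (sem D (child D v R)))"
  using eval_sem[of v] eval_sem[OF child_verts, of v L] eval_sem[OF child_verts, of v R]
  by (auto simp: unfold_inner leaf_iff hcat_def split: if_splits)

lemma sem_VComp: "v \<in> verts D \<Longrightarrow> label D v = VComp \<Longrightarrow>
  sem D v = plug (sem D (child D v L)) (sem D (child D v R)) \<and> is_context (sem D (child D v L))"
  using eval_sem[of v] eval_sem[OF child_verts, of v L] eval_sem[OF child_verts, of v R]
  by (auto simp: unfold_inner leaf_iff vcomp_def split: if_splits)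

lemma context_split:
  assumes "is_context F"
  obtains ys zs where "labs F = ys @ None # zs" "None \<notin> set ys" "None \<notin> set zs" "stars_ok F"
  using assms split_star[of "labs F" None] by (auto simp: is_context_iff)

text \<open>A concatenation of two contexts is undefined, and in a composition the \<open>*\<close>
  of the left value gives way to the right value; so no operation can produce a second
  \<open>*\<close>.\<close>

lemma sem_ok: "v \<in> verts D \<Longrightarrow> stars_ok (sem D v) \<and> count_list (labs (sem D v)) None \<le> 1"
proof (induction v rule: dag_induct)
  case (leaf v)
  then show ?case using leaf_label[OF leaf] by (auto simp: sem_Sym sem_SymStar)
next
  case (inner v)
  from inner_label[OF inner(1,2)] show ?case
  proof
    assume "label D v = HCat"
    with inner sem_HCat[OF inner(1)] show ?thesis by (auto simp: is_context_iff)
  next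
    assume "label D v = VComp"
    with sem_VComp[OF inner(1)] have s: "sem D v = plug (sem D (child D v L)) (sem D (child D v R))"
       "is_context (sem D (child D v L))" by auto
    from context_split[OF s(2)] obtain ys zs where
      l: "labs (sem D (child D v L)) = ys @ None # zs" "None \<notin> set ys" "None \<notin> set zs" "stars_ok (sem D (child D v L))" .
    show ?thesis unfolding s(1) labs_plug_split[OF l(4,1,2,3)] using inner(3,4) l(2,3) by (simp add: stars_ok_plug)
  qed
qed

text \<open>With at most one \<open>*\<close> in each value, the type is the number of stars. In
  this form it is additive under \<open>HCat\<close> and is inherited from the right child under
  \<open>VComp\<close>.\<close>

lemma vtype_eq_count: "v \<in> verts D \<Longrightarrow> vtype D v = count_list (labs (sem D v)) None"
  using sem_ok[of v] by (auto simp: vtype_def is_context_iff)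

lemma vtype_le: "vtype D v \<le> 1" by (simp add: vtype_def)

lemma vlen_eq:
  assumes "v \<in> verts D"
  shows "vlen D v = leaf_size D v + vtype D v"
proof -
  have *: "length xs = length (filter (\<lambda>x. x \<noteq> None) xs) + count_list xs None" for xs :: "'a option list"
    by (induction xs) auto
  show ?thesis unfolding vlen_def leaf_size_def card_labelled vtype_eq_count[OF assms] by (rule *)
qed

lemma left_size_split:
  assumes "v \<in> verts D" "vtype D v = 1"
  obtains ys zs where "labs (sem D v) = ys @ None # zs" "None \<notin> set ys" "None \<notin> set zs"
    "stars_ok (sem D v)" "length ys = left_size D v"
proof -
  from assms have "is_context (sem D v)" by (auto simp: vtype_def split: if_splits)
  from context_split[OF this] obtain ys zs where
    *: "labs (sem D v) = ys @ None # zs" "None \<notin> set ys" "None \<notin> set zs" "stars_ok (sem D v)" .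
  with star_index[OF *(1-3)] that show ?thesis by (simp add: left_size_def)
qed

lemma vtype_HCat:
  assumes "v \<in> verts D" "label D v = HCat"
  shows "vtype D v = vtype D (child D v L) + vtype D (child D v R)"
  using sem_HCat[OF assms] assms by (simp add: vtype_eq_count child_verts leaf_iff)

lemma vtype_VComp:
  assumes "v \<in> verts D" "label D v = VComp"
  shows "vtype D (child D v L) = 1" "vtype D v = vtype D (child D v R)"
proof -
  have s: "sem D v = plug (sem D (child D v L)) (sem D (child D v R))" "is_context (sem D (child D v L))"
    using sem_VComp[OF assms] by auto
  from s(2) show "vtype D (child D v L) = 1" by (auto simp: vtype_def split: if_splits)
  from context_split[OF s(2)] obtain ys zs where
    l: "labs (sem D (child D v L)) = ys @ None # zs" "None \<notin> set ys" "None \<notin> set zs" "stars_ok (sem D (child D v L))" .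
  have "child D v R \<in> verts D" using assms by (simp add: child_verts leaf_iff)
  then show "vtype D v = vtype D (child D v R)"
    using assms(1) l(2,3) by (simp add: vtype_eq_count s(1) labs_plug_split[OF l(4,1,2,3)])
qed

end

lemma fslp_iff: "f_slp D \<longleftrightarrow> fslp D"
  by (auto simp: f_slp_def fslp_def bdag_def fslp_axioms_def)

lemma height_eq:
  assumes "bdag D" "root_vertex D \<in> verts D"
  shows "height D = Max (depths (unfold D (root_vertex D)))"
  unfolding height_def using bdag.leaf_distances[OF assms] by simp

section \<open>Copying the path to a vertex\<close>

text \<open>At a \<open>VComp\<close> vertex the right value occupies the interval of numbers that
  begins at the left size of the left child; all other numbers belong to the left child.\<close>

definition step_dir :: "('v, 'a label, 'z) bdag_scheme \<Rightarrow> 'v \<Rightarrow> nat \<Rightarrow> dir" where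
  "step_dir D u k =
     (if label D u = HCat then (if k < vlen D (child D u L) then L else R)
      else if left_size D (child D u L) \<le> k \<and> k < left_size D (child D u L) + vlen D (child D u R) then R
      else L)"

text \<open>In the last case the number lies behind the plugged value. The left child has the single
  entry \<open>*\<close> in place of that value, which accounts for the \<open>+ 1\<close>.\<close>

definition step_pos :: "('v, 'a label, 'z) bdag_scheme \<Rightarrow> 'v \<Rightarrow> nat \<Rightarrow> nat" where
  "step_pos D u k =
     (if label D u = HCat then
        (if k < vlen D (child D u L) then k else k - vlen D (child D u L))
      else if k < left_size D (child D u L) then k
      else if k < left_size D (child D u L) + vlen D (child D u R) then k - left_size D (child D u L)
      else k + 1 - vlen D (child D u R))"

text \<open>Total form of the two operations, so that the step equation can be stated without
  options; definedness is treated separately.\<close>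

definition combine :: "'a label \<Rightarrow> 'a option forest \<Rightarrow> 'a option forest \<Rightarrow> 'a option forest" where
  "combine f F G = (if f = HCat then F @ G else plug F G)"

text \<open>Type, size and left size are functions of the pattern of \<open>None\<close> entries,
  and writing a symbol over a symbol preserves that pattern.\<close>

lemma isnone_update:
  "xs ! k \<noteq> None \<Longrightarrow> map (\<lambda>x. x = None) (xs[k := Some a]) = map (\<lambda>x. x = None) xs"
  by (cases "k < length xs") (auto simp: map_update list_update_same_conv list_update_beyond)

lemma count_isnone: "count_list xs None = count_list (map (\<lambda>x. x = None) xs) True"
  by (induction xs) auto

lemma filter_isnone: "length (filter (\<lambda>x. x \<noteq> None) xs) = length (filter Not (map (\<lambda>x. x = None) xs))"
  by (induction xs) auto

lemma is_context_relabel_nth: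
  assumes "stars_ok F" "labs F ! k \<noteq> None"
  shows "is_context (relabel_nth F k (Some a)) \<longleftrightarrow> is_context F"
  using assms by (simp add: is_context_iff stars_ok_relabel_nth labs_relabel_nth count_isnone isnone_update)

context fslp
begin

text \<open>The rules for concatenation and plugging, read as the choice of one child. That the
  addressed label is not \<open>*\<close> belongs to the invariant: at a leaf of the f-SLP the
  number must point to the symbol itself.\<close>

lemma step:
  assumes u: "u \<in> verts D" "\<not> is_leaf D u" and k: "k < vlen D u" "labs (sem D u) ! k \<noteq> None"
  shows "step_pos D u k < vlen D (child D u (step_dir D u k))"
    "labs (sem D (child D u (step_dir D u k))) ! step_pos D u k \<noteq> None"
    "relabel_nth (sem D u) k (Some a) = combine (label D u)
       (if step_dir D u k = L then relabel_nth (sem D (child D u L)) (step_pos D u k) (Some a)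
        else sem D (child D u L))
       (if step_dir D u k = R then relabel_nth (sem D (child D u R)) (step_pos D u k) (Some a)
        else sem D (child D u R))"
proof -
  have "step_pos D u k < vlen D (child D u (step_dir D u k)) \<and>
    labs (sem D (child D u (step_dir D u k))) ! step_pos D u k \<noteq> None \<and>
    relabel_nth (sem D u) k (Some a) = combine (label D u)
       (if step_dir D u k = L then relabel_nth (sem D (child D u L)) (step_pos D u k) (Some a)
        else sem D (child D u L))
       (if step_dir D u k = R then relabel_nth (sem D (child D u R)) (step_pos D u k) (Some a)
        else sem D (child D u R))"
  proof (cases "label D u = HCat")
    case True
    have "sem D u = sem D (child D u L) @ sem D (child D u R)" using sem_HCat[OF u(1) True] by simp
    then show ?thesis using True k
      by (auto simp: step_dir_def step_pos_def combine_def vlen_def relabel_nth_append nth_append)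
  next
    case False
    then have f: "label D u = VComp" using inner_label[OF u] by blast
    have s: "sem D u = plug (sem D (child D u L)) (sem D (child D u R))" using sem_VComp[OF u(1) f] by simp
    obtain ys zs where l: "labs (sem D (child D u L)) = ys @ None # zs" "None \<notin> set ys" "None \<notin> set zs"
      "stars_ok (sem D (child D u L))" "length ys = left_size D (child D u L)"
      using left_size_split[of "child D u L"] vtype_VComp[OF u(1) f] u by (auto simp: child_verts)
    have lu: "labs (sem D u) = ys @ labs (sem D (child D u R)) @ zs"
      unfolding s by (rule labs_plug_split[OF l(4,1-3)])
    consider "k < length ys" | "length ys \<le> k" "k < length ys + vlen D (child D u R)"
      | "length ys + vlen D (child D u R) \<le> k" by linarith
    then show ?thesis
    proof cases
      case 1
      then show ?thesis using k f l(1,5) unfolding s relabel_nth_plug[OF l(4,1-3)]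
        by (auto simp: step_dir_def step_pos_def combine_def vlen_def nth_append lu s[symmetric])
    next
      case 2
      then show ?thesis using k f l(1,5) unfolding s relabel_nth_plug[OF l(4,1-3)]
        by (auto simp: step_dir_def step_pos_def combine_def vlen_def nth_append lu s[symmetric] less_diff_conv2)
    next
      case 3
      \<comment> \<open>\<open>j\<close> counts the places behind the plugged value; writing
        \<open>k\<close> as a sum avoids truncated subtraction.\<close>
      define j where "j = k - length ys - vlen D (child D u R)"
      have kj: "k = length ys + vlen D (child D u R) + j" using 3 by (simp add: j_def)
      have d: "step_dir D u k = L" using 3 f l(5) by (auto simp: step_dir_def)
      have p: "step_pos D u k = length ys + 1 + j" using 3 f l(5) by (auto simp: step_pos_def kj)
      have j: "j < length zs" "zs ! j \<noteq> None" using k 3 by (auto simp: vlen_def lu kj nth_append)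
      show ?thesis using 3 f j unfolding s relabel_nth_plug[OF l(4,1-3)] d p
        by (auto simp: combine_def vlen_def l(1) nth_append kj)
    qed
  qed
  then show "step_pos D u k < vlen D (child D u (step_dir D u k))"
    "labs (sem D (child D u (step_dir D u k))) ! step_pos D u k \<noteq> None"
    "relabel_nth (sem D u) k (Some a) = combine (label D u)
       (if step_dir D u k = L then relabel_nth (sem D (child D u L)) (step_pos D u k) (Some a)
        else sem D (child D u L))
       (if step_dir D u k = R then relabel_nth (sem D (child D u R)) (step_pos D u k) (Some a)
        else sem D (child D u R))" by blast+
qed

end

text \<open>Runs on beyond the first leaf, where \<open>child\<close> is unspecified; the meaningful
  part ends at \<open>descent_length\<close>.\<close>

primrec descend :: "('v, 'a label, 'z) bdag_scheme \<Rightarrow> 'v \<Rightarrow> nat \<Rightarrow> nat \<Rightarrow> 'v \<times> nat" where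
  "descend D u k 0 = (u, k)"
| "descend D u k (Suc i) = (case descend D u k i of (v, j) \<Rightarrow> (child D v (step_dir D v j), step_pos D v j))"

definition descent_length :: "('v, 'a label, 'z) bdag_scheme \<Rightarrow> 'v \<Rightarrow> nat \<Rightarrow> nat" where
  "descent_length D u k = (LEAST i. is_leaf D (fst (descend D u k i)))"

text \<open>The kind of the leaf is kept, so that the copy of a leaf of type 1 again has type
  1.\<close>

primrec set_symbol :: "'a \<Rightarrow> 'a label \<Rightarrow> 'a label" where
  "set_symbol a (Sym b) = Sym a"
| "set_symbol a (SymStar b) = SymStar a"
| "set_symbol a HCat = HCat"
| "set_symbol a VComp = VComp"

text \<open>The copy of the \<open>i\<close>-th path vertex is \<open>N + i\<close>. Its edge in the
  direction of the descent leads to the next copy and its other edge to the old sibling. Consecutive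
  numbers fit the memory format, in which the vertices are the numbers below a bound, and they make
  every edge between copies ascend.\<close>

definition copy_path :: "(nat, 'a label, 'z) rooted_bdag_scheme \<Rightarrow> nat \<Rightarrow> 'a \<Rightarrow> (nat, 'a label) rooted_bdag" where
  "copy_path D k a =
     (let N = card (verts D);
          l = descent_length D (root_vertex D) k;
          u = (\<lambda>i. fst (descend D (root_vertex D) k i));
          d = (\<lambda>i. step_dir D (u i) (snd (descend D (root_vertex D) k i)))
      in \<lparr>verts = {..<N + l + 1},
          edges = edges D \<union>
            {(N + i, e, if e = d i then N + i + 1 else child D (u i) e) | i e. i < l},
          label = (\<lambda>v. if v < N then label D v
                       else if v < N + l then label D (u (v - N)) else set_symbol a (label D (u l))),
          root_vertex = N\<rparr>)"

section \<open>Correctness of the copied path\<close>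

locale relabelling = fslp D for D :: "(nat, 'a label) rooted_bdag" +
  fixes k :: nat and a :: 'a
  assumes verts_lessThan: "verts D = {..<card (verts D)}"
    and root: "root_vertex D \<in> verts D"
    and k_less: "k < vlen D (root_vertex D)"
    and k_label: "labs (sem D (root_vertex D)) ! k \<noteq> None"
begin

abbreviation N where "N \<equiv> card (verts D)"
definition len where "len = descent_length D (root_vertex D) k"
definition pu where "pu i = fst (descend D (root_vertex D) k i)"
definition pk where "pk i = snd (descend D (root_vertex D) k i)"
definition pd where "pd i = step_dir D (pu i) (pk i)"
abbreviation D' where "D' \<equiv> copy_path D k a"

lemma pu_0: "pu 0 = root_vertex D" and pk_0: "pk 0 = k"
  by (simp_all add: pu_def pk_def)

lemma pu_Suc: "pu (Suc i) = child D (pu i) (pd i)" and pk_Suc: "pk (Suc i) = step_pos D (pu i) (pk i)"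
  by (simp_all add: pu_def pk_def pd_def split_beta)

text \<open>The rank drops at each inner vertex, so a descent that never met a leaf would use up
  more than the rank of the root.\<close>

lemma ex_leaf: "\<exists>i. is_leaf D (pu i)"
proof (rule ccontr)
  assume *: "\<nexists>i. is_leaf D (pu i)"
  have "pu i \<in> verts D \<and> rank D (pu i) + i \<le> rank D (pu 0)" for i
  proof (induction i)
    case (Suc i)
    then have "rank D (pu (Suc i)) < rank D (pu i)" "pu (Suc i) \<in> verts D"
      using * unfolding pu_Suc by (auto intro: rank_child_less child_verts)
    then show ?case using Suc by simp
  qed (simp add: pu_0 root)
  from this[of "Suc (rank D (pu 0))"] show False by simp
qed

lemma len_leaf: "is_leaf D (pu len)" and not_leaf_less: "i < len \<Longrightarrow> \<not> is_leaf D (pu i)"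
  using LeastI_ex[OF ex_leaf] not_less_Least[of _ "\<lambda>i. is_leaf D (pu i)"]
  by (simp_all add: len_def descent_length_def pu_def)

text \<open>The last conjunct bounds the length of the path by the rank of the root, hence by the
  number of vertices; this keeps the numbers of the new vertices below the word bound.\<close>

lemma path_ok: "i \<le> len \<Longrightarrow> pu i \<in> verts D \<and> pk i < vlen D (pu i) \<and> labs (sem D (pu i)) ! pk i \<noteq> None
  \<and> rank D (pu i) + i \<le> rank D (root_vertex D)"
proof (induction i)
  case (Suc i)
  then have IH: "pu i \<in> verts D" "pk i < vlen D (pu i)" "labs (sem D (pu i)) ! pk i \<noteq> None"
    "rank D (pu i) + i \<le> rank D (root_vertex D)" and nl: "\<not> is_leaf D (pu i)"
    using not_leaf_less by auto
  from step(1,2)[OF IH(1) nl IH(2,3)] rank_child_less[OF IH(1) nl, of "pd i"] IH(4)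
  show ?case unfolding pu_Suc pk_Suc pd_def by (auto intro: child_verts[OF IH(1) nl])
qed (simp add: pu_0 pk_0 root k_less k_label)

lemma len_less: "len < N"
  using path_ok[of len] rank_less_card[OF root] by simp

lemma verts': "verts D' = {..<N + len + 1}"
  and root': "root_vertex D' = N"
  and edges': "edges D' = edges D \<union> {(N + i, e, if e = pd i then N + i + 1 else child D (pu i) e) | i e. i < len}"
  and label': "label D' v = (if v < N then label D v
                       else if v < N + len then label D (pu (v - N)) else set_symbol a (label D (pu len)))"
  by (simp_all add: copy_path_def Let_def len_def pu_def pd_def pk_def)

lemma old_edge: "v < N \<Longrightarrow> (v, d, w) \<in> edges D' \<longleftrightarrow> (v, d, w) \<in> edges D"
  by (auto simp: edges')

lemma new_edge: "(N + i, d, w) \<in> edges D' \<longleftrightarrow> i < len \<and> w = (if d = pd i then N + i + 1 else child D (pu i) d)"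
  using verts_lessThan edge_verts by (auto simp: edges')

lemma less_N: "v < N \<longleftrightarrow> v \<in> verts D" using verts_lessThan by (metis lessThan_iff)

lemma bdag': "bdag D'"
proof
  have in_verts: "w < N + len + 1" if "(v, d, w) \<in> edges D'" for v d w
  proof (cases "v < N")
    case True
    then show ?thesis using that edge_verts[of v d w] by (simp add: old_edge less_N[symmetric])
  next
    case False
    then obtain i where v: "v = N + i" by (metis le_add_diff_inverse not_less)
    with that have "i < len" "w = (if d = pd i then N + i + 1 else child D (pu i) d)" by (auto simp: new_edge)
    moreover have "child D (pu i) d < N" if "i < len"
      using path_ok[of i] not_leaf_less[of i] that unfolding less_N by (simp add: child_verts)
    ultimately show ?thesis by (simp split: if_splits)
  qed
  have src: "v < N + len" if "(v, d, w) \<in> edges D'" for v d w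
  proof (cases "v < N")
    case False
    then obtain i where v: "v = N + i" by (metis le_add_diff_inverse not_less)
    with that show ?thesis by (auto simp: new_edge)
  qed simp
  \<comment> \<open>The measure for acyclicity: copies get values from \<open>N\<close> on,
    decreasing along the path, and old vertices keep their ranks, which are below
    \<open>N\<close>.\<close>
  define \<mu> where "\<mu> v = (if v < N then rank D v else N + (N + len - v))" for v
  have "\<mu> w < \<mu> v" if "(v, w) \<in> adj D'" for v w
  proof -
    from that obtain d where e: "(v, d, w) \<in> edges D'" by (auto simp: adj_def)
    show ?thesis
    proof (cases "v < N")
      case True
      then have "(v, d, w) \<in> edges D" using e by (simp add: old_edge)
      then show ?thesis using rank_less[of v w] edge_verts[of v d w] by (auto simp: \<mu>_def adj_def less_N)
    next
      case False
      then obtain i where v: "v = N + i" by (metis le_add_diff_inverse not_less)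
      with e have i: "i < len" "w = (if d = pd i then N + i + 1 else child D (pu i) d)" by (auto simp: new_edge)
      moreover have c: "child D (pu i) d \<in> verts D"
        using path_ok[of i] not_leaf_less[of i] i(1) by (simp add: child_verts)
      moreover note c[folded less_N] rank_less_card[OF c]
      ultimately show ?thesis using v by (auto simp: \<mu>_def)
    qed
  qed
  then have acyc: "acyclic (adj D')" by (rule acyclicI_order)
  have out: "is_leaf D' v \<or> (\<forall>d. \<exists>!w. (v, d, w) \<in> edges D')" for v
  proof (cases "v < N")
    case True
    have "is_leaf D v \<or> (\<forall>d. \<exists>!w. (v, d, w) \<in> edges D)"
      using binary True unfolding binary_dag_def less_N by blast
    then show ?thesis by (simp add: old_edge[OF True] is_leaf_def)
  next
    case False
    then obtain i where v: "v = N + i" by (metis le_add_diff_inverse not_less)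
    then show ?thesis by (cases "i < len") (auto simp: new_edge is_leaf_def)
  qed
  have in_verts': "v \<in> verts D' \<and> w \<in> verts D'" if "(v, d, w) \<in> edges D'" for v d w
    using in_verts[OF that] src[OF that] by (simp add: verts')
  have "edges D' \<subseteq> verts D' \<times> UNIV \<times> verts D'"
  proof
    fix x assume "x \<in> edges D'"
    then show "x \<in> verts D' \<times> UNIV \<times> verts D'" by (cases x) (auto dest: in_verts')
  qed
  then show "binary_dag D'" unfolding binary_dag_def using acyc out by (simp add: verts')
qed

sublocale D': bdag D' by (rule bdag')

lemma leaf_old: "v < N \<Longrightarrow> is_leaf D' v \<longleftrightarrow> is_leaf D v"
  by (simp add: is_leaf_def old_edge)

lemma leaf_new: "is_leaf D' (N + i) \<longleftrightarrow> i \<ge> len"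
  by (auto simp: is_leaf_def new_edge)

lemma child_old: "v < N \<Longrightarrow> child D' v d = child D v d"
  by (simp add: child_def old_edge)

lemma child_new: "i < len \<Longrightarrow> child D' (N + i) d = (if d = pd i then N + i + 1 else child D (pu i) d)"
  by (intro D'.child_eq) (simp add: new_edge)

lemma label_old: "v < N \<Longrightarrow> label D' v = label D v"
  and label_new: "i < len \<Longrightarrow> label D' (N + i) = label D (pu i)"
  and label_last: "label D' (N + len) = set_symbol a (label D (pu len))"
  by (simp_all add: label')

lemma unfold_old: "v < N \<Longrightarrow> unfold D' v = unfold D v"
proof -
  have "v \<in> verts D \<Longrightarrow> unfold D' v = unfold D v" for v
  proof (induction v rule: dag_induct)
    case (leaf v)
    then have v: "v < N" "is_leaf D' v" by (auto simp: less_N leaf_old)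
    then show ?case using leaf by (simp add: unfold_leaf D'.unfold_leaf verts' label_old)
  next
    case (inner v)
    then have v: "v < N" "\<not> is_leaf D' v" by (auto simp: less_N leaf_old)
    then show ?case using inner by (simp add: unfold_inner D'.unfold_inner verts' label_old child_old)
  qed
  then show "v < N \<Longrightarrow> unfold D' v = unfold D v" by (simp add: less_N)
qed

text \<open>The induction runs upwards from the copied leaf. Equal depth sets give equal heights,
  and the third conjunct exhibits the rest of the path as a path to a leaf, so that its length is at
  most the height.\<close>

lemma eval_new: "i \<le> len \<Longrightarrow> eval_expr (unfold D' (N + i)) = Some (relabel_nth (sem D (pu i)) (pk i) (Some a))
  \<and> depths (unfold D' (N + i)) = depths (unfold D (pu i)) \<and> len - i \<in> depths (unfold D (pu i))"
proof (induction rule: inc_induct)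
  case base
  have p: "pu len \<in> verts D" "pk len < vlen D (pu len)" "labs (sem D (pu len)) ! pk len \<noteq> None"
    using path_ok[of len] by auto
  from leaf_label[OF p(1) len_leaf] obtain b where "label D (pu len) = Sym b \<or> label D (pu len) = SymStar b" by blast
  moreover have "unfold D' (N + len) = BLeaf (label D' (N + len))"
    by (intro D'.unfold_leaf) (auto simp: leaf_new verts')
  \<comment> \<open>The second entry of a \<open>SymStar\<close> leaf is \<open>*\<close>, so the
    addressed number is 0 for both kinds of leaves.\<close>
  ultimately show ?case using p by (cases "pk len"; cases "pk len - 1") (auto simp: label_last sem_Sym sem_SymStar vlen_def unfold_leaf len_leaf nth_Cons')
next
  case (step i)
  then have i: "i < len" by simp
  have p: "pu i \<in> verts D" "pk i < vlen D (pu i)" "labs (sem D (pu i)) ! pk i \<noteq> None" "\<not> is_leaf D (pu i)"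
    using path_ok[of i] not_leaf_less[OF i] i by auto
  have n: "N + i \<in> verts D'" "\<not> is_leaf D' (N + i)" using i by (auto simp: verts' leaf_new)
  have s: "pk (Suc i) < vlen D (child D (pu i) (pd i))" "labs (sem D (child D (pu i) (pd i))) ! pk (Suc i) \<noteq> None"
    "relabel_nth (sem D (pu i)) (pk i) (Some a) = combine (label D (pu i))
       (if pd i = L then relabel_nth (sem D (child D (pu i) L)) (pk (Suc i)) (Some a) else sem D (child D (pu i) L))
       (if pd i = R then relabel_nth (sem D (child D (pu i) R)) (pk (Suc i)) (Some a) else sem D (child D (pu i) R))"
    using fslp_axioms fslp.step[OF _ p(1,4,2,3)] by (auto simp: pd_def pk_Suc)
  have c: "child D (pu i) d \<in> verts D" for d using p by (simp add: child_verts)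
  have old: "unfold D' (child D (pu i) d) = unfold D (child D (pu i) d)" for d
    using c by (simp add: unfold_old less_N)
  have ev: "eval_expr (unfold D (child D (pu i) d)) = Some (sem D (child D (pu i) d))" for d
    by (rule eval_sem[OF c])
  have IH: "eval_expr (unfold D' (Suc (N + i))) = Some (relabel_nth (sem D (child D (pu i) (pd i))) (pk (Suc i)) (Some a))"
    "depths (unfold D' (Suc (N + i))) = depths (unfold D (child D (pu i) (pd i)))"
    "len - Suc i \<in> depths (unfold D (child D (pu i) (pd i)))"
    using step.IH by (auto simp: pu_Suc)
  \<comment> \<open>Definedness of the operations depends only on which operands are contexts, and
    relabelling does not affect that.\<close>
  have ctx: "is_context (relabel_nth (sem D (child D (pu i) (pd i))) (pk (Suc i)) (Some a)) \<longleftrightarrow>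
    is_context (sem D (child D (pu i) (pd i)))"
    using sem_ok[OF c] s(2) by (intro is_context_relabel_nth) auto
  have u: "unfold D' (N + i) = BNode (label D (pu i)) (unfold D' (child D' (N + i) L)) (unfold D' (child D' (N + i) R))"
    using n i by (simp add: D'.unfold_inner label_new)
  have d1: "len - i = Suc (len - Suc i)" using i by simp
  have "depths (unfold D' (N + i)) = depths (unfold D (pu i)) \<and> len - i \<in> depths (unfold D (pu i))"
    unfolding u using IH p i by (cases "pd i") (auto simp: child_new old unfold_inner d1)
  moreover have "eval_expr (unfold D' (N + i)) = Some (relabel_nth (sem D (pu i)) (pk i) (Some a))"
    using inner_label[OF p(1,4)]
  proof
    assume f: "label D (pu i) = HCat"
    show ?thesis using sem_HCat[OF p(1) f] IH(1) ctx i s(3) f unfolding u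
      by (cases "pd i") (auto simp: child_new old ev hcat_def combine_def)
  next
    assume f: "label D (pu i) = VComp"
    show ?thesis using sem_VComp[OF p(1) f] IH(1) ctx i s(3) f unfolding u
      by (cases "pd i") (auto simp: child_new old ev vcomp_def combine_def)
  qed
  ultimately show ?case by blast
qed

lemma vert_cases':
  assumes "v \<in> verts D'"
  obtains "v < N" | i where "v = N + i" "i \<le> len"
proof (cases "v < N")
  case False
  then have "v = N + (v - N)" "v - N \<le> len" using assms by (auto simp: verts')
  with that(2) show ?thesis by blast
qed (use that(1) in blast)

lemma fslp': "fslp D'"
proof
  fix v assume "v \<in> verts D'"
  then show "eval_expr (unfold D' v) \<noteq> None"
    by (cases rule: vert_cases') (auto simp: unfold_old less_N valid eval_new)
qed

sublocale D': fslp D' by (rule fslp')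

lemma sem_old: "v < N \<Longrightarrow> sem D' v = sem D v"
  by (simp add: sem_def unfold_old)

lemma sem_new: "i \<le> len \<Longrightarrow> sem D' (N + i) = relabel_nth (sem D (pu i)) (pk i) (Some a)"
  by (simp add: sem_def eval_new)

lemma sizes_old: "v < N \<Longrightarrow> vtype D' v = vtype D v" "v < N \<Longrightarrow> leaf_size D' v = leaf_size D v"
   "v < N \<Longrightarrow> left_size D' v = left_size D v"
  by (simp_all add: vtype_def leaf_size_def left_size_def sem_old)

text \<open>Why the program may copy the size records: a copy has the same pattern of stars as its
  original.\<close>

lemma sizes_new:
  assumes i: "i \<le> len"
  shows "vtype D' (N + i) = vtype D (pu i)" "leaf_size D' (N + i) = leaf_size D (pu i)"
    "vtype D (pu i) = 1 \<Longrightarrow> left_size D' (N + i) = left_size D (pu i)"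
proof -
  have p: "pu i \<in> verts D" "labs (sem D (pu i)) ! pk i \<noteq> None"
    using path_ok[OF i] by auto
  have v: "N + i \<in> verts D'" using i by (simp add: verts')
  show t: "vtype D' (N + i) = vtype D (pu i)"
    unfolding vtype_def sem_new[OF i] using sem_ok[OF p(1)] p(2) by (simp add: is_context_relabel_nth)
  show "leaf_size D' (N + i) = leaf_size D (pu i)"
    unfolding leaf_size_def card_labelled filter_isnone sem_new[OF i] labs_relabel_nth isnone_update[OF p(2)] ..
  assume t1: "vtype D (pu i) = 1"
  from left_size_split[OF p(1) this] obtain ys zs where
    y: "labs (sem D (pu i)) = ys @ None # zs" "None \<notin> set ys" "length ys = left_size D (pu i)" by metis
  from D'.left_size_split[OF v] t t1 obtain ys' zs' where
    y': "labs (sem D' (N + i)) = ys' @ None # zs'" "None \<notin> set ys'" "length ys' = left_size D' (N + i)" by metis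
  \<comment> \<open>The left size is expressed through the star pattern alone, so that equal
    patterns give equal left sizes.\<close>
  have *: "length (takeWhile Not (map (\<lambda>x. x = None) (xs @ None # zs))) = length xs"
    if "None \<notin> set xs" for xs zs :: "'a option list"
    using that
  proof (induction xs)
    case (Cons x xs) then show ?case by (cases x) auto
  qed simp
  have "map (\<lambda>x. x = None) (labs (sem D' (N + i))) = map (\<lambda>x. x = None) (labs (sem D (pu i)))"
    unfolding sem_new[OF i] labs_relabel_nth by (rule isnone_update[OF p(2)])
  then have "length (takeWhile Not (map (\<lambda>x. x = None) (labs (sem D' (N + i))))) =
    length (takeWhile Not (map (\<lambda>x. x = None) (labs (sem D (pu i)))))" by (rule arg_cong)
  then show "left_size D' (N + i) = left_size D (pu i)"
    unfolding y(1) y'(1) *[OF y(2)] *[OF y'(2)] y(3) y'(3) .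
qed

lemma height': "height D' = height D"
  using height_eq[OF bdag_axioms root] height_eq[OF bdag'] eval_new[of 0] pu_0
  by (simp add: root' verts')

lemma len_le_height: "len \<le> height D"
  using height_eq[OF bdag_axioms root] eval_new[of 0] pu_0 by simp

text \<open>All added edges start at copies, so restricting the edges to old sources and targets
  gives back \<open>edges D\<close>.\<close>

lemma extension: "is_extension D {N..N + len} D'"
proof -
  have "edges D' \<inter> (verts D \<times> UNIV \<times> verts D) = edges D"
  proof (intro set_eqI)
    fix x :: "nat \<times> dir \<times> nat"
    obtain v d w where x: "x = (v, d, w)" by (cases x)
    show "x \<in> edges D' \<inter> (verts D \<times> UNIV \<times> verts D) \<longleftrightarrow> x \<in> edges D"
      using old_edge[of v d w] edge_verts[of v d w] less_N[of v] unfolding x by auto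
  qed
  moreover have "verts D' = verts D \<union> {N..N + len}" unfolding verts' by (subst verts_lessThan) auto
  moreover have "{N..N + len} \<inter> verts D = {}" by (subst verts_lessThan) auto
  moreover have "label D' v = label D v" if "v \<in> verts D" for v using that less_N label_old by metis
  ultimately show ?thesis using fslp' by (simp add: is_extension_def fslp_iff)
qed

lemma sem_root': "sem D' (root_vertex D') = relabel_nth (sem D (root_vertex D)) k (Some a)"
  using sem_new[of 0] by (simp add: root' pu_0 pk_0)

end

section \<open>Configurations\<close>

definition ce :: "('v, 'a label, 'z) bdag_scheme \<Rightarrow> ('q, 'a label) dbuta \<Rightarrow> 'v \<Rightarrow> 'q" where
  "ce D B v = run B (unfold D v) {}"

text \<open>The state at \<open>u\<close> when marked leaves occur only below the
  \<open>d\<close>-child, which is in state \<open>q\<close>; the other child is then in its state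
  for the empty set.\<close>

primrec trans_state :: "('v, 'a label, 'z) bdag_scheme \<Rightarrow> ('q, 'a label) dbuta \<Rightarrow> 'v \<Rightarrow> dir \<Rightarrow> 'q \<Rightarrow> 'q" where
  "trans_state D B u L q = delta2 B q (ce D B (child D u R)) (label D u)"
| "trans_state D B u R q = delta2 B (ce D B (child D u L)) q (label D u)"

definition moves :: "('v, 'a label, 'z) bdag_scheme \<Rightarrow> ('q, 'a label) dbuta \<Rightarrow> 'v \<Rightarrow> 'q \<Rightarrow> (dir \<times> 'q) set" where
  "moves D B u p = {(d, q). u \<in> verts D \<and> \<not> is_leaf D u \<and> (child D u d, q) \<in> conf_a D B \<and> trans_state D B u d q = p}"

definition has_sink :: "('v, 'a label, 'z) bdag_scheme \<Rightarrow> ('q, 'a label) dbuta \<Rightarrow> 'v \<Rightarrow> 'q \<Rightarrow> bool" where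
  "has_sink D B u p \<longleftrightarrow> (u, p) \<in> conf_u D B \<and> moves D B u p \<noteq> {}"

text \<open>Names for the outgoing edges of \<open>Conf u p\<close> once the sinks are added, with
  \<open>None\<close> for the edge to the sink. The names do not mention the graph, so the edges of
  an old vertex are named alike before and after the extension.\<close>

definition options :: "('v, 'a label, 'z) bdag_scheme \<Rightarrow> ('q, 'a label) dbuta \<Rightarrow> 'v \<Rightarrow> 'q \<Rightarrow> (dir \<times> 'q) option set" where
  "options D B u p = Some ` moves D B u p \<union> (if has_sink D B u p then {None} else {})"

definition opt_target :: "('v, 'a label, 'z) bdag_scheme \<Rightarrow> 'v \<Rightarrow> 'q \<Rightarrow> (dir \<times> 'q) option \<Rightarrow> ('v, 'q) pnode" where
  "opt_target D u p o' = (case o' of None \<Rightarrow> Sink u p | Some (d, q) \<Rightarrow> Conf (child D u d) q)"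

definition opt_id :: "('v, 'a label, 'z) bdag_scheme \<Rightarrow> 'v \<Rightarrow> (dir \<times> 'q) option \<Rightarrow> (dir \<times> 'v \<times> 'q) option" where
  "opt_id D u = map_option (\<lambda>(d, q). (d, child D u d, q))"

definition opt_effect :: "('v, 'a label, 'z) bdag_scheme \<Rightarrow> 'v \<Rightarrow> (dir \<times> 'q) option \<Rightarrow> effect" where
  "opt_effect D u o' = (case o' of None \<Rightarrow> id | Some (d, q) \<Rightarrow> edge_effect D u d)"

definition sink_graph :: "('v, 'a label, 'z) bdag_scheme \<Rightarrow> ('q, 'a label) dbuta \<Rightarrow> ('v, 'q) pgraph" where
  "sink_graph D B = add_sinks (target_set D B) (trim (target_set D B) (product_graph D B))"

locale enumeration = fslp D for D :: "('v, 'a label, 'z) bdag_scheme" +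
  fixes B :: "('q, 'a label) dbuta"
  assumes dbuta: "is_dbuta B"
begin

lemma finite_states: "finite (states B)"
  and delta0_states: "c \<in> Sigma0 \<Longrightarrow> delta0 B c b \<in> states B"
  and delta2_states: "f \<in> Sigma2 \<Longrightarrow> p \<in> states B \<Longrightarrow> q \<in> states B \<Longrightarrow> delta2 B p q f \<in> states B"
  using dbuta by (auto simp: is_dbuta_def)

lemma leaf_Sigma0: "v \<in> verts D \<Longrightarrow> is_leaf D v \<Longrightarrow> label D v \<in> Sigma0"
  using leaf_label by (fastforce simp: Sigma0_def)

lemma inner_Sigma2: "v \<in> verts D \<Longrightarrow> \<not> is_leaf D v \<Longrightarrow> label D v \<in> Sigma2"
  using inner_label by (fastforce simp: Sigma2_def)

lemma run_states: "v \<in> verts D \<Longrightarrow> run B (unfold D v) S \<in> states B"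
proof (induction v arbitrary: S rule: dag_induct)
  case (leaf v) then show ?case by (simp add: unfold_leaf leaf_Sigma0 delta0_states)
next
  case (inner v) then show ?case by (simp add: unfold_inner inner_Sigma2 delta2_states)
qed

lemma ce_states: "v \<in> verts D \<Longrightarrow> ce D B v \<in> states B"
  by (simp add: ce_def run_states)

lemma conf_empty_iff: "(v, q) \<in> conf_empty D B \<longleftrightarrow> v \<in> verts D \<and> q = ce D B v"
  by (simp add: conf_empty_def ce_def)

lemma ce_leaf: "v \<in> verts D \<Longrightarrow> is_leaf D v \<Longrightarrow> ce D B v = delta0 B (label D v) False"
  by (simp add: ce_def unfold_leaf)

lemma ce_inner: "v \<in> verts D \<Longrightarrow> \<not> is_leaf D v \<Longrightarrow>
  ce D B v = delta2 B (ce D B (child D v L)) (ce D B (child D v R)) (label D v)"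
  by (simp add: ce_def unfold_inner)

lemma conf_a_D: "(v, q) \<in> conf_a D B \<Longrightarrow> v \<in> verts D \<and> q \<in> states B"
  by (auto simp: conf_a_def run_states)

lemma conf_u_D: "(v, q) \<in> conf_u D B \<Longrightarrow> (v, q) \<in> conf_a D B"
  by (auto simp: conf_a_def conf_u_def)

lemma conf_a_leaf:
  assumes v: "v \<in> verts D" "is_leaf D v"
  shows "(v, q) \<in> conf_a D B \<longleftrightarrow> q = delta0 B (label D v) True"
proof
  assume "(v, q) \<in> conf_a D B"
  then obtain S where S: "S \<subseteq> {[]}" "S \<noteq> {}" "q = run B (BLeaf (label D v)) S"
    using v by (auto simp: conf_a_def unfold_leaf)
  then have "S = {[]}" unfolding subset_singleton_iff by simp
  with S(3) show "q = delta0 B (label D v) True" by simp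
next
  assume q: "q = delta0 B (label D v) True"
  show "(v, q) \<in> conf_a D B" unfolding conf_a_def using v q
    by (auto simp: unfold_leaf intro!: exI[of _ "{[]}"])
qed

lemma conf_u_leaf:
  assumes v: "v \<in> verts D" "is_leaf D v"
  shows "(v, q) \<in> conf_u D B \<longleftrightarrow> q = delta0 B (label D v) True"
  unfolding conf_a_leaf[OF v, symmetric] using v by (simp add: conf_u_def conf_a_def)

lemma conf_aI: "v \<in> verts D \<Longrightarrow> S \<subseteq> leaves (unfold D v) \<Longrightarrow> S \<noteq> {} \<Longrightarrow> (v, run B (unfold D v) S) \<in> conf_a D B"
  by (auto simp: conf_a_def)

lemma conf_aE:
  assumes "(v, q) \<in> conf_a D B"
  obtains S where "v \<in> verts D" "S \<subseteq> leaves (unfold D v)" "S \<noteq> {}" "q = run B (unfold D v) S"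
  using assms by (auto simp: conf_a_def)

lemma leaves_below:
  assumes "v \<in> verts D" "\<not> is_leaf D v" "S \<subseteq> leaves (unfold D v)"
  shows "{p. d # p \<in> S} \<subseteq> leaves (unfold D (child D v d))"
    and "S \<noteq> {} \<Longrightarrow> {p. L # p \<in> S} \<noteq> {} \<or> {p. R # p \<in> S} \<noteq> {}"
proof -
  note S = assms(3)[unfolded unfold_inner[OF assms(1,2)] leaves.simps]
  show "{p. d # p \<in> S} \<subseteq> leaves (unfold D (child D v d))"
    using S by (cases d) auto
  assume "S \<noteq> {}"
  then obtain x where "x \<in> S" by blast
  with S show "{p. L # p \<in> S} \<noteq> {} \<or> {p. R # p \<in> S} \<noteq> {}" by auto
qed

text \<open>A leaf set that meets both subtrees amounts to a pair of nonempty leaf sets, one for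
  each child, and the runs below the children are independent.\<close>

lemma conf_u_inner:
  assumes v: "v \<in> verts D" "\<not> is_leaf D v"
  shows "(v, q) \<in> conf_u D B \<longleftrightarrow> (\<exists>q1 q2. (child D v L, q1) \<in> conf_a D B \<and> (child D v R, q2) \<in> conf_a D B \<and>
    delta2 B q1 q2 (label D v) = q)"
proof
  assume "(v, q) \<in> conf_u D B"
  then obtain S where S: "S \<subseteq> leaves (unfold D v)" "q = run B (unfold D v) S" "\<forall>d. \<exists>p. d # p \<in> S"
    using v by (auto simp: conf_u_def)
  have c: "(child D v d, run B (unfold D (child D v d)) {p. d # p \<in> S}) \<in> conf_a D B" for d
    using S(3) by (intro conf_aI child_verts[OF v] leaves_below(1)[OF v S(1)]) blast
  have q: "q = delta2 B (run B (unfold D (child D v L)) {p. L # p \<in> S})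
     (run B (unfold D (child D v R)) {p. R # p \<in> S}) (label D v)" using S(2) by (simp add: unfold_inner[OF v])
  show "\<exists>q1 q2. (child D v L, q1) \<in> conf_a D B \<and> (child D v R, q2) \<in> conf_a D B \<and>
    delta2 B q1 q2 (label D v) = q"
    by (intro exI conjI, rule c[of L], rule c[of R], rule q[symmetric])
next
  assume "\<exists>q1 q2. (child D v L, q1) \<in> conf_a D B \<and> (child D v R, q2) \<in> conf_a D B \<and>
    delta2 B q1 q2 (label D v) = q"
  then obtain q1 q2 where c: "(child D v L, q1) \<in> conf_a D B" "(child D v R, q2) \<in> conf_a D B"
    and q: "delta2 B q1 q2 (label D v) = q" by blast
  from c(1) obtain S1 where S1: "S1 \<subseteq> leaves (unfold D (child D v L))" "S1 \<noteq> {}" "q1 = run B (unfold D (child D v L)) S1"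
    by (rule conf_aE)
  from c(2) obtain S2 where S2: "S2 \<subseteq> leaves (unfold D (child D v R))" "S2 \<noteq> {}" "q2 = run B (unfold D (child D v R)) S2"
    by (rule conf_aE)
  define S where "S = (#) L ` S1 \<union> (#) R ` S2"
  have "{p. L # p \<in> S} = S1" "{p. R # p \<in> S} = S2" by (auto simp: S_def)
  then have "q = run B (unfold D v) S" using q S1(3) S2(3) by (simp add: unfold_inner[OF v])
  moreover have "S \<subseteq> leaves (unfold D v)" using S1(1) S2(1) by (auto simp: S_def unfold_inner[OF v])
  moreover have "\<forall>d. \<exists>p. d # p \<in> S" using S1(2) S2(2) by (auto simp: S_def all_dir)
  moreover from this have "S \<noteq> {}" by blast
  ultimately show "(v, q) \<in> conf_u D B" using v(1) unfolding conf_u_def by blast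
qed

text \<open>A nonempty leaf set meets both subtrees or exactly one of them, and the second case is a
  move. Thus the configurations of an inner vertex can be computed from those of its
  children.\<close>

lemma conf_a_inner:
  assumes v: "v \<in> verts D" "\<not> is_leaf D v"
  shows "(v, q) \<in> conf_a D B \<longleftrightarrow> (v, q) \<in> conf_u D B \<or> moves D B v q \<noteq> {}"
proof
  assume "(v, q) \<in> conf_a D B"
  then obtain S where S: "S \<subseteq> leaves (unfold D v)" "S \<noteq> {}" "q = run B (unfold D v) S"
    by (rule conf_aE)
  define S1 S2 where "S1 = {p. L # p \<in> S}" and "S2 = {p. R # p \<in> S}"
  have q: "q = delta2 B (run B (unfold D (child D v L)) S1) (run B (unfold D (child D v R)) S2) (label D v)"
    using S(3) by (simp add: unfold_inner[OF v] S1_def S2_def)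
  have c: "S1 \<noteq> {} \<Longrightarrow> (child D v L, run B (unfold D (child D v L)) S1) \<in> conf_a D B"
    "S2 \<noteq> {} \<Longrightarrow> (child D v R, run B (unfold D (child D v R)) S2) \<in> conf_a D B"
    unfolding S1_def S2_def by (intro conf_aI child_verts[OF v] leaves_below(1)[OF v S(1)]; assumption)+
  have "S1 \<noteq> {} \<or> S2 \<noteq> {}" unfolding S1_def S2_def by (rule leaves_below(2)[OF v S(1,2)])
  then consider "S1 \<noteq> {}" "S2 \<noteq> {}" | "S1 \<noteq> {}" "S2 = {}" | "S1 = {}" "S2 \<noteq> {}" by blast
  then show "(v, q) \<in> conf_u D B \<or> moves D B v q \<noteq> {}"
  proof cases
    case 1 with c q show ?thesis unfolding conf_u_inner[OF v] by blast
  next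
    case 2
    then have "(L, run B (unfold D (child D v L)) S1) \<in> moves D B v q" using c q v by (simp add: moves_def ce_def)
    then show ?thesis by blast
  next
    case 3
    then have "(R, run B (unfold D (child D v R)) S2) \<in> moves D B v q" using c q v by (simp add: moves_def ce_def)
    then show ?thesis by blast
  qed
next
  assume "(v, q) \<in> conf_u D B \<or> moves D B v q \<noteq> {}"
  then show "(v, q) \<in> conf_a D B"
  proof
    assume "moves D B v q \<noteq> {}"
    then obtain d q' where m: "(child D v d, q') \<in> conf_a D B" "trans_state D B v d q' = q" by (auto simp: moves_def)
    from m(1) obtain S1 where S: "S1 \<subseteq> leaves (unfold D (child D v d))" "S1 \<noteq> {}" "q' = run B (unfold D (child D v d)) S1"
      by (rule conf_aE)
    have *: "{p. d' # p \<in> (#) d ` S1} = (if d' = d then S1 else {})" for d d' :: dir by auto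
    have "run B (unfold D v) ((#) d ` S1) = q" unfolding m(2)[symmetric] S(3)
      by (cases d) (simp_all only: unfold_inner[OF v] run.simps ce_def * trans_state.simps if_True if_False dir.distinct dir.distinct[symmetric] simp_thms)
    moreover have "(#) d ` S1 \<subseteq> leaves (unfold D v)" using S(1) by (cases d) (auto simp: unfold_inner[OF v])
    ultimately show ?thesis using S(2) v conf_aI by blast
  qed (rule conf_u_D)
qed

lemma moves_conf_a: "(d, q) \<in> moves D B u p \<Longrightarrow> (u, p) \<in> conf_a D B"
  using conf_a_inner by (fastforce simp: moves_def)

lemma moves_subset: "moves D B u p \<subseteq> UNIV \<times> states B"
  by (auto simp: moves_def dest: conf_a_D)

lemma finite_moves: "finite (moves D B u p)"
proof -
  have "(UNIV :: dir set) = {L, R}" using dir.exhaust by auto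
  then have "finite ((UNIV :: dir set) \<times> states B)" using finite_states by (metis finite.emptyI finite.insertI finite_cartesian_product)
  then show ?thesis by (rule finite_subset[OF moves_subset])
qed

lemma options_conf_a: "o' \<in> options D B u p \<Longrightarrow> (u, p) \<in> conf_a D B"
  by (auto simp: options_def has_sink_def split: if_splits intro: moves_conf_a conf_u_D)

lemma options_iff: "o' \<in> options D B u p \<longleftrightarrow> (\<exists>m \<in> moves D B u p. o' = Some m) \<or> has_sink D B u p \<and> o' = None"
  by (auto simp: options_def)

lemma finite_opts: "finite (options D B u p)"
  by (simp add: options_def finite_moves)

subsection \<open>The graph with sinks\<close>

lemma ex_option_split: "(\<exists>u p o'. x = f u p o' \<and> ((\<exists>m \<in> M u p. o' = Some m) \<or> H u p \<and> o' = None)) \<longleftrightarrow>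
    (\<exists>u p m. m \<in> M u p \<and> x = f u p (Some m)) \<or> (\<exists>u p. H u p \<and> x = f u p None)"
  by auto

text \<open>The state of the other child for the empty set is unique, so the existential over
  \<open>conf_empty\<close> collapses into \<open>trans_state\<close>.\<close>

lemma product_graph_eq: "product_graph D B =
  ({Conf v q | v q. (v, q) \<in> conf_a D B},
   {(Conf u p, Some (d, child D u d, q), Conf (child D u d) q, edge_effect D u d) | u p d q. (d, q) \<in> moves D B u p})"
proof -
  have "(u, p) \<in> conf_a D B \<and> (v, q) \<in> conf_a D B \<and>
         (\<exists>v' q'. (v', q') \<in> conf_empty D B \<and> (u, d, v) \<in> edges D \<and> (u, opp d, v') \<in> edges D \<and>
            (case d of L \<Rightarrow> delta2 B q q' (label D u) = p | R \<Rightarrow> delta2 B q' q (label D u) = p))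
     \<longleftrightarrow> (d, q) \<in> moves D B u p \<and> v = child D u d" for u p d v q
  proof -
    have "(d, q) \<in> moves D B u p \<and> v = child D u d \<Longrightarrow> (u, p) \<in> conf_a D B" using moves_conf_a by blast
    then show ?thesis
      by (cases d) (auto simp: moves_def conf_empty_iff edge_iff child_verts)
  qed
  then show ?thesis unfolding product_graph_def by auto
qed

text \<open>At a leaf every configuration is a target, and at an inner vertex a configuration
  outside the target set has a move. A first removed configuration would therefore have a successor
  removed before it.\<close>

lemma removed_empty: "removed (target_set D B) (product_graph D B) = {}"
proof -
  have "x \<notin> removed (target_set D B) (product_graph D B)" for x
  proof
    assume "x \<in> removed (target_set D B) (product_graph D B)"
    then show False
    proof (induction rule: removed.induct)
      case (1 x)
      then obtain v q where x: "x = Conf v q" "(v, q) \<in> conf_a D B" "(v, q) \<notin> conf_u D B"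
        by (auto simp: product_graph_eq target_set_def)
      show ?case
      proof (cases "is_leaf D v")
        case True
        then show ?thesis using x(2,3) conf_a_D[OF x(2)] by (simp add: conf_a_leaf conf_u_leaf)
      next
        case False
        then obtain d q' where "(d, q') \<in> moves D B v q"
          using x(2,3) conf_a_D[OF x(2)] by (auto simp: conf_a_inner)
        then have "(x, Some (d, child D v d, q'), Conf (child D v d) q', edge_effect D v d) \<in> snd (product_graph D B)"
          unfolding product_graph_eq x(1) by auto
        then show ?thesis using 1(4) by blast
      qed
    qed
  qed
  then show ?thesis by blast
qed

lemma trim_eq: "trim (target_set D B) (product_graph D B) = product_graph D B"
  unfolding trim_def removed_empty by (cases "product_graph D B") auto

lemma sink_graph_eq: "sink_graph D B =
  ({Conf u p | u p. (u, p) \<in> conf_a D B} \<union> {Sink u p | u p. has_sink D B u p},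
   {(Conf u p, opt_id D u o', opt_target D u p o', opt_effect D u o') | u p o'. o' \<in> options D B u p})"
proof -
  have o: "out (snd (product_graph D B)) (Conf u p) \<noteq> {} \<longleftrightarrow> moves D B u p \<noteq> {}" for u p
    unfolding product_graph_eq out_def by auto
  have h: "Conf u p \<in> target_set D B \<and> out (snd (product_graph D B)) (Conf u p) \<noteq> {} \<longleftrightarrow> has_sink D B u p" for u p
    unfolding o by (auto simp: target_set_def has_sink_def)
  have opt: "{(Conf u p, opt_id D u o', opt_target D u p o', opt_effect D u o') | u p o'. o' \<in> options D B u p} =
     {(Conf u p, Some (d, child D u d, q), Conf (child D u d) q, edge_effect D u d) | u p d q. (d, q) \<in> moves D B u p} \<union>
     {(Conf v q, None, Sink v q, id) | v q. has_sink D B v q}" (is "?A = ?B \<union> ?C")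
  proof (intro set_eqI)
    fix x
    have "x \<in> ?A \<longleftrightarrow> (\<exists>u p m. m \<in> moves D B u p \<and> x = (Conf u p, opt_id D u (Some m), opt_target D u p (Some m), opt_effect D u (Some m))) \<or>
      (\<exists>u p. has_sink D B u p \<and> x = (Conf u p, opt_id D u None, opt_target D u p None, opt_effect D u (None :: (dir \<times> 'q) option)))"
      unfolding options_iff mem_Collect_eq by (rule ex_option_split)
    also have "\<dots> \<longleftrightarrow> x \<in> ?B \<union> ?C"
      by (auto simp: opt_id_def opt_target_def opt_effect_def)
    finally show "x \<in> ?A \<longleftrightarrow> x \<in> ?B \<union> ?C" .
  qed
  have "snd (sink_graph D B) = {(Conf u p, opt_id D u o', opt_target D u p o', opt_effect D u o') | u p o'. o' \<in> options D B u p}"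
    unfolding sink_graph_def trim_eq add_sinks_def snd_conv h opt by (simp add: product_graph_eq)
  moreover have "fst (sink_graph D B) = {Conf u p | u p. (u, p) \<in> conf_a D B} \<union> {Sink u p | u p. has_sink D B u p}"
    unfolding sink_graph_def trim_eq add_sinks_def fst_conv h by (simp add: product_graph_eq)
  ultimately show ?thesis by (metis prod.collapse)
qed

end

subsection \<open>Contraction\<close>

primrec vert :: "('v, 'q) pnode \<Rightarrow> 'v" where
  "vert (Conf v q) = v"
| "vert (Sink v q) = v"
| "vert (Aux v q k) = v"

text \<open>Even values for sinks and odd values for configurations put a sink below its own
  configuration and both below all configurations of parents, so every edge descends.\<close>

primrec pnode_rank :: "('v, 'l, 'z) bdag_scheme \<Rightarrow> ('v, 'q) pnode \<Rightarrow> nat" where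
  "pnode_rank D (Conf v q) = Suc (2 * rank D v)"
| "pnode_rank D (Sink v q) = 2 * rank D v"
| "pnode_rank D (Aux v q k) = 0"

text \<open>At outdegree 1 the next edge is forced, decoration included. Together with existence
  this makes \<open>resolve\<close> the function computed by the contraction.\<close>

lemma follow_unique: "follow E x z f \<Longrightarrow> follow E x z' f' \<Longrightarrow> z = z' \<and> f = f'"
proof (induction arbitrary: z' f' rule: follow.induct)
  case (stop u)
  from stop(2) show ?case by cases (use stop(1) in auto)
next
  case (move u i w g z f)
  from move.prems show ?case
  proof cases
    case (move i' w' g' f'')
    from \<open>outdeg E u = 1\<close> obtain e where "out E u = {e}" unfolding outdeg_def by (rule card_1_singletonE)
    moreover have "(u, i, w, g) \<in> out E u" "(u, i', w', g') \<in> out E u"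
      using move.hyps \<open>(u, i, w, g) \<in> E\<close> \<open>(u, i', w', g') \<in> E\<close> by (auto simp: out_def)
    ultimately have "w = w'" "g = g'" by auto
    then show ?thesis using move.IH \<open>follow E w' z' f''\<close> \<open>f' = f'' \<circ> g'\<close> by auto
  qed (use move.hyps in auto)
qed

definition resolve :: "('v, 'a label, 'z) bdag_scheme \<Rightarrow> ('q, 'a label) dbuta \<Rightarrow> ('v, 'q) pnode \<Rightarrow> ('v, 'q) pnode \<times> effect" where
  "resolve D B x = (SOME zf. follow (snd (sink_graph D B)) x (fst zf) (snd zf))"

text \<open>What contraction makes of the edge named \<open>o'\<close>. It depends on the child only
  through \<open>resolve\<close>, which for the program is one lookup in the table.\<close>

definition entry :: "('v, 'a label, 'z) bdag_scheme \<Rightarrow> ('q, 'a label) dbuta \<Rightarrow> 'v \<Rightarrow> 'q \<Rightarrow> (dir \<times> 'q) option \<Rightarrow>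
    ('v, 'q) pnode \<times> effect" where
  "entry D B u p o' = (fst (resolve D B (opt_target D u p o')), snd (resolve D B (opt_target D u p o')) \<circ> opt_effect D u o')"

definition cedge :: "('v, 'a label, 'z) bdag_scheme \<Rightarrow> ('q, 'a label) dbuta \<Rightarrow> 'v \<Rightarrow> 'q \<Rightarrow> (dir \<times> 'q) option \<Rightarrow>
    ('v, 'q) pedge" where
  "cedge D B u p o' = (Conf u p, opt_id D u o', fst (entry D B u p o'), snd (entry D B u p o'))"

definition order_of :: "('v, 'a label, 'z) bdag_scheme \<Rightarrow> ('q, 'a label) dbuta \<Rightarrow> ('v \<Rightarrow> 'q \<Rightarrow> (dir \<times> 'q) option list) \<Rightarrow>
    ('v, 'q) pnode \<Rightarrow> ('v, 'q) pedge list" where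
  "order_of D B ol x = (case x of Conf u p \<Rightarrow> map (cedge D B u p) (ol u p) | _ \<Rightarrow> [])"

definition comb_nodes where
  "comb_nodes D B ol = binarize_nodes (contract (sink_graph D B)) (order_of D B ol)"

definition comb_edges where
  "comb_edges D B ol = binarize_edges (contract (sink_graph D B)) (order_of D B ol)"

text \<open>Edge orders, expressed by option names. A configuration with exactly one option is
  contracted and has no comb, hence the restriction.\<close>

definition lists_opts :: "('v, 'a label, 'z) bdag_scheme \<Rightarrow> ('q, 'a label) dbuta \<Rightarrow> ('v \<Rightarrow> 'q \<Rightarrow> (dir \<times> 'q) option list) \<Rightarrow> bool" where
  "lists_opts D B ol \<longleftrightarrow> (\<forall>u p. (u, p) \<in> conf_a D B \<longrightarrow> card (options D B u p) \<noteq> 1 \<longrightarrow>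
     distinct (ol u p) \<and> set (ol u p) = options D B u p)"

text \<open>Unifies the three clauses of \<open>binarize_edges\<close>; here \<open>k\<close> ranges
  from 1 to one less than the number of options.\<close>

definition comb_edge :: "('v, 'a label, 'z) bdag_scheme \<Rightarrow> ('q, 'a label) dbuta \<Rightarrow> ('v \<Rightarrow> 'q \<Rightarrow> (dir \<times> 'q) option list) \<Rightarrow>
    'v \<Rightarrow> 'q \<Rightarrow> nat \<Rightarrow> dir \<Rightarrow> ('v, 'q) pnode \<times> effect" where
  "comb_edge D B ol u p k d =
     (if d = L then entry D B u p (ol u p ! (k - 1))
      else if k + 2 \<le> length (ol u p) then (aux (Conf u p) (k + 1), id)
      else entry D B u p (ol u p ! (length (ol u p) - 1)))"

text \<open>Keeps edges apart that become parallel by contraction, so that counting edges is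
  counting options.\<close>

lemma inj_opt_id: "inj (opt_id D u)"
  unfolding opt_id_def by (rule injI) (auto split: option.splits simp: map_option_case)

text \<open>An order matters only at the vertices of the graph; this allows an arbitrary order to be
  replaced by one of the form \<open>order_of\<close>.\<close>

lemma binarize_cong:
  assumes "\<And>u. u \<in> fst G \<Longrightarrow> f u = g u"
  shows "binarize_nodes G f = binarize_nodes G g" "binarize_edges G f = binarize_edges G g"
proof -
  show "binarize_nodes G f = binarize_nodes G g" unfolding binarize_nodes_def using assms by force
  have *: "u \<in> fst G \<and> P (f u) \<longleftrightarrow> u \<in> fst G \<and> P (g u)" for u P using assms by auto
  show "binarize_edges G f = binarize_edges G g" unfolding binarize_edges_def
    using assms by (intro arg_cong2[where f = "(\<union>)"] Collect_cong) metis+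
qed

context enumeration
begin

lemma inj_cedge: "inj (cedge D B u p)"
  using inj_opt_id[of D u] by (auto simp: inj_def cedge_def)

lemma out_Conf: "out (snd (sink_graph D B)) (Conf u p) =
    (\<lambda>o'. (Conf u p, opt_id D u o', opt_target D u p o', opt_effect D u o')) ` options D B u p"
  unfolding sink_graph_eq out_def by auto

lemma out_other: "(\<And>u p. x \<noteq> Conf u p) \<Longrightarrow> out (snd (sink_graph D B)) x = {}"
  unfolding sink_graph_eq out_def by auto

lemma outdeg_Conf: "outdeg (snd (sink_graph D B)) (Conf u p) = card (options D B u p)"
  unfolding outdeg_def out_Conf using inj_opt_id[of D u] by (intro card_image) (auto simp: inj_on_def inj_def)

lemma outdeg_other: "(\<And>u p. x \<noteq> Conf u p) \<Longrightarrow> outdeg (snd (sink_graph D B)) x = 0"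
  unfolding outdeg_def by (subst out_other) auto

lemma edge_sink_graph: "(x, i, w, g) \<in> snd (sink_graph D B) \<longleftrightarrow>
  (\<exists>u p o'. o' \<in> options D B u p \<and> x = Conf u p \<and> i = opt_id D u o' \<and> w = opt_target D u p o' \<and> g = opt_effect D u o')"
  unfolding sink_graph_eq by auto

lemma Some_opts: "Some (d, q) \<in> options D B u p \<longleftrightarrow> (d, q) \<in> moves D B u p"
  and None_opts: "None \<in> options D B u p \<longleftrightarrow> has_sink D B u p"
  by (auto simp: options_def)

lemma pnode_rank_target: "o' \<in> options D B u p \<Longrightarrow> pnode_rank D (opt_target D u p o') < pnode_rank D (Conf u p)"
  by (cases o') (auto simp: opt_target_def Some_opts moves_def rank_child_less)

text \<open>Chains of vertices of outdegree 1 end because \<open>pnode_rank\<close> drops along each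
  edge.\<close>

lemma follow_exists: "\<exists>z f. follow (snd (sink_graph D B)) x z f"
proof (induction x rule: measure_induct_rule[of "pnode_rank D"])
  case (less x)
  show ?case
  proof (cases "outdeg (snd (sink_graph D B)) x = 1")
    case True
    then obtain e where "out (snd (sink_graph D B)) x = {e}" unfolding outdeg_def by (rule card_1_singletonE)
    then have "e \<in> out (snd (sink_graph D B)) x" by simp
    then obtain i w g where e: "(x, i, w, g) \<in> snd (sink_graph D B)"
      unfolding out_def by (cases e) auto
    then obtain z f where "follow (snd (sink_graph D B)) w z f"
      using less pnode_rank_target unfolding edge_sink_graph by blast
    with True e show ?thesis by (blast intro: follow.move)
  qed (blast intro: follow.stop)
qed

lemma follow_resolve: "follow (snd (sink_graph D B)) x (fst (resolve D B x)) (snd (resolve D B x))"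
  unfolding resolve_def using follow_exists[of x] by (metis (mono_tags, lifting) fst_conv snd_conv someI_ex)

lemma follow_iff: "follow (snd (sink_graph D B)) x z f \<longleftrightarrow> z = fst (resolve D B x) \<and> f = snd (resolve D B x)"
  using follow_resolve follow_unique by blast

lemma redirect_eq: "(x, i, z, f) \<in> redirect (snd (sink_graph D B)) \<longleftrightarrow>
  (\<exists>u p o'. o' \<in> options D B u p \<and> (x, i, z, f) = cedge D B u p o')"
proof -
  have "(x, i, z, f) \<in> redirect (snd (sink_graph D B)) \<longleftrightarrow>
     (\<exists>w g. (x, i, w, g) \<in> snd (sink_graph D B) \<and> z = fst (resolve D B w) \<and> f = snd (resolve D B w) \<circ> g)"
    unfolding redirect_def follow_iff by auto
  also have "\<dots> \<longleftrightarrow> (\<exists>u p o'. o' \<in> options D B u p \<and> x = Conf u p \<and> i = opt_id D u o' \<and>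
       z = fst (resolve D B (opt_target D u p o')) \<and> f = snd (resolve D B (opt_target D u p o')) \<circ> opt_effect D u o')"
    unfolding edge_sink_graph by blast
  finally show ?thesis by (simp add: cedge_def entry_def conj_assoc)
qed

lemma contract_nodes: "x \<in> fst (contract (sink_graph D B)) \<longleftrightarrow>
   (\<exists>u p. x = Conf u p \<and> (u, p) \<in> conf_a D B \<and> card (options D B u p) \<noteq> 1) \<or> (\<exists>u p. x = Sink u p \<and> has_sink D B u p)"
  unfolding contract_def by (cases x) (auto simp: sink_graph_eq[THEN arg_cong[of _ _ fst]] outdeg_Conf outdeg_other)

lemma contract_edges: "e \<in> snd (contract (sink_graph D B)) \<longleftrightarrow>
   (\<exists>u p o'. o' \<in> options D B u p \<and> card (options D B u p) \<noteq> 1 \<and> e = cedge D B u p o')"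
proof (cases e)
  case (fields x i z f)
  show ?thesis unfolding fields contract_def
    by (simp add: redirect_eq) (auto simp: cedge_def outdeg_Conf)
qed

lemma contract_table_iff: "(x, z, f) \<in> contract_table (sink_graph D B) \<longleftrightarrow>
   (\<exists>u p. x = Conf u p \<and> (u, p) \<in> conf_a D B \<and> options D B u p \<noteq> {} \<and> card (options D B u p) = 1 \<and>
     (\<forall>o' \<in> options D B u p. (z, f) = entry D B u p o'))"
proof -
  have "(x, z, f) \<in> contract_table (sink_graph D B) \<longleftrightarrow>
    (\<exists>u p o'. o' \<in> options D B u p \<and> card (options D B u p) = 1 \<and> x = Conf u p \<and> (z, f) = entry D B u p o')"
    unfolding contract_table_def by (simp add: redirect_eq) (auto simp: cedge_def outdeg_Conf)
  also have "\<dots> \<longleftrightarrow> (\<exists>u p. x = Conf u p \<and> (u, p) \<in> conf_a D B \<and> options D B u p \<noteq> {} \<and> card (options D B u p) = 1 \<and>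
     (\<forall>o' \<in> options D B u p. (z, f) = entry D B u p o'))"
    using options_conf_a by (fastforce elim!: card_1_singletonE)
  finally show ?thesis .
qed

lemma out_contract_Conf: "card (options D B u p) \<noteq> 1 \<Longrightarrow>
   out (snd (contract (sink_graph D B))) (Conf u p) = cedge D B u p ` options D B u p"
  unfolding out_def set_eq_iff mem_Collect_eq contract_edges by (auto simp: cedge_def)

lemma out_contract_Sink: "out (snd (contract (sink_graph D B))) (Sink u p) = {}"
  unfolding out_def set_eq_iff mem_Collect_eq contract_edges by (auto simp: cedge_def)

lemma is_out_order_order_of:
  assumes "lists_opts D B ol"
  shows "is_out_order (contract (sink_graph D B)) (order_of D B ol)"
  unfolding is_out_order_def
proof
  fix x assume "x \<in> fst (contract (sink_graph D B))"
  then show "distinct (order_of D B ol x) \<and> set (order_of D B ol x) = out (snd (contract (sink_graph D B))) x"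
    unfolding contract_nodes using assms inj_on_subset[OF inj_cedge]
    by (auto simp: lists_opts_def order_of_def out_contract_Conf out_contract_Sink distinct_map)
qed

text \<open>The given data structure comes with an arbitrary order of the edges. The inverse of the
  injection \<open>cedge\<close> reads it as an order of options, which is the form in which it can
  be carried over to the extension.\<close>

lemma out_order_cases:
  assumes "is_out_order (contract (sink_graph D B)) oo"
  obtains ol where "lists_opts D B ol"
    "binarize_nodes (contract (sink_graph D B)) oo = comb_nodes D B ol"
    "binarize_edges (contract (sink_graph D B)) oo = comb_edges D B ol"
proof -
  define ol where "ol u p = map (the_inv (cedge D B u p)) (oo (Conf u p))" for u p
  have *: "distinct (ol u p) \<and> set (ol u p) = options D B u p \<and> map (cedge D B u p) (ol u p) = oo (Conf u p)"
    if "(u, p) \<in> conf_a D B" "card (options D B u p) \<noteq> 1" for u p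
  proof -
    have "Conf u p \<in> fst (contract (sink_graph D B))" using that by (auto simp: contract_nodes)
    then have o: "distinct (oo (Conf u p))" "set (oo (Conf u p)) = cedge D B u p ` options D B u p"
      using assms that by (auto simp: is_out_order_def out_contract_Conf)
    then have i: "x \<in> range (cedge D B u p)" if "x \<in> set (oo (Conf u p))" for x using that by auto
    have m: "map (cedge D B u p) (ol u p) = oo (Conf u p)"
      unfolding ol_def map_map using i by (intro map_idI) (auto simp: f_the_inv_into_f[OF inj_cedge])
    have "set (ol u p) = the_inv (cedge D B u p) ` cedge D B u p ` options D B u p" unfolding ol_def set_map o(2) ..
    also have "\<dots> = options D B u p" by (simp add: image_image the_inv_f_f[OF inj_cedge])
    finally show ?thesis using m o(1) distinct_map[of "cedge D B u p" "ol u p"] by simp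
  qed
  have eq: "oo x = order_of D B ol x" if "x \<in> fst (contract (sink_graph D B))" for x
  proof -
    from that consider u p where "x = Conf u p" "(u, p) \<in> conf_a D B" "card (options D B u p) \<noteq> 1"
      | u p where "x = Sink u p" by (auto simp: contract_nodes)
    then show ?thesis
    proof cases
      case 1 then show ?thesis using * by (simp add: order_of_def)
    next
      case 2
      then have "set (oo x) = {}" using assms that by (auto simp: is_out_order_def out_contract_Sink)
      then show ?thesis using 2 by (simp add: order_of_def)
    qed
  qed
  have "lists_opts D B ol" using * by (simp add: lists_opts_def)
  moreover note binarize_cong[of "contract (sink_graph D B)" oo "order_of D B ol", OF eq]
  ultimately show ?thesis by (intro that[of ol]) (simp_all add: comb_nodes_def comb_edges_def)
qed

lemma aux_Conf_eq_iff: "1 \<le> k \<Longrightarrow> 1 \<le> k' \<Longrightarrow> aux (Conf u p) k = aux (Conf u' p') k' \<longleftrightarrow> u = u' \<and> p = p' \<and> k = k'"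
  by auto

lemma length_opts:
  assumes "lists_opts D B ol" "(u, p) \<in> conf_a D B" "card (options D B u p) \<noteq> 1"
  shows "length (ol u p) = card (options D B u p)"
  using assms distinct_card[of "ol u p"] unfolding lists_opts_def by auto

lemma length_order_of: "length (order_of D B ol (Conf u p)) = length (ol u p)"
  by (simp add: order_of_def)

lemma order_of_Sink: "order_of D B ol (Sink u p) = []"
  by (simp add: order_of_def)

lemma comb_nodes_iff:
  assumes "lists_opts D B ol"
  shows "Sink u p \<in> comb_nodes D B ol \<longleftrightarrow> has_sink D B u p"
    and "Conf u p \<in> comb_nodes D B ol \<longleftrightarrow> (u, p) \<in> conf_a D B \<and> card (options D B u p) \<noteq> 1"
    and "Aux u p k \<in> comb_nodes D B ol \<longleftrightarrow> (u, p) \<in> conf_a D B \<and> card (options D B u p) \<noteq> 1 \<and>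
       2 \<le> k \<and> k + 1 \<le> card (options D B u p)"
proof -
  have l: "length (order_of D B ol (Conf u p)) = card (options D B u p)"
    if "(u, p) \<in> conf_a D B" "card (options D B u p) \<noteq> 1" for u p
    unfolding length_order_of by (rule length_opts[OF assms that])
  have n: "x \<in> comb_nodes D B ol \<longleftrightarrow> x \<in> fst (contract (sink_graph D B)) \<or>
     (\<exists>u p k. x = Aux u p k \<and> (u, p) \<in> conf_a D B \<and> card (options D B u p) \<noteq> 1 \<and> 2 \<le> k \<and> k + 1 \<le> card (options D B u p))" for x
  proof -
    have "(\<exists>w k. x = aux w k \<and> w \<in> fst (contract (sink_graph D B)) \<and> 2 \<le> k \<and> k \<le> length (order_of D B ol w) - 1)
      \<longleftrightarrow> (\<exists>u p k. x = Aux u p k \<and> (u, p) \<in> conf_a D B \<and> card (options D B u p) \<noteq> 1 \<and> 2 \<le> k \<and> k + 1 \<le> card (options D B u p))"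
      (is "?l \<longleftrightarrow> ?r")
    proof
      assume ?l
      then obtain w k where w: "x = aux w k" "w \<in> fst (contract (sink_graph D B))" "2 \<le> k" "k \<le> length (order_of D B ol w) - 1" by blast
      from w(2) consider u p where "w = Conf u p" "(u, p) \<in> conf_a D B" "card (options D B u p) \<noteq> 1"
        | u p where "w = Sink u p" unfolding contract_nodes by blast
      then show ?r
      proof cases
        case (1 u p)
        have "x = Aux u p k" using 1(1) w(1,3) by simp
        moreover have "k + 1 \<le> card (options D B u p)" using w(3,4) l[OF 1(2,3)] 1(1) by simp
        ultimately show ?thesis using 1(2,3) w(3) by blast
      next
        case 2 then show ?thesis using w(3,4) by (simp add: order_of_Sink)
      qed
    next
      assume ?r
      then obtain u p k where u: "x = Aux u p k" "(u, p) \<in> conf_a D B" "card (options D B u p) \<noteq> 1" "2 \<le> k" "k + 1 \<le> card (options D B u p)" by blast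
      have "x = aux (Conf u p) k" "k \<le> length (order_of D B ol (Conf u p)) - 1" using u(1,4,5) l[OF u(2,3)] by simp_all
      moreover have "Conf u p \<in> fst (contract (sink_graph D B))" using u(2,3) unfolding contract_nodes by blast
      ultimately show ?l using u(4) by blast
    qed
    then show ?thesis unfolding comb_nodes_def binarize_nodes_def Un_iff mem_Collect_eq by blast
  qed
  show "Sink u p \<in> comb_nodes D B ol \<longleftrightarrow> has_sink D B u p"
    and "Conf u p \<in> comb_nodes D B ol \<longleftrightarrow> (u, p) \<in> conf_a D B \<and> card (options D B u p) \<noteq> 1"
    and "Aux u p k \<in> comb_nodes D B ol \<longleftrightarrow> (u, p) \<in> conf_a D B \<and> card (options D B u p) \<noteq> 1 \<and>
       2 \<le> k \<and> k + 1 \<le> card (options D B u p)"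
    unfolding n contract_nodes by auto
qed

text \<open>The bounds on \<open>k\<close> describe the comb of a configuration with at least two
  options; without options there are no edges, and with one option the vertex has been
  contracted.\<close>

lemma comb_edges_iff:
  assumes "lists_opts D B ol"
  shows "(x, d, y, f) \<in> comb_edges D B ol \<longleftrightarrow>
    (\<exists>u p k. x = aux (Conf u p) k \<and> (u, p) \<in> conf_a D B \<and> 1 \<le> k \<and> k + 1 \<le> card (options D B u p) \<and>
       (y, f) = comb_edge D B ol u p k d)"
proof -
  have l: "length (ol u p) = card (options D B u p)"
    if "(u, p) \<in> conf_a D B" "card (options D B u p) \<noteq> 1" for u p
    by (rule length_opts[OF assms that])
  have ex: "(\<exists>w. w \<in> fst (contract (sink_graph D B)) \<and> 2 \<le> length (order_of D B ol w) \<and> P w) \<longleftrightarrow>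
     (\<exists>u p. (u, p) \<in> conf_a D B \<and> 2 \<le> card (options D B u p) \<and> P (Conf u p))" for P
  proof -
    have "w \<in> fst (contract (sink_graph D B)) \<and> 2 \<le> length (order_of D B ol w) \<longleftrightarrow>
      (\<exists>u p. w = Conf u p \<and> (u, p) \<in> conf_a D B \<and> 2 \<le> card (options D B u p))" for w
      unfolding contract_nodes using l by (cases w) (auto simp: length_order_of order_of_Sink)
    then have "(\<exists>w. (w \<in> fst (contract (sink_graph D B)) \<and> 2 \<le> length (order_of D B ol w)) \<and> P w) \<longleftrightarrow>
      (\<exists>w. (\<exists>u p. w = Conf u p \<and> (u, p) \<in> conf_a D B \<and> 2 \<le> card (options D B u p)) \<and> P w)" by (simp only:)
    then show ?thesis by auto
  qed
  have "(x, d, y, f) \<in> comb_edges D B ol \<longleftrightarrow>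
    (\<exists>w. w \<in> fst (contract (sink_graph D B)) \<and> 2 \<le> length (order_of D B ol w) \<and>
     ((\<exists>k. x = aux w k \<and> d = L \<and> 1 \<le> k \<and> k \<le> length (order_of D B ol w) - 1 \<and> (\<exists>i. order_of D B ol w ! (k - 1) = (w, i, y, f))) \<or>
      (\<exists>k. x = aux w k \<and> d = R \<and> y = aux w (k + 1) \<and> f = id \<and> 1 \<le> k \<and> k + 2 \<le> length (order_of D B ol w)) \<or>
      (x = aux w (length (order_of D B ol w) - 1) \<and> d = R \<and> (\<exists>i. last (order_of D B ol w) = (w, i, y, f)))))"
  proof -
    let ?N = "fst (contract (sink_graph D B))" and ?o = "order_of D B ol"
    have ar: "1 \<le> k \<Longrightarrow> k \<le> n - 1 \<Longrightarrow> 2 \<le> n" "1 \<le> k \<Longrightarrow> k + 2 \<le> n \<Longrightarrow> 2 \<le> n" for k n :: nat by auto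
    have 1: "(x, d, y, f) \<in> {(aux u k, L, z, f) | u k z f. u \<in> ?N \<and> 1 \<le> k \<and> k \<le> length (?o u) - 1 \<and>
        (\<exists>i. ?o u ! (k - 1) = (u, i, z, f))} \<longleftrightarrow> (\<exists>w k. x = aux w k \<and> d = L \<and> w \<in> ?N \<and> 1 \<le> k \<and> k \<le> length (?o w) - 1 \<and>
        (\<exists>i. ?o w ! (k - 1) = (w, i, y, f)))" by blast
    have 2: "(x, d, y, f) \<in> {(aux u k, R, aux u (k + 1), id) | u k. u \<in> ?N \<and> 1 \<le> k \<and>
        k + 2 \<le> length (?o u)} \<longleftrightarrow> (\<exists>w k. x = aux w k \<and> d = R \<and> y = aux w (k + 1) \<and> f = id \<and> w \<in> ?N \<and> 1 \<le> k \<and> k + 2 \<le> length (?o w))" by blast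
    have 3: "(x, d, y, f) \<in> {(aux u (length (?o u) - 1), R, z, f) | u z f. u \<in> ?N \<and>
        2 \<le> length (?o u) \<and> (\<exists>i. last (?o u) = (u, i, z, f))} \<longleftrightarrow>
        (\<exists>w. x = aux w (length (?o w) - 1) \<and> d = R \<and> w \<in> ?N \<and> 2 \<le> length (?o w) \<and> (\<exists>i. last (?o w) = (w, i, y, f)))" by blast
    show ?thesis unfolding comb_edges_def binarize_edges_def Un_iff 1 2 3 using ar by blast
  qed
  also have "\<dots> \<longleftrightarrow> (\<exists>u p. (u, p) \<in> conf_a D B \<and> 2 \<le> card (options D B u p) \<and>
     ((\<exists>k. x = aux (Conf u p) k \<and> d = L \<and> 1 \<le> k \<and> k \<le> card (options D B u p) - 1 \<and> (y, f) = entry D B u p (ol u p ! (k - 1))) \<or>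
      (\<exists>k. x = aux (Conf u p) k \<and> d = R \<and> y = aux (Conf u p) (k + 1) \<and> f = id \<and> 1 \<le> k \<and> k + 2 \<le> card (options D B u p)) \<or>
      (x = aux (Conf u p) (card (options D B u p) - 1) \<and> d = R \<and> (y, f) = entry D B u p (ol u p ! (card (options D B u p) - 1)))))"
    unfolding ex
  proof (intro ex_cong1 conj_cong refl, goal_cases)
    case (1 u p)
    then have len: "length (ol u p) = card (options D B u p)" by (intro l) auto
    have nth: "(\<exists>i. order_of D B ol (Conf u p) ! j = (Conf u p, i, y, f)) \<longleftrightarrow> (y, f) = entry D B u p (ol u p ! j)"
      if "j < length (ol u p)" for j
      using that by (auto simp: order_of_def cedge_def prod_eq_iff)
    have "(\<exists>i. last (order_of D B ol (Conf u p)) = (Conf u p, i, y, f)) \<longleftrightarrow> (y, f) = entry D B u p (ol u p ! (card (options D B u p) - 1))"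
      using nth[of "length (ol u p) - 1"] 1 len by (subst last_conv_nth) (auto simp: order_of_def)
    moreover have "length (order_of D B ol (Conf u p)) = card (options D B u p)" by (simp add: order_of_def len)
    moreover have "1 \<le> k \<and> k \<le> card (options D B u p) - 1 \<and> (\<exists>i. order_of D B ol (Conf u p) ! (k - 1) = (Conf u p, i, y, f)) \<longleftrightarrow>
       1 \<le> k \<and> k \<le> card (options D B u p) - 1 \<and> (y, f) = entry D B u p (ol u p ! (k - 1))" for k
      using nth[of "k - 1"] len by auto
    ultimately show ?case by simp
  qed
  also have "\<dots> \<longleftrightarrow> (\<exists>u p k. x = aux (Conf u p) k \<and> (u, p) \<in> conf_a D B \<and> 1 \<le> k \<and> k + 1 \<le> card (options D B u p) \<and>
       (y, f) = comb_edge D B ol u p k d)"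
  proof (intro ex_cong1, goal_cases)
    case (1 u p)
    show ?case
    proof (cases "(u, p) \<in> conf_a D B \<and> 2 \<le> card (options D B u p)")
      case True
      then have len: "length (ol u p) = card (options D B u p)" by (intro l) auto
      have k: "1 \<le> k \<and> k \<le> card (options D B u p) - 1 \<longleftrightarrow> 1 \<le> k \<and> k + 1 \<le> card (options D B u p)" for k by auto
      show ?thesis
      proof (cases d)
        case L
        then show ?thesis using True k by (simp add: comb_edge_def del: aux.simps One_nat_def) blast
      next
        case R
        \<comment> \<open>Only at the last comb vertex does the right edge leave the comb.\<close>
        have *: "k + 1 \<le> card (options D B u p) \<and> \<not> k + 2 \<le> card (options D B u p) \<longleftrightarrow> k = card (options D B u p) - 1" for k
          using True by auto
        have "(\<exists>k. x = aux (Conf u p) k \<and> (u, p) \<in> conf_a D B \<and> 1 \<le> k \<and> k + 1 \<le> card (options D B u p) \<and>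
           (y, f) = comb_edge D B ol u p k d) \<longleftrightarrow>
          (\<exists>k. x = aux (Conf u p) k \<and> 1 \<le> k \<and> k + 2 \<le> card (options D B u p) \<and> (y, f) = (aux (Conf u p) (k + 1), id)) \<or>
          (\<exists>k. x = aux (Conf u p) k \<and> 1 \<le> k \<and> (k + 1 \<le> card (options D B u p) \<and> \<not> k + 2 \<le> card (options D B u p)) \<and>
             (y, f) = entry D B u p (ol u p ! (card (options D B u p) - 1)))"
          unfolding comb_edge_def len using True R by (auto simp del: aux.simps split: if_splits)
        also have "\<dots> \<longleftrightarrow> (\<exists>k. x = aux (Conf u p) k \<and> 1 \<le> k \<and> k + 2 \<le> card (options D B u p) \<and> (y, f) = (aux (Conf u p) (k + 1), id)) \<or>
          (x = aux (Conf u p) (card (options D B u p) - 1) \<and> (y, f) = entry D B u p (ol u p ! (card (options D B u p) - 1)))"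
          
        proof -
          have "1 \<le> card (options D B u p) - 1" using True by linarith
          then show ?thesis unfolding * by blast
        qed
        finally show ?thesis using True R by (auto simp del: aux.simps)
      qed
    next
      case False
      have "2 \<le> card (options D B u p)" if "1 \<le> k" "k + 1 \<le> card (options D B u p)" for k using that by simp
      with False show ?thesis by blast
    qed
  qed
  finally show ?thesis .
qed

end

subsection \<open>Composition of preorder effects\<close>

text \<open>\<open>rep_effect\<close> detached from the memory, so that composition can be treated
  as arithmetic on five numbers.\<close>

definition rep5 :: "nat \<Rightarrow> nat \<Rightarrow> nat \<Rightarrow> nat \<Rightarrow> nat \<Rightarrow> nat \<Rightarrow> effect \<Rightarrow> bool" where
  "rep5 T b c b' c' t f \<longleftrightarrow> T \<le> 1 \<and> b \<le> 1 \<and> b' \<le> 1 \<and>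
     (t = 0 \<longrightarrow> b = 0 \<and> b' = 0) \<and> (T = 0 \<longrightarrow> b' = 0 \<and> c' = 0) \<and>
     (\<forall>p. place_type p = t \<longrightarrow> f p = affine T b c b' c' p)"

lemma rep_effect_rep5:
  "rep_effect A i t f \<longleftrightarrow> rep5 (A (5 * i)) (A (5 * i + 1)) (A (5 * i + 2)) (A (5 * i + 3)) (A (5 * i + 4)) t f"
  by (simp add: rep_effect_def rep5_def Let_def)

text \<open>The condition \<open>b b' = 0\<close> is what keeps \<open>b \<le> 1\<close> under composition.\<close>

definition nice :: "nat \<Rightarrow> nat \<Rightarrow> nat \<Rightarrow> effect \<Rightarrow> bool" where
  "nice t T K f \<longleftrightarrow> (\<exists>b c b' c'. rep5 T b c b' c' t f \<and> b * b' = 0 \<and> c + c' \<le> K)"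

text \<open>The outer formulas are applied to \<open>x + b y + c\<close> and
  \<open>b' y + c'\<close>. If the intermediate place has one component only, the assumption removes
  the terms that would come from the second one.\<close>

lemma affine_comp:
  assumes "T = 0 \<longrightarrow> b' = 0 \<and> c' = 0"
  shows "affine T' b2 c2 b2' c2' (affine T b c b' c' p) =
    affine T' (b + b2 * b') (c + b2 * c' + c2) (b2' * b') (b2' * c' + c2') p"
  using assms by (cases p) (auto simp: algebra_simps)

lemma place_type_affine: "T \<le> 1 \<Longrightarrow> place_type (affine T b c b' c' p) = T"
  by (cases p) auto

text \<open>The new coefficient \<open>b + b2 * b'\<close> cannot reach 2, since \<open>b\<close> or
  \<open>b'\<close> is 0.\<close>

lemma rep5_comp:
  assumes g: "rep5 T b c b' c' t g" and f: "rep5 T' b2 c2 b2' c2' T f" and "b * b' = 0"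
  shows "rep5 T' (b + b2 * b') (c + b2 * c' + c2) (b2' * b') (b2' * c' + c2') t (f \<circ> g)"
proof -
  have "f (g p) = affine T' (b + b2 * b') (c + b2 * c' + c2) (b2' * b') (b2' * c' + c2') p"
    if "place_type p = t" for p
  proof -
    have "g p = affine T b c b' c' p" "T \<le> 1" "T = 0 \<longrightarrow> b' = 0 \<and> c' = 0" using g that by (auto simp: rep5_def)
    moreover from this have "f (g p) = affine T' b2 c2 b2' c2' (g p)"
      using f by (simp add: rep5_def place_type_affine)
    ultimately show ?thesis by (simp only: affine_comp)
  qed
  moreover have "b + b2 * b' \<le> 1"
  proof (cases "b = 0")
    case True
    have "b2 \<le> 1" "b' \<le> 1" using f g by (simp_all add: rep5_def)
    with True show ?thesis using mult_le_mono[of b2 1 b' 1] by simp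
  next
    case False
    then show ?thesis using assms(3) g by (simp add: rep5_def)
  qed
  moreover have "b2' * b' \<le> 1" using f g mult_le_mono[of b2' 1 b' 1] by (simp add: rep5_def)
  ultimately show ?thesis using f g by (auto simp: rep5_def)
qed

text \<open>As \<open>b2\<close> or \<open>b2'\<close> is 0, the inner constant \<open>c'\<close>
  enters at most one of the two new constants. So the sums of constants merely add up along a path,
  and \<open>c'\<close> is never counted twice.\<close>

lemma rep5_comp_bounds:
  assumes g: "rep5 T b c b' c' t g" and f: "rep5 T' b2 c2 b2' c2' T f" and "b * b' = 0" "b2 * b2' = 0"
  shows "(b + b2 * b') * (b2' * b') = 0" "(c + b2 * c' + c2) + (b2' * c' + c2') \<le> (c + c') + (c2 + c2')"
proof -
  show "(b + b2 * b') * (b2' * b') = 0" using assms(3,4) by auto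
  have "b2 \<le> 1" "b2' \<le> 1" using f by (simp_all add: rep5_def)
  then have "b2 = 0 \<or> b2 = 1" "b2' = 0 \<or> b2' = 1" by auto
  then show "(c + b2 * c' + c2) + (b2' * c' + c2') \<le> (c + c') + (c2 + c2')" using assms(4) by auto
qed

lemma nice_comp:
  assumes "nice t T K g" "nice T T' K' f"
  shows "nice t T' (K + K') (f \<circ> g)"
proof -
  from assms obtain b c b' c' b2 c2 b2' c2' where
    *: "rep5 T b c b' c' t g" "b * b' = 0" "c + c' \<le> K" "rep5 T' b2 c2 b2' c2' T f" "b2 * b2' = 0" "c2 + c2' \<le> K'"
    unfolding nice_def by blast
  have "(c + b2 * c' + c2) + (b2' * c' + c2') \<le> K + K'" using rep5_comp_bounds(2)[OF *(1,4,2,5)] *(3,6) by linarith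
  then show ?thesis unfolding nice_def
    using rep5_comp[OF *(1,4,2)] rep5_comp_bounds(1)[OF *(1,4,2,5)] by blast
qed

text \<open>The identity keeps the type, and its second component has coefficient 1 exactly if there
  is a second component; hence \<open>t\<close> in two places.\<close>

lemma rep5_id: "t \<le> 1 \<Longrightarrow> rep5 t 0 0 t 0 t id"
proof -
  have "t = place_type p \<Longrightarrow> p = affine t 0 0 t 0 p" for p by (cases p) auto
  then show "t \<le> 1 \<Longrightarrow> rep5 t 0 0 t 0 t id" by (auto simp: rep5_def)
qed

lemma nice_id: "t \<le> 1 \<Longrightarrow> nice t t 0 id"
  unfolding nice_def by (intro exI conjI, rule rep5_id) auto

lemma rep5_apply: "rep5 T b c b' c' t f \<Longrightarrow> place_type p = t \<Longrightarrow> f p = affine T b c b' c' p"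
  by (simp add: rep5_def)

text \<open>The values at \<open>One 0\<close>, or at \<open>Two 0 0\<close> and
  \<open>Two 0 1\<close>, determine all coefficients. Hence bounds that \<open>nice\<close> states
  for some representation hold for the one found in memory.\<close>

lemma rep5_unique:
  assumes "rep5 T b c b' c' t f" "rep5 T2 b2 c2 b2' c2' t f" "t \<le> 1"
  shows "T2 = T \<and> b2 = b \<and> c2 = c \<and> b2' = b' \<and> c2' = c'"
proof (cases "t = 0")
  case True
  then have "f (One 0) = affine T b c b' c' (One 0)" "f (One 0) = affine T2 b2 c2 b2' c2' (One 0)"
    using rep5_apply[OF assms(1), of "One 0"] rep5_apply[OF assms(2), of "One 0"] True by simp_all
  then have "affine T b c b' c' (One 0) = affine T2 b2 c2 b2' c2' (One 0)" by simp
  moreover have "b = 0 \<and> b' = 0 \<and> b2 = 0 \<and> b2' = 0 \<and> (T = 0 \<longrightarrow> c' = 0) \<and> (T2 = 0 \<longrightarrow> c2' = 0) \<and> T \<le> 1 \<and> T2 \<le> 1"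
    using True assms(1,2) by (simp add: rep5_def)
  ultimately show ?thesis by (auto split: if_splits)
next
  case False
  then have t: "t = 1" using assms(3) by simp
  have eq: "affine T b c b' c' p = affine T2 b2 c2 b2' c2' p" if "place_type p = 1" for p
    using rep5_apply[OF assms(1), of p] rep5_apply[OF assms(2), of p] that t by simp
  have "(T = 0 \<longrightarrow> b' = 0 \<and> c' = 0) \<and> (T2 = 0 \<longrightarrow> b2' = 0 \<and> c2' = 0) \<and> T \<le> 1 \<and> T2 \<le> 1"
    using assms(1,2) by (simp add: rep5_def)
  then show ?thesis using eq[of "Two 0 0"] eq[of "Two 0 1"] by (auto split: if_splits)
qed

lemma nice_rep5:
  assumes "nice t T K f" "rep5 T2 b2 c2 b2' c2' t f" "t \<le> 1"
  shows "T2 = T" "b2 * b2' = 0" "c2 + c2' \<le> K"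
  using assms rep5_unique[OF _ assms(2,3)] unfolding nice_def by blast+

lemma rep5_effect:
  "rep5 0 0 0 0 0 0 (effect HCat 0 0 s1 s2 l1 L)"
  "rep5 0 0 s1 0 0 0 (effect HCat 0 0 s1 s2 l1 R)"
  "rep5 0 0 0 0 0 1 (effect HCat 0 1 s1 s2 l1 L)"
  "rep5 1 0 s1 1 0 1 (effect HCat 0 1 s1 s2 l1 R)"
  "rep5 1 0 0 1 0 1 (effect HCat 1 0 s1 s2 l1 L)"
  "rep5 0 1 s1 0 0 1 (effect HCat 1 0 s1 s2 l1 R)"
  "rep5 1 0 0 0 s2 0 (effect VComp 1 0 s1 s2 l1 L)"
  "rep5 0 0 l1 0 0 0 (effect VComp 1 0 s1 s2 l1 R)"
  "rep5 1 0 0 1 s2 1 (effect VComp 1 1 s1 s2 l1 L)"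
  "rep5 1 0 l1 1 0 1 (effect VComp 1 1 s1 s2 l1 R)"
proof -
  have *: "(\<forall>p. place_type p = 0 \<longrightarrow> P p) \<longleftrightarrow> (\<forall>x. P (One x))" "(\<forall>p. place_type p = 1 \<longrightarrow> P p) \<longleftrightarrow> (\<forall>x y. P (Two x y))" for P
    by (metis place.exhaust place_type.simps zero_neq_one)+
  show
  "rep5 0 0 0 0 0 0 (effect HCat 0 0 s1 s2 l1 L)"
  "rep5 0 0 s1 0 0 0 (effect HCat 0 0 s1 s2 l1 R)"
  "rep5 0 0 0 0 0 1 (effect HCat 0 1 s1 s2 l1 L)"
  "rep5 1 0 s1 1 0 1 (effect HCat 0 1 s1 s2 l1 R)"
  "rep5 1 0 0 1 0 1 (effect HCat 1 0 s1 s2 l1 L)"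
  "rep5 0 1 s1 0 0 1 (effect HCat 1 0 s1 s2 l1 R)"
  "rep5 1 0 0 0 s2 0 (effect VComp 1 0 s1 s2 l1 L)"
  "rep5 0 0 l1 0 0 0 (effect VComp 1 0 s1 s2 l1 R)"
  "rep5 1 0 0 1 s2 1 (effect VComp 1 1 s1 s2 l1 L)"
  "rep5 1 0 l1 1 0 1 (effect VComp 1 1 s1 s2 l1 R)"
    unfolding rep5_def * by (simp_all add: effect_def on_one_def on_two_def)
qed

lemma niceI: "rep5 T b c b' c' t f \<Longrightarrow> b * b' = 0 \<Longrightarrow> c + c' \<le> K \<Longrightarrow> nice t T K f"
  unfolding nice_def by blast

lemma nice_effect:
  "nice 0 0 K (effect HCat 0 0 s1 s2 l1 L)"
  "s1 \<le> K \<Longrightarrow> nice 0 0 K (effect HCat 0 0 s1 s2 l1 R)"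
  "nice 1 0 K (effect HCat 0 1 s1 s2 l1 L)"
  "s1 \<le> K \<Longrightarrow> nice 1 1 K (effect HCat 0 1 s1 s2 l1 R)"
  "nice 1 1 K (effect HCat 1 0 s1 s2 l1 L)"
  "s1 \<le> K \<Longrightarrow> nice 1 0 K (effect HCat 1 0 s1 s2 l1 R)"
  "s2 \<le> K \<Longrightarrow> nice 0 1 K (effect VComp 1 0 s1 s2 l1 L)"
  "l1 \<le> K \<Longrightarrow> nice 0 0 K (effect VComp 1 0 s1 s2 l1 R)"
  "s2 \<le> K \<Longrightarrow> nice 1 1 K (effect VComp 1 1 s1 s2 l1 L)"
  "l1 \<le> K \<Longrightarrow> nice 1 1 K (effect VComp 1 1 s1 s2 l1 R)"
           apply (rule niceI[OF rep5_effect(1)]; simp)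
          apply (rule niceI[OF rep5_effect(2)]; simp)
         apply (rule niceI[OF rep5_effect(3)]; simp)
        apply (rule niceI[OF rep5_effect(4)]; simp)
       apply (rule niceI[OF rep5_effect(5)]; simp)
      apply (rule niceI[OF rep5_effect(6)]; simp)
     apply (rule niceI[OF rep5_effect(7)]; simp)
    apply (rule niceI[OF rep5_effect(8)]; simp)
   apply (rule niceI[OF rep5_effect(9)]; simp)
  apply (rule niceI[OF rep5_effect(10)]; simp)
  done

text \<open>An edge of the f-SLP adds at most \<open>S\<close> to the constants and lowers the rank
  by at least 1, so the potential \<open>rank * S\<close> pays for all constants along a path. Edges
  that stay at the same f-SLP vertex carry identities and cost nothing.\<close>

definition good :: "('v, 'a label, 'z) bdag_scheme \<Rightarrow> nat \<Rightarrow> ('v, 'q) pnode \<Rightarrow> ('v, 'q) pnode \<Rightarrow> effect \<Rightarrow> bool" where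
  "good D S x z f \<longleftrightarrow> (vert x, vert z) \<in> (adj D)\<^sup>* \<and>
     (\<exists>K. nice (vtype D (vert x)) (vtype D (vert z)) K f \<and> K + rank D (vert z) * S \<le> rank D (vert x) * S)"

lemma good_id: "vert x = vert z \<Longrightarrow> good D S x z id"
proof -
  have "vtype D v \<le> 1" for v by (simp add: vtype_def)
  then show "vert x = vert z \<Longrightarrow> good D S x z id"
    unfolding good_def by (auto intro!: exI[of _ 0] nice_id)
qed

lemma good_comp: "good D S x y g \<Longrightarrow> good D S y z f \<Longrightarrow> good D S x z (f \<circ> g)"
  unfolding good_def
  by (elim conjE exE, intro conjI, erule (1) rtrancl_trans, intro exI conjI, erule (1) nice_comp) simp

lemma good_vert: "vert x = vert x' \<Longrightarrow> good D S x z f \<longleftrightarrow> good D S x' z f"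
  by (simp add: good_def)

context fslp
begin

text \<open>All entries in front of \<open>*\<close> are proper labels. Thus one bound for the leaf
  sizes also covers the left sizes that occur in effects.\<close>

lemma left_size_le:
  assumes "v \<in> verts D" "vtype D v = 1"
  shows "left_size D v \<le> leaf_size D v"
proof -
  from left_size_split[OF assms] obtain ys zs where
    "labs (sem D v) = ys @ None # zs" "None \<notin> set ys" "length ys = left_size D v" by metis
  moreover from this have "filter (\<lambda>x. x \<noteq> None) ys = ys" by (intro filter_True) metis
  ultimately show ?thesis unfolding leaf_size_def card_labelled by simp
qed

lemma vtype_cases: "vtype D v = 0 \<or> vtype D v = 1"
  by (simp add: vtype_def)

lemma nice_edge_effect:
  assumes u: "u \<in> verts D" "\<not> is_leaf D u" and S: "\<And>v. v \<in> verts D \<Longrightarrow> leaf_size D v \<le> S"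
  shows "nice (vtype D u) (vtype D (child D u d)) S (edge_effect D u d)"
proof -
  let ?l = "child D u L" and ?r = "child D u R"
  have c: "?l \<in> verts D" "?r \<in> verts D" using u by (auto simp: child_verts)
  have b: "leaf_size D ?l \<le> S" "leaf_size D ?r \<le> S" "vtype D ?l = 1 \<Longrightarrow> left_size D ?l \<le> S"
    using S[OF c(1)] S[OF c(2)] left_size_le[OF c(1)] by auto
  show ?thesis using inner_label[OF u]
  proof
    assume f: "label D u = HCat"
    have "vtype D ?l = 0 \<and> vtype D ?r = 0 \<or> vtype D ?l = 0 \<and> vtype D ?r = 1 \<or> vtype D ?l = 1 \<and> vtype D ?r = 0"
      using vtype_HCat[OF u(1) f] vtype_le[of u] vtype_cases[of ?l] vtype_cases[of ?r] by linarith
    then show ?thesis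
      unfolding edge_effect_def Let_def vtype_HCat[OF u(1) f] f
      using b by (cases d) (auto intro: nice_effect[unfolded One_nat_def])
  next
    assume f: "label D u = VComp"
    then show ?thesis
      unfolding edge_effect_def Let_def vtype_VComp[OF u(1) f] f
      using b vtype_cases[of ?r] vtype_VComp(1)[OF u(1) f]
      by (cases d) (auto intro: nice_effect[unfolded One_nat_def])
  qed
qed

end

section \<open>Effects along contracted paths and right paths\<close>

context enumeration
begin

lemma target_node: "o' \<in> options D B u p \<Longrightarrow> opt_target D u p o' \<in> fst (sink_graph D B)"
  by (cases o') (auto simp: sink_graph_eq opt_target_def Some_opts None_opts moves_def)

lemma resolve_node:
  assumes "x \<in> fst (sink_graph D B)"
  shows "fst (resolve D B x) \<in> fst (contract (sink_graph D B))"
proof -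
  have "z \<in> fst (contract (sink_graph D B))" if "follow (snd (sink_graph D B)) x z f" "x \<in> fst (sink_graph D B)" for x z f
    using that
  proof (induction rule: follow.induct)
    case (stop u)
    then show ?case by (simp add: contract_def)
  next
    case (move u i w g z f)
    have "w \<in> fst (sink_graph D B)" using move(2) target_node unfolding edge_sink_graph by blast
    then show ?case by (rule move.IH)
  qed
  then show ?thesis using assms follow_resolve by blast
qed

lemma entry_node: "o' \<in> options D B u p \<Longrightarrow> fst (entry D B u p o') \<in> fst (contract (sink_graph D B))"
  by (simp add: entry_def resolve_node target_node)

lemma contract_node_comb: "x \<in> fst (contract (sink_graph D B)) \<Longrightarrow> x \<in> comb_nodes D B ol"
  by (simp add: comb_nodes_def binarize_nodes_def)

text \<open>The edge to the sink is an identity at the same vertex; any other edge has constants of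
  sum at most \<open>S\<close>, which the drop of the rank pays for.\<close>

lemma good_edge:
  assumes "\<And>v. v \<in> verts D \<Longrightarrow> leaf_size D v \<le> S" "o' \<in> options D B u p"
  shows "good D S (Conf u p) (opt_target D u p o') (opt_effect D u o')"
proof (cases o')
  case None
  then show ?thesis by (simp add: opt_target_def opt_effect_def good_id)
next
  case (Some m)
  obtain d q where m: "m = (d, q)" by (cases m)
  then have u: "u \<in> verts D" "\<not> is_leaf D u" using assms(2) Some by (auto simp: Some_opts moves_def)
  have "Suc (rank D (child D u d)) * S \<le> rank D u * S"
    using rank_child_less[OF u] by (intro mult_le_mono1) (simp add: Suc_le_eq)
  moreover have "(u, child D u d) \<in> adj D" using child_edge[OF u] by (auto simp: adj_def)
  ultimately show ?thesis using nice_edge_effect[OF u assms(1), of d]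
    by (auto simp: Some m opt_target_def opt_effect_def good_def)
qed

lemma good_resolve:
  assumes S: "\<And>v. v \<in> verts D \<Longrightarrow> leaf_size D v \<le> S"
  shows "good D S x (fst (resolve D B x)) (snd (resolve D B x))"
proof -
  have "good D S x z f" if "follow (snd (sink_graph D B)) x z f" for x z f
    using that
  proof (induction rule: follow.induct)
    case (move u i w g z f)
    have "good D S u w g" using move(2) good_edge[OF S] unfolding edge_sink_graph by blast
    then show ?case using move.IH by (rule good_comp)
  qed (rule good_id, rule refl)
  then show ?thesis using follow_resolve by blast
qed

lemma good_entry:
  assumes S: "\<And>v. v \<in> verts D \<Longrightarrow> leaf_size D v \<le> S" and o: "o' \<in> options D B u p"
  shows "good D S (Conf u p) (fst (entry D B u p o')) (snd (entry D B u p o'))"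
  unfolding entry_def using good_comp[OF good_edge[OF S o] good_resolve[OF S]] by simp

lemma resolve_simps:
  "card (options D B u p) \<noteq> 1 \<Longrightarrow> resolve D B (Conf u p) = (Conf u p, id)"
  "resolve D B (Sink u p) = (Sink u p, id)"
  "options D B u p = {o'} \<Longrightarrow> resolve D B (Conf u p) = entry D B u p o'"
proof -
  show "card (options D B u p) \<noteq> 1 \<Longrightarrow> resolve D B (Conf u p) = (Conf u p, id)"
    using follow.stop[of "snd (sink_graph D B)" "Conf u p"] by (simp add: outdeg_Conf follow_iff prod_eq_iff)
  show "resolve D B (Sink u p) = (Sink u p, id)"
    using follow.stop[of "snd (sink_graph D B)" "Sink u p"] by (simp add: outdeg_other follow_iff prod_eq_iff)
  assume o: "options D B u p = {o'}"
  have "(Conf u p, opt_id D u o', opt_target D u p o', opt_effect D u o') \<in> snd (sink_graph D B)"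
    unfolding edge_sink_graph using o by blast
  then have "follow (snd (sink_graph D B)) (Conf u p) (fst (entry D B u p o')) (snd (entry D B u p o'))"
    unfolding entry_def fst_conv snd_conv by (rule follow.move[rotated, OF _ follow_resolve]) (simp add: outdeg_Conf o)
  then show "resolve D B (Conf u p) = entry D B u p o'" by (simp add: follow_iff prod_eq_iff)
qed

subsection \<open>Right paths\<close>

lemma nth_opts:
  assumes "lists_opts D B ol" "(u, p) \<in> conf_a D B" "j < card (options D B u p)" "card (options D B u p) \<noteq> 1"
  shows "ol u p ! j \<in> options D B u p"
  using assms length_opts[OF assms(1,2,4)] nth_mem[of j "ol u p"] unfolding lists_opts_def by metis

lemma comb_edge_good:
  assumes S: "\<And>v. v \<in> verts D \<Longrightarrow> leaf_size D v \<le> S" and ol: "lists_opts D B ol"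
    and e: "(x, d, y, f) \<in> comb_edges D B ol"
  shows "good D S x y f" "y \<in> comb_nodes D B ol"
proof -
  from e obtain u p k where *: "x = aux (Conf u p) k" "(u, p) \<in> conf_a D B" "1 \<le> k" "k + 1 \<le> card (options D B u p)"
     "(y, f) = comb_edge D B ol u p k d" unfolding comb_edges_iff[OF ol] by blast
  then have c: "card (options D B u p) \<noteq> 1" by linarith
  have x: "vert x = u" using *(1,3) by simp
  have len: "length (ol u p) = card (options D B u p)" by (rule length_opts[OF ol *(2) c])
  have ent: "good D S x y f \<and> y \<in> comb_nodes D B ol" if "(y, f) = entry D B u p (ol u p ! j)" "j < card (options D B u p)" for j
    using that good_entry[OF S nth_opts[OF ol *(2) that(2) c]] entry_node[OF nth_opts[OF ol *(2) that(2) c]]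
      good_vert[of x "Conf u p" D S y f] x
    by (metis contract_node_comb fst_conv snd_conv vert.simps(1))
  have "good D S x y f \<and> y \<in> comb_nodes D B ol"
  proof (cases "d = R \<and> k + 2 \<le> length (ol u p)")
    case True
    then have "y = Aux u p (k + 1)" "f = id" using *(3,5) by (auto simp: comb_edge_def)
    then show ?thesis using True x c *(2,3) len by (auto simp: good_id comb_nodes_iff[OF ol])
  next
    case False
    then consider "(y, f) = entry D B u p (ol u p ! (k - 1))" | "(y, f) = entry D B u p (ol u p ! (length (ol u p) - 1))"
      using *(5) by (cases d) (auto simp: comb_edge_def)
    then show ?thesis using ent[of "k - 1"] ent[of "length (ol u p) - 1"] len *(3,4) by cases auto
  qed
  then show "good D S x y f" "y \<in> comb_nodes D B ol" by blast+
qed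

lemma comb_edges_unique:
  assumes ol: "lists_opts D B ol" and "(x, d, y, f) \<in> comb_edges D B ol" "(x, d, y', f') \<in> comb_edges D B ol"
  shows "y = y' \<and> f = f'"
proof -
  from assms(2,3) obtain u p k u' p' k' where
    *: "x = aux (Conf u p) k" "1 \<le> k" "(y, f) = comb_edge D B ol u p k d"
       "x = aux (Conf u' p') k'" "1 \<le> k'" "(y', f') = comb_edge D B ol u' p' k' d" unfolding comb_edges_iff[OF ol] by blast
  then have "u = u' \<and> p = p' \<and> k = k'" using aux_Conf_eq_iff by metis
  with *(3,6) show ?thesis by (metis prod.inject)
qed

lemma right_path_unique:
  assumes ol: "lists_opts D B ol"
  shows "right_path (comb_edges D B ol) x z f \<Longrightarrow> right_path (comb_edges D B ol) x z' f' \<Longrightarrow> z = z' \<and> f = f'"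
proof (induction arbitrary: z' f' rule: right_path.induct)
  case (stop u)
  from stop(2) show ?case by cases (use stop(1) in auto)
next
  case (move u w g z f)
  from move.prems show ?case
  proof cases
    case stop then show ?thesis using move.hyps(1) by blast
  next
    case (move w' g' f'')
    then show ?thesis using move.IH comb_edges_unique[OF ol move.hyps(1)] by blast
  qed
qed

text \<open>The right edges inside a comb are identities, so all its vertices share the right leaf
  and the effect obtained through the last option. The program therefore computes this pair once per
  configuration.\<close>

lemma right_path_comb:
  assumes ol: "lists_opts D B ol" and c: "(u, p) \<in> conf_a D B" and k: "1 \<le> k" "k + 1 \<le> card (options D B u p)"
    and rp: "right_path (comb_edges D B ol) (fst (entry D B u p (ol u p ! (card (options D B u p) - 1)))) z f"
  shows "right_path (comb_edges D B ol) (aux (Conf u p) k) z (f \<circ> snd (entry D B u p (ol u p ! (card (options D B u p) - 1))))"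
proof -
  define e where "e = entry D B u p (ol u p ! (card (options D B u p) - 1))"
  have c1: "card (options D B u p) \<noteq> 1" using k by linarith
  have len: "length (ol u p) = card (options D B u p)" by (rule length_opts[OF ol c c1])
  have "k \<le> card (options D B u p) - 1" using k by simp
  then show ?thesis using k(1) unfolding e_def[symmetric]
  proof (induction k rule: inc_induct)
    case base
    have "(aux (Conf u p) (card (options D B u p) - 1), R, fst e, snd e) \<in> comb_edges D B ol"
      unfolding comb_edges_iff[OF ol] using c k base
      by (intro exI[of _ u] exI[of _ p] exI[of _ "card (options D B u p) - 1"]) (auto simp: comb_edge_def len e_def)
    then show ?case using rp unfolding e_def[symmetric] by (rule right_path.move)
  next
    case (step k)
    have "(aux (Conf u p) k, R, aux (Conf u p) (k + 1), id) \<in> comb_edges D B ol"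
      unfolding comb_edges_iff[OF ol] using c step.hyps step.prems
      by (intro exI[of _ u] exI[of _ p] exI[of _ k]) (auto simp: comb_edge_def len)
    from right_path.move[OF this, of z "f \<circ> snd e"] step.IH step.prems show ?case by (simp del: aux.simps add: o_def)
  qed
qed

lemma no_comb_edge:
  assumes ol: "lists_opts D B ol"
  shows "(Sink u p, d, y, f) \<notin> comb_edges D B ol" "card (options D B u p) < 2 \<Longrightarrow> (Conf u p, d, y, f) \<notin> comb_edges D B ol"
  unfolding comb_edges_iff[OF ol] by (auto split: if_splits)

lemma right_path_leaf:
  assumes ol: "lists_opts D B ol"
  shows "right_path (comb_edges D B ol) (Sink u p) (Sink u p) id"
    "card (options D B u p) < 2 \<Longrightarrow> right_path (comb_edges D B ol) (Conf u p) (Conf u p) id"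
  using no_comb_edge[OF ol] by (auto intro!: right_path.stop)

text \<open>Induction on the rank of the underlying f-SLP vertex. Inside a comb everything reduces
  to the last option, which leads to a sink or to a vertex of smaller rank.\<close>

lemma right_path_exists:
  assumes ol: "lists_opts D B ol"
  shows "x \<in> comb_nodes D B ol \<Longrightarrow> \<exists>z f. right_path (comb_edges D B ol) x z f"
proof (induction "rank D (vert x)" arbitrary: x rule: less_induct)
  case less
  have comb: "\<exists>z f. right_path (comb_edges D B ol) (aux (Conf u p) k) z f"
    if "vert x = u" "(u, p) \<in> conf_a D B" "1 \<le> k" "k + 1 \<le> card (options D B u p)" for u p k
  proof -
    let ?o = "ol u p ! (card (options D B u p) - 1)"
    have o: "?o \<in> options D B u p" using that by (intro nth_opts[OF ol]) auto
    have n: "fst (entry D B u p ?o) \<in> comb_nodes D B ol" by (intro contract_node_comb entry_node o)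
    have "\<exists>z f. right_path (comb_edges D B ol) (fst (entry D B u p ?o)) z f"
    proof (cases ?o)
      case None
      then have "fst (entry D B u p ?o) = Sink u p" by (simp add: entry_def opt_target_def resolve_simps)
      then show ?thesis using right_path_leaf(1)[OF ol] by metis
    next
      case (Some m)
      obtain d q where m: "m = (d, q)" by (cases m)
      with o Some have u: "u \<in> verts D" "\<not> is_leaf D u" by (auto simp: Some_opts moves_def)
      \<comment> \<open>The maximum serves as the bound \<open>S\<close>; what matters here is the
        reachability part of \<open>good\<close>.\<close>
      have "leaf_size D v \<le> Max (leaf_size D ` verts D)" if "v \<in> verts D" for v using that finite_verts by simp
      from good_resolve[OF this, of "Conf (child D u d) q"]
      have "(child D u d, vert (fst (entry D B u p ?o))) \<in> (adj D)\<^sup>*"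
        unfolding Some m by (simp add: entry_def opt_target_def good_def)
      then have "rank D (vert (fst (entry D B u p ?o))) \<le> rank D (child D u d)"
        by (induction rule: rtrancl_induct) (auto dest: rank_less)
      with rank_child_less[OF u, of d] have "rank D (vert (fst (entry D B u p ?o))) < rank D (vert x)" using that(1) by simp
      from less.hyps[OF this n] show ?thesis .
    qed
    then show ?thesis using right_path_comb[OF ol that(2-4)] by blast
  qed
  show ?case
  proof (cases x)
    case (Conf u p)
    then have c: "(u, p) \<in> conf_a D B" "card (options D B u p) \<noteq> 1" using less.prems by (auto simp: comb_nodes_iff[OF ol])
    show ?thesis
    proof (cases "card (options D B u p) < 2")
      case True then show ?thesis unfolding Conf using right_path_leaf(2)[OF ol] by blast
    next
      case False then show ?thesis using comb[of u p 1] c Conf by simp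
    qed
  next
    case (Sink u p) then show ?thesis using right_path_leaf(1)[OF ol] by blast
  next
    case (Aux u p k)
    then have "(u, p) \<in> conf_a D B" "2 \<le> k" "k + 1 \<le> card (options D B u p)" using less.prems by (auto simp: comb_nodes_iff[OF ol])
    then show ?thesis using comb[of u p k] Aux by simp
  qed
qed

lemma good_right_path:
  assumes S: "\<And>v. v \<in> verts D \<Longrightarrow> leaf_size D v \<le> S" and ol: "lists_opts D B ol"
  shows "right_path (comb_edges D B ol) x z f \<Longrightarrow> good D S x z f"
proof (induction rule: right_path.induct)
  case (move u w g z f)
  show ?case by (rule good_comp[OF comb_edge_good(1)[OF S ol move.hyps(1)] move.IH]) assumption
qed (rule good_id, rule refl)

text \<open>The stages of the transformation are hidden in \<open>sink_graph\<close>,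
  \<open>comb_nodes\<close> and \<open>comb_edges\<close>, and the order of edges has become an
  order of options.\<close>

lemma is_enum_ds_iff: "is_enum_ds D B X \<longleftrightarrow>
   ds_conf_empty X = conf_empty D B \<and> ds_conf_a X = conf_a D B \<and> ds_conf_u X = conf_u D B \<and>
   (\<forall>(v, q) \<in> conf_u D B. \<not> is_leaf D v \<longrightarrow> linear_order_on (quads D B v q) (ds_order X v q)) \<and>
   (\<forall>(u, d, v) \<in> edges D. ds_effect X u d = edge_effect D u d) \<and>
   ds_table X = contract_table (sink_graph D B) \<and>
   (\<exists>ol. lists_opts D B ol \<and> ds_nodes X = comb_nodes D B ol \<and> ds_edges X = comb_edges D B ol) \<and>
   (\<forall>u \<in> ds_nodes X. right_path (ds_edges X) u (ds_omega X u) (ds_gamma X u))"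
proof -
  have "(\<exists>out_order. is_out_order (contract (sink_graph D B)) out_order \<and>
           ds_nodes X = binarize_nodes (contract (sink_graph D B)) out_order \<and>
           ds_edges X = binarize_edges (contract (sink_graph D B)) out_order) \<longleftrightarrow>
      (\<exists>ol. lists_opts D B ol \<and> ds_nodes X = comb_nodes D B ol \<and> ds_edges X = comb_edges D B ol)" (is "?l \<longleftrightarrow> ?r")
  proof
    assume ?l
    then obtain oo where oo: "is_out_order (contract (sink_graph D B)) oo"
      "ds_nodes X = binarize_nodes (contract (sink_graph D B)) oo"
      "ds_edges X = binarize_edges (contract (sink_graph D B)) oo" by blast
    from out_order_cases[OF oo(1)] obtain ol where "lists_opts D B ol"
      "binarize_nodes (contract (sink_graph D B)) oo = comb_nodes D B ol"
      "binarize_edges (contract (sink_graph D B)) oo = comb_edges D B ol" .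
    with oo show ?r by metis
  next
    assume ?r then show ?l using is_out_order_order_of unfolding comb_nodes_def comb_edges_def by blast
  qed
  then show ?thesis unfolding is_enum_ds_def Let_def sink_graph_def[symmetric] by simp
qed

end

section \<open>The data structure for an extension\<close>

text \<open>The memory format demands that quadruples be listed in increasing order, so the order is
  derived from the list that the program writes.\<close>

definition list_order :: "'c list \<Rightarrow> ('c \<times> 'c) set" where
  "list_order xs = {(xs ! i, xs ! j) | i j. i \<le> j \<and> j < length xs}"

lemma linear_order_list_order:
  assumes "distinct xs"
  shows "linear_order_on (set xs) (list_order xs)"
proof -
  have inj: "xs ! i = xs ! j \<Longrightarrow> i < length xs \<Longrightarrow> j < length xs \<Longrightarrow> i = j" for i j
    using assms by (simp add: nth_eq_iff_index_eq)
  have sub: "list_order xs \<subseteq> set xs \<times> set xs" by (auto simp: list_order_def)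
  have "(xs ! i, xs ! i) \<in> list_order xs" if "i < length xs" for i using that unfolding list_order_def by blast
  then have "refl_on (set xs) (list_order xs)" using sub by (auto simp: refl_on_def in_set_conv_nth)
  moreover have "trans (list_order xs)"
  proof (rule transI)
    fix x y z assume "(x, y) \<in> list_order xs" "(y, z) \<in> list_order xs"
    then obtain i j j' k where *: "i \<le> j" "j < length xs" "x = xs ! i" "y = xs ! j" "j' \<le> k" "k < length xs" "y = xs ! j'" "z = xs ! k"
      unfolding list_order_def by blast
    then have "j = j'" using inj by simp
    then have "i \<le> k" using * by simp
    with * show "(x, z) \<in> list_order xs" unfolding list_order_def by blast
  qed
  moreover have "antisym (list_order xs)"
  proof (rule antisymI)
    fix x y assume "(x, y) \<in> list_order xs" "(y, x) \<in> list_order xs"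
    then obtain i j i' j' where *: "i \<le> j" "j < length xs" "x = xs ! i" "y = xs ! j" "j' \<le> i'" "i' < length xs" "y = xs ! j'" "x = xs ! i'"
      unfolding list_order_def by blast
    then have "j = j'" "i = i'" using inj by simp_all
    with * show "x = y" by simp
  qed
  moreover have "total_on (set xs) (list_order xs)"
  proof (rule total_onI)
    fix x y assume "x \<in> set xs" "y \<in> set xs"
    then obtain i j where *: "i < length xs" "j < length xs" "x = xs ! i" "y = xs ! j" by (metis in_set_conv_nth)
    then show "(x, y) \<in> list_order xs \<or> (y, x) \<in> list_order xs"
      unfolding list_order_def by (cases "i \<le> j") (auto intro: nat_le_linear)
  qed
  ultimately show ?thesis using sub
    by (simp add: linear_order_on_def partial_order_on_def preorder_on_def)
qed

lemma sorted_list_order: "sorted_wrt (\<lambda>x y. (x, y) \<in> list_order xs) xs"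
  by (auto simp: sorted_wrt_iff_nth_less list_order_def intro: less_imp_le)

text \<open>The order in which the program finds the options. The sink comes last because its
  presence depends on whether there are moves at all.\<close>

definition opt_list :: "nat \<Rightarrow> ('v, 'a label, 'z) bdag_scheme \<Rightarrow> (nat, 'a label) dbuta \<Rightarrow> 'v \<Rightarrow> nat \<Rightarrow> (dir \<times> nat) option list" where
  "opt_list n D B u p =
     map (\<lambda>q. Some (L, q)) (filter (\<lambda>q. (L, q) \<in> moves D B u p) [0..<n]) @
     map (\<lambda>q. Some (R, q)) (filter (\<lambda>q. (R, q) \<in> moves D B u p) [0..<n]) @
     (if has_sink D B u p then [None] else [])"

text \<open>Lexicographic, as two nested loops over the states produce it.\<close>

definition quad_list :: "nat \<Rightarrow> ('v, 'a label, 'z) bdag_scheme \<Rightarrow> (nat, 'a label) dbuta \<Rightarrow> 'v \<Rightarrow> nat \<Rightarrow> (nat \<times> nat) list" where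
  "quad_list n D B v q = filter (\<lambda>(q1, q2). (child D v L, q1) \<in> conf_a D B \<and> (child D v R, q2) \<in> conf_a D B \<and>
     delta2 B q1 q2 (label D v) = q) (List.product [0..<n] [0..<n])"

definition the_right_path :: "('v, 'q) dedge set \<Rightarrow> ('v, 'q) pnode \<Rightarrow> ('v, 'q) pnode \<times> effect" where
  "the_right_path E x = (SOME zf. right_path E x (fst zf) (snd zf))"

definition rep_edge :: "mem \<Rightarrow> nat \<Rightarrow> nat \<Rightarrow> (nat, nat) pnode \<times> effect \<Rightarrow> bool" where
  "rep_edge m j t yf \<longleftrightarrow> fst yf = pnode (m ''tgtv'' j) (m ''tgtq'' j) (m ''tgtk'' j) \<and> rep_effect (m ''dec'') j t (snd yf)"

definition rep_leaf :: "mem \<Rightarrow> nat \<Rightarrow> nat \<Rightarrow> (nat, nat) pnode \<Rightarrow> effect \<Rightarrow> bool" where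
  "rep_leaf m i t z f \<longleftrightarrow> z = pnode (m ''omegav'' i) (m ''omegaq'' i) (m ''omegak'' i) \<and> rep_effect (m ''gamma'') i t f"

text \<open>The share of \<open>rep_enum_ds\<close> that belongs to one vertex and one state: the
  unit that is either preserved or computed anew. Edge effects belong to the vertex as a whole and
  are kept apart.\<close>

definition rep_at ::
  "(nat, 'a label, 'z) bdag_scheme \<Rightarrow> (nat, 'a label) dbuta \<Rightarrow> (nat, nat) enum_ds \<Rightarrow> nat \<Rightarrow> mem \<Rightarrow> nat \<Rightarrow> nat \<Rightarrow> bool" where
  "rep_at D B X n m v q \<longleftrightarrow>
     m ''confE'' (v * n + q) = of_bool ((v, q) \<in> ds_conf_empty X) \<and>
     m ''confA'' (v * n + q) = of_bool ((v, q) \<in> ds_conf_a X) \<and>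
     m ''confU'' (v * n + q) = of_bool ((v, q) \<in> ds_conf_u X) \<and>
     ((v, q) \<in> ds_conf_u X \<longrightarrow> \<not> is_leaf D v \<longrightarrow>
        (\<exists>xs. distinct xs \<and> set xs = quads D B v q \<and>
           sorted_wrt (\<lambda>x y. (x, y) \<in> ds_order X v q) xs \<and>
           m ''ordlen'' (v * n + q) = length xs \<and>
           (\<forall>i < length xs. \<exists>v1 v2.
              xs ! i = (v1, m ''ordq1'' ((v * n + q) * (n * n) + i),
                        v2, m ''ordq2'' ((v * n + q) * (n * n) + i))))) \<and>
     (\<forall>k \<le> 2 * n. let x = pnode v q k; i = pnode_index n v q k in
        m ''status'' i =
          (if x \<in> ds_nodes X then (if \<exists>d y f. (x, d, y, f) \<in> ds_edges X then 2 else 1)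
           else if \<exists>y f. (x, y, f) \<in> ds_table X then 3 else 0) \<and>
        (\<forall>d y f. (x, d, y, f) \<in> ds_edges X \<longrightarrow> rep_edge m (2 * i + dir_num d) (vtype D v) (y, f)) \<and>
        (\<forall>y f. (x, y, f) \<in> ds_table X \<longrightarrow> rep_edge m (2 * i) (vtype D v) (y, f)) \<and>
        (x \<in> ds_nodes X \<longrightarrow> rep_leaf m i (vtype D v) (ds_omega X x) (ds_gamma X x)))"

text \<open>The conditions on the linear orders range over \<open>ds_conf_u X\<close>; the
  assumption turns this into a range over vertices and states, as in the other conditions.\<close>

lemma rep_enum_ds_iff:
  assumes "ds_conf_u X \<subseteq> verts D \<times> {..<card (states B)}"
  shows "rep_enum_ds D B X m \<longleftrightarrow>
    (\<forall>v \<in> verts D. \<forall>q < card (states B). rep_at D B X (card (states B)) m v q) \<and>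
    (\<forall>(u, d, v) \<in> edges D. rep_effect (m ''effect'') (2 * u + dir_num d) (vtype D u) (ds_effect X u d))"
proof -
  let ?n = "card (states B)"
  let ?ord = "\<lambda>v q. \<not> is_leaf D v \<longrightarrow>
        (\<exists>xs. distinct xs \<and> set xs = quads D B v q \<and>
           sorted_wrt (\<lambda>x y. (x, y) \<in> ds_order X v q) xs \<and>
           m ''ordlen'' (v * ?n + q) = length xs \<and>
           (\<forall>i < length xs. \<exists>v1 v2.
              xs ! i = (v1, m ''ordq1'' ((v * ?n + q) * (?n * ?n) + i),
                        v2, m ''ordq2'' ((v * ?n + q) * (?n * ?n) + i))))"
  have ord: "(\<forall>(v, q) \<in> ds_conf_u X. ?ord v q) \<longleftrightarrow> (\<forall>v \<in> verts D. \<forall>q < ?n. (v, q) \<in> ds_conf_u X \<longrightarrow> ?ord v q)"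
    using assms by fast
  show ?thesis unfolding rep_enum_ds_def Let_def ord unfolding rep_at_def rep_edge_def rep_leaf_def Let_def fst_conv snd_conv
    by (simp only: ball_conj_distrib imp_conjR all_conj_distrib)
      (intro iffI; elim conjE; intro conjI; assumption)
qed

lemma inj_pnode: "pnode v q k = pnode v' q' k' \<longleftrightarrow> v = v' \<and> q = q' \<and> k = k'"
  by (auto simp: pnode_def)

lemma vert_pnode [simp]: "vert (pnode v q k) = v"
  by (simp add: pnode_def)

lemma pnode_Suc: "1 \<le> k \<Longrightarrow> pnode v q k = aux (Conf v q) k"
  by (simp add: pnode_def)

section \<open>Data of the old vertices under an extension\<close>

locale enum_extension = old: enumeration D B + new: enumeration D' B
  for D :: "(nat, 'a label, 'z) bdag_scheme" and D' :: "(nat, 'a label, 'y) bdag_scheme"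
  and B :: "(nat, 'a label) dbuta" +
  fixes n :: nat and X :: "(nat, nat) enum_ds" and ol :: "nat \<Rightarrow> nat \<Rightarrow> (dir \<times> nat) option list"
  assumes states: "states B = {..<n}"
    and sub: "v \<in> verts D \<Longrightarrow> v \<in> verts D'"
    and leaf_eq: "v \<in> verts D \<Longrightarrow> is_leaf D' v \<longleftrightarrow> is_leaf D v"
    and child_eq: "v \<in> verts D \<Longrightarrow> child D' v d = child D v d"
    and label_eq: "v \<in> verts D \<Longrightarrow> label D' v = label D v"
    and unfold_eq: "v \<in> verts D \<Longrightarrow> unfold D' v = unfold D v"
    and enum: "is_enum_ds D B X"
    and lists: "lists_opts D B ol" "ds_nodes X = comb_nodes D B ol" "ds_edges X = comb_edges D B ol"
begin

lemma conf_a_n: "(v, q) \<in> conf_a D' B \<Longrightarrow> v \<in> verts D' \<and> q < n"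
  using new.conf_a_D states by auto

lemma sem_eq: "v \<in> verts D \<Longrightarrow> sem D' v = sem D v"
  by (simp add: sem_def unfold_eq)

lemma sizes_eq: "v \<in> verts D \<Longrightarrow> vtype D' v = vtype D v" "v \<in> verts D \<Longrightarrow> leaf_size D' v = leaf_size D v"
  "v \<in> verts D \<Longrightarrow> left_size D' v = left_size D v"
  by (simp_all add: vtype_def leaf_size_def left_size_def sem_eq)

lemma conf_eq:
  assumes "v \<in> verts D"
  shows "(v, q) \<in> conf_empty D' B \<longleftrightarrow> (v, q) \<in> conf_empty D B"
    "(v, q) \<in> conf_a D' B \<longleftrightarrow> (v, q) \<in> conf_a D B"
    "(v, q) \<in> conf_u D' B \<longleftrightarrow> (v, q) \<in> conf_u D B"
    "ce D' B v = ce D B v"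
  using assms by (simp_all add: conf_empty_def conf_a_def conf_u_def ce_def unfold_eq leaf_eq sub)

lemma moves_eq: "u \<in> verts D \<Longrightarrow> moves D' B u p = moves D B u p"
proof -
  have "\<not> is_leaf D u \<Longrightarrow> trans_state D' B u d q = trans_state D B u d q" if "u \<in> verts D" for d q
    using that by (cases d) (simp_all add: child_eq label_eq conf_eq old.child_verts)
  then show "u \<in> verts D \<Longrightarrow> moves D' B u p = moves D B u p"
    unfolding moves_def by (auto simp: leaf_eq sub child_eq conf_eq old.child_verts)
qed

lemma options_eq: "u \<in> verts D \<Longrightarrow> options D' B u p = options D B u p"
  and has_sink_eq: "u \<in> verts D \<Longrightarrow> has_sink D' B u p = has_sink D B u p"
  by (simp_all add: options_def has_sink_def moves_eq conf_eq)

lemma edge_effect_eq: "u \<in> verts D \<Longrightarrow> \<not> is_leaf D u \<Longrightarrow> edge_effect D' u d = edge_effect D u d"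
  unfolding edge_effect_def by (simp add: child_eq label_eq sizes_eq old.child_verts)

lemma opt_eq:
  assumes "o' \<in> options D B u p"
  shows "opt_target D' u p o' = opt_target D u p o'" "opt_id D' u o' = opt_id D u o'" "opt_effect D' u o' = opt_effect D u o'"
    "vert (opt_target D u p o') \<in> verts D" "u \<in> verts D"
proof -
  show u: "u \<in> verts D" using old.conf_a_D[OF old.options_conf_a[OF assms]] by simp
  have "\<not> is_leaf D u" if "o' = Some x" for x using assms that by (cases x) (auto simp: old.Some_opts moves_def)
  then show "opt_target D' u p o' = opt_target D u p o'" "opt_id D' u o' = opt_id D u o'" "opt_effect D' u o' = opt_effect D u o'"
    "vert (opt_target D u p o') \<in> verts D"
    using u by (cases o'; auto simp: opt_target_def opt_id_def opt_effect_def child_eq edge_effect_eq old.child_verts)+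
qed

text \<open>A contracted path that starts at an old vertex never leaves the old vertices, and the
  outdegrees there are unchanged.\<close>

lemma resolve_eq: "vert x \<in> verts D \<Longrightarrow> resolve D' B x = resolve D B x"
proof -
  have "follow (snd (sink_graph D' B)) x z f" if "follow (snd (sink_graph D B)) x z f" "vert x \<in> verts D" for x z f
    using that
  proof (induction rule: follow.induct)
    case (stop x)
    then have "outdeg (snd (sink_graph D' B)) x = outdeg (snd (sink_graph D B)) x"
      by (cases x) (simp_all add: new.outdeg_Conf old.outdeg_Conf new.outdeg_other old.outdeg_other options_eq)
    with stop(1) have "outdeg (snd (sink_graph D' B)) x \<noteq> 1" by simp
    then show ?case by (rule follow.stop)
  next
    case (move x i w g z f)
    then have "outdeg (snd (sink_graph D' B)) x = outdeg (snd (sink_graph D B)) x"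
      by (cases x) (simp_all add: new.outdeg_Conf old.outdeg_Conf new.outdeg_other old.outdeg_other options_eq)
    moreover from move(2) obtain u p o' where e: "o' \<in> options D B u p" "x = Conf u p" "i = opt_id D u o'"
      "w = opt_target D u p o'" "g = opt_effect D u o'" unfolding old.edge_sink_graph by blast
    moreover have "(x, i, w, g) \<in> snd (sink_graph D' B)" unfolding new.edge_sink_graph
      using e opt_eq[OF e(1)] by (intro exI[of _ u] exI[of _ p] exI[of _ o']) (simp add: options_eq)
    moreover have "vert w \<in> verts D" using opt_eq(4)[OF e(1)] e(4) by simp
    ultimately show ?case using move by (intro follow.move[of _ x i w g]) auto
  qed
  then show "vert x \<in> verts D \<Longrightarrow> resolve D' B x = resolve D B x"
    using old.follow_resolve[of x] by (simp add: new.follow_iff prod_eq_iff)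
qed

lemma entry_eq: "o' \<in> options D B u p \<Longrightarrow> entry D' B u p o' = entry D B u p o'"
  unfolding entry_def by (simp add: opt_eq resolve_eq)

text \<open>At old vertices the order is the one fixed by the given binarization, since any other
  choice would change combs that are already stored.\<close>

definition ol' :: "nat \<Rightarrow> nat \<Rightarrow> (dir \<times> nat) option list" where
  "ol' u p = (if u \<in> verts D then ol u p else opt_list n D' B u p)"

lemma moves_n: "(d, q) \<in> moves D' B u p \<Longrightarrow> q < n"
  by (auto simp: moves_def dest: conf_a_n)

lemma opt_list: "distinct (opt_list n D' B u p)" "set (opt_list n D' B u p) = options D' B u p"
proof -
  show "distinct (opt_list n D' B u p)" unfolding opt_list_def by (auto simp: distinct_map inj_on_def)
  show "set (opt_list n D' B u p) = options D' B u p"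
  proof (intro set_eqI)
    fix o' :: "(dir \<times> nat) option"
    show "o' \<in> set (opt_list n D' B u p) \<longleftrightarrow> o' \<in> options D' B u p"
    proof (cases o')
      case None then show ?thesis by (auto simp: opt_list_def options_def)
    next
      case (Some m)
      obtain d q where "m = (d, q)" by (cases m)
      then show ?thesis using Some moves_n[of d q u p] by (cases d) (auto simp: opt_list_def options_def)
    qed
  qed
qed

lemma lists': "lists_opts D' B ol'"
  unfolding lists_opts_def
proof (intro allI impI)
  fix u p assume *: "(u, p) \<in> conf_a D' B" "card (options D' B u p) \<noteq> 1"
  show "distinct (ol' u p) \<and> set (ol' u p) = options D' B u p"
  proof (cases "u \<in> verts D")
    case True
    then show ?thesis using * lists(1) unfolding lists_opts_def ol'_def by (simp add: conf_eq options_eq)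
  next
    case False
    then show ?thesis using opt_list by (simp add: ol'_def)
  qed
qed

definition X' :: "(nat, nat) enum_ds" where
  "X' = \<lparr>ds_conf_empty = conf_empty D' B, ds_conf_a = conf_a D' B, ds_conf_u = conf_u D' B,
     ds_order = (\<lambda>v q. if v \<in> verts D then ds_order X v q
       else list_order (map (\<lambda>(q1, q2). (child D' v L, q1, child D' v R, q2)) (quad_list n D' B v q))),
     ds_effect = edge_effect D',
     ds_nodes = comb_nodes D' B ol', ds_edges = comb_edges D' B ol', ds_table = contract_table (sink_graph D' B),
     ds_omega = (\<lambda>x. fst (the_right_path (comb_edges D' B ol') x)),
     ds_gamma = (\<lambda>x. snd (the_right_path (comb_edges D' B ol') x))\<rparr>"

lemma right_path': "x \<in> comb_nodes D' B ol' \<Longrightarrow> right_path (comb_edges D' B ol') x (ds_omega X' x) (ds_gamma X' x)"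
proof -
  assume "x \<in> comb_nodes D' B ol'"
  then obtain z f where zf: "right_path (comb_edges D' B ol') x z f" using new.right_path_exists[OF lists'] by blast
  have "right_path (comb_edges D' B ol') x (fst (the_right_path (comb_edges D' B ol') x)) (snd (the_right_path (comb_edges D' B ol') x))"
    unfolding the_right_path_def by (rule someI[of "\<lambda>zf. right_path (comb_edges D' B ol') x (fst zf) (snd zf)" "(z, f)"]) (simp add: zf)
  then show ?thesis by (simp add: X'_def)
qed

lemma quad_list:
  "distinct (map (\<lambda>(q1, q2). (child D' v L, q1, child D' v R, q2)) (quad_list n D' B v q))"
  "set (map (\<lambda>(q1, q2). (child D' v L, q1, child D' v R, q2)) (quad_list n D' B v q)) = quads D' B v q"
proof -
  have "distinct (quad_list n D' B v q)" unfolding quad_list_def by (simp add: distinct_product)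
  then show "distinct (map (\<lambda>(q1, q2). (child D' v L, q1, child D' v R, q2)) (quad_list n D' B v q))"
    by (auto simp: distinct_map inj_on_def)
  show "set (map (\<lambda>(q1, q2). (child D' v L, q1, child D' v R, q2)) (quad_list n D' B v q)) = quads D' B v q"
    unfolding quad_list_def quads_def using conf_a_n by (force simp: image_iff)
qed

lemma quads_eq: "v \<in> verts D \<Longrightarrow> \<not> is_leaf D v \<Longrightarrow> quads D' B v q = quads D B v q"
  unfolding quads_def by (auto simp: child_eq conf_eq label_eq old.child_verts)

lemma enum': "is_enum_ds D' B X'"
  unfolding new.is_enum_ds_iff
proof (intro conjI)
  show "\<forall>(v, q) \<in> conf_u D' B. \<not> is_leaf D' v \<longrightarrow> linear_order_on (quads D' B v q) (ds_order X' v q)"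
  proof clarify
    fix v q assume vq: "(v, q) \<in> conf_u D' B" "\<not> is_leaf D' v"
    show "linear_order_on (quads D' B v q) (ds_order X' v q)"
    proof (cases "v \<in> verts D")
      case True
      then have "linear_order_on (quads D B v q) (ds_order X v q)"
        using enum vq unfolding old.is_enum_ds_iff by (auto simp: conf_eq leaf_eq)
      with True vq show ?thesis by (simp add: X'_def quads_eq leaf_eq)
    next
      case False
      then show ?thesis using linear_order_list_order[OF quad_list(1)[of v q]] quad_list(2)[of v q] by (simp add: X'_def)
    qed
  qed
  show "\<exists>ol. lists_opts D' B ol \<and> ds_nodes X' = comb_nodes D' B ol \<and> ds_edges X' = comb_edges D' B ol"
    using lists' by (auto simp: X'_def)
  show "\<forall>u \<in> ds_nodes X'. right_path (ds_edges X') u (ds_omega X' u) (ds_gamma X' u)"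
    using right_path' by (simp add: X'_def)
qed (auto simp: X'_def)

lemma nodes_old:
  assumes "vert x \<in> verts D"
  shows "x \<in> ds_nodes X' \<longleftrightarrow> x \<in> ds_nodes X"
  using assms by (cases x) (simp_all add: X'_def lists(2) old.comb_nodes_iff[OF lists(1)] new.comb_nodes_iff[OF lists']
      conf_eq options_eq has_sink_eq)

lemma comb_edge_eq:
  assumes "(u, p) \<in> conf_a D B" "1 \<le> k" "k + 1 \<le> card (options D B u p)"
  shows "comb_edge D' B ol' u p k d = comb_edge D B ol u p k d"
proof -
  have u: "u \<in> verts D" using old.conf_a_D[OF assms(1)] by simp
  have c: "card (options D B u p) \<noteq> 1" using assms by linarith
  have "entry D' B u p (ol u p ! j) = entry D B u p (ol u p ! j)" if "j < card (options D B u p)" for j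
    using old.nth_opts[OF lists(1) assms(1) that c] by (rule entry_eq)
  moreover have "length (ol u p) = card (options D B u p)" by (rule old.length_opts[OF lists(1) assms(1) c])
  ultimately show ?thesis using assms(2,3) u by (simp add: comb_edge_def ol'_def)
qed

lemma edges_old:
  assumes "vert x \<in> verts D"
  shows "(x, d, y, f) \<in> ds_edges X' \<longleftrightarrow> (x, d, y, f) \<in> ds_edges X"
proof -
  have "(\<exists>u p k. x = aux (Conf u p) k \<and> (u, p) \<in> conf_a D' B \<and> 1 \<le> k \<and> k + 1 \<le> card (options D' B u p) \<and>
       (y, f) = comb_edge D' B ol' u p k d) \<longleftrightarrow>
    (\<exists>u p k. x = aux (Conf u p) k \<and> (u, p) \<in> conf_a D B \<and> 1 \<le> k \<and> k + 1 \<le> card (options D B u p) \<and>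
       (y, f) = comb_edge D B ol u p k d)"
  proof (intro ex_cong1)
    fix u p k
    have "u \<in> verts D" if "x = aux (Conf u p) k" "1 \<le> k" using assms that by (auto split: if_splits)
    then show "(x = aux (Conf u p) k \<and> (u, p) \<in> conf_a D' B \<and> 1 \<le> k \<and> k + 1 \<le> card (options D' B u p) \<and>
         (y, f) = comb_edge D' B ol' u p k d) \<longleftrightarrow>
      (x = aux (Conf u p) k \<and> (u, p) \<in> conf_a D B \<and> 1 \<le> k \<and> k + 1 \<le> card (options D B u p) \<and>
         (y, f) = comb_edge D B ol u p k d)"
      using conf_eq(2) options_eq comb_edge_eq by metis
  qed
  then show ?thesis unfolding lists(3) X'_def enum_ds.simps old.comb_edges_iff[OF lists(1)] new.comb_edges_iff[OF lists'] .
qed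

lemma table_old:
  assumes "vert x \<in> verts D"
  shows "(x, y, f) \<in> ds_table X' \<longleftrightarrow> (x, y, f) \<in> ds_table X"
proof -
  have t: "ds_table X = contract_table (sink_graph D B)" "ds_table X' = contract_table (sink_graph D' B)"
    using enum enum' unfolding old.is_enum_ds_iff new.is_enum_ds_iff by auto
  show ?thesis
  proof (cases x)
    case (Conf u p)
    then have "u \<in> verts D" using assms by simp
    then show ?thesis unfolding t new.contract_table_iff old.contract_table_iff Conf
      by (auto simp: conf_eq options_eq entry_eq)
  qed (simp_all add: t new.contract_table_iff old.contract_table_iff)
qed

text \<open>Right paths from old vertices stay among old vertices, by the reachability part of
  \<open>good\<close>.\<close>

lemma right_path_old:
  "right_path (ds_edges X) x z f \<Longrightarrow> vert x \<in> verts D \<Longrightarrow> right_path (ds_edges X') x z f"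
proof (induction rule: right_path.induct)
  case (stop u)
  then show ?case using edges_old by (intro right_path.stop) blast
next
  case (move u w g z f)
  have "(vert u, vert w) \<in> (adj D)\<^sup>*"
    using old.comb_edge_good(1)[OF _ lists(1), of "Max (leaf_size D ` verts D)"] move.hyps(1)
    unfolding lists(3) good_def by (simp add: old.finite_verts)
  then have "vert w \<in> verts D" using move.prems by (induction rule: rtrancl_induct) (auto dest: old.adj_verts)
  then show ?case using move edges_old by (blast intro: right_path.move)
qed

lemma omega_old:
  assumes "x \<in> ds_nodes X" "vert x \<in> verts D"
  shows "ds_omega X' x = ds_omega X x" "ds_gamma X' x = ds_gamma X x"
proof -
  have "right_path (ds_edges X) x (ds_omega X x) (ds_gamma X x)"
    using enum assms(1) unfolding old.is_enum_ds_iff by blast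
  then have 1: "right_path (ds_edges X') x (ds_omega X x) (ds_gamma X x)" using assms(2) by (rule right_path_old)
  have 2: "right_path (ds_edges X') x (ds_omega X' x) (ds_gamma X' x)"
    using enum' nodes_old[OF assms(2)] assms(1) unfolding new.is_enum_ds_iff by blast
  have "ds_edges X' = comb_edges D' B ol'" by (simp add: X'_def)
  then show "ds_omega X' x = ds_omega X x" "ds_gamma X' x = ds_gamma X x"
    using new.right_path_unique[OF lists', of x] 1 2 by metis+
qed

lemma conf_X: "ds_conf_empty X = conf_empty D B" "ds_conf_a X = conf_a D B" "ds_conf_u X = conf_u D B"
   "ds_conf_empty X' = conf_empty D' B" "ds_conf_a X' = conf_a D' B" "ds_conf_u X' = conf_u D' B"
  using enum unfolding old.is_enum_ds_iff by (auto simp: X'_def)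

text \<open>The memory is the same on both sides: all components of \<open>X'\<close> agree with
  those of \<open>X\<close> at an old vertex, so nothing has to be rewritten there.\<close>

lemma rep_at_old:
  assumes v: "v \<in> verts D" and r: "rep_at D B X n m v q"
  shows "rep_at D' B X' n m v q"
proof -
  have o: "ds_order X' v q = ds_order X v q" using v by (simp add: X'_def)
  have q: "(v, q) \<in> ds_conf_u X' \<longrightarrow> \<not> is_leaf D' v \<longrightarrow> P (quads D' B v q) \<longleftrightarrow> (v, q) \<in> ds_conf_u X \<longrightarrow> \<not> is_leaf D v \<longrightarrow> P (quads D B v q)" for P
    using v by (auto simp: conf_X conf_eq leaf_eq quads_eq)
  have vx: "vert (pnode v q k) \<in> verts D" for k using v by simp
  have om: "(pnode v q k \<in> ds_nodes X' \<longrightarrow> rep_leaf m i (vtype D' v) (ds_omega X' (pnode v q k)) (ds_gamma X' (pnode v q k))) \<longleftrightarrow>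
    (pnode v q k \<in> ds_nodes X \<longrightarrow> rep_leaf m i (vtype D v) (ds_omega X (pnode v q k)) (ds_gamma X (pnode v q k)))" for k i
    using nodes_old[OF vx] omega_old[OF _ vx] sizes_eq(1)[OF v] by metis
  have c: "(v, q) \<in> ds_conf_empty X' \<longleftrightarrow> (v, q) \<in> ds_conf_empty X" "(v, q) \<in> ds_conf_a X' \<longleftrightarrow> (v, q) \<in> ds_conf_a X"
    "(v, q) \<in> ds_conf_u X' \<longleftrightarrow> (v, q) \<in> ds_conf_u X" using v by (simp_all add: conf_X conf_eq)
  show ?thesis using r unfolding rep_at_def Let_def om unfolding nodes_old[OF vx] edges_old[OF vx] table_old[OF vx] sizes_eq(1)[OF v] c o leaf_eq[OF v]
    by (auto simp: quads_eq[OF v])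
qed

end

section \<open>What has to be stored for a new vertex\<close>

context enum_extension
begin

definition entries :: "nat \<Rightarrow> nat \<Rightarrow> ((nat, nat) pnode \<times> effect) list" where
  "entries v q = map (entry D' B v q) (opt_list n D' B v q)"

text \<open>A sufficient condition in the terms of the program: positions in
  \<open>entries v q\<close> and offsets in a block instead of graph nodes. The outdegree
  \<open>d\<close> after adding the sink decides the form: 0 gives a leaf, 1 a table entry, and more
  gives a comb of \<open>d - 1\<close> vertices.\<close>

definition spec_at :: "mem \<Rightarrow> nat \<Rightarrow> nat \<Rightarrow> bool" where
  "spec_at m v q \<longleftrightarrow> (let r = v * n + q; b = r * (2 * n + 1); es = entries v q; d = length es; t = vtype D' v in
     m ''confE'' r = of_bool (q = ce D' B v) \<and>
     m ''confA'' r = of_bool ((v, q) \<in> conf_a D' B) \<and>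
     m ''confU'' r = of_bool ((v, q) \<in> conf_u D' B) \<and>
     (\<not> is_leaf D' v \<longrightarrow>
        m ''ordlen'' r = length (quad_list n D' B v q) \<and>
        (\<forall>i < length (quad_list n D' B v q). quad_list n D' B v q ! i =
           (m ''ordq1'' (r * (n * n) + i), m ''ordq2'' (r * (n * n) + i)))) \<and>
     (\<forall>k \<le> 2 * n. m ''status'' (b + k) =
        (if k = 0 then of_bool (has_sink D' B v q)
         else if (v, q) \<notin> conf_a D' B then 0
         else if k = 1 \<and> d = 0 then 1
         else if k = 1 \<and> d = 1 then 3
         else if k + 1 \<le> d then 2 else 0)) \<and>
     (d = 1 \<longrightarrow> rep_edge m (2 * (b + 1)) t (es ! 0)) \<and>
     (\<forall>k. 1 \<le> k \<and> k + 1 \<le> d \<longrightarrow>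
        rep_edge m (2 * (b + k)) t (es ! (k - 1)) \<and>
        rep_edge m (2 * (b + k) + 1) t (if k + 2 \<le> d then (pnode v q (k + 1), id) else es ! (d - 1)) \<and>
        rep_leaf m (b + k) t (ds_omega X' (fst (es ! (d - 1)))) (ds_gamma X' (fst (es ! (d - 1))) \<circ> snd (es ! (d - 1)))) \<and>
     (has_sink D' B v q \<longrightarrow> rep_leaf m b t (Sink v q) id) \<and>
     ((v, q) \<in> conf_a D' B \<and> d = 0 \<longrightarrow> rep_leaf m (b + 1) t (Conf v q) id))"

lemma length_opt_list: "length (opt_list n D' B v q) = card (options D' B v q)"
  using distinct_card[OF opt_list(1)] by (simp add: opt_list(2))

lemma length_entries: "length (entries v q) = card (options D' B v q)"
  by (simp add: entries_def length_opt_list)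

lemma card_opts_le: "card (options D' B v q) \<le> 2 * n + 1"
proof -
  have "length (filter P [0..<n]) \<le> n" for P using length_filter_le[of P "[0..<n]"] by simp
  then have "length (opt_list n D' B v q) \<le> n + n + 1" unfolding opt_list_def
    by (simp add: add_mono) (meson add_le_mono le_SucI)
  then show ?thesis by (simp add: length_opt_list)
qed

text \<open>Comb indices end at \<open>d - 1\<close>, which is at most \<open>2 * n\<close>, so a
  block of \<open>2 * n + 1\<close> places holds the sink, the configuration and its comb.\<close>

lemma nodes_bounds:
  assumes "pnode v q k \<in> ds_nodes X'"
  shows "v \<in> verts D'" "q < n" "k \<le> 2 * n"
proof -
  have "((v, q) \<in> conf_a D' B) \<and> k \<le> 2 * n"
  proof -
    have n: "pnode v q k \<in> comb_nodes D' B ol'" using assms by (simp add: X'_def)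
    have h: "has_sink D' B v q \<Longrightarrow> (v, q) \<in> conf_a D' B" using new.conf_u_D by (auto simp: has_sink_def)
    have "1 \<le> n" if "(v, q) \<in> conf_a D' B" using conf_a_n[OF that] by simp
    with n h card_opts_le[of v q] show ?thesis
      by (auto simp: pnode_def new.comb_nodes_iff[OF lists'] split: if_splits)
  qed
  with conf_a_n show "v \<in> verts D'" "q < n" "k \<le> 2 * n" by auto
qed

lemma omega_leaf:
  "has_sink D' B v q \<Longrightarrow> ds_omega X' (Sink v q) = Sink v q \<and> ds_gamma X' (Sink v q) = id"
  "(v, q) \<in> conf_a D' B \<Longrightarrow> card (options D' B v q) = 0 \<Longrightarrow> ds_omega X' (Conf v q) = Conf v q \<and> ds_gamma X' (Conf v q) = id"
  using new.right_path_unique[OF lists' right_path' new.right_path_leaf(1)[OF lists'], of v q]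
    new.right_path_unique[OF lists' right_path' new.right_path_leaf(2)[OF lists'], of v q]
  by (auto simp: new.comb_nodes_iff[OF lists'])

lemma entry_nth_opts: "j < card (options D' B v q) \<Longrightarrow> \<exists>o' \<in> options D' B v q. entries v q ! j = entry D' B v q o' \<and> opt_list n D' B v q ! j = o'"
  using opt_list(2)[of v q] nth_mem[of j "opt_list n D' B v q"] by (auto simp: entries_def length_opt_list)

lemma entries_nodes: "j < card (options D' B v q) \<Longrightarrow> fst (entries v q ! j) \<in> ds_nodes X'"
  using entry_nth_opts[of j v q] new.contract_node_comb[OF new.entry_node] by (auto simp: X'_def)

lemma comb_edge_entries:
  assumes "v \<notin> verts D" "1 \<le> k" "k + 1 \<le> card (options D' B v q)"
  shows "comb_edge D' B ol' v q k d = (if d = L then entries v q ! (k - 1)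
     else if k + 2 \<le> length (entries v q) then (pnode v q (k + 1), id) else entries v q ! (length (entries v q) - 1))"
  using assms by (simp add: comb_edge_def ol'_def entries_def length_opt_list pnode_def)

text \<open>Matches the block layout with the descriptions of comb vertices, comb edges and table.
  The right leaves of all comb vertices come from \<open>right_path_comb\<close>.\<close>

lemma rep_at_new:
  assumes v: "v \<in> verts D'" "v \<notin> verts D" and q: "q < n" and s: "spec_at m v q"
  shows "rep_at D' B X' n m v q"
proof -
  define b where "b = (v * n + q) * (2 * n + 1)"
  define d where "d = card (options D' B v q)"
  note len = length_entries[of v q, folded d_def]
  note S = s[unfolded spec_at_def Let_def, folded b_def, unfolded len]
  have ce: "(v, q) \<in> conf_empty D' B \<longleftrightarrow> q = ce D' B v" using v(1) by (simp add: new.conf_empty_iff)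
  have no: "(v, q) \<notin> conf_a D' B \<Longrightarrow> d = 0"
    unfolding d_def using new.options_conf_a[of _ v q] by (simp add: new.finite_opts) blast
  have hs: "has_sink D' B v q \<Longrightarrow> (v, q) \<in> conf_a D' B" using new.conf_u_D by (auto simp: has_sink_def)
  have nodes: "pnode v q k \<in> ds_nodes X' \<longleftrightarrow>
     (if k = 0 then has_sink D' B v q else (v, q) \<in> conf_a D' B \<and> d \<noteq> 1 \<and> (k = 1 \<or> k + 1 \<le> d))" for k
    by (auto simp: X'_def pnode_def new.comb_nodes_iff[OF lists'] d_def)
  have edges: "(pnode v q k, e, y, f) \<in> ds_edges X' \<longleftrightarrow> 1 \<le> k \<and> (v, q) \<in> conf_a D' B \<and> k + 1 \<le> d \<and>
     (y, f) = (if e = L then entries v q ! (k - 1)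
     else if k + 2 \<le> d then (pnode v q (k + 1), id) else entries v q ! (d - 1))" for k e y f
  proof (cases "1 \<le> k")
    case True
    have "(pnode v q k, e, y, f) \<in> ds_edges X' \<longleftrightarrow> (v, q) \<in> conf_a D' B \<and> k + 1 \<le> d \<and> (y, f) = comb_edge D' B ol' v q k e"
      unfolding pnode_Suc[OF True] X'_def enum_ds.simps new.comb_edges_iff[OF lists'] d_def
    proof
      assume "\<exists>u p k'. aux (Conf v q) k = aux (Conf u p) k' \<and> (u, p) \<in> conf_a D' B \<and> 1 \<le> k' \<and>
        k' + 1 \<le> card (options D' B u p) \<and> (y, f) = comb_edge D' B ol' u p k' e"
      then obtain u p k' where *: "aux (Conf v q) k = aux (Conf u p) k'" "(u, p) \<in> conf_a D' B" "1 \<le> k'"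
        "k' + 1 \<le> card (options D' B u p)" "(y, f) = comb_edge D' B ol' u p k' e" by blast
      from *(1) have "v = u \<and> q = p \<and> k = k'" unfolding new.aux_Conf_eq_iff[OF True *(3)] .
      with *(2,4,5) show "(v, q) \<in> conf_a D' B \<and> k + 1 \<le> card (options D' B v q) \<and> (y, f) = comb_edge D' B ol' v q k e" by simp
    qed (use True in blast)
    then show ?thesis using True comb_edge_entries[OF v(2) True, of q e] unfolding len d_def[symmetric] by auto
  next
    case False
    then show ?thesis by (simp add: pnode_def X'_def new.no_comb_edge[OF lists'])
  qed
  have table: "(pnode v q k, y, f) \<in> ds_table X' \<longleftrightarrow> k = 1 \<and> (v, q) \<in> conf_a D' B \<and> d = 1 \<and> (y, f) = entries v q ! 0" for k y f
  proof (cases "k = 1 \<and> d = 1")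
    case True
    then obtain o' where o: "options D' B v q = {o'}" unfolding d_def using card_1_singletonE by metis
    then have "entries v q ! 0 = entry D' B v q o'" using entry_nth_opts[of 0 v q] by auto
    then show ?thesis using True o by (auto simp: X'_def new.contract_table_iff pnode_def)
  next
    case False
    then show ?thesis by (auto simp: X'_def new.contract_table_iff pnode_def d_def split: if_splits)
  qed
  have pair_ex: "(\<exists>y f. (y, f) = z) \<longleftrightarrow> True" for z :: "(nat, nat) pnode \<times> effect" by (cases z) auto
  have ex: "(\<exists>e y f. (pnode v q k, e, y, f) \<in> ds_edges X') \<longleftrightarrow> 1 \<le> k \<and> (v, q) \<in> conf_a D' B \<and> k + 1 \<le> d" for k
    unfolding edges ex_simps pair_ex simp_thms by simp
  have ext: "(\<exists>y f. (pnode v q k, y, f) \<in> ds_table X') \<longleftrightarrow> k = 1 \<and> (v, q) \<in> conf_a D' B \<and> d = 1" for k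
    unfolding table ex_simps pair_ex simp_thms by simp
  have idx: "pnode_index n v q k = b + k" for k by (simp add: pnode_index_def b_def)
  have comb: "ds_omega X' (pnode v q k) = ds_omega X' (fst (entries v q ! (d - 1))) \<and>
      ds_gamma X' (pnode v q k) = ds_gamma X' (fst (entries v q ! (d - 1))) \<circ> snd (entries v q ! (d - 1))"
    if k: "1 \<le> k" "k + 1 \<le> d" and c: "(v, q) \<in> conf_a D' B" for k
  proof -
    have e: "entry D' B v q (ol' v q ! (card (options D' B v q) - 1)) = entries v q ! (d - 1)"
      using v(2) k by (simp add: ol'_def entries_def length_opt_list d_def)
    have n: "fst (entries v q ! (d - 1)) \<in> comb_nodes D' B ol'"
      using entries_nodes[of "d - 1" v q] k by (simp add: d_def X'_def)
    have "pnode v q k \<in> comb_nodes D' B ol'" using nodes[of k] k c by (simp add: X'_def)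
    from right_path'[OF this] new.right_path_comb[OF lists' c k[unfolded d_def], unfolded e, OF right_path'[OF n]]
    show ?thesis using new.right_path_unique[OF lists'] unfolding pnode_Suc[OF k(1)] by blast
  qed
  have leaf: "rep_leaf m (b + k) (vtype D' v) (ds_omega X' (pnode v q k)) (ds_gamma X' (pnode v q k))"
    if "pnode v q k \<in> ds_nodes X'" for k
  proof (cases "k = 0")
    case True
    then have "has_sink D' B v q" using that unfolding nodes by simp
    then show ?thesis using S omega_leaf(1)[of v q] True by (simp add: pnode_def)
  next
    case False
    then have n: "(v, q) \<in> conf_a D' B" "d \<noteq> 1" "k = 1 \<or> k + 1 \<le> d" using that unfolding nodes by auto
    show ?thesis
    proof (cases "k + 1 \<le> d")
      case True
      with False have k: "1 \<le> k" "k + 1 \<le> d" by auto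
      then show ?thesis using S comb[OF k n(1)] by simp
    next
      case False
      then have "k = 1" "d = 0" using n by auto
      then show ?thesis using S omega_leaf(2)[of v q] n(1) by (simp add: pnode_def d_def)
    qed
  qed
  have ord: "(v, q) \<in> conf_u D' B \<longrightarrow> \<not> is_leaf D' v \<longrightarrow>
        (\<exists>xs. distinct xs \<and> set xs = quads D' B v q \<and>
           sorted_wrt (\<lambda>x y. (x, y) \<in> ds_order X' v q) xs \<and>
           m ''ordlen'' (v * n + q) = length xs \<and>
           (\<forall>i < length xs. \<exists>v1 v2.
              xs ! i = (v1, m ''ordq1'' ((v * n + q) * (n * n) + i),
                        v2, m ''ordq2'' ((v * n + q) * (n * n) + i))))"
  proof (intro impI exI conjI)
    let ?xs = "map (\<lambda>(q1, q2). (child D' v L, q1, child D' v R, q2)) (quad_list n D' B v q)"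
    assume l: "\<not> is_leaf D' v"
    show "distinct ?xs" "set ?xs = quads D' B v q" by (rule quad_list)+
    show "sorted_wrt (\<lambda>x y. (x, y) \<in> ds_order X' v q) ?xs" using v(2) sorted_list_order[of ?xs] by (simp add: X'_def)
    show "m ''ordlen'' (v * n + q) = length ?xs" using S l by simp
    show "\<forall>i < length ?xs. \<exists>v1 v2. ?xs ! i = (v1, m ''ordq1'' ((v * n + q) * (n * n) + i), v2, m ''ordq2'' ((v * n + q) * (n * n) + i))"
      using S l by simp
  qed
  have stat: "m ''status'' (b + k) = (if pnode v q k \<in> ds_nodes X' then (if \<exists>e y f. (pnode v q k, e, y, f) \<in> ds_edges X' then 2 else 1)
           else if \<exists>y f. (pnode v q k, y, f) \<in> ds_table X' then 3 else 0)" if "k \<le> 2 * n" for k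
    unfolding ex ext nodes using S that hs no by auto
  show ?thesis unfolding rep_at_def Let_def conf_X idx ce
  proof (intro conjI allI impI)
    fix k assume k: "k \<le> 2 * n"
    show "m ''status'' (b + k) = (if pnode v q k \<in> ds_nodes X' then (if \<exists>e y f. (pnode v q k, e, y, f) \<in> ds_edges X' then 2 else 1)
           else if \<exists>y f. (pnode v q k, y, f) \<in> ds_table X' then 3 else 0)" by (rule stat[OF k])
    show "rep_edge m (2 * (b + k) + dir_num e) (vtype D' v) (y, f)" if "(pnode v q k, e, y, f) \<in> ds_edges X'" for e y f
      using that S unfolding edges by (cases e) auto
    show "rep_edge m (2 * (b + k)) (vtype D' v) (y, f)" if "(pnode v q k, y, f) \<in> ds_table X'" for y f
      using that S unfolding table by auto
    show "pnode v q k \<in> ds_nodes X' \<Longrightarrow> rep_leaf m (b + k) (vtype D' v) (ds_omega X' (pnode v q k)) (ds_gamma X' (pnode v q k))"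
      by (rule leaf)
  qed (use S ord in auto)
qed

text \<open>Status 3 tells exactly whether the child configuration was contracted, and then the
  table entry at the same index holds the resolved target and effect. One test and one lookup
  replace the traversal of the path.\<close>

lemma resolve_rep:
  assumes c: "(c, p) \<in> conf_a D' B" and r: "rep_at D' B X' n m c p"
  shows "m ''status'' (pnode_index n c p 1) = 3 \<Longrightarrow> rep_edge m (2 * pnode_index n c p 1) (vtype D' c) (resolve D' B (Conf c p))"
    and "m ''status'' (pnode_index n c p 1) \<noteq> 3 \<Longrightarrow> resolve D' B (Conf c p) = (Conf c p, id)"
proof -
  have n: "1 \<le> 2 * n" using conf_a_n[OF c] by simp
  have [simp]: "pnode c p (Suc 0) = Conf c p" by (simp add: pnode_def)
  note R = r[unfolded rep_at_def Let_def, THEN conjunct2, THEN conjunct2, THEN conjunct2, THEN conjunct2, rule_format, OF n, simplified]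
  have node: "Conf c p \<in> ds_nodes X' \<longleftrightarrow> card (options D' B c p) \<noteq> 1"
    using c by (simp add: X'_def new.comb_nodes_iff[OF lists'])
  have table: "(Conf c p, fst (resolve D' B (Conf c p)), snd (resolve D' B (Conf c p))) \<in> ds_table X'"
    if "options D' B c p = {o'}" for o'
    unfolding X'_def enum_ds.simps new.contract_table_iff new.resolve_simps(3)[OF that] using c that by auto
  {
    assume "m ''status'' (pnode_index n c p 1) = 3"
    then have "Conf c p \<notin> ds_nodes X'" using R by (auto split: if_splits)
    then have "card (options D' B c p) = 1" using node by simp
    then obtain o' where o: "options D' B c p = {o'}" by (rule card_1_singletonE)
    from table[OF o] show "rep_edge m (2 * pnode_index n c p 1) (vtype D' c) (resolve D' B (Conf c p))"
      using R by fastforce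
  next
    assume s: "m ''status'' (pnode_index n c p 1) \<noteq> 3"
    have "card (options D' B c p) \<noteq> 1"
    proof
      assume "card (options D' B c p) = 1"
      then obtain o' where o: "options D' B c p = {o'}" by (rule card_1_singletonE)
      from table[OF o] have "\<exists>y f. (Conf c p, y, f) \<in> ds_table X'" by blast
      moreover have "Conf c p \<notin> ds_nodes X'" using node o by simp
      ultimately have "m ''status'' (pnode_index n c p 1) = 3" using R by simp
      with s show False by simp
    qed
    then show "resolve D' B (Conf c p) = (Conf c p, id)" by (rule new.resolve_simps(1))
  }
qed

lemma omega_rep:
  assumes "pnode v q k \<in> ds_nodes X'" and r: "rep_at D' B X' n m v q"
  shows "rep_leaf m (pnode_index n v q k) (vtype D' v) (ds_omega X' (pnode v q k)) (ds_gamma X' (pnode v q k))"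
  using r nodes_bounds(3)[OF assms(1)] assms(1) unfolding rep_at_def Let_def by blast

end

section \<open>Verification of RAM programs\<close>

definition bd :: "nat \<Rightarrow> mem \<Rightarrow> bool" where
  "bd M m \<longleftrightarrow> (\<forall>x i. m x i < M)"

primrec asize :: "aexp \<Rightarrow> nat" where
  "asize (Num n) = 1"
| "asize (Cell x i) = asize i"
| "asize (Add e1 e2) = asize e1 + asize e2"
| "asize (Sub e1 e2) = asize e1 + asize e2"
| "asize (Mul e1 e2) = asize e1 + asize e2"

text \<open>An expression with \<open>k\<close> leaves and constants below \<open>16\<close> has a value below \<open>M ^ k\<close> if the memory
  is bounded by \<open>M\<close>; so programs with small expressions run within the word bound \<open>M ^ K\<close>.\<close>

primrec small_nums :: "aexp \<Rightarrow> bool" where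
  "small_nums (Num n) \<longleftrightarrow> n < 16"
| "small_nums (Cell x i) \<longleftrightarrow> small_nums i"
| "small_nums (Add e1 e2) \<longleftrightarrow> small_nums e1 \<and> small_nums e2"
| "small_nums (Sub e1 e2) \<longleftrightarrow> small_nums e1 \<and> small_nums e2"
| "small_nums (Mul e1 e2) \<longleftrightarrow> small_nums e1 \<and> small_nums e2"

definition aok :: "nat \<Rightarrow> aexp \<Rightarrow> bool" where
  "aok K e \<longleftrightarrow> small_nums e \<and> asize e \<le> K"

primrec bok :: "nat \<Rightarrow> bexp \<Rightarrow> bool" where
  "bok K (Less e1 e2) \<longleftrightarrow> aok K e1 \<and> aok K e2"
| "bok K (Eq e1 e2) \<longleftrightarrow> aok K e1 \<and> aok K e2"
| "bok K (Neg b) \<longleftrightarrow> bok K b"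
| "bok K (Conj b1 b2) \<longleftrightarrow> bok K b1 \<and> bok K b2"

lemma asize_pos: "1 \<le> asize e"
  by (induction e) auto

lemma aval_less:
  assumes "bd M m" "16 \<le> M"
  shows "small_nums e \<Longrightarrow> aval e m < M ^ asize e"
proof (induction e)
  case (Cell x i)
  have "m x (aval i m) < M" using assms(1) by (simp add: bd_def)
  also have "M \<le> M ^ asize i" using asize_pos[of i] assms(2) by (intro self_le_power) auto
  finally show ?case by simp
next
  case (Add e1 e2)
  have 2: "2 \<le> M ^ asize e" for e
  proof -
    have "M \<le> M ^ asize e" using asize_pos[of e] assms(2) by (intro self_le_power) auto
    then show ?thesis using assms(2) by simp
  qed
  \<comment> \<open>For numbers at least 2 a sum is at most the product, so adding up leaves in the
    exponent covers \<open>Add\<close> as well as \<open>Mul\<close>.\<close>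
  have "x + y \<le> x * y" if "2 \<le> x" "2 \<le> y" for x y :: nat
    using mult_le_mono1[OF that(1), of y] mult_le_mono2[OF that(2), of x] by linarith
  from this[OF 2 2, of e1 e2] have "M ^ asize e1 + M ^ asize e2 \<le> M ^ asize (Add e1 e2)" by (simp add: power_add)
  moreover have "aval e1 m < M ^ asize e1" "aval e2 m < M ^ asize e2" using Add by simp_all
  ultimately show ?case unfolding aval.simps by linarith
next
  case (Sub e1 e2)
  then have "aval e1 m - aval e2 m < M ^ asize e1" by (simp add: less_imp_diff_less)
  also have "\<dots> \<le> M ^ (asize e1 + asize e2)" using assms(2) by (intro power_increasing) auto
  finally show ?case by simp
next
  case (Mul e1 e2)
  then have "aval e1 m * aval e2 m < M ^ asize e1 * M ^ asize e2" by (intro mult_strict_mono') simp_all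
  then show ?case by (simp add: power_add)
qed (use assms in simp)

lemma afits_aok:
  assumes "bd M m" "16 \<le> M"
  shows "aok K e \<Longrightarrow> afits (M ^ K) e m"
proof -
  have *: "aval e m < M ^ K" if "small_nums e" "asize e \<le> K" for e
    using aval_less[OF assms that(1)] power_increasing[OF that(2), of M] assms(2) by linarith
  have "small_nums e \<Longrightarrow> asize e \<le> K \<Longrightarrow> afits (M ^ K) e m"
  proof (induction e)
    case (Num n) then show ?case using *[of "Num n"] by simp
  next
    case (Cell x i)
    then show ?case using *[of "Cell x i"] by simp
  next
    case (Add e1 e2) then show ?case using *[of "Add e1 e2"] by simp
  next
    case (Mul e1 e2) then show ?case using *[of "Mul e1 e2"] by simp
  qed auto
  then show "aok K e \<Longrightarrow> afits (M ^ K) e m" by (simp add: aok_def)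
qed

lemma bfits_bok:
  assumes "bd M m" "16 \<le> M"
  shows "bok K b \<Longrightarrow> bfits (M ^ K) b m"
  by (induction b) (auto intro: afits_aok[OF assms])

section \<open>Hoare triples with time and memory bounds\<close>

definition upd :: "mem \<Rightarrow> string \<Rightarrow> nat \<Rightarrow> nat \<Rightarrow> mem" where
  "upd m x i v = m(x := (m x)(i := v))"

lemma upd_apply [simp]: "upd m x i v y j = (if x = y \<and> i = j then v else m y j)"
  by (simp add: upd_def)

lemma bd_upd: "bd M m \<Longrightarrow> v < M \<Longrightarrow> bd M (upd m x i v)"
  by (simp add: bd_def)

text \<open>Total correctness within time \<open>T\<close>. The memory bound \<open>M\<close> is
  invariant, while the word bound \<open>M ^ K\<close> leaves room for the intermediate values of a
  single expression.\<close>

definition ht :: "nat \<Rightarrow> nat \<Rightarrow> (mem \<Rightarrow> bool) \<Rightarrow> com \<Rightarrow> nat \<Rightarrow> (mem \<Rightarrow> bool) \<Rightarrow> bool" where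
  "ht K M P c T Q \<longleftrightarrow> (\<forall>m. bd M m \<longrightarrow> P m \<longrightarrow> (\<exists>t m'. exec (M ^ K) c m t m' \<and> t \<le> T \<and> bd M m' \<and> Q m'))"

primrec straight :: "nat \<Rightarrow> com \<Rightarrow> bool" where
  "straight K Skip \<longleftrightarrow> True"
| "straight K (Assign x i e) \<longleftrightarrow> aok K i \<and> aok K e"
| "straight K (Seq c1 c2) \<longleftrightarrow> straight K c1 \<and> straight K c2"
| "straight K (Cond b c1 c2) \<longleftrightarrow> bok K b \<and> straight K c1 \<and> straight K c2"
| "straight K (While b c) \<longleftrightarrow> False"

text \<open>Both branches of \<open>Cond\<close> are added, which gives a bound independent of the
  memory. Loops are excluded by \<open>straight\<close>.\<close>

primrec ctime :: "com \<Rightarrow> nat" where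
  "ctime Skip = 1"
| "ctime (Assign x i e) = 1 + acost i + acost e"
| "ctime (Seq c1 c2) = ctime c1 + ctime c2"
| "ctime (Cond b c1 c2) = 1 + bcost b + (ctime c1 + ctime c2)"
| "ctime (While b c) = 0"

text \<open>An assigned value must be below \<open>M\<close> itself, not merely below the word
  bound; otherwise the memory bound would not survive the assignment.\<close>

primrec wp :: "nat \<Rightarrow> com \<Rightarrow> (mem \<Rightarrow> bool) \<Rightarrow> mem \<Rightarrow> bool" where
  "wp M Skip Q m \<longleftrightarrow> Q m"
| "wp M (Assign x i e) Q m \<longleftrightarrow> aval e m < M \<and> Q (upd m x (aval i m) (aval e m))"
| "wp M (Seq c1 c2) Q m \<longleftrightarrow> wp M c1 (wp M c2 Q) m"
| "wp M (Cond b c1 c2) Q m \<longleftrightarrow> (if bval b m then wp M c1 Q m else wp M c2 Q m)"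
| "wp M (While b c) Q m \<longleftrightarrow> False"

lemma wp_exec:
  assumes M: "16 \<le> M"
  shows "straight K c \<Longrightarrow> bd M m \<Longrightarrow> wp M c Q m \<Longrightarrow> \<exists>t m'. exec (M ^ K) c m t m' \<and> t \<le> ctime c \<and> bd M m' \<and> Q m'"
proof (induction c arbitrary: m Q)
  case Skip then show ?case by (intro exI[of _ 1] exI[of _ m]) (simp add: exec.Skip[unfolded One_nat_def])
next
  case (Assign x i e)
  then have "afits (M ^ K) i m" "afits (M ^ K) e m" by (auto intro: afits_aok[OF _ M])
  from exec.Assign[OF this, of x] Assign show ?case by (auto simp: upd_def[symmetric] intro: bd_upd)
next
  case (Seq c1 c2)
  from Seq.IH(1)[OF _ Seq.prems(2), of "wp M c2 Q"] Seq.prems obtain t m' where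
    1: "exec (M ^ K) c1 m t m'" "t \<le> ctime c1" "bd M m'" "wp M c2 Q m'" by auto
  from Seq.IH(2)[OF _ 1(3,4)] Seq.prems obtain t' m'' where
    2: "exec (M ^ K) c2 m' t' m''" "t' \<le> ctime c2" "bd M m''" "Q m''" by auto
  from exec.Seq[OF 1(1) 2(1)] 1(2) 2(2-4) show ?case by (intro exI[of _ "t + t'"] exI[of _ m'']) auto
next
  case (Cond b c1 c2)
  then have b: "bfits (M ^ K) b m" by (auto intro: bfits_bok[OF _ M])
  show ?case
  proof (cases "bval b m")
    case True
    with Cond.IH(1)[of m Q] Cond.prems obtain t m' where
      1: "exec (M ^ K) c1 m t m'" "t \<le> ctime c1" "bd M m'" "Q m'" by auto
    from exec.CondTrue[OF b True 1(1), of c2] 1(2-4) show ?thesis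
      by (intro exI[of _ "1 + bcost b + t"] exI[of _ m']) auto
  next
    case False
    with Cond.IH(2)[of m Q] Cond.prems obtain t m' where
      1: "exec (M ^ K) c2 m t m'" "t \<le> ctime c2" "bd M m'" "Q m'" by auto
    from exec.CondFalse[OF b False 1(1), of c1] 1(2-4) show ?thesis
      by (intro exI[of _ "1 + bcost b + t"] exI[of _ m']) auto
  qed
qed simp

lemma ht_wp:
  assumes "16 \<le> M" "straight K c" "\<And>m. bd M m \<Longrightarrow> P m \<Longrightarrow> wp M c Q m" "ctime c \<le> T"
  shows "ht K M P c T Q"
  unfolding ht_def using wp_exec[OF assms(1,2)] assms(3,4) by (meson le_trans)

lemma ht_seq:
  assumes "ht K M P c1 T1 Q" "ht K M Q c2 T2 Q2"
  shows "ht K M P (Seq c1 c2) (T1 + T2) Q2"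
  unfolding ht_def
proof (intro allI impI)
  fix m assume "bd M m" "P m"
  with assms(1) obtain t m' where 1: "exec (M ^ K) c1 m t m'" "t \<le> T1" "bd M m'" "Q m'" unfolding ht_def by blast
  with assms(2) obtain t' m'' where 2: "exec (M ^ K) c2 m' t' m''" "t' \<le> T2" "bd M m''" "Q2 m''" unfolding ht_def by blast
  from exec.Seq[OF 1(1) 2(1)] 1(2) 2(2-4)
  show "\<exists>t m'. exec (M ^ K) (Seq c1 c2) m t m' \<and> t \<le> T1 + T2 \<and> bd M m' \<and> Q2 m'"
    by (intro exI[of _ "t + t'"] exI[of _ m'']) auto
qed

lemma ht_conseq:
  assumes "ht K M P c T Q" "\<And>m. bd M m \<Longrightarrow> P' m \<Longrightarrow> P m" "\<And>m. bd M m \<Longrightarrow> Q m \<Longrightarrow> Q' m" "T \<le> T'"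
  shows "ht K M P' c T' Q'"
  using assms unfolding ht_def by (meson le_trans)

lemma ht_cond:
  assumes M: "16 \<le> M" and b: "bok K b"
    and 1: "ht K M (\<lambda>m. P m \<and> bval b m) c1 T1 Q" and 2: "ht K M (\<lambda>m. P m \<and> \<not> bval b m) c2 T2 Q"
  shows "ht K M P (Cond b c1 c2) (1 + bcost b + (T1 + T2)) Q"
  unfolding ht_def
proof (intro allI impI)
  fix m assume m: "bd M m" "P m"
  have b: "bfits (M ^ K) b m" by (rule bfits_bok[OF m(1) M b])
  show "\<exists>t m'. exec (M ^ K) (Cond b c1 c2) m t m' \<and> t \<le> 1 + bcost b + (T1 + T2) \<and> bd M m' \<and> Q m'"
  proof (cases "bval b m")
    case True
    with 1 m obtain t m' where *: "exec (M ^ K) c1 m t m'" "t \<le> T1" "bd M m'" "Q m'" unfolding ht_def by blast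
    from exec.CondTrue[OF b True *(1), of c2] *(2-4) show ?thesis by (intro exI[of _ "1 + bcost b + t"] exI[of _ m']) auto
  next
    case False
    with 2 m obtain t m' where *: "exec (M ^ K) c2 m t m'" "t \<le> T2" "bd M m'" "Q m'" unfolding ht_def by blast
    from exec.CondFalse[OF b False *(1), of c1] *(2-4) show ?thesis by (intro exI[of _ "1 + bcost b + t"] exI[of _ m']) auto
  qed
qed

text \<open>The number of iterations is fixed in advance and the invariant is indexed by the
  iteration, so the guard is decided by the index and termination needs no separate measure.\<close>

lemma ht_while:
  assumes M: "16 \<le> M" and b: "bok K b"
    and body: "\<And>j. j < l \<Longrightarrow> ht K M (Inv j) c T (Inv (Suc j))"
    and guard: "\<And>j m. j \<le> l \<Longrightarrow> Inv j m \<Longrightarrow> bval b m \<longleftrightarrow> j < l"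
  shows "ht K M (Inv 0) (While b c) (1 + bcost b + l * (1 + bcost b + T)) (Inv l)"
proof -
  have "j \<le> l \<Longrightarrow> ht K M (Inv j) (While b c) (1 + bcost b + (l - j) * (1 + bcost b + T)) (Inv l)" for j
  proof (induction rule: inc_induct)
    case base
    show ?case unfolding ht_def
    proof (intro allI impI)
      fix m assume m: "bd M m" "Inv l m"
      from exec.WhileFalse[OF bfits_bok[OF m(1) M b], of c] guard[OF _ m(2)] m
      show "\<exists>t m'. exec (M ^ K) (While b c) m t m' \<and> t \<le> 1 + bcost b + (l - l) * (1 + bcost b + T) \<and> bd M m' \<and> Inv l m'"
        by (intro exI[of _ "1 + bcost b"] exI[of _ m]) auto
    qed
  next
    case (step j)
    show ?case unfolding ht_def
    proof (intro allI impI)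
      fix m assume m: "bd M m" "Inv j m"
      have g: "bval b m" using guard[OF _ m(2)] step.hyps by simp
      from body[OF \<open>j < l\<close>] m obtain t m' where
        1: "exec (M ^ K) c m t m'" "t \<le> T" "bd M m'" "Inv (Suc j) m'" unfolding ht_def by blast
      from step.IH 1(3,4) obtain t' m'' where
        2: "exec (M ^ K) (While b c) m' t' m''" "t' \<le> 1 + bcost b + (l - Suc j) * (1 + bcost b + T)" "bd M m''" "Inv l m''"
        unfolding ht_def by blast
      have "l - j = Suc (l - Suc j)" using \<open>j < l\<close> by simp
      then have "1 + bcost b + t + t' \<le> 1 + bcost b + (l - j) * (1 + bcost b + T)" using 1(2) 2(2) by simp
      with exec.WhileTrue[OF bfits_bok[OF m(1) M b] g 1(1) 2(1)] 2(3,4)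
      show "\<exists>t m'. exec (M ^ K) (While b c) m t m' \<and> t \<le> 1 + bcost b + (l - j) * (1 + bcost b + T) \<and> bd M m' \<and> Inv l m'"
        by blast
    qed
  qed
  from this[of 0] show ?thesis by simp
qed

definition reg :: "string \<Rightarrow> aexp" where
  "reg x = Cell x (Num 0)"

definition set_reg :: "string \<Rightarrow> aexp \<Rightarrow> com" where
  "set_reg x e = Assign x (Num 0) e"

definition for_loop :: "string \<Rightarrow> aexp \<Rightarrow> com \<Rightarrow> com" where
  "for_loop i e c = Seq (set_reg i (Num 0))
     (While (Less (reg i) e) (Seq c (set_reg i (Add (reg i) (Num 1)))))"

text \<open>Initialising takes 3 steps, a test \<open>4 + acost e\<close> and the increment 6, so
  the numerals leave some slack.\<close>

lemma ht_for:
  assumes M: "16 \<le> M" and e: "aok K e" "2 \<le> K" and l: "l < M"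
    and start: "\<And>m. bd M m \<Longrightarrow> P m \<Longrightarrow> Inv 0 (upd m i 0 0)"
    and val: "\<And>j m. j \<le> l \<Longrightarrow> Inv j m \<Longrightarrow> aval e m = l \<and> m i 0 = j"
    and body: "\<And>j. j < l \<Longrightarrow> ht K M (Inv j) c T (\<lambda>m. m i 0 = j \<and> Inv (Suc j) (upd m i 0 (Suc j)))"
  shows "ht K M P (for_loop i e c) (10 + acost e + l * (12 + acost e + T)) (Inv l)"
proof -
  have a: "ht K M P (set_reg i (Num 0)) 3 (Inv 0)"
    unfolding set_reg_def using start M e by (intro ht_wp) (auto simp: aok_def)
  have k: "aok K (Num 0)" "aok K (Cell i (Num 0))" "aok K (Add (Cell i (Num 0)) (Num 1))" using e by (auto simp: aok_def)
  have b: "ht K M (Inv j) (Seq c (set_reg i (Add (reg i) (Num 1)))) (T + 6) (Inv (Suc j))" if "j < l" for j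
  proof (rule ht_seq[OF body[OF that]], rule ht_wp[OF M])
    show "straight K (set_reg i (Add (reg i) (Num 1)))" using k by (simp add: set_reg_def reg_def)
  qed (use that l in \<open>auto simp: set_reg_def reg_def\<close>)
  have w: "ht K M (Inv 0) (While (Less (reg i) e) (Seq c (set_reg i (Add (reg i) (Num 1)))))
     (1 + bcost (Less (reg i) e) + l * (1 + bcost (Less (reg i) e) + (T + 6))) (Inv l)"
    by (rule ht_while[OF M]) (use k e b val in \<open>auto simp: reg_def\<close>)
  show ?thesis unfolding for_loop_def
    by (rule ht_conseq[OF ht_seq[OF a w]]) (auto simp: reg_def algebra_simps)
qed

definition same :: "(string \<times> nat) set \<Rightarrow> mem \<Rightarrow> mem \<Rightarrow> bool" where
  "same A m m' \<longleftrightarrow> (\<forall>x i. (x, i) \<notin> A \<longrightarrow> m' x i = m x i)"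

lemma same_refl [simp]: "same A m m" by (simp add: same_def)

lemma same_upd: "same A m m' \<Longrightarrow> (x, i) \<in> A \<Longrightarrow> same A m (upd m' x i v)"
  by (auto simp: same_def)

lemma same_trans: "same A m m' \<Longrightarrow> same A m' m'' \<Longrightarrow> same A m m''"
  by (simp add: same_def)

lemma same_mono: "same A m m' \<Longrightarrow> A \<subseteq> A' \<Longrightarrow> same A' m m'"
  by (auto simp: same_def)

lemma sameD: "same A m m' \<Longrightarrow> (x, i) \<notin> A \<Longrightarrow> m' x i = m x i"
  by (simp add: same_def)

section \<open>The program that computes the extension\<close>

fun seq :: "com list \<Rightarrow> com" where
  "seq [] = Skip"
| "seq [c] = c"
| "seq (c # cs) = Seq c (seq cs)"

definition copy_record :: com where
  "copy_record = seq [Assign ''kind'' (reg ''x'') (Cell ''kind'' (reg ''u'')),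
     Assign ''type'' (reg ''x'') (Cell ''type'' (reg ''u'')),
     Assign ''size'' (reg ''x'') (Cell ''size'' (reg ''u'')),
     Assign ''lsize'' (reg ''x'') (Cell ''lsize'' (reg ''u''))]"

definition go_left :: com where
  "go_left = seq [Assign ''left'' (reg ''x'') (Add (reg ''x'') (Num 1)),
     Assign ''right'' (reg ''x'') (reg ''z''), set_reg ''u'' (reg ''y'')]"

definition go_right :: com where
  "go_right = seq [Assign ''left'' (reg ''x'') (reg ''y''),
     Assign ''right'' (reg ''x'') (Add (reg ''x'') (Num 1)), set_reg ''u'' (reg ''z'')]"

text \<open>A transcription of \<open>step_dir\<close> and \<open>step_pos\<close>. Register
  \<open>s\<close> holds \<open>vlen\<close> of the left child under \<open>HCat\<close> and of the
  right child under \<open>VComp\<close>, computed as size plus type.\<close>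

definition descend_body :: com where
  "descend_body = seq [copy_record,
     set_reg ''y'' (Cell ''left'' (reg ''u'')), set_reg ''z'' (Cell ''right'' (reg ''u'')),
     Cond (Eq (Cell ''kind'' (reg ''u'')) (Num 2))
       (seq [set_reg ''s'' (Add (Cell ''size'' (reg ''y'')) (Cell ''type'' (reg ''y''))),
          Cond (Less (reg ''k'') (reg ''s'')) go_left
            (seq [set_reg ''k'' (Sub (reg ''k'') (reg ''s'')), go_right])])
       (seq [set_reg ''s'' (Add (Cell ''size'' (reg ''z'')) (Cell ''type'' (reg ''z''))),
          Cond (Less (reg ''k'') (Cell ''lsize'' (reg ''y''))) go_left
            (Cond (Less (reg ''k'') (Add (Cell ''lsize'' (reg ''y'')) (reg ''s'')))
              (seq [set_reg ''k'' (Sub (reg ''k'') (Cell ''lsize'' (reg ''y''))), go_right])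
              (seq [set_reg ''k'' (Sub (Add (reg ''k'') (Num 1)) (reg ''s'')), go_left]))]),
     set_reg ''x'' (Add (reg ''x'') (Num 1))]"

text \<open>\<open>N0\<close> keeps the old number of vertices: it is the number of the new root,
  and the second program needs it to tell new vertices from old ones.\<close>

definition extend_init :: com where
  "extend_init = seq [set_reg ''N0'' (reg ''N''), set_reg ''u'' (reg ''root''), set_reg ''x'' (reg ''N'')]"

definition extend_final :: com where
  "extend_final = seq [copy_record, Assign ''sym'' (reg ''x'') (reg ''a''),
     set_reg ''root'' (reg ''N0''), set_reg ''N'' (Add (reg ''x'') (Num 1))]"

text \<open>Kinds 0 and 1 are the leaves, so the guard asks for an inner vertex.\<close>

definition extend_program :: com where
  "extend_program = Seq extend_init (Seq (While (Less (Num 1) (Cell ''kind'' (reg ''u''))) descend_body) extend_final)"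

lemmas program_defs = copy_record_def go_left_def go_right_def descend_body_def extend_init_def extend_final_def
  set_reg_def reg_def

text \<open>\<open>b\<close> bounds the given cells. The factor 8 between \<open>b\<close> and
  \<open>M\<close> covers stored sums such as size plus type and the new vertex numbers, both of
  order \<open>2 * b\<close>.\<close>

locale relabelling_run = relabelling D k a for D :: "(nat, 'a label) rooted_bdag" and k a +
  fixes code :: "'a \<Rightarrow> nat" and m0 :: mem and b M K :: nat
  assumes slp: "rep_slp code D m0" and sizes: "rep_sizes D m0"
    and k0: "m0 ''k'' 0 = k" and a0: "m0 ''a'' 0 = code a"
    and cells: "\<And>x i. m0 x i < b" and M: "8 * b \<le> M" "16 \<le> M" and K: "8 \<le> K"
begin

lemma N_cell: "m0 ''N'' 0 = N" and root_cell: "m0 ''root'' 0 = root_vertex D"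
  using slp by (auto simp: rep_slp_def)

lemma slp_cell: "v \<in> verts D \<Longrightarrow>
   case label D v of
          Sym a \<Rightarrow> m0 ''kind'' v = 0 \<and> m0 ''sym'' v = code a
        | SymStar a \<Rightarrow> m0 ''kind'' v = 1 \<and> m0 ''sym'' v = code a
        | HCat \<Rightarrow> m0 ''kind'' v = 2 \<and>
            (v, L, m0 ''left'' v) \<in> edges D \<and> (v, R, m0 ''right'' v) \<in> edges D
        | VComp \<Rightarrow> m0 ''kind'' v = 3 \<and>
            (v, L, m0 ''left'' v) \<in> edges D \<and> (v, R, m0 ''right'' v) \<in> edges D"
  using slp unfolding rep_slp_def by blast

lemma kind_cell: "v \<in> verts D \<Longrightarrow> m0 ''kind'' v = (case label D v of Sym _ \<Rightarrow> 0 | SymStar _ \<Rightarrow> 1 | HCat \<Rightarrow> 2 | VComp \<Rightarrow> 3)"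
  using slp_cell[of v] by (cases "label D v") simp_all

lemma sym_cell: "v \<in> verts D \<Longrightarrow> label D v = Sym c \<or> label D v = SymStar c \<Longrightarrow> m0 ''sym'' v = code c"
  using slp_cell[of v] by auto

lemma child_cells: "v \<in> verts D \<Longrightarrow> \<not> is_leaf D v \<Longrightarrow> m0 ''left'' v = child D v L \<and> m0 ''right'' v = child D v R"
proof -
  assume v: "v \<in> verts D" "\<not> is_leaf D v"
  then have "(v, L, m0 ''left'' v) \<in> edges D \<and> (v, R, m0 ''right'' v) \<in> edges D"
    using slp_cell[OF v(1)] inner_label[OF v] by auto
  then show ?thesis using child_eq[of v L] child_eq[of v R] by auto
qed

lemma size_cells: "v \<in> verts D \<Longrightarrow> m0 ''type'' v = vtype D v" "v \<in> verts D \<Longrightarrow> m0 ''size'' v = leaf_size D v"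
  "v \<in> verts D \<Longrightarrow> vtype D v = 1 \<Longrightarrow> m0 ''lsize'' v = left_size D v"
  using sizes by (auto simp: rep_sizes_def)

text \<open>In the record arrays only indices from \<open>N\<close> on may change, so the records of
  old vertices can be read throughout the descent.\<close>

definition touched :: "(string \<times> nat) set" where
  "touched = {(x, i). x \<in> {''N0'', ''u'', ''x'', ''y'', ''z'', ''s'', ''k''} \<or>
     x \<in> {''kind'', ''type'', ''size'', ''lsize'', ''left'', ''right''} \<and> N \<le> i}"

definition copied :: "mem \<Rightarrow> nat \<Rightarrow> bool" where
  "copied m i \<longleftrightarrow> m ''kind'' (N + i) = m0 ''kind'' (pu i) \<and> m ''type'' (N + i) = m0 ''type'' (pu i) \<and>
     m ''size'' (N + i) = m0 ''size'' (pu i) \<and> m ''lsize'' (N + i) = m0 ''lsize'' (pu i)"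

definition linked :: "mem \<Rightarrow> nat \<Rightarrow> bool" where
  "linked m i \<longleftrightarrow> m ''left'' (N + i) = (if pd i = L then N + i + 1 else child D (pu i) L) \<and>
     m ''right'' (N + i) = (if pd i = R then N + i + 1 else child D (pu i) R)"

definition Inv :: "nat \<Rightarrow> mem \<Rightarrow> bool" where
  "Inv j m \<longleftrightarrow> same touched m0 m \<and> m ''N0'' 0 = N \<and> m ''u'' 0 = pu j \<and> m ''k'' 0 = pk j \<and> m ''x'' 0 = N + j \<and>
     (\<forall>i < j. copied m i \<and> linked m i)"

lemma N_less: "N < b" using cells[of "''N''" 0] by (simp add: N_cell)

lemma body_wp:
  assumes j: "j < len" and m: "bd M m" "Inv j m"
  shows "wp M descend_body (Inv (Suc j)) m"
proof -
  let ?u = "pu j"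
  have u: "?u \<in> verts D" "\<not> is_leaf D ?u" "pk j < vlen D ?u" using path_ok[of j] not_leaf_less[OF j] j by auto
  have uN: "?u < N" using u(1) by (simp add: less_N)
  have c: "child D ?u L \<in> verts D" "child D ?u R \<in> verts D" using u by (auto simp: child_verts)
  then have cN: "child D ?u L < N" "child D ?u R < N" by (simp_all add: less_N)
  have sm: "same touched m0 m" and reg: "m ''N0'' 0 = N" "m ''u'' 0 = ?u" "m ''k'' 0 = pk j" "m ''x'' 0 = N + j"
    and prev: "\<And>i. i < j \<Longrightarrow> copied m i \<and> linked m i" using m(2) by (auto simp: Inv_def)
  have old: "m x v = m0 x v" if "v < N" "x \<in> {''kind'', ''type'', ''size'', ''lsize'', ''left'', ''right''}" for x v
    using sameD[OF sm, of x v] that by (auto simp: touched_def)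
  note rd = old[OF uN, simplified] old[OF cN(1), simplified] old[OF cN(2), simplified]
  have lt: "m0 x i < M" for x i using cells[of x i] M by simp
  have vl: "vlen D v < 2 * b" if "v \<in> verts D" for v
    using vlen_eq[OF that] cells[of "''size''" v] cells[of "''type''" v] that by (simp add: size_cells)
  have pkb: "pk j + 1 < M" using u(3) vl[OF u(1)] M by simp
  have Nj: "N + j + 1 < M" using N_less len_less j M by simp
  have kind: "m0 ''kind'' ?u = (if label D ?u = HCat then 2 else 3)" using inner_label[OF u(1,2)] u(1) by (auto simp: kind_cell)
  have len: "leaf_size D v + vtype D v = vlen D v" if "v \<in> verts D" for v using vlen_eq[OF that] by simp
  note vls = vl[OF c(1)] vl[OF c(2)]
  have tp: "vtype D (child D ?u L) = 1" if "label D ?u \<noteq> HCat" using vtype_VComp(1)[OF u(1)] inner_label[OF u(1,2)] that by simp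
  define m1 where "m1 = upd (upd (upd (upd m ''kind'' (N + j) (m0 ''kind'' ?u)) ''type'' (N + j) (m0 ''type'' ?u))
     ''size'' (N + j) (m0 ''size'' ?u)) ''lsize'' (N + j) (m0 ''lsize'' ?u)"
  have m1: "same touched m0 m1" unfolding m1_def by (intro same_upd sm) (auto simp: touched_def)
  have c1: "copied m1 j" unfolding copied_def m1_def by simp
  have p1: "copied m1 i \<and> linked m1 i" if "i < j" for i using prev[OF that] that unfolding copied_def linked_def m1_def by simp
  have reg1: "m1 ''N0'' 0 = N" "m1 ''u'' 0 = ?u" "m1 ''k'' 0 = pk j" "m1 ''x'' 0 = N + j" unfolding m1_def using reg by simp_all
  have rd1: "m1 x v = m0 x v" if "v < N" "x \<in> {''kind'', ''type'', ''size'', ''lsize'', ''left'', ''right''}" for x v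
    using sameD[OF m1, of x v] that by (auto simp: touched_def)
  have new: "Inv (Suc j) (upd (upd (upd (upd (upd (upd (upd (upd m1 ''y'' 0 (child D ?u L)) ''z'' 0 (child D ?u R)) ''s'' 0 s)
     ''k'' 0 k') ''left'' (N + j) l) ''right'' (N + j) r) ''u'' 0 u') ''x'' 0 (Suc (N + j)))"
    if "k' = pk (Suc j)" "u' = pu (Suc j)" "l = (if pd j = L then N + j + 1 else child D ?u L)"
      "r = (if pd j = R then N + j + 1 else child D ?u R)" for s k' l r u'
    unfolding Inv_def
  proof (intro conjI allI impI)
    show "same touched m0 (upd (upd (upd (upd (upd (upd (upd (upd m1 ''y'' 0 (child D ?u L)) ''z'' 0 (child D ?u R)) ''s'' 0 s)
     ''k'' 0 k') ''left'' (N + j) l) ''right'' (N + j) r) ''u'' 0 u') ''x'' 0 (Suc (N + j)))"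
      by (intro same_upd m1) (auto simp: touched_def)
    fix i assume "i < Suc j"
    then show "copied (upd (upd (upd (upd (upd (upd (upd (upd m1 ''y'' 0 (child D ?u L)) ''z'' 0 (child D ?u R)) ''s'' 0 s)
     ''k'' 0 k') ''left'' (N + j) l) ''right'' (N + j) r) ''u'' 0 u') ''x'' 0 (Suc (N + j))) i"
      "linked (upd (upd (upd (upd (upd (upd (upd (upd m1 ''y'' 0 (child D ?u L)) ''z'' 0 (child D ?u R)) ''s'' 0 s)
     ''k'' 0 k') ''left'' (N + j) l) ''right'' (N + j) r) ''u'' 0 u') ''x'' 0 (Suc (N + j))) i"
      using p1[of i] c1 that by (cases "i = j"; simp add: copied_def linked_def)+
  qed (use that reg1 in simp_all)
  \<comment> \<open>Two branches leave register \<open>k\<close> alone; writing back its old value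
    reduces them to the general form.\<close>
  have new2: "Inv (Suc j) (upd (upd (upd (upd (upd (upd (upd m1 ''y'' 0 (child D ?u L)) ''z'' 0 (child D ?u R)) ''s'' 0 s)
     ''left'' (N + j) l) ''right'' (N + j) r) ''u'' 0 u') ''x'' 0 (Suc (N + j)))"
    if "pk j = pk (Suc j)" "u' = pu (Suc j)" "l = (if pd j = L then N + j + 1 else child D ?u L)"
      "r = (if pd j = R then N + j + 1 else child D ?u R)" for s l r u'
  proof -
    have "upd (upd (upd (upd m1 ''y'' 0 (child D ?u L)) ''z'' 0 (child D ?u R)) ''s'' 0 s) ''k'' 0 (pk j) =
      upd (upd (upd m1 ''y'' 0 (child D ?u L)) ''z'' 0 (child D ?u R)) ''s'' 0 s"
      using reg1(3) by (auto simp: upd_def fun_eq_iff)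
    then show ?thesis using new[OF that, of s] by simp
  qed
  have steps: "pu (Suc j) = child D ?u (pd j)" "pk (Suc j) = step_pos D ?u (pk j)" "pd j = step_dir D ?u (pk j)"
    by (simp_all add: pu_Suc pk_Suc pd_def)
  have cr: "wp M copy_record Q m = Q m1" for Q
    unfolding m1_def using lt uN reg by (simp add: copy_record_def reg_def rd)
  note ev = program_defs reg1 rd1 uN cN kind child_cells[OF u(1,2)] size_cells(1,2)[OF c(1)] size_cells(1,2)[OF c(2)] len[OF c(1)] len[OF c(2)] lt
  have vM: "vlen D (child D ?u L) < M" "vlen D (child D ?u R) < M" using vls M by simp_all
  have cM: "child D ?u L < M" "child D ?u R < M" using cN N_less M by simp_all
  have dM: "pk j - x < M" "Suc (pk j) - x < M" for x using pkb by simp_all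
  note ev = ev vM cM dM pkb Suc_lessD[OF pkb[unfolded Suc_eq_plus1[symmetric]]] Nj Nj[unfolded Suc_eq_plus1[symmetric]]
  show ?thesis
  proof (cases "label D ?u = HCat")
    case True
    show ?thesis
    proof (cases "pk j < vlen D (child D ?u L)")
      case l: True
      have d: "pd j = L" "pk (Suc j) = pk j" by (simp_all add: steps step_dir_def step_pos_def True l)
      show ?thesis unfolding descend_body_def seq.simps wp.simps cr
        by (simp add: ev True l) (rule new2; simp add: d steps(1))
    next
      case r: False
      have d: "pd j = R" "pk (Suc j) = pk j - vlen D (child D ?u L)" by (simp_all add: steps step_dir_def step_pos_def True r)
      show ?thesis unfolding descend_body_def seq.simps wp.simps cr
        by (simp add: ev True r) (rule new; simp add: d steps(1))
    qed
  next
    case False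
    have ls: "m0 ''lsize'' (child D ?u L) = left_size D (child D ?u L)" using size_cells(3)[OF c(1) tp[OF False]] .
    show ?thesis
    proof (cases "pk j < left_size D (child D ?u L)")
      case l: True
      have d: "pd j = L" "pk (Suc j) = pk j" using l False by (simp_all add: steps step_dir_def step_pos_def)
      show ?thesis unfolding descend_body_def seq.simps wp.simps cr
        by (simp add: ev ls False l) (rule new2; simp add: d steps(1))
    next
      case nl: False
      show ?thesis
      proof (cases "pk j < left_size D (child D ?u L) + vlen D (child D ?u R)")
        case r: True
        have d: "pd j = R" "pk (Suc j) = pk j - left_size D (child D ?u L)" using nl r False by (simp_all add: steps step_dir_def step_pos_def)
        show ?thesis unfolding descend_body_def seq.simps wp.simps cr
          by (simp add: ev ls False nl r) (rule new; simp add: d steps(1))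
      next
        case r: False
        have d: "pd j = L" "pk (Suc j) = pk j + 1 - vlen D (child D ?u R)" using nl r False by (simp_all add: steps step_dir_def step_pos_def)
        show ?thesis unfolding descend_body_def seq.simps wp.simps cr
          by (simp add: ev ls False nl r) (rule new; simp add: d steps(1))
      qed
    qed
  qed
qed

definition touched' :: "(string \<times> nat) set" where
  "touched' = touched \<union> {(x, i). x \<in> {''N'', ''root''} \<or> x = ''sym'' \<and> N \<le> i}"

definition Post :: "mem \<Rightarrow> bool" where
  "Post m \<longleftrightarrow> same touched' m0 m \<and> m ''N0'' 0 = N \<and> m ''N'' 0 = N + len + 1 \<and> m ''root'' 0 = N \<and>
     (\<forall>i \<le> len. copied m i) \<and> (\<forall>i < len. linked m i) \<and> m ''sym'' (N + len) = code a"

lemma final_wp: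
  assumes m: "bd M m" "Inv len m"
  shows "wp M extend_final Post m"
proof -
  have sm: "same touched m0 m" and reg: "m ''N0'' 0 = N" "m ''u'' 0 = pu len" "m ''x'' 0 = N + len"
    and prev: "\<And>i. i < len \<Longrightarrow> copied m i \<and> linked m i" using m(2) by (auto simp: Inv_def)
  have uN: "pu len < N" using path_ok[of len] by (simp add: less_N)
  have old: "m x v = m0 x v" if "v < N" "x \<in> {''kind'', ''type'', ''size'', ''lsize'', ''left'', ''right''}" for x v
    using sameD[OF sm, of x v] that by (auto simp: touched_def)
  have ar: "m ''a'' 0 = code a" using sameD[OF sm, of "''a''" 0] a0 by (simp add: touched_def)
  have lt: "m0 x i < M" for x i using cells[of x i] M by simp
  have Nj: "N + len + 1 < M" using N_less len_less M by simp
  have al: "code a < M" using lt[of "''a''" 0] a0 by simp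
  let ?m = "upd (upd (upd (upd (upd (upd (upd m ''kind'' (N + len) (m0 ''kind'' (pu len))) ''type'' (N + len) (m0 ''type'' (pu len)))
     ''size'' (N + len) (m0 ''size'' (pu len))) ''lsize'' (N + len) (m0 ''lsize'' (pu len))) ''sym'' (N + len) (code a)) ''root'' 0 N) ''N'' 0 (N + len + 1)"
  have "Post ?m" unfolding Post_def
  proof (intro conjI allI impI)
    show "same touched' m0 ?m" by (intro same_upd same_mono[OF sm]) (auto simp: touched_def touched'_def)
    fix i assume "i \<le> len"
    then show "copied ?m i" using prev[of i] by (cases "i = len") (simp_all add: copied_def)
  next
    fix i assume "i < len"
    then show "linked ?m i" using prev[of i] by (simp add: linked_def)
  qed (use reg in simp_all)
  then show ?thesis using lt Nj al old[OF uN, simplified]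
    by (simp add: program_defs reg ar)
qed

lemma extend_correct: "ht K M (\<lambda>m. m = m0) extend_program
   (ctime extend_init + (1 + bcost (Less (Num 1) (Cell ''kind'' (reg ''u''))) +
      len * (1 + bcost (Less (Num 1) (Cell ''kind'' (reg ''u''))) + ctime descend_body) + ctime extend_final)) Post"
  unfolding extend_program_def
proof (intro ht_seq)
  have ok: "aok K (Num 1)" "aok K (Cell ''kind'' (reg ''u''))" using K by (auto simp: aok_def reg_def)
  show "ht K M (\<lambda>m. m = m0) extend_init (ctime extend_init) (Inv 0)"
  proof (rule ht_wp[OF M(2)])
    show "straight K extend_init" using K by (simp add: program_defs aok_def)
    fix m assume "m = m0"
    moreover have "m0 x i < M" for x i using cells[of x i] M by simp
    moreover have "same touched m0 (upd (upd (upd m0 ''N0'' 0 N) ''u'' 0 r) ''x'' 0 N)" for r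
      by (intro same_upd same_refl) (auto simp: touched_def)
    ultimately show "wp M extend_init (Inv 0) m"
      by (auto simp: program_defs Inv_def pu_0 pk_0 N_cell root_cell k0)
        (use N_cell root_cell in metis)+
  qed simp
  show "ht K M (Inv 0) (While (Less (Num 1) (Cell ''kind'' (reg ''u''))) descend_body)
    (1 + bcost (Less (Num 1) (Cell ''kind'' (reg ''u''))) + len * (1 + bcost (Less (Num 1) (Cell ''kind'' (reg ''u''))) + ctime descend_body)) (Inv len)"
  proof (rule ht_while[OF M(2)])
    show "bok K (Less (Num 1) (Cell ''kind'' (reg ''u'')))" using ok by simp
    fix j assume j: "j < len"
    show "ht K M (Inv j) descend_body (ctime descend_body) (Inv (Suc j))"
    proof (rule ht_wp[OF M(2)])
      show "straight K descend_body" using K by (simp add: program_defs aok_def)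
    qed (use body_wp[OF j] in auto)
  next
    fix j m assume j: "j \<le> len" and m: "Inv j m"
    have u: "pu j \<in> verts D" using path_ok[OF j] by simp
    then have "m ''kind'' (pu j) = m0 ''kind'' (pu j)"
      using m sameD[of touched m0 m "''kind''" "pu j"] by (auto simp: Inv_def touched_def less_N[symmetric])
    moreover have "is_leaf D (pu j) \<longleftrightarrow> \<not> j < len"
      using not_leaf_less[of j] len_leaf j by (cases "j = len") auto
    ultimately show "bval (Less (Num 1) (Cell ''kind'' (reg ''u''))) m \<longleftrightarrow> j < len"
      using m leaf_label[OF u] inner_label[OF u] by (cases "is_leaf D (pu j)") (auto simp: Inv_def reg_def kind_cell[OF u])
  qed
  show "ht K M (Inv len) extend_final (ctime extend_final) Post"
  proof (rule ht_wp[OF M(2)])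
    show "straight K extend_final" using K by (simp add: program_defs aok_def)
  qed (use final_wp in auto)
qed

text \<open>The old records are untouched, and a new record is a copy whose sizes are right by
  \<open>sizes_new\<close> and whose children are the linked ones.\<close>

lemma Post_rep:
  assumes m: "Post m"
  shows "rep_slp code D' m" "rep_sizes D' m"
proof -
  have sm: "same touched' m0 m" and reg: "m ''N'' 0 = N + len + 1" "m ''root'' 0 = N" "m ''sym'' (N + len) = code a"
    and cp: "\<And>i. i \<le> len \<Longrightarrow> copied m i" and lk: "\<And>i. i < len \<Longrightarrow> linked m i" using m by (auto simp: Post_def)
  have old: "m x v = m0 x v" if "v < N" "x \<in> {''kind'', ''sym'', ''type'', ''size'', ''lsize'', ''left'', ''right''}" for x v
    using sameD[OF sm, of x v] that by (auto simp: touched'_def touched_def)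
  show "rep_sizes D' m" unfolding rep_sizes_def
  proof
    fix v assume "v \<in> verts D'"
    then show "m ''type'' v = vtype D' v \<and> m ''size'' v = leaf_size D' v \<and> (vtype D' v = 1 \<longrightarrow> m ''lsize'' v = left_size D' v)"
    proof (cases rule: vert_cases')
      case 1
      then have "v \<in> verts D" by (simp add: less_N)
      with 1 show ?thesis using old[OF 1] by (simp add: size_cells sizes_old)
    next
      case (2 i)
      then show ?thesis using cp[OF 2(2)] path_ok[OF 2(2)] sizes_new[OF 2(2)] by (simp add: copied_def size_cells)
    qed
  qed
  have inner: "(v, d, w) \<in> edges D'" if "v \<in> verts D'" "\<not> is_leaf D' v" "w = child D' v d" for v d w
    using D'.child_edge[OF that(1,2)] that(3) by simp
  have main: "case label D' v of
          Sym c \<Rightarrow> m ''kind'' v = 0 \<and> m ''sym'' v = code c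
        | SymStar c \<Rightarrow> m ''kind'' v = 1 \<and> m ''sym'' v = code c
        | HCat \<Rightarrow> m ''kind'' v = 2 \<and> m ''left'' v = child D' v L \<and> m ''right'' v = child D' v R
        | VComp \<Rightarrow> m ''kind'' v = 3 \<and> m ''left'' v = child D' v L \<and> m ''right'' v = child D' v R" if v: "v \<in> verts D'" for v
    using v
  proof (cases rule: vert_cases')
    case 1
    then have vD: "v \<in> verts D" by (simp add: less_N)
    show ?thesis using old[OF 1] kind_cell[OF vD] sym_cell[OF vD] child_cells[OF vD] leaf_iff[OF vD]
      by (auto simp: label_old[OF 1] child_old[OF 1] split: label.splits)
  next
    case (2 i)
    have p: "pu i \<in> verts D" using path_ok[OF 2(2)] by simp
    show ?thesis
    proof (cases "i < len")
      case True
      have nl: "\<not> is_leaf D (pu i)" by (rule not_leaf_less[OF True])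
      show ?thesis using inner_label[OF p nl] cp[OF 2(2)] lk[OF True]
        by (cases "pd i") (auto simp: 2(1) label_new[OF True] child_new[OF True] copied_def linked_def kind_cell[OF p])
    next
      case False
      then have i: "i = len" using 2 by simp
      show ?thesis using leaf_label[OF p] len_leaf cp[OF 2(2)] reg(3)
        by (auto simp: 2(1) i label_last copied_def kind_cell[OF p[unfolded i]])
    qed
  qed
  show "rep_slp code D' m" unfolding rep_slp_def
  proof (intro conjI ballI)
    show "verts D' = {..<m ''N'' 0}" "root_vertex D' = m ''root'' 0" using reg by (simp_all add: verts' root')
    fix v assume v: "v \<in> verts D'"
    show "case label D' v of
          Sym c \<Rightarrow> m ''kind'' v = 0 \<and> m ''sym'' v = code c
        | SymStar c \<Rightarrow> m ''kind'' v = 1 \<and> m ''sym'' v = code c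
        | HCat \<Rightarrow> m ''kind'' v = 2 \<and> (v, L, m ''left'' v) \<in> edges D' \<and> (v, R, m ''right'' v) \<in> edges D'
        | VComp \<Rightarrow> m ''kind'' v = 3 \<and> (v, L, m ''left'' v) \<in> edges D' \<and> (v, R, m ''right'' v) \<in> edges D'"
      using main[OF v] inner[OF v] D'.leaf_iff[OF v] by (auto split: label.splits)
  qed
qed

end

section \<open>The program that updates the enumeration data structure\<close>

text \<open>If the expressions do not read the array, successive writes to it act like one
  simultaneous write.\<close>

primrec avoids :: "string \<Rightarrow> aexp \<Rightarrow> bool" where
  "avoids A (Num n) \<longleftrightarrow> True"
| "avoids A (Cell x i) \<longleftrightarrow> x \<noteq> A \<and> avoids A i"
| "avoids A (Add e1 e2) \<longleftrightarrow> avoids A e1 \<and> avoids A e2"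
| "avoids A (Sub e1 e2) \<longleftrightarrow> avoids A e1 \<and> avoids A e2"
| "avoids A (Mul e1 e2) \<longleftrightarrow> avoids A e1 \<and> avoids A e2"

lemma aval_avoids: "avoids A e \<Longrightarrow> aval e (upd m A i v) = aval e m"
  by (induction e) auto

lemma upd_other: "x \<noteq> y \<Longrightarrow> upd m x i v y = m y"
  by (simp add: upd_def)

section \<open>Effects stored in five cells\<close>

definition idx5 :: "aexp \<Rightarrow> nat \<Rightarrow> aexp" where
  "idx5 e c = Add (Mul (Num 5) e) (Num c)"

definition copy5 :: "string \<Rightarrow> aexp \<Rightarrow> string \<Rightarrow> aexp \<Rightarrow> com" where
  "copy5 A e A' e' = seq [Assign A (idx5 e 0) (Cell A' (idx5 e' 0)), Assign A (idx5 e 1) (Cell A' (idx5 e' 1)),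
     Assign A (idx5 e 2) (Cell A' (idx5 e' 2)), Assign A (idx5 e 3) (Cell A' (idx5 e' 3)),
     Assign A (idx5 e 4) (Cell A' (idx5 e' 4))]"

definition put5 :: "string \<Rightarrow> aexp \<Rightarrow> aexp \<Rightarrow> aexp \<Rightarrow> aexp \<Rightarrow> aexp \<Rightarrow> aexp \<Rightarrow> com" where
  "put5 A e x0 x1 x2 x3 x4 = seq [Assign A (idx5 e 0) x0, Assign A (idx5 e 1) x1,
     Assign A (idx5 e 2) x2, Assign A (idx5 e 3) x3, Assign A (idx5 e 4) x4]"

text \<open>The coefficients of \<open>affine_comp\<close> as a program; \<open>G\<close> holds the
  effect that is applied first.\<close>

definition comp5 :: "string \<Rightarrow> aexp \<Rightarrow> string \<Rightarrow> aexp \<Rightarrow> string \<Rightarrow> aexp \<Rightarrow> com" where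
  "comp5 A e F f G g = put5 A e (Cell F (idx5 f 0))
     (Add (Cell G (idx5 g 1)) (Mul (Cell F (idx5 f 1)) (Cell G (idx5 g 3))))
     (Add (Add (Cell G (idx5 g 2)) (Mul (Cell F (idx5 f 1)) (Cell G (idx5 g 4)))) (Cell F (idx5 f 2)))
     (Mul (Cell F (idx5 f 3)) (Cell G (idx5 g 3)))
     (Add (Mul (Cell F (idx5 f 3)) (Cell G (idx5 g 4))) (Cell F (idx5 f 4)))"

definition set5 :: "mem \<Rightarrow> string \<Rightarrow> nat \<Rightarrow> nat \<Rightarrow> nat \<Rightarrow> nat \<Rightarrow> nat \<Rightarrow> nat \<Rightarrow> mem" where
  "set5 m A i x0 x1 x2 x3 x4 = upd (upd (upd (upd (upd m A (5 * i) x0) A (5 * i + 1) x1) A (5 * i + 2) x2) A (5 * i + 3) x3) A (5 * i + 4) x4"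

lemma set5_other: "A \<noteq> A' \<Longrightarrow> set5 m A i x0 x1 x2 x3 x4 A' = m A'"
  by (simp add: set5_def upd_other)

lemma set5_apply_other [simp]: "A \<noteq> A' \<Longrightarrow> set5 m A i x0 x1 x2 x3 x4 A' j = m A' j"
  by (simp add: set5_other)

text \<open>Groups of five cells with different indices are disjoint.\<close>

lemma rep_effect_set5: "rep_effect (set5 m A i x0 x1 x2 x3 x4 A) j t f \<longleftrightarrow>
    (if i = j then rep5 x0 x1 x2 x3 x4 t f else rep_effect (m A) j t f)"
proof -
  have "5 * i + c \<noteq> 5 * j + c'" if "i \<noteq> j" "c < 5" "c' < 5" for c c'
    using that by presburger
  from this[of 0 0] this[of 0 1] this[of 0 2] this[of 0 3] this[of 0 4]
    this[of 1 0] this[of 1 1] this[of 1 2] this[of 1 3] this[of 1 4]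
    this[of 2 0] this[of 2 1] this[of 2 2] this[of 2 3] this[of 2 4]
    this[of 3 0] this[of 3 1] this[of 3 2] this[of 3 3] this[of 3 4]
    this[of 4 0] this[of 4 1] this[of 4 2] this[of 4 3] this[of 4 4]
  show ?thesis by (cases "i = j") (simp_all add: rep_effect_rep5 set5_def)
qed

lemma same_set5:
  assumes "same Fr m m'" "\<And>c. c < 5 \<Longrightarrow> (A, 5 * i + c) \<in> Fr"
  shows "same Fr m (set5 m' A i x0 x1 x2 x3 x4)"
  unfolding set5_def using assms(2)[of 0] assms(2)[of 1] assms(2)[of 2] assms(2)[of 3] assms(2)[of 4]
  by (intro same_upd assms(1)) simp_all

lemma wp_put5:
  assumes "avoids A e" "avoids A x0" "avoids A x1" "avoids A x2" "avoids A x3" "avoids A x4"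
  shows "wp M (put5 A e x0 x1 x2 x3 x4) Q m \<longleftrightarrow>
     aval x0 m < M \<and> aval x1 m < M \<and> aval x2 m < M \<and> aval x3 m < M \<and> aval x4 m < M \<and>
     Q (set5 m A (aval e m) (aval x0 m) (aval x1 m) (aval x2 m) (aval x3 m) (aval x4 m))"
  using assms by (simp add: put5_def idx5_def aval_avoids set5_def)

lemma copy5_put5: "copy5 A e A' e' = put5 A e (Cell A' (idx5 e' 0)) (Cell A' (idx5 e' 1)) (Cell A' (idx5 e' 2))
   (Cell A' (idx5 e' 3)) (Cell A' (idx5 e' 4))"
  by (simp add: copy5_def put5_def)

lemma wp_copy5:
  assumes "avoids A e" "avoids A e'" "A' \<noteq> A"
  shows "wp M (copy5 A e A' e') Q m \<longleftrightarrow> (let j = aval e' m in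
     m A' (5 * j) < M \<and> m A' (5 * j + 1) < M \<and> m A' (5 * j + 2) < M \<and> m A' (5 * j + 3) < M \<and> m A' (5 * j + 4) < M \<and>
     Q (set5 m A (aval e m) (m A' (5 * j)) (m A' (5 * j + 1)) (m A' (5 * j + 2)) (m A' (5 * j + 3)) (m A' (5 * j + 4))))"
  unfolding copy5_put5 by (subst wp_put5) (use assms in \<open>auto simp: idx5_def Let_def\<close>)

text \<open>The \<open>nice\<close> bounds apply to the cells in memory because representations are
  unique, so all five results are below \<open>M\<close>. The continuation only has to cope with
  some representation of the composition.\<close>

lemma wp_comp5:
  assumes m: "bd M m" and av: "avoids A e" "avoids A f" "avoids A g" "F \<noteq> A" "G \<noteq> A"
    and g: "rep_effect (m G) (aval g m) t h" "nice t T K1 h"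
    and f: "rep_effect (m F) (aval f m) T h'" "nice T T' K2 h'"
    and t: "t \<le> 1" "T \<le> 1" and M: "K1 + K2 < M" "1 < M"
    and Q: "\<And>x0 x1 x2 x3 x4. rep5 x0 x1 x2 x3 x4 t (h' \<circ> h) \<Longrightarrow> Q (set5 m A (aval e m) x0 x1 x2 x3 x4)"
  shows "wp M (comp5 A e F f G g) Q m"
proof -
  let ?G = "\<lambda>c. m G (5 * aval g m + c)" and ?F = "\<lambda>c. m F (5 * aval f m + c)"
  have g5: "rep5 (?G 0) (?G 1) (?G 2) (?G 3) (?G 4) t h" using g(1) by (simp add: rep_effect_rep5)
  have f5: "rep5 (?F 0) (?F 1) (?F 2) (?F 3) (?F 4) T h'" using f(1) by (simp add: rep_effect_rep5)
  note ng = nice_rep5[OF g(2) g5 t(1)] and nf = nice_rep5[OF f(2) f5 t(2)]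
  have f5': "rep5 (?F 0) (?F 1) (?F 2) (?F 3) (?F 4) (?G 0) h'" using f5 ng(1) by simp
  note c = rep5_comp[OF g5 f5' ng(2)]
  have cb: "(?G 2 + ?F 1 * ?G 4 + ?F 2) + (?F 3 * ?G 4 + ?F 4) \<le> K1 + K2"
    using rep5_comp_bounds(2)[OF g5 f5' ng(2) nf(2)] ng(3) nf(3) by linarith
  have b1: "?F 0 \<le> 1" "?G 1 + ?F 1 * ?G 3 \<le> 1" "?F 3 * ?G 3 \<le> 1" using c unfolding rep5_def by blast+
  show ?thesis unfolding comp5_def
    by (subst wp_put5) (use av cb b1 M Q[OF c] in \<open>simp_all add: idx5_def\<close>)
qed

definition put3 :: "string \<Rightarrow> string \<Rightarrow> string \<Rightarrow> aexp \<Rightarrow> aexp \<Rightarrow> aexp \<Rightarrow> aexp \<Rightarrow> com" where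
  "put3 a1 a2 a3 e x1 x2 x3 = seq [Assign a1 e x1, Assign a2 e x2, Assign a3 e x3]"

text \<open>Recovers the block number from an address. Each array has blocks of fixed size, one per
  vertex and state, so the disjointness of frames becomes a comparison of quotients.\<close>

lemma block_eq: "k < s \<Longrightarrow> (r * s + k) div s = (r :: nat)"
  by (intro div_nat_eqI) (auto simp: algebra_simps)

lemma block_mult: "k < s \<Longrightarrow> c < l \<Longrightarrow> (l * (r * s + k) + c) div (l * s) = (r :: nat)"
proof -
  assume "k < s" "c < l"
  have "l * k + c < l * k + l" using \<open>c < l\<close> by simp
  also have "\<dots> \<le> l * s" using \<open>k < s\<close> mult_le_mono2[of "Suc k" s l] by simp
  finally have "(r * (l * s) + (l * k + c)) div (l * s) = r" by (rule block_eq)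
  moreover have "l * (r * s + k) + c = r * (l * s) + (l * k + c)" by (simp add: algebra_simps)
  ultimately show ?thesis by (simp only:)
qed

lemma rep_edge_cong:
  assumes "m' ''tgtv'' j = m ''tgtv'' j" "m' ''tgtq'' j = m ''tgtq'' j" "m' ''tgtk'' j = m ''tgtk'' j"
    "\<And>c. c < 5 \<Longrightarrow> m' ''dec'' (5 * j + c) = m ''dec'' (5 * j + c)"
  shows "rep_edge m' j t yf \<longleftrightarrow> rep_edge m j t yf"
  using assms(4)[of 0] assms(4)[of 1] assms(4)[of 2] assms(4)[of 3] assms(4)[of 4]
  by (simp add: rep_edge_def rep_effect_rep5 assms(1-3))

lemma rep_leaf_cong:
  assumes "m' ''omegav'' j = m ''omegav'' j" "m' ''omegaq'' j = m ''omegaq'' j" "m' ''omegak'' j = m ''omegak'' j"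
    "\<And>c. c < 5 \<Longrightarrow> m' ''gamma'' (5 * j + c) = m ''gamma'' (5 * j + c)"
  shows "rep_leaf m' j t z f \<longleftrightarrow> rep_leaf m j t z f"
  using assms(4)[of 0] assms(4)[of 1] assms(4)[of 2] assms(4)[of 3] assms(4)[of 4]
  by (simp add: rep_leaf_def rep_effect_rep5 assms(1-3))

text \<open>The cells on which \<open>rep_at\<close> depends for the row
  \<open>r = v * n + q\<close>. The factor 10 for \<open>dec\<close> is two edges of five cells
  each.\<close>

definition reads :: "nat \<Rightarrow> nat \<Rightarrow> (string \<times> nat) set" where
  "reads n r = {(x, i). x \<in> {''confE'', ''confA'', ''confU'', ''ordlen''} \<and> i = r \<or>
     x \<in> {''ordq1'', ''ordq2''} \<and> i div (n * n) = r \<or>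
     x \<in> {''status'', ''omegav'', ''omegaq'', ''omegak''} \<and> i div (2 * n + 1) = r \<or>
     x \<in> {''tgtv'', ''tgtq'', ''tgtk''} \<and> i div (2 * (2 * n + 1)) = r \<or>
     x = ''dec'' \<and> i div (10 * (2 * n + 1)) = r \<or> x = ''gamma'' \<and> i div (5 * (2 * n + 1)) = r}"

context enum_extension
begin

text \<open>Keeps each list of quadruples inside its block of \<open>n * n\<close> cells.\<close>

lemma card_quads_le: "card (quads D' B v q) \<le> n * n"
proof -
  have "length (quad_list n D' B v q) \<le> length (List.product [0..<n] [0..<n])"
    unfolding quad_list_def by (rule length_filter_le)
  then show ?thesis using distinct_card[OF quad_list(1)[of v q]] unfolding quad_list(2) by simp
qed

lemma rep_at_cong:
  assumes r: "rep_at D' B X' n m v q" and eq: "\<And>x i. (x, i) \<in> reads n (v * n + q) \<Longrightarrow> m' x i = m x i"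
  shows "rep_at D' B X' n m' v q"
proof -
  let ?r = "v * n + q"
  have conf: "m' x ?r = m x ?r" if "x \<in> {''confE'', ''confA'', ''confU'', ''ordlen''}" for x
    using that by (intro eq) (auto simp: reads_def)
  have i: "pnode_index n v q k = ?r * (2 * n + 1) + k" for k by (simp add: pnode_index_def)
  have st: "m' x (pnode_index n v q k) = m x (pnode_index n v q k)"
    if "k \<le> 2 * n" "x \<in> {''status'', ''omegav'', ''omegaq'', ''omegak''}" for x k
    using that block_eq[of k "2 * n + 1" ?r] unfolding i by (intro eq) (auto simp: reads_def)
  have tg: "m' x (2 * pnode_index n v q k + c) = m x (2 * pnode_index n v q k + c)"
    if "k \<le> 2 * n" "c < 2" "x \<in> {''tgtv'', ''tgtq'', ''tgtk''}" for x k c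
    using that block_mult[of k "2 * n + 1" c 2 ?r] unfolding i by (intro eq) (auto simp: reads_def)
  have de: "m' ''dec'' (5 * (2 * pnode_index n v q k + c) + c') = m ''dec'' (5 * (2 * pnode_index n v q k + c) + c')"
    if "k \<le> 2 * n" "c < 2" "c' < 5" for k c c'
    using that block_mult[of k "2 * n + 1" "5 * c + c'" 10 ?r] unfolding i by (intro eq) (auto simp: reads_def algebra_simps)
  have ga: "m' ''gamma'' (5 * pnode_index n v q k + c) = m ''gamma'' (5 * pnode_index n v q k + c)"
    if "k \<le> 2 * n" "c < 5" for k c
    using that block_mult[of k "2 * n + 1" c 5 ?r] unfolding i by (intro eq) (auto simp: reads_def)
  have ed: "rep_edge m' (2 * pnode_index n v q k + c) t yf \<longleftrightarrow> rep_edge m (2 * pnode_index n v q k + c) t yf"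
    if "k \<le> 2 * n" "c < 2" for k c t yf
    using tg de that by (intro rep_edge_cong) auto
  have ed0: "rep_edge m' (2 * pnode_index n v q k) t yf \<longleftrightarrow> rep_edge m (2 * pnode_index n v q k) t yf"
    if "k \<le> 2 * n" for k t yf using ed[OF that, of 0] by simp
  have le: "rep_leaf m' (pnode_index n v q k) t z f \<longleftrightarrow> rep_leaf m (pnode_index n v q k) t z f"
    if "k \<le> 2 * n" for k t z f
    using st ga that by (intro rep_leaf_cong) auto
  have dn: "dir_num d < 2" for d by (cases d) auto
  have oq: "m' x (?r * (n * n) + i) = m x (?r * (n * n) + i)" if "i < n * n" "x \<in> {''ordq1'', ''ordq2''}" for i x
    using that block_eq[of i "n * n" ?r] by (intro eq) (auto simp: reads_def)
  have ord: "(\<exists>xs. distinct xs \<and> set xs = quads D' B v q \<and>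
           sorted_wrt (\<lambda>x y. (x, y) \<in> ds_order X' v q) xs \<and> m' ''ordlen'' ?r = length xs \<and>
           (\<forall>i < length xs. \<exists>v1 v2. xs ! i = (v1, m' ''ordq1'' (?r * (n * n) + i), v2, m' ''ordq2'' (?r * (n * n) + i))))"
    if "(\<exists>xs. distinct xs \<and> set xs = quads D' B v q \<and>
           sorted_wrt (\<lambda>x y. (x, y) \<in> ds_order X' v q) xs \<and> m ''ordlen'' ?r = length xs \<and>
           (\<forall>i < length xs. \<exists>v1 v2. xs ! i = (v1, m ''ordq1'' (?r * (n * n) + i), v2, m ''ordq2'' (?r * (n * n) + i))))"
  proof -
    from that obtain xs where xs: "distinct xs" "set xs = quads D' B v q"
      "sorted_wrt (\<lambda>x y. (x, y) \<in> ds_order X' v q) xs" "m ''ordlen'' ?r = length xs"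
      "\<forall>i < length xs. \<exists>v1 v2. xs ! i = (v1, m ''ordq1'' (?r * (n * n) + i), v2, m ''ordq2'' (?r * (n * n) + i))" by blast
    have "length xs \<le> n * n" using card_quads_le[of v q] distinct_card[OF xs(1)] unfolding xs(2) by simp
    with xs oq conf show ?thesis by (intro exI[of _ xs]) auto
  qed
  show ?thesis unfolding rep_at_def Let_def
  proof (intro conjI allI impI)
    fix k assume k: "k \<le> 2 * n"
    note R = r[unfolded rep_at_def Let_def, THEN conjunct2, THEN conjunct2, THEN conjunct2, THEN conjunct2, rule_format, OF k]
    show "m' ''status'' (pnode_index n v q k) = (if pnode v q k \<in> ds_nodes X' then if \<exists>d y f. (pnode v q k, d, y, f) \<in> ds_edges X' then 2 else 1
        else if \<exists>y f. (pnode v q k, y, f) \<in> ds_table X' then 3 else 0)" using R st[OF k] by simp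
    show "rep_edge m' (2 * pnode_index n v q k + dir_num d) (vtype D' v) (y, f)" if "(pnode v q k, d, y, f) \<in> ds_edges X'" for d y f
      using R that unfolding ed[OF k dn] by blast
    show "rep_edge m' (2 * pnode_index n v q k) (vtype D' v) (y, f)" if "(pnode v q k, y, f) \<in> ds_table X'" for y f
      using R that unfolding ed0[OF k] by blast
    show "rep_leaf m' (pnode_index n v q k) (vtype D' v) (ds_omega X' (pnode v q k)) (ds_gamma X' (pnode v q k))"
      if "pnode v q k \<in> ds_nodes X'" using R that unfolding le[OF k] by blast
  next
    assume u: "(v, q) \<in> ds_conf_u X'" "\<not> is_leaf D' v"
    show "\<exists>xs. distinct xs \<and> set xs = quads D' B v q \<and>
           sorted_wrt (\<lambda>x y. (x, y) \<in> ds_order X' v q) xs \<and> m' ''ordlen'' ?r = length xs \<and>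
           (\<forall>i < length xs. \<exists>v1 v2. xs ! i = (v1, m' ''ordq1'' (?r * (n * n) + i), v2, m' ''ordq2'' (?r * (n * n) + i)))"
      using r u unfolding rep_at_def by (intro ord) blast
  qed (use r conf in \<open>auto simp: rep_at_def\<close>)
qed

end

text \<open>The assumption \<open>new_child\<close> is what makes descending vertex numbers an
  admissible order of computation. The bound \<open>b ^ 8\<close> leaves room for node indices,
  which are below \<open>b ^ 4\<close>, and for constants of composed effects, which are below
  \<open>b ^ 2\<close>.\<close>

locale enum_run = enum_extension D D' B n X ol
  for D D' :: "(nat, 'a label) rooted_bdag" and B :: "(nat, 'a label) dbuta" and n X ol +
  fixes code :: "'a \<Rightarrow> nat" and m0 :: mem and b M K N0 N1 :: nat
  assumes verts_D: "verts D = {..<N0}" and verts_D': "verts D' = {..<N1}"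
    and slp: "rep_slp code D' m0" and sizes: "rep_sizes D' m0" and N0_cell: "m0 ''N0'' 0 = N0"
    and dbuta_cells: "rep_dbuta code B m0" and ds: "rep_enum_ds D B X m0"
    and new_child: "\<And>v d. v \<in> verts D' \<Longrightarrow> N0 \<le> v \<Longrightarrow> \<not> is_leaf D' v \<Longrightarrow> child D' v d < N0 \<or> v < child D' v d"
    and N1: "N1 < b" and n: "n < b" and leaf_sizes: "\<And>v. v \<in> verts D' \<Longrightarrow> leaf_size D' v \<le> b"
    and M: "b ^ 8 \<le> M" and b: "16 \<le> b" and K: "60 \<le> K"
begin

lemma n_cell: "m0 ''Q'' 0 = n"
proof -
  have "states B = {..<m0 ''Q'' 0}" using dbuta_cells by (simp add: rep_dbuta_def Let_def)
  then show ?thesis using states by simp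
qed

lemma delta_cells:
  "m0 ''delta0'' (4 * code a + of_bool c) = delta0 B (Sym a) c"
  "m0 ''delta0'' (4 * code a + 2 + of_bool c) = delta0 B (SymStar a) c"
  "p < n \<Longrightarrow> q < n \<Longrightarrow> m0 ''delta2'' (2 * (p * n + q)) = delta2 B p q HCat"
  "p < n \<Longrightarrow> q < n \<Longrightarrow> m0 ''delta2'' (2 * (p * n + q) + 1) = delta2 B p q VComp"
  using dbuta_cells unfolding rep_dbuta_def Let_def n_cell by blast+

lemma state_less: "q \<in> states B \<Longrightarrow> q < n"
  using states by simp

lemma b_pow: "b ^ i \<le> M" if "i \<le> 8"
  using power_increasing[OF that, of b] b M by linarith

lemma M16: "16 \<le> M" using b_pow[of 1] b by simp

lemma index_less: "v < N1 \<Longrightarrow> q < n \<Longrightarrow> v * n + q < N1 * n"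
proof -
  assume "v < N1" "q < n"
  then have "v * n + q < Suc v * n" by simp
  also have "\<dots> \<le> N1 * n" using \<open>v < N1\<close> by (intro mult_le_mono1) simp
  finally show ?thesis .
qed

lemma r_less: "v < N1 \<Longrightarrow> q < n \<Longrightarrow> v * n + q < M"
proof -
  assume "v < N1" "q < n"
  then have "v * n + q < N1 * n" by (rule index_less)
  also have "\<dots> \<le> b ^ 2" unfolding power2_eq_square using N1 n by (intro mult_le_mono) auto
  also have "\<dots> \<le> M" by (rule b_pow) simp
  finally show ?thesis .
qed

lemma pnode_index_less: "v < N1 \<Longrightarrow> q < n \<Longrightarrow> k \<le> 2 * n \<Longrightarrow> (v * n + q) * (2 * n + 1) + k < M"
proof -
  assume v: "v < N1" "q < n" "k \<le> 2 * n"
  have "(v * n + q) * (2 * n + 1) + k < Suc (v * n + q) * (2 * n + 1)" using v by simp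
  also have "\<dots> \<le> (b * b) * (b * b)"
  proof (rule mult_le_mono)
    have "Suc (v * n + q) \<le> N1 * n" using index_less[OF v(1,2)] by simp
    also have "\<dots> \<le> b * b" using N1 n by (intro mult_le_mono) auto
    finally show "Suc (v * n + q) \<le> b * b" .
    have "2 * n + 1 \<le> 3 * b" using n by simp
    also have "\<dots> \<le> b * b" using b by (intro mult_le_mono1) simp
    finally show "2 * n + 1 \<le> b * b" .
  qed
  also have "\<dots> = b ^ 4" by (simp add: power4_eq_xxxx mult.assoc)
  also have "\<dots> \<le> M" by (rule b_pow) simp
  finally show ?thesis .
qed

lemma small_less: "x \<le> 4 * b \<Longrightarrow> x < M" 
proof -
  assume "x \<le> 4 * b"
  also have "4 * b < b * b" using b by simp
  also have "b * b \<le> M" using b_pow[of 2] by (simp add: power2_eq_square)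
  finally show ?thesis .
qed

text \<open>With \<open>b\<close> as bound for the leaf sizes, \<open>rank D' v * b\<close> is the
  largest constant that \<open>good\<close> admits in an effect that starts at
  \<open>v\<close>.\<close>

lemma rank_bound: "v \<in> verts D' \<Longrightarrow> rank D' v * b < M"
proof -
  assume "v \<in> verts D'"
  then have "rank D' v < N1" using new.rank_less_card[of v] by (simp add: verts_D')
  then have "rank D' v * b < b * b" using N1 b by simp
  also have "\<dots> \<le> M" using b_pow[of 2] by (simp add: power2_eq_square)
  finally show ?thesis .
qed

lemma good_bound:
  assumes "good D' b x z f" "vert x \<in> verts D'"
  obtains K1 where "nice (vtype D' (vert x)) (vtype D' (vert z)) K1 f" "K1 + rank D' (vert z) * b \<le> rank D' (vert x) * b"
  using assms by (auto simp: good_def)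

definition finished :: "mem \<Rightarrow> nat \<Rightarrow> bool" where
  "finished m u \<longleftrightarrow> (\<forall>p < n. rep_at D' B X' n m u p) \<and>
     (\<forall>d. \<not> is_leaf D' u \<longrightarrow> rep_effect (m ''effect'') (2 * u + dir_num d) (vtype D' u) (edge_effect D' u d))"

lemma finished_old: "u < N0 \<Longrightarrow> finished m0 u"
proof -
  assume "u < N0"
  then have u: "u \<in> verts D" by (simp add: verts_D)
  have nc: "card (states B) = n" using states by simp
  have "ds_conf_u X \<subseteq> verts D \<times> {..<card (states B)}"
    using old.conf_u_D old.conf_a_D states by (auto simp: conf_X nc dest!: old.conf_u_D old.conf_a_D)
  from ds[unfolded rep_enum_ds_iff[OF this] nc]
  have 1: "\<forall>v \<in> verts D. \<forall>q < n. rep_at D B X n m0 v q"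
    and 2: "\<forall>(u, d, v) \<in> edges D. rep_effect (m0 ''effect'') (2 * u + dir_num d) (vtype D u) (ds_effect X u d)" by auto
  have eff: "\<forall>(u, d, v) \<in> edges D. ds_effect X u d = edge_effect D u d" using enum unfolding old.is_enum_ds_iff by blast
  show ?thesis unfolding finished_def
  proof (intro conjI allI impI)
    show "rep_at D' B X' n m0 u p" if "p < n" for p using 1 u that by (blast intro: rep_at_old)
    fix d assume "\<not> is_leaf D' u"
    then have l: "\<not> is_leaf D u" using leaf_eq[OF u] by simp
    then have "(u, d, child D u d) \<in> edges D" using old.child_edge[OF u] by blast
    then have "rep_effect (m0 ''effect'') (2 * u + dir_num d) (vtype D u) (edge_effect D u d)" using 2 eff by fastforce
    then show "rep_effect (m0 ''effect'') (2 * u + dir_num d) (vtype D' u) (edge_effect D' u d)"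
      by (simp add: sizes_eq[OF u] edge_effect_eq[OF u l])
  qed
qed

end

section \<open>Collecting the outgoing edges of a configuration\<close>

definition width :: aexp where
  "width = Add (Mul (Num 2) (reg ''Q'')) (Num 1)"

text \<open>Register \<open>i\<close> becomes the index of the child configuration, which is node 1
  of its block. For status 3 the table effect is composed with the edge effect; otherwise the child
  configuration is itself the target, hence the final \<open>Num 1\<close>.\<close>

definition emit :: "string \<Rightarrow> nat \<Rightarrow> com" where
  "emit c e = seq [set_reg ''i'' (Add (Mul (Add (Mul (reg c) (reg ''Q'')) (reg ''p'')) width) (Num 1)),
     Cond (Eq (Cell ''status'' (reg ''i'')) (Num 3))
       (Seq (comp5 ''od'' (reg ''d'') ''dec'' (Mul (Num 2) (reg ''i'')) ''effect'' (Add (Mul (Num 2) (reg ''v'')) (Num e)))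
         (put3 ''ov'' ''oq'' ''ok'' (reg ''d'') (Cell ''tgtv'' (Mul (Num 2) (reg ''i'')))
           (Cell ''tgtq'' (Mul (Num 2) (reg ''i''))) (Cell ''tgtk'' (Mul (Num 2) (reg ''i'')))))
       (Seq (copy5 ''od'' (reg ''d'') ''effect'' (Add (Mul (Num 2) (reg ''v'')) (Num e)))
         (put3 ''ov'' ''oq'' ''ok'' (reg ''d'') (reg c) (reg ''p'') (Num 1))),
     set_reg ''d'' (Add (reg ''d'') (Num 1))]"

text \<open>The right child contributes its state \<open>e2\<close> for the empty set, and
  \<open>h\<close> selects the transition table of the operation at the vertex.\<close>

definition left_test :: bexp where
  "left_test = Conj (Eq (Cell ''confA'' (Add (Mul (reg ''v1'') (reg ''Q'')) (reg ''p''))) (Num 1))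
     (Eq (Cell ''delta2'' (Add (Mul (Num 2) (Add (Mul (reg ''p'') (reg ''Q'')) (reg ''e2''))) (reg ''h''))) (reg ''q''))"

definition right_test :: bexp where
  "right_test = Conj (Eq (Cell ''confA'' (Add (Mul (reg ''v2'') (reg ''Q'')) (reg ''p''))) (Num 1))
     (Eq (Cell ''delta2'' (Add (Mul (Num 2) (Add (Mul (reg ''e1'') (reg ''Q'')) (reg ''p''))) (reg ''h''))) (reg ''q''))"

text \<open>The bound \<open>nb\<close> is 0 at a leaf and the number of states otherwise, so one
  program serves leaves and inner vertices.\<close>

definition gather :: "bexp \<Rightarrow> string \<Rightarrow> nat \<Rightarrow> com" where
  "gather t c e = for_loop ''p'' (reg ''nb'') (Cond t (emit c e) Skip)"

definition qframe :: "nat \<Rightarrow> nat \<Rightarrow> (string \<times> nat) set" where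
  "qframe n r = {(x, i). x \<in> {''p'', ''d'', ''r'', ''b'', ''i'', ''k'', ''j'', ''w1'', ''w2'', ''w3'', ''ov'', ''oq'', ''ok'', ''od'', ''og''} \<or>
     x \<in> {''confE'', ''confA''} \<and> i = r \<or>
     x \<in> {''status'', ''omegav'', ''omegaq'', ''omegak''} \<and> i div (2 * n + 1) = r \<or>
     x \<in> {''tgtv'', ''tgtq'', ''tgtk''} \<and> i div (2 * (2 * n + 1)) = r \<or>
     x = ''dec'' \<and> i div (10 * (2 * n + 1)) = r \<or> x = ''gamma'' \<and> i div (5 * (2 * n + 1)) = r}"

text \<open>Makes the initial memory available as a constant to which frame conditions can
  refer.\<close>

lemma ht_pointwise: "(\<And>m1. bd M m1 \<Longrightarrow> P m1 \<Longrightarrow> ht K M (\<lambda>m. m = m1) c T Q) \<Longrightarrow> ht K M P c T Q"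
  unfolding ht_def by blast

lemma wp_mono: "wp M c P m \<Longrightarrow> (\<And>m. P m \<Longrightarrow> Q m) \<Longrightarrow> wp M c Q m"
proof (induction c arbitrary: P Q m)
  case (Seq c1 c2)
  from Seq.prems(1) have "wp M c1 (wp M c2 P) m" by simp
  then have "wp M c1 (wp M c2 Q) m" by (rule Seq.IH(1)) (rule Seq.IH(2), assumption, rule Seq.prems(2))
  then show ?case by simp
next
  case (Cond b c1 c2)
  from Cond.prems(1) Cond.IH(1)[OF _ Cond.prems(2)] Cond.IH(2)[OF _ Cond.prems(2)] show ?case by (simp split: if_splits)
qed simp_all

locale vertex_run = enum_run D D' B n X ol code m0 b M K N0 N1
  for D D' :: "(nat, 'a label) rooted_bdag" and B n X ol and code :: "'a \<Rightarrow> nat" and m0 b M K N0 N1 +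
  fixes v :: nat
  assumes v: "N0 \<le> v" "v < N1"
begin

lemma vD': "v \<in> verts D'" and vD: "v \<notin> verts D"
  using v by (auto simp: verts_D verts_D')

abbreviation t where "t \<equiv> vtype D' v"
abbreviation inner where "inner \<equiv> \<not> is_leaf D' v"

lemma t_le: "t \<le> 1" by (rule new.vtype_le)

lemma child_v: "inner \<Longrightarrow> child D' v d \<in> verts D' \<and> child D' v d < N1 \<and> (child D' v d < N0 \<or> v < child D' v d)"
  using new_child[OF vD' v(1)] new.child_verts[OF vD'] verts_D' by auto

definition done_verts :: "mem \<Rightarrow> bool" where
  "done_verts m \<longleftrightarrow> (\<forall>u \<in> verts D'. u < N0 \<or> v < u \<longrightarrow> finished m u)"

text \<open>What the loop over the states may rely on: the data of the vertex as a whole, and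
  \<open>confU\<close> and the order lists for all of its states, which are filled beforehand in one
  pass.\<close>

definition ready :: "mem \<Rightarrow> bool" where
  "ready m \<longleftrightarrow> m ''Q'' 0 = n \<and> m ''v'' 0 = v \<and> m ''type'' v = t \<and> done_verts m \<and>
     m ''e'' 0 = ce D' B v \<and> m ''nb'' 0 = (if inner then n else 0) \<and>
     (inner \<longrightarrow> m ''v1'' 0 = child D' v L \<and> m ''v2'' 0 = child D' v R \<and>
        m ''e1'' 0 = ce D' B (child D' v L) \<and> m ''e2'' 0 = ce D' B (child D' v R) \<and>
        (\<forall>p < n. \<forall>q < n. m ''delta2'' (2 * (p * n + q) + m ''h'' 0) = delta2 B p q (label D' v)) \<and>
        (\<forall>d. rep_effect (m ''effect'') (2 * v + dir_num d) t (edge_effect D' v d))) \<and>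
     (\<forall>q < n. m ''confU'' (v * n + q) = of_bool ((v, q) \<in> conf_u D' B) \<and>
        (inner \<longrightarrow> m ''ordlen'' (v * n + q) = length (quad_list n D' B v q) \<and>
          (\<forall>i < length (quad_list n D' B v q). quad_list n D' B v q ! i =
             (m ''ordq1'' ((v * n + q) * (n * n) + i), m ''ordq2'' ((v * n + q) * (n * n) + i)))))"

lemma index_neq: "u \<noteq> v \<Longrightarrow> p < n \<Longrightarrow> q < n \<Longrightarrow> u * n + p \<noteq> v * n + q"
  by (metis block_eq)

lemma finished_cong:
  assumes "finished m u" "same Fr m m'"
    and "\<And>p. p < n \<Longrightarrow> reads n (u * n + p) \<inter> Fr = {}" "\<And>i. i div 10 = u \<Longrightarrow> (''effect'', i) \<notin> Fr"
  shows "finished m' u"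
proof -
  have eq: "m' x i = m x i" if "(x, i) \<notin> Fr" for x i using sameD[OF assms(2) that] .
  have eff: "rep_effect (m' ''effect'') (2 * u + dir_num d) tt f \<longleftrightarrow> rep_effect (m ''effect'') (2 * u + dir_num d) tt f" for d tt f
  proof -
    have "m' ''effect'' (5 * (2 * u + dir_num d) + c) = m ''effect'' (5 * (2 * u + dir_num d) + c)" if "c < 5" for c
      using that by (intro eq assms(4)) (cases d; simp)
    from this[of 0] this[of 1] this[of 2] this[of 3] this[of 4] show ?thesis by (simp add: rep_effect_rep5)
  qed
  show ?thesis unfolding finished_def
  proof (intro conjI allI impI)
    show "rep_at D' B X' n m' u p" if p: "p < n" for p
    proof (rule rep_at_cong)
      show "rep_at D' B X' n m u p" using assms(1) p by (simp add: finished_def)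
      fix x i assume "(x, i) \<in> reads n (u * n + p)"
      then have "(x, i) \<notin> Fr" using assms(3)[OF p] by blast
      then show "m' x i = m x i" by (rule eq)
    qed
  qed (use assms(1) in \<open>auto simp: finished_def eff\<close>)
qed

lemma reads_qframe: "r' \<noteq> r \<Longrightarrow> reads n r' \<inter> qframe n r = {}"
  by (auto simp: reads_def qframe_def)

text \<open>The work on one state writes only to scratch arrays and to its own row, whereas
  \<open>ready\<close> concerns other arrays and the rows of other vertices.\<close>

lemma ready_same:
  assumes "ready m" "same (qframe n (v * n + q)) m m'" "q < n"
  shows "ready m'"
proof -
  have eq: "m' x = m x" if "x \<in> {''Q'', ''v'', ''type'', ''e'', ''nb'', ''v1'', ''v2'', ''e1'', ''e2'', ''delta2'', ''h'', ''effect'', ''confU'', ''ordlen'', ''ordq1'', ''ordq2''}" for x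
    using sameD[OF assms(2), of x] that by (intro ext) (auto simp: qframe_def)
  have "done_verts m'" unfolding done_verts_def
  proof (intro ballI impI)
    fix u assume u: "u \<in> verts D'" "u < N0 \<or> v < u"
    have "done_verts m" using assms(1) by (simp add: ready_def)
    with u have "finished m u" unfolding done_verts_def by blast
    then show "finished m' u"
    proof (rule finished_cong[OF _ assms(2)])
      show "reads n (u * n + p) \<inter> qframe n (v * n + q) = {}" if "p < n" for p
        using u(2) v(1) that assms(3) by (intro reads_qframe index_neq) auto
      show "(''effect'', i) \<notin> qframe n (v * n + q)" for i by (simp add: qframe_def)
    qed
  qed
  then show ?thesis using assms(1) unfolding ready_def by (simp add: eq)
qed

definition Out :: "mem \<Rightarrow> ((nat, nat) pnode \<times> effect) list \<Rightarrow> bool" where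
  "Out m xs \<longleftrightarrow> m ''d'' 0 = length xs \<and> (\<forall>j < length xs.
     fst (xs ! j) = pnode (m ''ov'' j) (m ''oq'' j) (m ''ok'' j) \<and> rep_effect (m ''od'') j t (snd (xs ! j)))"

lemma Out_snoc:
  assumes "Out m xs" "rep5 x0 x1 x2 x3 x4 t f" "y = pnode a1 a2 a3"
  shows "Out (upd (upd (upd (upd (set5 m ''od'' (length xs) x0 x1 x2 x3 x4) ''ov'' (length xs) a1) ''oq'' (length xs) a2) ''ok'' (length xs) a3)
    ''d'' 0 (Suc (length xs))) (xs @ [(y, f)])"
  using assms by (auto simp: Out_def nth_append upd_other rep_effect_set5 less_Suc_eq)

definition eframe :: "(string \<times> nat) set" where
  "eframe = {(x, i). x \<in> {''d'', ''i'', ''ov'', ''oq'', ''ok'', ''od''}}"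

lemma entry_facts:
  assumes "o' \<in> options D' B v q"
  shows "good D' b (Conf v q) (fst (entry D' B v q o')) (snd (entry D' B v q o'))"
  using leaf_sizes assms by (rule new.good_entry)

lemma emit_wp:
  assumes m: "bd M m" "ready m" "Out m xs" "length xs \<le> 2 * n" and inn: inner
    and mv: "(d, p) \<in> moves D' B v q" and p: "m ''p'' 0 = p" and c: "m c 0 = child D' v d" "c = ''v1'' \<or> c = ''v2''"
  shows "wp M (emit c (dir_num d)) (\<lambda>m'. same eframe m m' \<and> Out m' (xs @ [entry D' B v q (Some (d, p))])) m"
proof -
  let ?c = "child D' v d"
  have ca: "(?c, p) \<in> conf_a D' B" using mv by (auto simp: moves_def)
  have pn: "p < n" using conf_a_n[OF ca] by simp
  have "done_verts m" using m(2) by (simp add: ready_def)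
  with child_v[OF inn, of d] have fin: "finished m ?c" unfolding done_verts_def by blast
  then have ra: "rep_at D' B X' n m ?c p" using pn by (simp add: finished_def)
  have cN: "?c < N1" using child_v[OF inn] by simp
  define i where "i = pnode_index n ?c p 1"
  have i: "i = (?c * n + p) * (2 * n + 1) + 1" by (simp add: i_def pnode_index_def)
  have iM: "i < M" unfolding i using pnode_index_less[OF cN pn, of 1] pn by simp
  have regs: "m ''Q'' 0 = n" "m ''v'' 0 = v" "m ''d'' 0 = length xs" using m(2,3) by (simp_all add: ready_def Out_def)
  have lt: "m x j < M" for x j using m(1) by (simp add: bd_def)
  have cM: "?c < M" using lt[of c 0] c(1) by simp
  have pM: "p < M" using lt[of "''p''" 0] p by simp
  have eff: "rep_effect (m ''effect'') (2 * v + dir_num d) t (edge_effect D' v d)" using m(2) inn by (simp add: ready_def)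
  have lM: "Suc (length xs) < M" using small_less[of "Suc (length xs)"] m(4) n by simp
  have ne: "nice t (vtype D' ?c) b (edge_effect D' v d)"
    using new.nice_edge_effect[OF vD' inn leaf_sizes] .
  define m1 where "m1 = upd m ''i'' 0 i"
  have m1o: "m1 x = m x" if "x \<noteq> ''i''" for x using that by (simp add: m1_def upd_other)
  have m1i: "m1 ''i'' 0 = i" by (simp add: m1_def)
  have sm1: "same eframe m m1" unfolding m1_def by (intro same_upd same_refl) (simp add: eframe_def)
  have O1: "Out m1 xs" using m(3) by (simp add: Out_def m1o)
  have bd1: "bd M m1" using m(1) iM by (simp add: m1_def bd_upd)
  have fin: "same eframe m (upd (upd (upd (upd (set5 m1 ''od'' (length xs) x0 x1 x2 x3 x4) ''ov'' (length xs) a1) ''oq'' (length xs) a2) ''ok'' (length xs) a3)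
    ''d'' 0 (Suc (length xs)))" for x0 x1 x2 x3 x4 a1 a2 a3
    by (intro same_upd same_set5 sm1) (simp_all add: eframe_def)
  have set_i: "wp M (set_reg ''i'' (Add (Mul (Add (Mul (reg c) (reg ''Q'')) (reg ''p'')) width) (Num 1))) Q m = Q m1" for Q
    using iM by (simp add: set_reg_def reg_def width_def regs c p m1_def i)
  have cne: "c \<noteq> ''i''" using c(2) by auto
  show ?thesis
  proof (cases "m ''status'' i = 3")
    case True
    note re = resolve_rep(1)[OF ca ra, folded i_def, OF True]
    define z f where "z = fst (resolve D' B (Conf ?c p))" and "f = snd (resolve D' B (Conf ?c p))"
    have z: "z = pnode (m ''tgtv'' (2 * i)) (m ''tgtq'' (2 * i)) (m ''tgtk'' (2 * i))"
      and f: "rep_effect (m ''dec'') (2 * i) (vtype D' ?c) f" using re by (simp_all add: rep_edge_def z_def f_def)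
    have ent: "entry D' B v q (Some (d, p)) = (z, f \<circ> edge_effect D' v d)"
      by (simp add: entry_def opt_target_def opt_effect_def z_def f_def)
    have gf: "good D' b (Conf ?c p) z f" unfolding z_def f_def by (rule new.good_resolve) (rule leaf_sizes)
    then obtain K1 where K1: "nice (vtype D' ?c) (vtype D' (vert z)) K1 f" "K1 + rank D' (vert z) * b \<le> rank D' ?c * b"
      using good_bound[of "Conf ?c p" z f] child_v[OF inn, of d] by auto
    \<comment> \<open>The drop of the rank from \<open>v\<close> to its child pays for the edge
      effect, whose constants sum up to at most \<open>b\<close>.\<close>
    have "rank D' ?c * b + b \<le> rank D' v * b"
      using new.rank_child_less[OF vD' inn, of d] mult_le_mono1[of "Suc (rank D' ?c)" "rank D' v" b] by simp
    then have KM: "b + K1 < M" using K1(2) rank_bound[OF vD'] by simp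
    have br: "wp M (comp5 ''od'' (reg ''d'') ''dec'' (Mul (Num 2) (reg ''i'')) ''effect'' (Add (Mul (Num 2) (reg ''v'')) (Num (dir_num d))))
      (wp M (put3 ''ov'' ''oq'' ''ok'' (reg ''d'') (Cell ''tgtv'' (Mul (Num 2) (reg ''i'')))
           (Cell ''tgtq'' (Mul (Num 2) (reg ''i''))) (Cell ''tgtk'' (Mul (Num 2) (reg ''i''))))
        (wp M (set_reg ''d'' (Add (reg ''d'') (Num 1))) (\<lambda>m'. same eframe m m' \<and> Out m' (xs @ [entry D' B v q (Some (d, p))])))) m1"
    proof (rule wp_comp5[OF bd1])
      show "rep_effect (m1 ''effect'') (aval (Add (Mul (Num 2) (reg ''v'')) (Num (dir_num d))) m1) t (edge_effect D' v d)"
        using eff by (simp add: reg_def m1o regs)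
      show "nice t (vtype D' ?c) b (edge_effect D' v d)" by (rule ne)
      show "rep_effect (m1 ''dec'') (aval (Mul (Num 2) (reg ''i'')) m1) (vtype D' ?c) f" using f by (simp add: reg_def m1_def upd_other)
      show "nice (vtype D' ?c) (vtype D' (vert z)) K1 f" by (rule K1(1))
      show "b + K1 < M" by (rule KM)
      fix x0 x1 x2 x3 x4 assume r5: "rep5 x0 x1 x2 x3 x4 t (f \<circ> edge_effect D' v d)"
      show "wp M (put3 ''ov'' ''oq'' ''ok'' (reg ''d'') (Cell ''tgtv'' (Mul (Num 2) (reg ''i'')))
           (Cell ''tgtq'' (Mul (Num 2) (reg ''i''))) (Cell ''tgtk'' (Mul (Num 2) (reg ''i''))))
        (wp M (set_reg ''d'' (Add (reg ''d'') (Num 1))) (\<lambda>m'. same eframe m m' \<and> Out m' (xs @ [entry D' B v q (Some (d, p))])))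
         (set5 m1 ''od'' (aval (reg ''d'') m1) x0 x1 x2 x3 x4)"
        using fin Out_snoc[OF O1 r5 z] lM lt m1i
        by (simp add: put3_def set_reg_def reg_def m1o regs ent)
    qed (use t_le new.vtype_le[of ?c] M16 in \<open>simp_all add: reg_def\<close>)
    then show ?thesis unfolding emit_def seq.simps wp.simps set_i
      using True m1i by (simp add: reg_def m1o)
  next
    case False
    note re = resolve_rep(2)[OF ca ra, folded i_def, OF False]
    have ent: "entry D' B v q (Some (d, p)) = (pnode ?c p 1, edge_effect D' v d)"
      by (simp add: entry_def opt_target_def opt_effect_def re pnode_def)
    have eff5: "rep5 (m ''effect'' (5 * (2 * v + dir_num d))) (m ''effect'' (5 * (2 * v + dir_num d) + 1)) (m ''effect'' (5 * (2 * v + dir_num d) + 2))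
       (m ''effect'' (5 * (2 * v + dir_num d) + 3)) (m ''effect'' (5 * (2 * v + dir_num d) + 4)) t (edge_effect D' v d)"
      using eff by (simp add: rep_effect_rep5)
    have ok: "c \<noteq> ''od''" "c \<noteq> ''ov''" "c \<noteq> ''oq''" "c \<noteq> ''i''" "c \<noteq> ''ok''" using c(2) by auto
    have "wp M (copy5 ''od'' (reg ''d'') ''effect'' (Add (Mul (Num 2) (reg ''v'')) (Num (dir_num d))))
      (wp M (put3 ''ov'' ''oq'' ''ok'' (reg ''d'') (reg c) (reg ''p'') (Num 1))
        (wp M (set_reg ''d'' (Add (reg ''d'') (Num 1))) (\<lambda>m'. same eframe m m' \<and> Out m' (xs @ [entry D' B v q (Some (d, p))])))) m1"
      using fin Out_snoc[OF O1 eff5 refl, of ?c p 1] cM pM lM lt M16 ok not_sym[OF ok(1)] not_sym[OF ok(2)] not_sym[OF ok(3)] not_sym[OF ok(5)]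
      by (subst wp_copy5) (simp_all add: put3_def set_reg_def reg_def m1o regs ent c(1) p Let_def)
    then show ?thesis unfolding emit_def seq.simps wp.simps set_i
      using False m1i by (simp add: reg_def m1o)
  qed
qed

lemma child_confA:
  assumes "done_verts m" inner "p < n"
  shows "m ''confA'' (child D' v d * n + p) = of_bool ((child D' v d, p) \<in> conf_a D' B)"
    and "m ''confE'' (child D' v d * n + p) = of_bool (p = ce D' B (child D' v d))"
proof -
  have "finished m (child D' v d)" using assms child_v[OF assms(2), of d] unfolding done_verts_def by blast
  then have "rep_at D' B X' n m (child D' v d) p" using assms(3) by (simp add: finished_def)
  then show "m ''confA'' (child D' v d * n + p) = of_bool ((child D' v d, p) \<in> conf_a D' B)"
    and "m ''confE'' (child D' v d * n + p) = of_bool (p = ce D' B (child D' v d))"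
    using child_v[OF assms(2), of d] by (simp_all add: rep_at_def conf_X new.conf_empty_iff)
qed

lemma ce_child: "inner \<Longrightarrow> ce D' B (child D' v d) < n"
  using child_v new.ce_states state_less by blast

lemma tests:
  assumes m: "ready m" "m ''q'' 0 = q" "m ''p'' 0 = p" and inn: inner and p: "p < n"
  shows "bval left_test m \<longleftrightarrow> (L, p) \<in> moves D' B v q" "bval right_test m \<longleftrightarrow> (R, p) \<in> moves D' B v q"
proof -
  have d: "done_verts m" using m(1) by (simp add: ready_def)
  have r: "m ''Q'' 0 = n" "m ''v1'' 0 = child D' v L" "m ''v2'' 0 = child D' v R"
        "m ''e1'' 0 = ce D' B (child D' v L)" "m ''e2'' 0 = ce D' B (child D' v R)"
        "\<And>p q. p < n \<Longrightarrow> q < n \<Longrightarrow> m ''delta2'' (2 * (p * n + q) + m ''h'' 0) = delta2 B p q (label D' v)"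
    using m(1) inn by (simp_all add: ready_def)
  show "bval left_test m \<longleftrightarrow> (L, p) \<in> moves D' B v q"
    using r(6)[OF p ce_child[OF inn, of R]] by (simp add: left_test_def reg_def r(1-5) m child_confA(1)[OF d inn p] moves_def vD' inn)
  show "bval right_test m \<longleftrightarrow> (R, p) \<in> moves D' B v q"
    using r(6)[OF ce_child[OF inn, of L] p] by (simp add: right_test_def reg_def r(1-5) m child_confA(1)[OF d inn p] moves_def vD' inn)
qed

definition gframe :: "(string \<times> nat) set" where
  "gframe = insert (''p'', 0) eframe"

lemma eframe_gframe: "eframe \<subseteq> gframe" by (auto simp: gframe_def)
lemma gframe_qframe: "gframe \<subseteq> qframe n r" by (auto simp: gframe_def eframe_def qframe_def)

definition sub_entries :: "nat \<Rightarrow> dir \<Rightarrow> nat \<Rightarrow> ((nat, nat) pnode \<times> effect) list" where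
  "sub_entries q d j = map (\<lambda>p. entry D' B v q (Some (d, p))) (filter (\<lambda>p. (d, p) \<in> moves D' B v q) [0..<j])"

lemma length_sub_entries: "length (sub_entries q d j) \<le> j"
  using length_filter_le[of "\<lambda>p. (d, p) \<in> moves D' B v q" "[0..<j]"] by (simp add: sub_entries_def)

lemma Out_upd: "x \<notin> {''d'', ''ov'', ''oq'', ''ok'', ''od''} \<Longrightarrow> Out (upd m x i y) xs \<longleftrightarrow> Out m xs"
  by (simp add: Out_def upd_other)

lemma gather_ht:
  assumes m1: "ready m1" "Out m1 xs" "m1 ''q'' 0 = q" "length xs \<le> n" "q < n"
    and t: "test = (if d = L then left_test else right_test)" "c = (if d = L then ''v1'' else ''v2'')"
  shows "ht K M (\<lambda>m. m = m1) (gather test c (dir_num d))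
     (10 + acost (reg ''nb'') + n * (12 + acost (reg ''nb'') + ctime (Cond test (emit c (dir_num d)) Skip)))
     (\<lambda>m. same gframe m1 m \<and> Out m (xs @ sub_entries q d n))"
proof -
  let ?l = "if inner then n else 0"
  define I where "I j m \<longleftrightarrow> same gframe m1 m \<and> Out m (xs @ sub_entries q d j) \<and> m ''p'' 0 = j" for j m
  have rd: "ready m" if "same gframe m1 m" for m
    by (rule ready_same[OF m1(1) same_mono[OF that gframe_qframe] m1(5)])
  have "ht K M (\<lambda>m. m = m1) (gather test c (dir_num d))
     (10 + acost (reg ''nb'') + ?l * (12 + acost (reg ''nb'') + ctime (Cond test (emit c (dir_num d)) Skip))) (I ?l)"
    unfolding gather_def
  proof (rule ht_for[OF M16])
    show "aok K (reg ''nb'')" "2 \<le> K" using K by (auto simp: aok_def reg_def)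
    show "?l < M" using small_less[of n] n by simp
    fix m assume "m = m1"
    then show "I 0 (upd m ''p'' 0 0)" using m1(2)
      by (auto simp: I_def sub_entries_def Out_upd gframe_def intro!: same_upd)
  next
    fix j m assume "I j m"
    then show "aval (reg ''nb'') m = ?l \<and> m ''p'' 0 = j" using rd[of m] by (simp add: I_def ready_def reg_def)
  next
    fix j assume "j < ?l"
    then have j: "j < n" and inn: inner by (auto split: if_splits)
    show "ht K M (I j) (Cond test (emit c (dir_num d)) Skip) (ctime (Cond test (emit c (dir_num d)) Skip))
      (\<lambda>m. m ''p'' 0 = j \<and> I (Suc j) (upd m ''p'' 0 (Suc j)))"
    proof (rule ht_wp[OF M16])
      show "straight K (Cond test (emit c (dir_num d)) Skip)" using K
        unfolding t by (cases d) (simp_all add: left_test_def right_test_def emit_def width_def set_reg_def reg_def comp5_def put5_def put3_def copy5_def idx5_def aok_def)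
      fix m assume bm: "bd M m" and I: "I j m"
      then have sm: "same gframe m1 m" and O: "Out m (xs @ sub_entries q d j)" and p: "m ''p'' 0 = j" by (simp_all add: I_def)
      note r = rd[OF sm]
      have q: "m ''q'' 0 = q" using sameD[OF sm, of "''q''" 0] m1(3) by (simp add: gframe_def eframe_def)
      have test: "bval test m \<longleftrightarrow> (d, j) \<in> moves D' B v q" using tests[OF r q p inn j] t by (cases d) auto
      have snoc: "sub_entries q d (Suc j) = sub_entries q d j @ (if (d, j) \<in> moves D' B v q then [entry D' B v q (Some (d, j))] else [])"
        by (simp add: sub_entries_def)
      show "wp M (Cond test (emit c (dir_num d)) Skip) (\<lambda>m. m ''p'' 0 = j \<and> I (Suc j) (upd m ''p'' 0 (Suc j))) m"
      proof (cases "(d, j) \<in> moves D' B v q")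
        case True
        have cc: "m c 0 = child D' v d" "c = ''v1'' \<or> c = ''v2''" using r inn t by (cases d; simp add: ready_def)+
        have "length (xs @ sub_entries q d j) \<le> 2 * n" using m1(4) length_sub_entries[of q d j] j by simp
        from emit_wp[OF bm r O this inn True p cc]
        have "wp M (emit c (dir_num d)) (\<lambda>m'. same eframe m m' \<and> Out m' ((xs @ sub_entries q d j) @ [entry D' B v q (Some (d, j))])) m" .
        moreover have "m' ''p'' 0 = j \<and> I (Suc j) (upd m' ''p'' 0 (Suc j))"
          if "same eframe m m' \<and> Out m' ((xs @ sub_entries q d j) @ [entry D' B v q (Some (d, j))])" for m'
        proof -
          have "same gframe m1 (upd m' ''p'' 0 (Suc j))"
            using same_trans[OF sm same_mono[OF conjunct1[OF that] eframe_gframe]] by (rule same_upd) (simp add: gframe_def)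
          then show ?thesis using that p sameD[of eframe m m' "''p''" 0] True by (simp add: I_def snoc Out_upd eframe_def)
        qed
        ultimately have "wp M (emit c (dir_num d)) (\<lambda>m. m ''p'' 0 = j \<and> I (Suc j) (upd m ''p'' 0 (Suc j))) m"
          by (rule wp_mono)
        then show ?thesis using True test by simp
      next
        case False
        have "same gframe m1 (upd m ''p'' 0 (Suc j))" using sm by (rule same_upd) (simp add: gframe_def)
        then show ?thesis using False test p O by (simp add: I_def snoc Out_upd)
      qed
    qed simp
  qed
  then show ?thesis
  proof (rule ht_conseq)
    fix m assume I: "I ?l m"
    \<comment> \<open>A leaf has no moves, so stopping at 0 instead of \<open>n\<close> loses
      nothing.\<close>
    have "sub_entries q d ?l = sub_entries q d n" by (cases inner) (auto simp: sub_entries_def moves_def)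
    with I show "same gframe m1 m \<and> Out m (xs @ sub_entries q d n)" by (simp add: I_def)
  qed auto
qed

end

section \<open>The program for one state of a vertex\<close>

definition put_id :: "string \<Rightarrow> aexp \<Rightarrow> com" where
  "put_id A e = put5 A e (Cell ''type'' (reg ''v'')) (Num 0) (Num 0) (Cell ''type'' (reg ''v'')) (Num 0)"

definition q_init :: com where
  "q_init = seq [set_reg ''r'' (Add (Mul (reg ''v'') (reg ''Q'')) (reg ''q'')),
     set_reg ''b'' (Mul (reg ''r'') width),
     Cond (Eq (reg ''q'') (reg ''e'')) (Assign ''confE'' (reg ''r'') (Num 1)) (Assign ''confE'' (reg ''r'') (Num 0)),
     set_reg ''d'' (Num 0)]"

text \<open>Cells of new vertices have arbitrary initial contents, so the status of each possible
  node of the block has to be reset.\<close>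

definition q_clear_body :: com where
  "q_clear_body = Assign ''status'' (Add (reg ''b'') (reg ''k'')) (Num 0)"

text \<open>Runs after both gathering loops: \<open>0 < d\<close> then says that there is a move,
  which together with \<open>confU\<close> is the condition for a sink.\<close>

definition q_sink :: com where
  "q_sink = Cond (Conj (Less (Num 0) (reg ''d'')) (Eq (Cell ''confU'' (reg ''r'')) (Num 1)))
     (seq [Assign ''status'' (reg ''b'') (Num 1),
        put_id ''gamma'' (reg ''b''),
        put3 ''omegav'' ''omegaq'' ''omegak'' (reg ''b'') (reg ''v'') (reg ''q'') (Num 0),
        put_id ''od'' (reg ''d''),
        put3 ''ov'' ''oq'' ''ok'' (reg ''d'') (reg ''v'') (reg ''q'') (Num 0),
        set_reg ''d'' (Add (reg ''d'') (Num 1))]) Skip"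

definition q_leaf :: com where
  "q_leaf = seq [Assign ''status'' (Add (reg ''b'') (Num 1)) (Num 1),
     put_id ''gamma'' (Add (reg ''b'') (Num 1)),
     put3 ''omegav'' ''omegaq'' ''omegak'' (Add (reg ''b'') (Num 1)) (reg ''v'') (reg ''q'') (Num 1)]"

definition q_single :: com where
  "q_single = seq [Assign ''status'' (Add (reg ''b'') (Num 1)) (Num 3),
     copy5 ''dec'' (Mul (Num 2) (Add (reg ''b'') (Num 1))) ''od'' (Num 0),
     put3 ''tgtv'' ''tgtq'' ''tgtk'' (Mul (Num 2) (Add (reg ''b'') (Num 1)))
       (Cell ''ov'' (Num 0)) (Cell ''oq'' (Num 0)) (Cell ''ok'' (Num 0))]"

definition last_out :: aexp where
  "last_out = Sub (reg ''d'') (Num 1)"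

text \<open>Looks up the right leaf of the last entry once for the whole comb; \<open>og\<close>
  keeps the composed effect.\<close>

definition q_comb_init :: com where
  "q_comb_init = seq [set_reg ''i'' (Add (Mul (Add (Mul (Cell ''ov'' last_out) (reg ''Q'')) (Cell ''oq'' last_out)) width) (Cell ''ok'' last_out)),
     set_reg ''w1'' (Cell ''omegav'' (reg ''i'')), set_reg ''w2'' (Cell ''omegaq'' (reg ''i'')), set_reg ''w3'' (Cell ''omegak'' (reg ''i'')),
     comp5 ''og'' (Num 0) ''gamma'' (reg ''i'') ''od'' last_out]"

definition left_slot :: aexp where "left_slot = Mul (Num 2) (reg ''k'')"
definition right_slot :: aexp where "right_slot = Add (Mul (Num 2) (reg ''k'')) (Num 1)"

text \<open>The counter \<open>j\<close> starts at 0 and treats comb vertex \<open>j + 1\<close>, so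
  \<open>j + 2 < d\<close> says that the right edge stays inside the comb.\<close>

definition q_comb_body :: com where
  "q_comb_body = seq [set_reg ''k'' (Add (reg ''b'') (Add (reg ''j'') (Num 1))),
     Assign ''status'' (reg ''k'') (Num 2),
     copy5 ''dec'' left_slot ''od'' (reg ''j''),
     put3 ''tgtv'' ''tgtq'' ''tgtk'' left_slot (Cell ''ov'' (reg ''j'')) (Cell ''oq'' (reg ''j'')) (Cell ''ok'' (reg ''j'')),
     Cond (Less (Add (reg ''j'') (Num 2)) (reg ''d''))
       (Seq (put_id ''dec'' right_slot)
         (put3 ''tgtv'' ''tgtq'' ''tgtk'' right_slot (reg ''v'') (reg ''q'') (Add (reg ''j'') (Num 2))))
       (Seq (copy5 ''dec'' right_slot ''od'' last_out)
         (put3 ''tgtv'' ''tgtq'' ''tgtk'' right_slot (Cell ''ov'' last_out) (Cell ''oq'' last_out) (Cell ''ok'' last_out))),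
     copy5 ''gamma'' (reg ''k'') ''og'' (Num 0),
     put3 ''omegav'' ''omegaq'' ''omegak'' (reg ''k'') (reg ''w1'') (reg ''w2'') (reg ''w3'')]"

definition q_comb :: com where
  "q_comb = Seq q_comb_init (for_loop ''j'' last_out q_comb_body)"

definition q_finish :: com where
  "q_finish = Cond (Conj (Eq (reg ''d'') (Num 0)) (Eq (Cell ''confU'' (reg ''r'')) (Num 0)))
     (Assign ''confA'' (reg ''r'') (Num 0))
     (Seq (Assign ''confA'' (reg ''r'') (Num 1))
        (Cond (Eq (reg ''d'') (Num 0)) q_leaf (Cond (Eq (reg ''d'') (Num 1)) q_single q_comb)))"

definition q_body :: com where
  "q_body = Seq q_init (Seq (for_loop ''k'' width q_clear_body)
     (Seq (gather left_test ''v1'' 0) (Seq (gather right_test ''v2'' 1) (Seq q_sink q_finish))))"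

lemmas q_defs = q_init_def q_clear_body_def q_sink_def q_leaf_def q_single_def q_comb_init_def q_comb_body_def
  put_id_def last_out_def left_slot_def right_slot_def width_def set_reg_def reg_def put3_def

lemmas ok_defs = q_defs comp5_def put5_def copy5_def idx5_def aok_def

locale state_run = vertex_run D D' B n X ol code m0 b M K N0 N1 v
  for D D' :: "(nat, 'a label) rooted_bdag" and B n X ol and code :: "'a \<Rightarrow> nat" and m0 b M K N0 N1 v +
  fixes q :: nat and mq :: mem
  assumes q: "q < n" and mq: "bd M mq" "ready mq" "mq ''q'' 0 = q"
begin

abbreviation rr where "rr \<equiv> v * n + q"
definition bb where "bb = rr * (2 * n + 1)"
abbreviation F where "F \<equiv> qframe n rr"

lemma frame_mem:
  "k \<le> 2 * n \<Longrightarrow> x \<in> {''status'', ''omegav'', ''omegaq'', ''omegak''} \<Longrightarrow> (x, bb + k) \<in> F"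
  "k \<le> 2 * n \<Longrightarrow> c < 2 \<Longrightarrow> x \<in> {''tgtv'', ''tgtq'', ''tgtk''} \<Longrightarrow> (x, 2 * (bb + k) + c) \<in> F"
  "k \<le> 2 * n \<Longrightarrow> c < 2 \<Longrightarrow> c' < 5 \<Longrightarrow> (''dec'', 5 * (2 * (bb + k) + c) + c') \<in> F"
  "k \<le> 2 * n \<Longrightarrow> c' < 5 \<Longrightarrow> (''gamma'', 5 * (bb + k) + c') \<in> F"
proof -
  show "k \<le> 2 * n \<Longrightarrow> x \<in> {''status'', ''omegav'', ''omegaq'', ''omegak''} \<Longrightarrow> (x, bb + k) \<in> F"
    using block_eq[of k "2 * n + 1" rr] by (auto simp: qframe_def bb_def)
  show "k \<le> 2 * n \<Longrightarrow> c < 2 \<Longrightarrow> x \<in> {''tgtv'', ''tgtq'', ''tgtk''} \<Longrightarrow> (x, 2 * (bb + k) + c) \<in> F"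
    using block_mult[of k "2 * n + 1" c 2 rr] by (auto simp: qframe_def bb_def)
  show "k \<le> 2 * n \<Longrightarrow> c < 2 \<Longrightarrow> c' < 5 \<Longrightarrow> (''dec'', 5 * (2 * (bb + k) + c) + c') \<in> F"
    using block_mult[of k "2 * n + 1" "5 * c + c'" 10 rr] by (auto simp: qframe_def bb_def algebra_simps)
  show "k \<le> 2 * n \<Longrightarrow> c' < 5 \<Longrightarrow> (''gamma'', 5 * (bb + k) + c') \<in> F"
    using block_mult[of k "2 * n + 1" c' 5 rr] by (auto simp: qframe_def bb_def)
qed

lemma frame_regs: "x \<in> {''p'', ''d'', ''r'', ''b'', ''i'', ''k'', ''j'', ''w1'', ''w2'', ''w3'', ''ov'', ''oq'', ''ok'', ''od'', ''og''} \<Longrightarrow> (x, i) \<in> F"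
  "x \<in> {''confE'', ''confA''} \<Longrightarrow> (x, rr) \<in> F"
  by (auto simp: qframe_def)

lemma same_idx5: "same F m m' \<Longrightarrow> k \<le> 2 * n \<Longrightarrow> c < 2 \<Longrightarrow> same F m (set5 m' ''dec'' (2 * (bb + k) + c) x0 x1 x2 x3 x4)"
  "same F m m' \<Longrightarrow> k \<le> 2 * n \<Longrightarrow> same F m (set5 m' ''gamma'' (bb + k) x0 x1 x2 x3 x4)"
  "same F m m' \<Longrightarrow> A \<in> {''od'', ''og''} \<Longrightarrow> same F m (set5 m' A i x0 x1 x2 x3 x4)"
  by (intro same_set5 frame_mem frame_regs; auto)+

definition base :: "mem \<Rightarrow> bool" where
  "base m \<longleftrightarrow> same F mq m \<and> m ''r'' 0 = rr \<and> m ''b'' 0 = bb \<and> m ''confE'' rr = of_bool (q = ce D' B v)"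

lemma base_ready: "base m \<Longrightarrow> ready m"
  using ready_same[OF mq(2) _ q] by (simp add: base_def)

lemma base_regs: "base m \<Longrightarrow> m ''q'' 0 = q \<and> m ''Q'' 0 = n \<and> m ''v'' 0 = v \<and> m ''type'' v = t \<and>
   m ''confU'' rr = of_bool ((v, q) \<in> conf_u D' B) \<and> m ''r'' 0 = rr \<and> m ''b'' 0 = bb"
  using base_ready[of m] sameD[of F mq m "''q''" 0] mq(3) q by (simp add: base_def ready_def qframe_def)

lemma rrM: "rr < M" using r_less[OF v(2) q] .
lemma bbM: "k \<le> 2 * n \<Longrightarrow> bb + k < M" using pnode_index_less[OF v(2) q] by (simp add: bb_def)
lemma nM: "x \<le> 3 * n + 3 \<Longrightarrow> x < M" using small_less[of x] n b by simp
lemma vM: "v < M" using small_less[of v] v N1 by simp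
lemma qM: "q < M" using nM[of q] q by simp

lemma init_wp: "wp M q_init (\<lambda>m. base m \<and> Out m []) mq"
proof -
  have r: "mq ''Q'' 0 = n" "mq ''v'' 0 = v" "mq ''e'' 0 = ce D' B v" using mq(2) by (simp_all add: ready_def)
  let ?m = "\<lambda>x. upd (upd (upd (upd mq ''r'' 0 rr) ''b'' 0 bb) ''confE'' rr x) ''d'' 0 0"
  have "same F mq (?m x)" for x by (intro same_upd same_refl frame_regs) auto
  then have "base (?m (of_bool (q = ce D' B v)))" by (simp add: base_def)
  moreover have "Out (?m x) []" for x by (simp add: Out_def)
  ultimately show ?thesis using rrM bbM[of 0] M16 r mq(3) by (simp add: q_defs bb_def) auto
qed

definition zeros :: "mem \<Rightarrow> bool" where
  "zeros m \<longleftrightarrow> (\<forall>k \<le> 2 * n. m ''status'' (bb + k) = 0)"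

lemma clear_ht: "ht K M (\<lambda>m. base m \<and> Out m []) (for_loop ''k'' width q_clear_body)
   (10 + acost width + (2 * n + 1) * (12 + acost width + ctime q_clear_body)) (\<lambda>m. base m \<and> zeros m \<and> Out m [])"
proof -
  define I where "I j m \<longleftrightarrow> base m \<and> Out m [] \<and> m ''k'' 0 = j \<and> (\<forall>k < j. m ''status'' (bb + k) = 0)" for j m
  have k: "base (upd m ''k'' 0 j) = base m" for m j
    using same_upd[OF _ frame_regs(1), of mq m "''k''" 0 j] same_upd[OF _ frame_regs(1), of mq "upd m ''k'' 0 j" "''k''" 0 "m ''k'' 0"]
    by (auto simp: base_def upd_def)
  have "ht K M (\<lambda>m. base m \<and> Out m []) (for_loop ''k'' width q_clear_body)
   (10 + acost width + (2 * n + 1) * (12 + acost width + ctime q_clear_body)) (I (2 * n + 1))"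
  proof (rule ht_for[OF M16])
    show "aok K width" "2 \<le> K" using K by (auto simp: ok_defs)
    show "2 * n + 1 < M" by (rule nM) simp
    show "I 0 (upd m ''k'' 0 0)" if "base m \<and> Out m []" for m using that by (simp add: I_def k Out_upd)
    show "aval width m = 2 * n + 1 \<and> m ''k'' 0 = j" if "I j m" for j m
      using that base_regs[of m] by (simp add: I_def width_def reg_def)
    fix j assume j: "j < 2 * n + 1"
    show "ht K M (I j) q_clear_body (ctime q_clear_body) (\<lambda>m. m ''k'' 0 = j \<and> I (Suc j) (upd m ''k'' 0 (Suc j)))"
    proof (rule ht_wp[OF M16])
      show "straight K q_clear_body" using K by (simp add: ok_defs)
      fix m assume m: "bd M m" "I j m"
      have "base (upd m ''status'' (bb + j) 0)" using m(2) frame_mem(1)[of j "''status''"] j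
        by (auto simp: I_def base_def intro: same_upd)
      then show "wp M q_clear_body (\<lambda>m. m ''k'' 0 = j \<and> I (Suc j) (upd m ''k'' 0 (Suc j))) m"
        using m(2) base_regs[of m] M16 by (auto simp: q_defs I_def k Out_upd less_Suc_eq)
    qed simp
  qed
  then show ?thesis by (rule ht_conseq) (auto simp: I_def zeros_def less_Suc_eq_le)
qed

lemma base_same: "base m \<Longrightarrow> same gframe m m' \<Longrightarrow> base m' \<and> (zeros m \<longrightarrow> zeros m')"
proof -
  assume b: "base m" and s: "same gframe m m'"
  have "m' x = m x" if "x \<in> {''r'', ''b'', ''confE'', ''status''}" for x
    using sameD[OF s, of x] that by (intro ext) (auto simp: gframe_def eframe_def)
  then show ?thesis using b same_trans[OF _ same_mono[OF s gframe_qframe], of rr mq]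
    by (simp add: base_def zeros_def)
qed

definition move_entries where
  "move_entries = sub_entries q L n @ sub_entries q R n"

definition t_gather :: "com \<Rightarrow> nat" where
  "t_gather c = 10 + acost (reg ''nb'') + n * (12 + acost (reg ''nb'') + ctime c)"

lemma gathers_ht: "ht K M (\<lambda>m. base m \<and> zeros m \<and> Out m []) (Seq (gather left_test ''v1'' 0) (gather right_test ''v2'' 1))
   (t_gather (Cond left_test (emit ''v1'' 0) Skip) + t_gather (Cond right_test (emit ''v2'' 1) Skip))
   (\<lambda>m. base m \<and> zeros m \<and> Out m move_entries)"
proof (rule ht_seq)
  show "ht K M (\<lambda>m. base m \<and> zeros m \<and> Out m []) (gather left_test ''v1'' 0) (t_gather (Cond left_test (emit ''v1'' 0) Skip))
    (\<lambda>m. base m \<and> zeros m \<and> Out m (sub_entries q L n))"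
  proof (rule ht_pointwise)
    fix m1 assume m: "base m1 \<and> zeros m1 \<and> Out m1 []"
    have "ht K M (\<lambda>m. m = m1) (gather left_test ''v1'' (dir_num L)) (t_gather (Cond left_test (emit ''v1'' (dir_num L)) Skip))
      (\<lambda>m. same gframe m1 m \<and> Out m ([] @ sub_entries q L n))"
      unfolding t_gather_def using m base_ready[of m1] base_regs[of m1] q by (intro gather_ht) auto
    then show "ht K M (\<lambda>m. m = m1) (gather left_test ''v1'' 0) (t_gather (Cond left_test (emit ''v1'' 0) Skip))
      (\<lambda>m. base m \<and> zeros m \<and> Out m (sub_entries q L n))"
      unfolding dir_num.simps using m base_same[of m1] by (elim ht_conseq) auto
  qed
  show "ht K M (\<lambda>m. base m \<and> zeros m \<and> Out m (sub_entries q L n)) (gather right_test ''v2'' 1) (t_gather (Cond right_test (emit ''v2'' 1) Skip))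
    (\<lambda>m. base m \<and> zeros m \<and> Out m move_entries)"
  proof (rule ht_pointwise)
    fix m1 assume m: "base m1 \<and> zeros m1 \<and> Out m1 (sub_entries q L n)"
    have "ht K M (\<lambda>m. m = m1) (gather right_test ''v2'' (dir_num R)) (t_gather (Cond right_test (emit ''v2'' (dir_num R)) Skip))
      (\<lambda>m. same gframe m1 m \<and> Out m (sub_entries q L n @ sub_entries q R n))"
      unfolding t_gather_def using m base_ready[of m1] base_regs[of m1] q length_sub_entries[of q L n] by (intro gather_ht) auto
    then show "ht K M (\<lambda>m. m = m1) (gather right_test ''v2'' 1) (t_gather (Cond right_test (emit ''v2'' 1) Skip))
      (\<lambda>m. base m \<and> zeros m \<and> Out m move_entries)"
      unfolding dir_num.simps move_entries_def using m base_same[of m1] by (elim ht_conseq) auto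
  qed
qed

lemma move_entries_Nil: "move_entries = [] \<longleftrightarrow> moves D' B v q = {}"
proof -
  have "move_entries = [] \<longleftrightarrow> (\<forall>d. \<forall>p < n. (d, p) \<notin> moves D' B v q)"
    by (auto simp: move_entries_def sub_entries_def filter_empty_conv all_dir)
  then show ?thesis using moves_n by fastforce
qed

lemma entries_eq: "entries v q = move_entries @ (if has_sink D' B v q then [(Sink v q, id)] else [])"
proof -
  have "entry D' B v q None = (Sink v q, id)" by (simp add: entry_def opt_target_def opt_effect_def new.resolve_simps)
  then show ?thesis by (simp add: entries_def opt_list_def move_entries_def sub_entries_def)
qed

text \<open>At a leaf there are no moves and \<open>conf_a\<close> coincides with
  \<open>conf_u\<close>, so the equation for inner vertices holds everywhere.\<close>

lemma conf_a_iff: "(v, q) \<in> conf_a D' B \<longleftrightarrow> (v, q) \<in> conf_u D' B \<or> moves D' B v q \<noteq> {}"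
proof (cases inner)
  case True then show ?thesis using new.conf_a_inner[OF vD'] by simp
next
  case False
  then have "moves D' B v q = {}" by (auto simp: moves_def)
  with False show ?thesis using new.conf_a_leaf[OF vD'] new.conf_u_leaf[OF vD'] by simp
qed

lemma length_entries_le: "length (entries v q) \<le> 2 * n + 1"
  using card_opts_le[of v q] by (simp only: length_entries)

definition sink_ok :: "mem \<Rightarrow> bool" where
  "sink_ok m \<longleftrightarrow> (has_sink D' B v q \<longrightarrow> rep_leaf m bb t (Sink v q) id)"

definition stat :: "mem \<Rightarrow> bool" where
  "stat m \<longleftrightarrow> (\<forall>k \<le> 2 * n. m ''status'' (bb + k) = (if k = 0 then of_bool (has_sink D' B v q) else 0))"

definition S4 :: "mem \<Rightarrow> bool" where
  "S4 m \<longleftrightarrow> base m \<and> stat m \<and> sink_ok m \<and> Out m (entries v q)"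

lemma sink_wp:
  assumes m: "bd M m" "base m" "zeros m" "Out m move_entries"
  shows "wp M q_sink S4 m"
proof (cases "has_sink D' B v q")
  case True
  then have h: "(v, q) \<in> conf_u D' B" "move_entries \<noteq> []" by (auto simp: has_sink_def move_entries_Nil)
  have d: "m ''d'' 0 = length move_entries" using m(4) by (simp add: Out_def)
  have l: "length move_entries \<le> 2 * n" using length_entries_le True by (simp add: entries_eq)
  note rg = base_regs[OF m(2)]
  let ?l = "length move_entries"
  define m1 where "m1 = upd (upd (upd (set5 (upd m ''status'' bb 1) ''gamma'' bb t 0 0 t 0) ''omegav'' bb v) ''omegaq'' bb q) ''omegak'' bb 0"
  define m2 where "m2 = upd (upd (upd (upd (set5 m1 ''od'' ?l t 0 0 t 0) ''ov'' ?l v) ''oq'' ?l q) ''ok'' ?l 0) ''d'' 0 (Suc ?l)"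
  have s0: "same F mq m" using m(2) by (simp add: base_def)
  have s1: "same F mq m1" unfolding m1_def
  proof (intro same_upd)
    have "same F mq (upd m ''status'' bb 1)" using frame_mem(1)[of 0 "''status''"] by (intro same_upd s0) simp
    then show "same F mq (set5 (upd m ''status'' bb 1) ''gamma'' bb t 0 0 t 0)" using same_idx5(2)[of mq _ 0] by simp
  qed (use frame_mem(1)[of 0] in simp_all)
  have s2: "same F mq m2" unfolding m2_def by (intro same_upd same_idx5(3) s1 frame_regs) auto
  have sink: "Sink v q = pnode v q 0" by (simp add: pnode_def)
  have "Out m1 move_entries" using m(4) by (simp add: Out_def m1_def upd_other set5_other)
  from Out_snoc[OF this rep5_id[OF t_le] sink] have O: "Out m2 (entries v q)" using True by (simp add: m2_def entries_eq)
  have "base m2" using m(2) s2 by (simp add: base_def m1_def m2_def)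
  moreover have "stat m2" using m(3) True by (auto simp: stat_def zeros_def m1_def m2_def)
  moreover have "sink_ok m2" using rep5_id[OF t_le]
    by (simp add: sink_ok_def rep_leaf_def m1_def m2_def upd_other set5_other rep_effect_set5 sink[symmetric])
  ultimately have "S4 m2" using O by (simp add: S4_def)
  then show ?thesis using h(2) d rg t_le M16 nM[of "Suc ?l"] l vM qM True h(1)
    by (simp add: q_sink_def put_id_def wp_put5 put3_def set_reg_def reg_def m1_def m2_def)
next
  case False
  have e: "entries v q = move_entries" using False by (simp add: entries_eq)
  have d: "m ''d'' 0 = length move_entries" using m(4) by (simp add: Out_def)
  have "S4 m" using m False by (simp add: S4_def stat_def zeros_def sink_ok_def e)
  moreover have "\<not> (0 < length move_entries \<and> (v, q) \<in> conf_u D' B)" using False by (auto simp: has_sink_def move_entries_Nil)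
  ultimately show ?thesis using d base_regs[OF m(2)] by (auto simp: q_sink_def reg_def)
qed

end

context state_run
begin

text \<open>A contracted path may end far below the child; closure under edges ensures that the data
  at its end is complete as well.\<close>

lemma done_closed:
  assumes "(u, w) \<in> (adj D')\<^sup>*" "u < N0 \<or> v < u"
  shows "w < N0 \<or> v < w"
  using assms
proof (induction rule: rtrancl_induct)
  case (step w x)
  then have w: "w < N0 \<or> v < w" by simp
  from step(2) have "w \<in> verts D'" "\<not> is_leaf D' w" "\<exists>d. x = child D' w d" by (auto simp: new.adj_iff)
  then obtain d where wx: "w \<in> verts D'" "\<not> is_leaf D' w" "x = child D' w d" by blast
  show ?case
  proof (cases "w < N0")
    case True
    then have "w \<in> verts D" by (simp add: verts_D)
    then have "x \<in> verts D" using wx old.child_verts[of w d] by (simp add: child_eq leaf_eq)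
    then show ?thesis by (simp add: verts_D)
  next
    case False
    with w new_child[OF wx(1) _ wx(2), of d] wx(3) show ?thesis by auto
  qed
qed

lemma entries_cases:
  assumes "j < length (entries v q)"
  obtains "entries v q ! j = (Sink v q, id)" "has_sink D' B v q"
    | d p where "(d, p) \<in> moves D' B v q" "entries v q ! j = entry D' B v q (Some (d, p))"
proof -
  obtain o' where o: "o' \<in> options D' B v q" "entries v q ! j = entry D' B v q o'"
    using entry_nth_opts[of j v q] assms by (auto simp: length_entries)
  show ?thesis
  proof (cases o')
    case None
    then have "has_sink D' B v q" "entry D' B v q o' = (Sink v q, id)" using o(1)
      by (simp_all add: new.None_opts entry_def opt_target_def opt_effect_def new.resolve_simps)
    with o(2) that(1) show ?thesis by simp
  next
    case (Some m)
    then show ?thesis using o that(2) by (cases m) (auto simp: new.Some_opts)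
  qed
qed

lemma good_entries:
  assumes "j < length (entries v q)"
  shows "good D' b (Conf v q) (fst (entries v q ! j)) (snd (entries v q ! j))"
  using entry_nth_opts[of j v q] assms entry_facts by (auto simp: length_entries)

text \<open>The node whose right leaf is looked up is either the sink of the same configuration,
  which has just been written, or belongs to a completed vertex.\<close>

lemma target_leaf:
  assumes m: "base m" "sink_ok m" and j: "j < length (entries v q)" and z: "fst (entries v q ! j) = pnode zv zq zk"
  shows "zv < N1" "zq < n" "zk \<le> 2 * n"
    "rep_leaf m (pnode_index n zv zq zk) (vtype D' zv) (ds_omega X' (pnode zv zq zk)) (ds_gamma X' (pnode zv zq zk))"
proof -
  have nz: "pnode zv zq zk \<in> ds_nodes X'" using entries_nodes[of j v q] j z by (simp add: length_entries)
  note nb = nodes_bounds[OF nz]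
  show "zv < N1" "zq < n" "zk \<le> 2 * n" using nb by (simp_all add: verts_D')
  show "rep_leaf m (pnode_index n zv zq zk) (vtype D' zv) (ds_omega X' (pnode zv zq zk)) (ds_gamma X' (pnode zv zq zk))"
  proof (cases rule: entries_cases[OF j])
    case 1
    then have "pnode zv zq zk = pnode v q 0" using z by (simp add: pnode_def)
    then have eq: "zv = v" "zq = q" "zk = 0" by (simp_all add: inj_pnode)
    have "pnode v q 0 = Sink v q" by (simp add: pnode_def)
    then show ?thesis using m(2) 1(2) omega_leaf(1)[OF 1(2)] unfolding eq by (simp add: sink_ok_def bb_def pnode_index_def)
  next
    case (2 d p)
    have inn: inner using 2(1) by (auto simp: moves_def)
    have "fst (entries v q ! j) = fst (resolve D' B (Conf (child D' v d) p))" unfolding 2(2) by (simp add: entry_def opt_target_def)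
    then have zr: "fst (resolve D' B (Conf (child D' v d) p)) = pnode zv zq zk" using z by simp
    have "good D' b (Conf (child D' v d) p) (fst (resolve D' B (Conf (child D' v d) p))) (snd (resolve D' B (Conf (child D' v d) p)))"
      by (rule new.good_resolve) (rule leaf_sizes)
    then have "(child D' v d, zv) \<in> (adj D')\<^sup>*" unfolding zr by (simp add: good_def)
    then have dz: "zv < N0 \<or> v < zv" by (rule done_closed) (use child_v[OF inn, of d] in blast)
    have "done_verts m" using base_ready[OF m(1)] by (simp add: ready_def)
    then have "finished m zv" using dz nb(1) unfolding done_verts_def by blast
    then have "rep_at D' B X' n m zv zq" using nb(2) by (simp add: finished_def)
    then show ?thesis by (rule omega_rep[OF nz])
  qed
qed

definition SA :: "mem \<Rightarrow> bool" where
  "SA m \<longleftrightarrow> S4 m \<and> m ''confA'' rr = of_bool ((v, q) \<in> conf_a D' B)"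

text \<open>Justifies the test in \<open>q_finish\<close>, which decides membership in
  \<open>conf_a\<close> from the number of entries and \<open>confU\<close>.\<close>

lemma conf_a_entries: "(v, q) \<in> conf_a D' B \<longleftrightarrow> entries v q \<noteq> [] \<or> (v, q) \<in> conf_u D' B"
  unfolding conf_a_iff using move_entries_Nil by (auto simp: entries_eq has_sink_def)

lemma spec_atI:
  assumes m: "base m" "m ''confA'' rr = of_bool ((v, q) \<in> conf_a D' B)" "sink_ok m"
    and st: "\<And>k. k \<le> 2 * n \<Longrightarrow> m ''status'' (bb + k) =
        (if k = 0 then of_bool (has_sink D' B v q) else if (v, q) \<notin> conf_a D' B then 0
         else if k = 1 \<and> length (entries v q) = 0 then 1 else if k = 1 \<and> length (entries v q) = 1 then 3
         else if k + 1 \<le> length (entries v q) then 2 else 0)"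
    and 1: "length (entries v q) = 1 \<Longrightarrow> rep_edge m (2 * (bb + 1)) t (entries v q ! 0)"
    and 2: "\<And>k. 1 \<le> k \<Longrightarrow> k + 1 \<le> length (entries v q) \<Longrightarrow> rep_edge m (2 * (bb + k)) t (entries v q ! (k - 1)) \<and>
        rep_edge m (2 * (bb + k) + 1) t (if k + 2 \<le> length (entries v q) then (pnode v q (k + 1), id) else entries v q ! (length (entries v q) - 1)) \<and>
        rep_leaf m (bb + k) t (ds_omega X' (fst (entries v q ! (length (entries v q) - 1))))
          (ds_gamma X' (fst (entries v q ! (length (entries v q) - 1))) \<circ> snd (entries v q ! (length (entries v q) - 1)))"
    and 0: "(v, q) \<in> conf_a D' B \<Longrightarrow> length (entries v q) = 0 \<Longrightarrow> rep_leaf m (bb + 1) t (Conf v q) id"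
  shows "spec_at m v q"
proof -
  have r: "ready m" by (rule base_ready[OF m(1)])
  have cu: "m ''confU'' rr = of_bool ((v, q) \<in> conf_u D' B)" using base_regs[OF m(1)] by simp
  have ord: "inner \<Longrightarrow> m ''ordlen'' rr = length (quad_list n D' B v q) \<and>
          (\<forall>i < length (quad_list n D' B v q). quad_list n D' B v q ! i =
             (m ''ordq1'' (rr * (n * n) + i), m ''ordq2'' (rr * (n * n) + i)))"
    using r q unfolding ready_def by blast
  show ?thesis unfolding spec_at_def Let_def bb_def[symmetric]
  proof (intro conjI)
    show "m ''confE'' rr = of_bool (q = ce D' B v)" using m(1) by (simp add: base_def)
    show "has_sink D' B v q \<longrightarrow> rep_leaf m bb t (Sink v q) id" using m(3) by (simp add: sink_ok_def)
  qed (use m(2) cu ord st 0 1 2 in blast)+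
qed

definition final :: "mem \<Rightarrow> bool" where
  "final m \<longleftrightarrow> same F mq m \<and> spec_at m v q"

lemma leaf_wp:
  assumes m: "bd M m" "SA m" "(v, q) \<in> conf_a D' B" "entries v q = []"
  shows "wp M q_leaf final m"
proof -
  have S: "base m" "stat m" "sink_ok m" "m ''confA'' rr = 1" using m by (simp_all add: SA_def S4_def)
  note rg = base_regs[OF S(1)]
  have n1: "1 \<le> 2 * n" using q by simp
  have ns: "\<not> has_sink D' B v q" using m(4) by (auto simp: entries_eq)
  define m1 where "m1 = upd (upd (upd (set5 (upd m ''status'' (bb + 1) 1) ''gamma'' (bb + 1) t 0 0 t 0) ''omegav'' (bb + 1) v) ''omegaq'' (bb + 1) q) ''omegak'' (bb + 1) 1"
  have s: "same F mq m1" unfolding m1_def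
    using S(1) n1 by (intro same_upd same_idx5(2) frame_mem(1)) (auto simp: base_def)
  have b1: "base m1" using S(1) s by (simp add: base_def m1_def)
  have "Conf v q = pnode v q 1" by (simp add: pnode_def)
  then have lf: "rep_leaf m1 (bb + 1) t (Conf v q) id" using rep5_id[OF t_le]
    by (simp add: rep_leaf_def m1_def upd_other set5_other rep_effect_set5)
  have "spec_at m1 v q"
  proof (rule spec_atI[OF b1])
    show "m1 ''confA'' rr = of_bool ((v, q) \<in> conf_a D' B)" using S(4) m(3) by (simp add: m1_def)
    show "sink_ok m1" using ns by (simp add: sink_ok_def)
    show "m1 ''status'' (bb + k) = (if k = 0 then of_bool (has_sink D' B v q) else if (v, q) \<notin> conf_a D' B then 0
         else if k = 1 \<and> length (entries v q) = 0 then 1 else if k = 1 \<and> length (entries v q) = 1 then 3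
         else if k + 1 \<le> length (entries v q) then 2 else 0)" if "k \<le> 2 * n" for k
      using S(2) that m(3,4) by (auto simp: stat_def m1_def)
  qed (use lf m(4) in simp_all)
  then have "final m1" using s by (simp add: final_def)
  then show ?thesis using rg t_le M16 vM qM
    by (simp add: q_leaf_def put_id_def wp_put5 put3_def set_reg_def reg_def m1_def)
qed

lemma Out_nth: "Out m xs \<Longrightarrow> j < length xs \<Longrightarrow> fst (xs ! j) = pnode (m ''ov'' j) (m ''oq'' j) (m ''ok'' j) \<and>
   rep5 (m ''od'' (5 * j)) (m ''od'' (5 * j + 1)) (m ''od'' (5 * j + 2)) (m ''od'' (5 * j + 3)) (m ''od'' (5 * j + 4)) t (snd (xs ! j))"
  by (simp add: Out_def rep_effect_rep5)

lemma single_wp: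
  assumes m: "bd M m" "SA m" "length (entries v q) = 1"
  shows "wp M q_single final m"
proof -
  have ca: "(v, q) \<in> conf_a D' B" using m(3) unfolding conf_a_entries by auto
  have S: "base m" "stat m" "sink_ok m" "m ''confA'' rr = 1" "Out m (entries v q)" using m ca by (simp_all add: SA_def S4_def)
  note rg = base_regs[OF S(1)]
  have lt: "m x j < M" for x j using m(1) by (simp add: bd_def)
  have n1: "1 \<le> 2 * n" using q by simp
  have O: "fst (entries v q ! 0) = pnode (m ''ov'' 0) (m ''oq'' 0) (m ''ok'' 0)"
     "rep5 (m ''od'' 0) (m ''od'' 1) (m ''od'' 2) (m ''od'' 3) (m ''od'' 4) t (snd (entries v q ! 0))"
    using Out_nth[OF S(5), of 0] m(3) by (simp_all add: numeral_2_eq_2)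
  define m1 where "m1 = upd (upd (upd (set5 (upd m ''status'' (bb + 1) 3) ''dec'' (2 * (bb + 1)) (m ''od'' 0) (m ''od'' 1) (m ''od'' 2) (m ''od'' 3) (m ''od'' 4))
     ''tgtv'' (2 * (bb + 1)) (m ''ov'' 0)) ''tgtq'' (2 * (bb + 1)) (m ''oq'' 0)) ''tgtk'' (2 * (bb + 1)) (m ''ok'' 0)"
  have s: "same F mq m1" unfolding m1_def
  proof (intro same_upd)
    have "same F mq m" using S(1) by (simp add: base_def)
    then have "same F mq (upd m ''status'' (bb + 1) 3)" using frame_mem(1)[OF n1, of "''status''"] by (intro same_upd) simp_all
    then show "same F mq (set5 (upd m ''status'' (bb + 1) 3) ''dec'' (2 * (bb + 1)) (m ''od'' 0) (m ''od'' 1) (m ''od'' 2) (m ''od'' 3) (m ''od'' 4))"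
      using same_idx5(1)[of mq "upd m ''status'' (bb + 1) 3" 1 0] n1 by simp
  qed (use frame_mem(2)[OF n1, of 0] in simp_all)
  have b1: "base m1" using S(1) s by (simp add: base_def m1_def)
  have ed: "rep_edge m1 (2 * (bb + 1)) t (entries v q ! 0)" using O
    by (simp add: rep_edge_def m1_def upd_other set5_other rep_effect_set5)
  have "spec_at m1 v q"
  proof (rule spec_atI[OF b1])
    show "m1 ''confA'' rr = of_bool ((v, q) \<in> conf_a D' B)" using S(4) ca by (simp add: m1_def)
    show "sink_ok m1" using S(3) by (simp add: sink_ok_def rep_leaf_def m1_def upd_other set5_other)
    show "m1 ''status'' (bb + k) = (if k = 0 then of_bool (has_sink D' B v q) else if (v, q) \<notin> conf_a D' B then 0
         else if k = 1 \<and> length (entries v q) = 0 then 1 else if k = 1 \<and> length (entries v q) = 1 then 3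
         else if k + 1 \<le> length (entries v q) then 2 else 0)" if "k \<le> 2 * n" for k
      using S(2) that m(3) ca by (auto simp: stat_def m1_def)
  qed (use ed m(3) in simp_all)
  then have "final m1" using s by (simp add: final_def)
  then show ?thesis using rg lt M16
    by (simp add: q_single_def wp_copy5 Let_def put3_def set_reg_def reg_def m1_def flip: numeral_2_eq_2)
qed

abbreviation "dd \<equiv> length (entries v q)"
definition zz where "zz = fst (entries v q ! (dd - 1))"
definition om where "om = ds_omega X' zz"
definition ga where "ga = ds_gamma X' zz \<circ> snd (entries v q ! (dd - 1))"

definition og_ok :: "mem \<Rightarrow> bool" where
  "og_ok m \<longleftrightarrow> om = pnode (m ''w1'' 0) (m ''w2'' 0) (m ''w3'' 0) \<and> rep_effect (m ''og'') 0 t ga"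

lemma comb_init_wp:
  assumes m: "bd M m" "SA m" "2 \<le> dd"
  shows "wp M q_comb_init (\<lambda>m. SA m \<and> og_ok m) m"
proof -
  have S: "base m" "stat m" "sink_ok m" "Out m (entries v q)" "m ''confA'' rr = of_bool ((v, q) \<in> conf_a D' B)"
    using m(2) by (simp_all add: SA_def S4_def)
  note rg = base_regs[OF S(1)]
  have lt: "m x j < M" for x j using m(1) by (simp add: bd_def)
  have d: "m ''d'' 0 = dd" using S(4) by (simp add: Out_def)
  let ?j = "dd - 1"
  have j: "?j < dd" using m(3) by simp
  define zv zq zk where "zv = m ''ov'' ?j" and "zq = m ''oq'' ?j" and "zk = m ''ok'' ?j"
  have z: "zz = pnode zv zq zk" and g: "rep_effect (m ''od'') ?j t (snd (entries v q ! ?j))"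
    using S(4) j by (simp_all add: Out_def zz_def zv_def zq_def zk_def)
  note tl = target_leaf[OF S(1,3) j z[unfolded zz_def]]
  define i where "i = pnode_index n zv zq zk"
  have i: "i = (zv * n + zq) * (2 * n + 1) + zk" by (simp add: i_def pnode_index_def)
  have iM: "i < M" unfolding i using pnode_index_less[OF tl(1-3)] .
  have ol: "om = pnode (m ''omegav'' i) (m ''omegaq'' i) (m ''omegak'' i)"
    and f: "rep_effect (m ''gamma'') i (vtype D' zv) (ds_gamma X' zz)"
    using tl(4) by (simp_all add: rep_leaf_def om_def z i_def)
  have zn: "zz \<in> comb_nodes D' B ol'" using entries_nodes[of ?j v q] j by (simp add: zz_def length_entries X'_def)
  have "good D' b zz om (ds_gamma X' zz)"
    unfolding om_def by (rule new.good_right_path[OF _ lists' right_path'[OF zn]]) (rule leaf_sizes)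
  then obtain K2 where K2: "nice (vtype D' zv) (vtype D' (vert om)) K2 (ds_gamma X' zz)" "K2 + rank D' (vert om) * b \<le> rank D' zv * b"
    using good_bound[of zz om] tl(1) unfolding z by (auto simp: verts_D')
  obtain K1 where K1: "nice t (vtype D' zv) K1 (snd (entries v q ! ?j))" "K1 + rank D' zv * b \<le> rank D' v * b"
    using good_bound[OF good_entries[OF j]] vD' unfolding zz_def[symmetric] z by auto
  \<comment> \<open>\<open>K1\<close> is charged to the rank drop from \<open>v\<close> to the
    target of the last entry and \<open>K2\<close> to the drop from there to the right leaf, so
    together they are at most \<open>rank D' v * b\<close>.\<close>
  have KM: "K1 + K2 < M" using K1(2) K2(2) rank_bound[OF vD'] by simp
  define m1 where "m1 = upd (upd (upd (upd m ''i'' 0 i) ''w1'' 0 (m ''omegav'' i)) ''w2'' 0 (m ''omegaq'' i)) ''w3'' 0 (m ''omegak'' i)"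
  have m1o: "m1 x = m x" if "x \<notin> {''i'', ''w1'', ''w2'', ''w3''}" for x using that by (simp add: m1_def upd_def)
  have b1: "bd M m1" unfolding m1_def using lt iM by (intro bd_upd m(1)) auto
  have i1: "m1 ''i'' 0 = i" by (simp add: m1_def)
  have "wp M (comp5 ''og'' (Num 0) ''gamma'' (reg ''i'') ''od'' last_out) (\<lambda>m. SA m \<and> og_ok m) m1"
  proof (rule wp_comp5[OF b1])
    show "rep_effect (m1 ''od'') (aval last_out m1) t (snd (entries v q ! ?j))" using g by (simp add: last_out_def reg_def m1o d)
    show "rep_effect (m1 ''gamma'') (aval (reg ''i'') m1) (vtype D' zv) (ds_gamma X' zz)" using f i1 by (simp add: reg_def m1o)
    show "nice t (vtype D' zv) K1 (snd (entries v q ! ?j))" "nice (vtype D' zv) (vtype D' (vert om)) K2 (ds_gamma X' zz)" by (rule K1(1), rule K2(1))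
    show "K1 + K2 < M" by (rule KM)
    fix x0 x1 x2 x3 x4 assume r5: "rep5 x0 x1 x2 x3 x4 t (ds_gamma X' zz \<circ> snd (entries v q ! ?j))"
    let ?m = "set5 m1 ''og'' (aval (Num 0) m1) x0 x1 x2 x3 x4"
    have mo: "?m x = m x" if "x \<notin> {''i'', ''w1'', ''w2'', ''w3'', ''og''}" for x using that by (simp add: set5_def upd_def m1o)
    have "same F mq m" using S(1) by (simp add: base_def)
    then have "same F mq ?m" unfolding m1_def by (intro same_idx5(3) same_upd frame_regs) auto
    then have "base ?m" using S(1) by (simp add: base_def mo m1o)
    moreover have "stat ?m" "sink_ok ?m" "Out ?m (entries v q)" "?m ''confA'' rr = of_bool ((v, q) \<in> conf_a D' B)"
      using S by (simp_all add: stat_def sink_ok_def rep_leaf_def Out_def mo m1o set5_other)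
    moreover have "og_ok ?m" using r5 ol by (simp add: og_ok_def ga_def rep_effect_set5 m1_def)
    ultimately show "SA ?m \<and> og_ok ?m" by (simp add: SA_def S4_def)
  qed (use t_le new.vtype_le[of zv] M16 in \<open>simp_all add: last_out_def reg_def\<close>)
  moreover have set_i: "wp M (set_reg ''i'' (Add (Mul (Add (Mul (Cell ''ov'' last_out) (reg ''Q'')) (Cell ''oq'' last_out)) width) (Cell ''ok'' last_out))) Q m
      = Q (upd m ''i'' 0 i)" for Q
    using iM rg by (simp add: set_reg_def reg_def width_def last_out_def d zv_def zq_def zk_def i)
  ultimately show ?thesis using lt
    unfolding q_comb_init_def seq.simps wp.simps(3) set_i by (simp add: set_reg_def reg_def m1_def)
qed

definition comb_done :: "mem \<Rightarrow> nat \<Rightarrow> bool" where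
  "comb_done m k \<longleftrightarrow> rep_edge m (2 * (bb + k)) t (entries v q ! (k - 1)) \<and>
        rep_edge m (2 * (bb + k) + 1) t (if k + 2 \<le> dd then (pnode v q (k + 1), id) else entries v q ! (dd - 1)) \<and>
        rep_leaf m (bb + k) t om ga"

definition CI :: "nat \<Rightarrow> mem \<Rightarrow> bool" where
  "CI j m \<longleftrightarrow> base m \<and> sink_ok m \<and> Out m (entries v q) \<and> m ''confA'' rr = of_bool ((v, q) \<in> conf_a D' B) \<and> og_ok m \<and> m ''j'' 0 = j \<and>
     (\<forall>k \<le> 2 * n. m ''status'' (bb + k) = (if k = 0 then of_bool (has_sink D' B v q) else if k \<le> j then 2 else 0)) \<and>
     (\<forall>k. 1 \<le> k \<and> k \<le> j \<longrightarrow> comb_done m k)"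

lemma comb_body_wp:
  assumes m: "bd M m" "CI j m" and j: "j + 1 < dd"
  shows "wp M q_comb_body (\<lambda>m. m ''j'' 0 = j \<and> CI (Suc j) (upd m ''j'' 0 (Suc j))) m"
proof -
  have S: "base m" "sink_ok m" "Out m (entries v q)" "m ''confA'' rr = of_bool ((v, q) \<in> conf_a D' B)" "og_ok m" "m ''j'' 0 = j"
    and st: "\<And>k. k \<le> 2 * n \<Longrightarrow> m ''status'' (bb + k) = (if k = 0 then of_bool (has_sink D' B v q) else if k \<le> j then 2 else 0)"
    and dn: "\<And>k. 1 \<le> k \<Longrightarrow> k \<le> j \<Longrightarrow> comb_done m k"
    using m(2) by (simp_all add: CI_def)
  note rg = base_regs[OF S(1)]
  have lt: "m x j < M" for x j using m(1) by (simp add: bd_def)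
  have d: "m ''d'' 0 = dd" using S(3) by (simp add: Out_def)
  define k where "k = j + 1"
  have k: "1 \<le> k" "k \<le> 2 * n" "k + 1 \<le> dd" using j length_entries_le by (simp_all add: k_def)
  define c where "c = bb + k"
  have cM: "c < M" unfolding c_def by (rule bbM[OF k(2)])
  have jM: "j + 2 < M" using nM[of "j + 2"] k(2) by (simp add: k_def)
  have O: "fst (entries v q ! i) = pnode (m ''ov'' i) (m ''oq'' i) (m ''ok'' i)"
    "rep5 (m ''od'' (5 * i)) (m ''od'' (5 * i + 1)) (m ''od'' (5 * i + 2)) (m ''od'' (5 * i + 3)) (m ''od'' (5 * i + 4)) t (snd (entries v q ! i))"
    if "i < dd" for i using Out_nth[OF S(3) that] by simp_all
  \<comment> \<open>\<open>m1\<close>, \<open>m2\<close> and \<open>m3\<close> are the memories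
    after storing the left edge, the right edge and the right leaf; \<open>m2\<close> is kept
    general because the right edge has two forms.\<close>
  define m1 where "m1 = upd (upd (upd (set5 (upd (upd m ''k'' 0 c) ''status'' c 2) ''dec'' (2 * c) (m ''od'' (5 * j)) (m ''od'' (5 * j + 1)) (m ''od'' (5 * j + 2)) (m ''od'' (5 * j + 3)) (m ''od'' (5 * j + 4)))
     ''tgtv'' (2 * c) (m ''ov'' j)) ''tgtq'' (2 * c) (m ''oq'' j)) ''tgtk'' (2 * c) (m ''ok'' j)"
  define m2 where "m2 e0 e1 e2 e3 e4 y0 y1 y2 = upd (upd (upd (set5 m1 ''dec'' (2 * c + 1) e0 e1 e2 e3 e4) ''tgtv'' (2 * c + 1) y0) ''tgtq'' (2 * c + 1) y1) ''tgtk'' (2 * c + 1) y2" for e0 e1 e2 e3 e4 y0 y1 y2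
  define m3 where "m3 e0 e1 e2 e3 e4 y0 y1 y2 = upd (upd (upd (set5 (m2 e0 e1 e2 e3 e4 y0 y1 y2) ''gamma'' c (m ''og'' 0) (m ''og'' 1) (m ''og'' 2) (m ''og'' 3) (m ''og'' 4))
     ''omegav'' c (m ''w1'' 0)) ''omegaq'' c (m ''w2'' 0)) ''omegak'' c (m ''w3'' 0)" for e0 e1 e2 e3 e4 y0 y1 y2
  have fin: "CI (Suc j) (upd (m3 e0 e1 e2 e3 e4 y0 y1 y2) ''j'' 0 (Suc j))"
    if e: "rep5 e0 e1 e2 e3 e4 t (snd (if k + 2 \<le> dd then (pnode v q (k + 1), id) else entries v q ! (dd - 1)))"
      and y: "fst (if k + 2 \<le> dd then (pnode v q (k + 1), id) else entries v q ! (dd - 1)) = pnode y0 y1 y2"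
    for e0 e1 e2 e3 e4 y0 y1 y2
  proof -
    let ?m = "upd (m3 e0 e1 e2 e3 e4 y0 y1 y2) ''j'' 0 (Suc j)"
    have s0: "same F mq m" using S(1) by (simp add: base_def)
    have s1: "same F mq m1" unfolding m1_def
    proof (intro same_upd)
      have "same F mq (upd (upd m ''k'' 0 c) ''status'' c 2)"
        using frame_mem(1)[OF k(2), of "''status''"] by (intro same_upd s0) (simp_all add: c_def frame_regs)
      then show "same F mq (set5 (upd (upd m ''k'' 0 c) ''status'' c 2) ''dec'' (2 * c) (m ''od'' (5 * j)) (m ''od'' (5 * j + 1)) (m ''od'' (5 * j + 2)) (m ''od'' (5 * j + 3)) (m ''od'' (5 * j + 4)))"
        using same_idx5(1)[of mq _ k 0] k(2) by (simp add: c_def)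
    qed (use frame_mem(2)[OF k(2), of 0] in \<open>simp_all add: c_def\<close>)
    have s2: "same F mq (m2 e0 e1 e2 e3 e4 y0 y1 y2)" unfolding m2_def
      using frame_mem(2)[OF k(2), of 1] same_idx5(1)[OF s1 k(2), of 1] by (intro same_upd) (simp_all add: c_def)
    have s3: "same F mq ?m" unfolding m3_def
      using frame_mem(1)[OF k(2)] same_idx5(2)[OF s2 k(2)] by (intro same_upd) (simp_all add: c_def frame_regs)
    have mo: "?m x = m x" if "x \<notin> {''k'', ''status'', ''dec'', ''tgtv'', ''tgtq'', ''tgtk'', ''gamma'', ''omegav'', ''omegaq'', ''omegak'', ''j''}" for x
      using that by (simp add: m1_def m2_def m3_def upd_def set5_def)
    have b: "base ?m" using S(1) s3 by (simp add: base_def mo)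
    have O': "Out ?m (entries v q)" using S(3) by (simp add: Out_def mo)
    have og: "og_ok ?m" using S(5) by (simp add: og_ok_def mo)
    have ogr: "rep5 (m ''og'' 0) (m ''og'' 1) (m ''og'' 2) (m ''og'' 3) (m ''og'' 4) t ga" "om = pnode (m ''w1'' 0) (m ''w2'' 0) (m ''w3'' 0)"
      using S(5) by (simp_all add: og_ok_def rep_effect_rep5 numeral_2_eq_2)
    have ss: "sink_ok ?m" using S(2) k(1) by (simp add: sink_ok_def rep_leaf_def m1_def m2_def m3_def upd_other set5_other rep_effect_set5 c_def)
    have stt: "?m ''status'' (bb + k') = (if k' = 0 then of_bool (has_sink D' B v q) else if k' \<le> Suc j then 2 else 0)" if "k' \<le> 2 * n" for k'
      using st[OF that] by (auto simp: m1_def m2_def m3_def c_def k_def)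
    have dk: "comb_done ?m k" using O[of j] j e y ogr
      by (simp add: comb_done_def rep_edge_def rep_leaf_def m1_def m2_def m3_def upd_other set5_other rep_effect_set5 c_def[symmetric])
        (simp add: k_def)
    have dd: "comb_done ?m k'" if "1 \<le> k'" "k' \<le> Suc j" for k'
    proof (cases "k' = k")
      case False
      with that have k': "k' \<le> j" "bb + k' \<noteq> c" by (auto simp: k_def c_def)
      then have "2 * (bb + k') \<noteq> 2 * c" "2 * (bb + k') \<noteq> 2 * c + 1" "2 * (bb + k') + 1 \<noteq> 2 * c" "2 * (bb + k') + 1 \<noteq> 2 * c + 1" by presburger+
      with dn[OF that(1) k'(1)] k'(2) show ?thesis
        unfolding comb_done_def rep_edge_def rep_leaf_def
        by (simp add: m1_def m2_def m3_def upd_other set5_other rep_effect_set5 not_sym)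
    qed (use dk in simp)
    show ?thesis using b ss O' og stt dd S(4) unfolding CI_def by (simp add: mo)
  qed
  have jx: "(m3 e0 e1 e2 e3 e4 y0 y1 y2) ''j'' 0 = j" for e0 e1 e2 e3 e4 y0 y1 y2
    by (simp add: m1_def m2_def m3_def S(6))
  have m1o: "m1 x = m x" if "x \<notin> {''k'', ''status'', ''dec'', ''tgtv'', ''tgtq'', ''tgtk''}" for x
    using that by (simp add: m1_def upd_def set5_def)
  have m1k: "m1 ''k'' 0 = c" by (simp add: m1_def)
  have m2o: "m2 e0 e1 e2 e3 e4 y0 y1 y2 x = m x" if "x \<notin> {''k'', ''status'', ''dec'', ''tgtv'', ''tgtq'', ''tgtk''}" for x e0 e1 e2 e3 e4 y0 y1 y2
    using that by (simp add: m1_def m2_def upd_def set5_def)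
  have m2k: "m2 e0 e1 e2 e3 e4 y0 y1 y2 ''k'' 0 = c" for e0 e1 e2 e3 e4 y0 y1 y2 by (simp add: m1_def m2_def)
  have A: "wp M (set_reg ''k'' (Add (reg ''b'') (Add (reg ''j'') (Num 1)))) (wp M (Assign ''status'' (reg ''k'') (Num 2))
    (wp M (copy5 ''dec'' left_slot ''od'' (reg ''j'')) (wp M (put3 ''tgtv'' ''tgtq'' ''tgtk'' left_slot (Cell ''ov'' (reg ''j'')) (Cell ''oq'' (reg ''j'')) (Cell ''ok'' (reg ''j''))) Q))) m = Q m1" for Q
  proof -
    have "wp M (set_reg ''k'' (Add (reg ''b'') (Add (reg ''j'') (Num 1)))) Q m = Q (upd m ''k'' 0 c)" for Q
      using cM rg S(6) by (simp add: set_reg_def reg_def c_def k_def)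
    then show ?thesis using lt M16 S(6) by (simp add: left_slot_def wp_copy5 Let_def put3_def reg_def m1_def)
  qed
  have C: "wp M (copy5 ''gamma'' (reg ''k'') ''og'' (Num 0)) (wp M (put3 ''omegav'' ''omegaq'' ''omegak'' (reg ''k'') (reg ''w1'') (reg ''w2'') (reg ''w3'')) Q)
     (m2 e0 e1 e2 e3 e4 y0 y1 y2) = Q (m3 e0 e1 e2 e3 e4 y0 y1 y2)" for Q e0 e1 e2 e3 e4 y0 y1 y2
    using lt by (simp add: wp_copy5 Let_def put3_def reg_def m2o m2k m3_def flip: numeral_2_eq_2)
  show ?thesis unfolding q_comb_body_def seq.simps wp.simps(3) A
  proof (cases "k + 2 \<le> dd")
    case True
    have f: "CI (Suc j) (upd (m3 t 0 0 t 0 v q (j + 2)) ''j'' 0 (Suc j))"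
      using rep5_id[OF t_le] True by (intro fin) (simp_all add: k_def)
    have bt: "bval (Less (Add (reg ''j'') (Num 2)) (reg ''d'')) m1" using True by (simp add: reg_def m1o S(6) d k_def)
    have "wp M (put_id ''dec'' right_slot) (wp M (put3 ''tgtv'' ''tgtq'' ''tgtk'' right_slot (reg ''v'') (reg ''q'') (Add (reg ''j'') (Num 2))) Q) m1
      = Q (m2 t 0 0 t 0 v q (j + 2))" for Q
      using rg S(6) t_le M16 vM qM jM by (simp add: put_id_def wp_put5 right_slot_def put3_def reg_def m1o m1k m2_def)
    then show "wp M (Cond (Less (Add (reg ''j'') (Num 2)) (reg ''d''))
       (Seq (put_id ''dec'' right_slot)
         (put3 ''tgtv'' ''tgtq'' ''tgtk'' right_slot (reg ''v'') (reg ''q'') (Add (reg ''j'') (Num 2))))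
       (Seq (copy5 ''dec'' right_slot ''od'' last_out)
         (put3 ''tgtv'' ''tgtq'' ''tgtk'' right_slot (Cell ''ov'' last_out) (Cell ''oq'' last_out) (Cell ''ok'' last_out))))
       (wp M (copy5 ''gamma'' (reg ''k'') ''og'' (Num 0)) (wp M (put3 ''omegav'' ''omegaq'' ''omegak'' (reg ''k'') (reg ''w1'') (reg ''w2'') (reg ''w3''))
         (\<lambda>m. m ''j'' 0 = j \<and> CI (Suc j) (upd m ''j'' 0 (Suc j))))) m1"
      unfolding wp.simps if_P[OF bt] by (simp only: C f jx simp_thms)
  next
    case False
    let ?l = "dd - 1"
    have l: "?l < dd" using j by simp
    have f: "CI (Suc j) (upd (m3 (m ''od'' (5 * ?l)) (m ''od'' (5 * ?l + 1)) (m ''od'' (5 * ?l + 2)) (m ''od'' (5 * ?l + 3)) (m ''od'' (5 * ?l + 4))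
        (m ''ov'' ?l) (m ''oq'' ?l) (m ''ok'' ?l)) ''j'' 0 (Suc j))"
      using O[OF l] False by (intro fin) simp_all
    have bt: "\<not> bval (Less (Add (reg ''j'') (Num 2)) (reg ''d'')) m1" using False by (simp add: reg_def m1o S(6) d k_def)
    have la: "aval last_out m1 = ?l" by (simp add: last_out_def reg_def m1o d)
    have la': "aval last_out (set5 m1 ''dec'' i x0 x1 x2 x3 x4) = ?l" "aval last_out (upd (set5 m1 ''dec'' i x0 x1 x2 x3 x4) ''tgtv'' i' y) = ?l"
       "aval last_out (upd (upd (set5 m1 ''dec'' i x0 x1 x2 x3 x4) ''tgtv'' i' y) ''tgtq'' i' y') = ?l" for i i' y y' x0 x1 x2 x3 x4
      by (simp_all add: last_out_def reg_def m1o d)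
    have av: "avoids ''dec'' right_slot" "avoids ''dec'' last_out" by (simp_all add: right_slot_def last_out_def reg_def)
    have "wp M (copy5 ''dec'' right_slot ''od'' last_out)
         (wp M (put3 ''tgtv'' ''tgtq'' ''tgtk'' right_slot (Cell ''ov'' last_out) (Cell ''oq'' last_out) (Cell ''ok'' last_out)) Q) m1
      = Q (m2 (m ''od'' (5 * ?l)) (m ''od'' (5 * ?l + 1)) (m ''od'' (5 * ?l + 2)) (m ''od'' (5 * ?l + 3)) (m ''od'' (5 * ?l + 4))
        (m ''ov'' ?l) (m ''oq'' ?l) (m ''ok'' ?l))" for Q
      using lt by (subst wp_copy5[OF av]) (simp_all add: Let_def la la' put3_def right_slot_def reg_def m1o m1k m2_def)
    then show "wp M (Cond (Less (Add (reg ''j'') (Num 2)) (reg ''d''))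
       (Seq (put_id ''dec'' right_slot)
         (put3 ''tgtv'' ''tgtq'' ''tgtk'' right_slot (reg ''v'') (reg ''q'') (Add (reg ''j'') (Num 2))))
       (Seq (copy5 ''dec'' right_slot ''od'' last_out)
         (put3 ''tgtv'' ''tgtq'' ''tgtk'' right_slot (Cell ''ov'' last_out) (Cell ''oq'' last_out) (Cell ''ok'' last_out))))
       (wp M (copy5 ''gamma'' (reg ''k'') ''og'' (Num 0)) (wp M (put3 ''omegav'' ''omegaq'' ''omegak'' (reg ''k'') (reg ''w1'') (reg ''w2'') (reg ''w3''))
         (\<lambda>m. m ''j'' 0 = j \<and> CI (Suc j) (upd m ''j'' 0 (Suc j))))) m1"
      unfolding wp.simps if_not_P[OF bt] by (simp only: C f jx simp_thms)
  qed
qed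

end

text \<open>Uses \<open>2 * n\<close> in place of the actual length \<open>d - 1\<close> of the
  comb, so the time depends on the number of states only.\<close>

definition comb_time :: "nat \<Rightarrow> nat" where
  "comb_time n = ctime q_comb_init + (10 + acost last_out + 2 * n * (12 + acost last_out + ctime q_comb_body))"

definition finish_time :: "nat \<Rightarrow> nat" where
  "finish_time n = 1 + bcost (Conj (Eq (reg ''d'') (Num 0)) (Eq (Cell ''confU'' (reg ''r'')) (Num 0))) +
     (ctime (Assign ''confA'' (reg ''r'') (Num 0)) + (ctime (Assign ''confA'' (reg ''r'') (Num 1)) +
       (1 + bcost (Eq (reg ''d'') (Num 0)) + (ctime q_leaf + (1 + bcost (Eq (reg ''d'') (Num 1)) + (ctime q_single + comb_time n))))))"

definition gather_time :: "nat \<Rightarrow> com \<Rightarrow> nat" where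
  "gather_time n c = 10 + acost (reg ''nb'') + n * (12 + acost (reg ''nb'') + ctime c)"

definition q_time :: "nat \<Rightarrow> nat" where
  "q_time n = ctime q_init + ((10 + acost width + (2 * n + 1) * (12 + acost width + ctime q_clear_body)) +
     (gather_time n (Cond left_test (emit ''v1'' 0) Skip) + (gather_time n (Cond right_test (emit ''v2'' 1) Skip) +
       (ctime q_sink + finish_time n))))"

text \<open>The two gathering loops are verified as a unit, whereas \<open>q_body\<close> nests its
  sequence to the right.\<close>

lemma ht_seq_assoc:
  assumes "ht K M P (Seq c1 c2) (T1 + T2) Q" "ht K M Q c3 T3 Q2"
  shows "ht K M P (Seq c1 (Seq c2 c3)) (T1 + (T2 + T3)) Q2"
  unfolding ht_def
proof (intro allI impI)
  fix m assume "bd M m" "P m"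
  with ht_seq[OF assms] obtain t m' where *: "exec (M ^ K) (Seq (Seq c1 c2) c3) m t m'" "t \<le> T1 + T2 + T3" "bd M m'" "Q2 m'"
    unfolding ht_def by blast
  from *(1) obtain ta tb tc m1 m2 where "exec (M ^ K) c1 m ta m1" "exec (M ^ K) c2 m1 tb m2" "exec (M ^ K) c3 m2 tc m'" "t = ta + tb + tc"
    by (auto elim!: exec.cases[of _ "Seq _ _"])
  then have "exec (M ^ K) (Seq c1 (Seq c2 c3)) m (ta + (tb + tc)) m'" by (intro exec.Seq)
  with * \<open>t = ta + tb + tc\<close> show "\<exists>t m'. exec (M ^ K) (Seq c1 (Seq c2 c3)) m t m' \<and> t \<le> T1 + (T2 + T3) \<and> bd M m' \<and> Q2 m'"
    by (intro exI[of _ "ta + (tb + tc)"] exI[of _ m']) simp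
qed

context state_run
begin

lemma comb_ht: "2 \<le> dd \<Longrightarrow> ht K M SA q_comb (comb_time n) final"
proof -
  assume d2: "2 \<le> dd"
  have ca: "(v, q) \<in> conf_a D' B" using d2 unfolding conf_a_entries by auto
  have loop: "ht K M (\<lambda>m. SA m \<and> og_ok m) (for_loop ''j'' last_out q_comb_body)
     (10 + acost last_out + (dd - 1) * (12 + acost last_out + ctime q_comb_body)) (CI (dd - 1))"
  proof (rule ht_for[OF M16])
    show "aok K last_out" "2 \<le> K" using K by (auto simp: ok_defs)
    show "dd - 1 < M" using nM[of "dd - 1"] length_entries_le by simp
    fix m assume m: "SA m \<and> og_ok m"
    then have S: "base m" "stat m" "sink_ok m" "Out m (entries v q)" "m ''confA'' rr = of_bool ((v, q) \<in> conf_a D' B)" "og_ok m"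
      by (simp_all add: SA_def S4_def)
    have "same F mq (upd m ''j'' 0 0)" using S(1) by (intro same_upd frame_regs) (auto simp: base_def)
    then have "base (upd m ''j'' 0 0)" using S(1) by (simp add: base_def)
    then show "CI 0 (upd m ''j'' 0 0)" using S(2-6)
      by (simp add: CI_def stat_def sink_ok_def rep_leaf_def Out_upd og_ok_def upd_other)
  next
    fix j m assume "CI j m"
    then show "aval last_out m = dd - 1 \<and> m ''j'' 0 = j" by (simp add: CI_def Out_def last_out_def reg_def)
  next
    fix j assume j: "j < dd - 1"
    show "ht K M (CI j) q_comb_body (ctime q_comb_body) (\<lambda>m. m ''j'' 0 = j \<and> CI (Suc j) (upd m ''j'' 0 (Suc j)))"
    proof (rule ht_wp[OF M16])
      show "straight K q_comb_body" using K by (simp add: ok_defs)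
    qed (use comb_body_wp j in auto)
  qed
  have init: "ht K M SA q_comb_init (ctime q_comb_init) (\<lambda>m. SA m \<and> og_ok m)"
  proof (rule ht_wp[OF M16])
    show "straight K q_comb_init" using K by (simp add: ok_defs)
  qed (use comb_init_wp d2 in auto)
  have "(dd - 1) * (12 + acost last_out + ctime q_comb_body) \<le> 2 * n * (12 + acost last_out + ctime q_comb_body)"
    using length_entries_le by (intro mult_le_mono1) simp
  then have le: "ctime q_comb_init + (10 + acost last_out + (dd - 1) * (12 + acost last_out + ctime q_comb_body)) \<le> comb_time n"
    by (simp add: comb_time_def)
  show ?thesis unfolding q_comb_def
  proof (rule ht_conseq[OF ht_seq[OF init loop] _ _ le])
    fix m assume m: "CI (dd - 1) m"
    have "spec_at m v q"
    proof (rule spec_atI)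
      show "m ''status'' (bb + k) = (if k = 0 then of_bool (has_sink D' B v q) else if (v, q) \<notin> conf_a D' B then 0
         else if k = 1 \<and> dd = 0 then 1 else if k = 1 \<and> dd = 1 then 3 else if k + 1 \<le> dd then 2 else 0)" if "k \<le> 2 * n" for k
        using m that d2 ca by (auto simp: CI_def)
      show "rep_edge m (2 * (bb + k)) t (entries v q ! (k - 1)) \<and>
        rep_edge m (2 * (bb + k) + 1) t (if k + 2 \<le> dd then (pnode v q (k + 1), id) else entries v q ! (dd - 1)) \<and>
        rep_leaf m (bb + k) t (ds_omega X' (fst (entries v q ! (dd - 1))))
          (ds_gamma X' (fst (entries v q ! (dd - 1))) \<circ> snd (entries v q ! (dd - 1)))" if "1 \<le> k" "k + 1 \<le> dd" for k
      proof -
        have "comb_done m k" using m that by (simp add: CI_def)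
        then show ?thesis by (simp only: comb_done_def om_def ga_def zz_def)
      qed
    qed (use m d2 in \<open>simp_all add: CI_def\<close>)
    then show "final m" using m by (simp add: final_def CI_def base_def)
  qed auto
qed

lemma finish_ht: "ht K M S4 q_finish (finish_time n) final"
  unfolding q_finish_def finish_time_def
proof (rule ht_cond[OF M16])
  have d: "m ''d'' 0 = dd \<and> m ''r'' 0 = rr \<and> m ''confU'' rr = of_bool ((v, q) \<in> conf_u D' B)" if "S4 m" for m
    using that base_regs[of m] by (simp add: S4_def Out_def)
  have same_A: "S4 m \<Longrightarrow> S4 (upd m ''confA'' rr x)" for m x
    using same_upd[OF _ frame_regs(2), of mq m "''confA''" x]
    by (simp add: S4_def base_def stat_def sink_ok_def rep_leaf_def Out_upd upd_other)
  show "bok K (Conj (Eq (reg ''d'') (Num 0)) (Eq (Cell ''confU'' (reg ''r'')) (Num 0)))" using K by (simp add: ok_defs)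
  show "ht K M (\<lambda>m. S4 m \<and> bval (Conj (Eq (reg ''d'') (Num 0)) (Eq (Cell ''confU'' (reg ''r'')) (Num 0))) m)
     (Assign ''confA'' (reg ''r'') (Num 0)) (ctime (Assign ''confA'' (reg ''r'') (Num 0))) final"
  proof (rule ht_wp[OF M16])
    show "straight K (Assign ''confA'' (reg ''r'') (Num 0))" using K by (simp add: ok_defs)
    fix m assume m: "S4 m \<and> bval (Conj (Eq (reg ''d'') (Num 0)) (Eq (Cell ''confU'' (reg ''r'')) (Num 0))) m"
    then have e: "entries v q = []" "(v, q) \<notin> conf_u D' B" using d[of m] by (auto simp: reg_def)
    then have ca: "(v, q) \<notin> conf_a D' B" unfolding conf_a_entries by simp
    have ns: "\<not> has_sink D' B v q" using e by (simp add: has_sink_def)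
    let ?m = "upd m ''confA'' rr 0"
    have S: "S4 ?m" using m same_A by blast
    have "spec_at ?m v q"
      by (rule spec_atI) (use S ca e(1) ns in \<open>auto simp: S4_def stat_def\<close>)
    then have "final ?m" using S by (simp add: final_def S4_def base_def)
    then show "wp M (Assign ''confA'' (reg ''r'') (Num 0)) final m" using d[of m] m M16 by (simp add: reg_def)
  qed simp
  let ?SA = "\<lambda>m. SA m \<and> (v, q) \<in> conf_a D' B"
  have dA: "m ''d'' 0 = dd" if "SA m" for m using that d[of m] by (simp add: SA_def)
  show "ht K M (\<lambda>m. S4 m \<and> \<not> bval (Conj (Eq (reg ''d'') (Num 0)) (Eq (Cell ''confU'' (reg ''r'')) (Num 0))) m)
    (Seq (Assign ''confA'' (reg ''r'') (Num 1)) (Cond (Eq (reg ''d'') (Num 0)) q_leaf (Cond (Eq (reg ''d'') (Num 1)) q_single q_comb)))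
    (ctime (Assign ''confA'' (reg ''r'') (Num 1)) +
       (1 + bcost (Eq (reg ''d'') (Num 0)) + (ctime q_leaf + (1 + bcost (Eq (reg ''d'') (Num 1)) + (ctime q_single + comb_time n))))) final"
  proof (rule ht_seq[where Q = ?SA])
    show "ht K M (\<lambda>m. S4 m \<and> \<not> bval (Conj (Eq (reg ''d'') (Num 0)) (Eq (Cell ''confU'' (reg ''r'')) (Num 0))) m)
      (Assign ''confA'' (reg ''r'') (Num 1)) (ctime (Assign ''confA'' (reg ''r'') (Num 1))) ?SA"
    proof (rule ht_wp[OF M16])
      show "straight K (Assign ''confA'' (reg ''r'') (Num 1))" using K by (simp add: ok_defs)
      fix m assume m: "S4 m \<and> \<not> bval (Conj (Eq (reg ''d'') (Num 0)) (Eq (Cell ''confU'' (reg ''r'')) (Num 0))) m"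
      then have ca: "(v, q) \<in> conf_a D' B" using d[of m] unfolding conf_a_entries by (auto simp: reg_def split: if_splits)
      have "S4 (upd m ''confA'' rr 1)" using m same_A by blast
      then show "wp M (Assign ''confA'' (reg ''r'') (Num 1)) ?SA m" using d[of m] m M16 ca by (simp add: reg_def SA_def)
    qed simp
    show "ht K M ?SA (Cond (Eq (reg ''d'') (Num 0)) q_leaf (Cond (Eq (reg ''d'') (Num 1)) q_single q_comb))
      (1 + bcost (Eq (reg ''d'') (Num 0)) + (ctime q_leaf + (1 + bcost (Eq (reg ''d'') (Num 1)) + (ctime q_single + comb_time n)))) final"
    proof (rule ht_cond[OF M16])
      show "bok K (Eq (reg ''d'') (Num 0))" using K by (simp add: ok_defs)
      show "ht K M (\<lambda>m. ?SA m \<and> bval (Eq (reg ''d'') (Num 0)) m) q_leaf (ctime q_leaf) final"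
      proof (rule ht_wp[OF M16])
        show "straight K q_leaf" using K by (simp add: ok_defs)
        fix m assume "bd M m" "?SA m \<and> bval (Eq (reg ''d'') (Num 0)) m"
        then show "wp M q_leaf final m" using dA[of m] by (intro leaf_wp) (auto simp: reg_def)
      qed simp
      show "ht K M (\<lambda>m. ?SA m \<and> \<not> bval (Eq (reg ''d'') (Num 0)) m) (Cond (Eq (reg ''d'') (Num 1)) q_single q_comb)
        (1 + bcost (Eq (reg ''d'') (Num 1)) + (ctime q_single + comb_time n)) final"
      proof (rule ht_cond[OF M16])
        show "bok K (Eq (reg ''d'') (Num 1))" using K by (simp add: ok_defs)
        show "ht K M (\<lambda>m. (?SA m \<and> \<not> bval (Eq (reg ''d'') (Num 0)) m) \<and> bval (Eq (reg ''d'') (Num 1)) m) q_single (ctime q_single) final"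
        proof (rule ht_wp[OF M16])
          show "straight K q_single" using K by (simp add: ok_defs)
          fix m assume "bd M m" "(?SA m \<and> \<not> bval (Eq (reg ''d'') (Num 0)) m) \<and> bval (Eq (reg ''d'') (Num 1)) m"
          then show "wp M q_single final m" using dA[of m] by (intro single_wp) (auto simp: reg_def)
        qed simp
        show "ht K M (\<lambda>m. (?SA m \<and> \<not> bval (Eq (reg ''d'') (Num 0)) m) \<and> \<not> bval (Eq (reg ''d'') (Num 1)) m) q_comb (comb_time n) final"
        proof (rule ht_pointwise)
          fix m assume m: "(?SA m \<and> \<not> bval (Eq (reg ''d'') (Num 0)) m) \<and> \<not> bval (Eq (reg ''d'') (Num 1)) m"
          then have "dd \<noteq> 0" "dd \<noteq> 1" using dA[of m] by (auto simp: reg_def)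
          then have "2 \<le> dd" by linarith
          from comb_ht[OF this] show "ht K M (\<lambda>m'. m' = m) q_comb (comb_time n) final"
            by (rule ht_conseq) (use m in auto)
        qed
      qed
    qed
  qed
qed

lemma q_body_ht: "ht K M (\<lambda>m. m = mq) q_body (q_time n) final"
proof -
  have init: "ht K M (\<lambda>m. m = mq) q_init (ctime q_init) (\<lambda>m. base m \<and> Out m [])"
  proof (rule ht_wp[OF M16])
    show "straight K q_init" using K by (simp add: ok_defs)
  qed (use init_wp in auto)
  have sink: "ht K M (\<lambda>m. base m \<and> zeros m \<and> Out m move_entries) q_sink (ctime q_sink) S4"
  proof (rule ht_wp[OF M16])
    show "straight K q_sink" using K by (simp add: ok_defs)
  qed (use sink_wp in auto)
  show ?thesis unfolding q_body_def q_time_def gather_time_def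
  proof (rule ht_seq[OF init ht_seq[OF clear_ht]])
    show "ht K M (\<lambda>m. base m \<and> zeros m \<and> Out m [])
     (Seq (gather left_test ''v1'' 0) (Seq (gather right_test ''v2'' 1) (Seq q_sink q_finish)))
     (10 + acost (reg ''nb'') + n * (12 + acost (reg ''nb'') + ctime (Cond left_test (emit ''v1'' 0) Skip)) +
      (10 + acost (reg ''nb'') + n * (12 + acost (reg ''nb'') + ctime (Cond right_test (emit ''v2'' 1) Skip)) + (ctime q_sink + finish_time n))) final"
      using gathers_ht[unfolded t_gather_def] ht_seq[OF sink finish_ht] by (rule ht_seq_assoc)
  qed
qed

end

section \<open>Preparing a vertex: states, effects and order lists\<close>

definition v_clear_body :: com where
  "v_clear_body = Seq (Assign ''confU'' (Add (Mul (reg ''v'') (reg ''Q'')) (reg ''q'')) (Num 0))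
     (Assign ''ordlen'' (Add (Mul (reg ''v'') (reg ''Q'')) (reg ''q'')) (Num 0))"

text \<open>Kinds 0 and 1 select the \<open>Sym\<close> and the \<open>SymStar\<close> cells in the
  layout of \<open>delta0\<close>; adding 1 switches to a marked leaf.\<close>

definition leaf_code :: aexp where
  "leaf_code = Add (Mul (Num 4) (Cell ''sym'' (reg ''v''))) (Mul (Num 2) (Cell ''kind'' (reg ''v'')))"

definition v_leaf :: com where
  "v_leaf = seq [set_reg ''nb'' (Num 0), set_reg ''e'' (Cell ''delta0'' leaf_code),
     Assign ''confU'' (Add (Mul (reg ''v'') (reg ''Q'')) (Cell ''delta0'' (Add leaf_code (Num 1)))) (Num 1)]"

text \<open>The types themselves serve as target types and coefficients. As they are 0 or 1, and not
  both 1 under \<open>HCat\<close>, one formula for each label and direction reproduces all cases of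
  \<open>effect\<close>.\<close>

definition v_setup :: com where
  "v_setup = seq [set_reg ''nb'' (reg ''Q''), set_reg ''v1'' (Cell ''left'' (reg ''v'')), set_reg ''v2'' (Cell ''right'' (reg ''v'')),
     set_reg ''h'' (Sub (Cell ''kind'' (reg ''v'')) (Num 2)),
     Cond (Eq (Cell ''kind'' (reg ''v'')) (Num 2))
       (Seq (put5 ''effect'' (Mul (Num 2) (reg ''v'')) (Cell ''type'' (reg ''v1'')) (Num 0) (Num 0) (Cell ''type'' (reg ''v1'')) (Num 0))
         (put5 ''effect'' (Add (Mul (Num 2) (reg ''v'')) (Num 1)) (Cell ''type'' (reg ''v2'')) (Cell ''type'' (reg ''v1''))
           (Cell ''size'' (reg ''v1'')) (Cell ''type'' (reg ''v2'')) (Num 0)))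
       (Seq (put5 ''effect'' (Mul (Num 2) (reg ''v'')) (Num 1) (Num 0) (Num 0) (Cell ''type'' (reg ''v2'')) (Cell ''size'' (reg ''v2'')))
         (put5 ''effect'' (Add (Mul (Num 2) (reg ''v'')) (Num 1)) (Cell ''type'' (reg ''v2'')) (Num 0)
           (Cell ''lsize'' (reg ''v1'')) (Cell ''type'' (reg ''v2'')) (Num 0)))]"

text \<open>The state of a child for the empty set is stored as a row of bits and has to be found by
  a scan.\<close>

definition find_body :: com where
  "find_body = Seq
     (Cond (Eq (Cell ''confE'' (Add (Mul (reg ''v1'') (reg ''Q'')) (reg ''q''))) (Num 1)) (set_reg ''e1'' (reg ''q'')) Skip)
     (Cond (Eq (Cell ''confE'' (Add (Mul (reg ''v2'') (reg ''Q'')) (reg ''q''))) (Num 1)) (set_reg ''e2'' (reg ''q'')) Skip)"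

definition v_state :: com where
  "v_state = set_reg ''e'' (Cell ''delta2'' (Add (Mul (Num 2) (Add (Mul (reg ''e1'') (reg ''Q'')) (reg ''e2''))) (reg ''h'')))"

definition pair_index :: aexp where
  "pair_index = Add (Mul (reg ''r'') (Mul (reg ''Q'') (reg ''Q''))) (Cell ''ordlen'' (reg ''r''))"

text \<open>Each pair of states is visited once and appended to the list of its result state, with
  \<open>ordlen\<close> as fill pointer. One pass over all pairs serves all states together, whereas
  a separate search for each state would cost a further factor \<open>|Q|\<close>.\<close>

definition pair_body :: com where
  "pair_body = Cond (Conj (Eq (Cell ''confA'' (Add (Mul (reg ''v1'') (reg ''Q'')) (reg ''p1''))) (Num 1))
       (Eq (Cell ''confA'' (Add (Mul (reg ''v2'') (reg ''Q'')) (reg ''p2''))) (Num 1)))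
     (seq [set_reg ''r'' (Add (Mul (reg ''v'') (reg ''Q''))
          (Cell ''delta2'' (Add (Mul (Num 2) (Add (Mul (reg ''p1'') (reg ''Q'')) (reg ''p2''))) (reg ''h'')))),
        Assign ''ordq1'' pair_index (reg ''p1''), Assign ''ordq2'' pair_index (reg ''p2''),
        Assign ''ordlen'' (reg ''r'') (Add (Cell ''ordlen'' (reg ''r'')) (Num 1)),
        Assign ''confU'' (reg ''r'') (Num 1)]) Skip"

definition v_inner :: com where
  "v_inner = Seq v_setup (Seq (for_loop ''q'' (reg ''Q'') find_body)
     (Seq v_state (for_loop ''p1'' (reg ''Q'') (for_loop ''p2'' (reg ''Q'') pair_body))))"

definition vertex_program :: com where
  "vertex_program = Seq (for_loop ''q'' (reg ''Q'') v_clear_body)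
     (Seq (Cond (Less (Cell ''kind'' (reg ''v'')) (Num 2)) v_leaf v_inner) (for_loop ''q'' (reg ''Q'') q_body))"

lemmas v_defs = v_clear_body_def leaf_code_def v_leaf_def v_setup_def find_body_def v_state_def pair_index_def pair_body_def
  set_reg_def reg_def

lemmas vok_defs = v_defs put5_def idx5_def aok_def

definition loop_time :: "nat \<Rightarrow> nat \<Rightarrow> nat" where
  "loop_time n T = 10 + acost (reg ''Q'') + n * (12 + acost (reg ''Q'') + T)"

definition inner_time :: "nat \<Rightarrow> nat" where
  "inner_time n = ctime v_setup + (loop_time n (ctime find_body) + (ctime v_state + loop_time n (loop_time n (ctime pair_body))))"

definition vertex_time :: "nat \<Rightarrow> nat" where
  "vertex_time n = loop_time n (ctime v_clear_body) +
     ((1 + bcost (Less (Cell ''kind'' (reg ''v'')) (Num 2)) + (ctime v_leaf + inner_time n)) + loop_time n (q_time n))"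

definition vframe :: "nat \<Rightarrow> nat \<Rightarrow> (string \<times> nat) set" where
  "vframe n v = {(x, i). x \<in> {''q'', ''nb'', ''e'', ''e1'', ''e2'', ''h'', ''v1'', ''v2'', ''p1'', ''p2'', ''r''} \<or>
     x \<in> {''confU'', ''ordlen''} \<and> i div n = v \<or> x \<in> {''ordq1'', ''ordq2''} \<and> i div (n * n) div n = v \<or>
     x = ''effect'' \<and> i div 10 = v}"

definition inputs :: "string set" where
  "inputs = {''N'', ''N0'', ''root'', ''kind'', ''sym'', ''left'', ''right'', ''type'', ''size'', ''lsize'',
     ''Q'', ''delta0'', ''delta2'', ''final''}"

lemma product_snoc: "List.product (xs @ [x]) ys = List.product xs ys @ map (Pair x) ys"
  by (induction xs) auto

context vertex_run
begin

definition start :: "mem \<Rightarrow> bool" where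
  "start m \<longleftrightarrow> (\<forall>x \<in> inputs. m x = m0 x) \<and>
     m ''v'' 0 = v \<and> done_verts m"

lemma reads_vframe: "u \<noteq> v \<Longrightarrow> p < n \<Longrightarrow> reads n (u * n + p) \<inter> vframe n v = {}"
  using block_eq[of p n u] by (auto simp: reads_def vframe_def)

lemma start_same: "start m \<Longrightarrow> same (vframe n v) m m' \<Longrightarrow> start m'"
proof -
  assume s: "start m" and f: "same (vframe n v) m m'"
  have eq: "m' x = m x" if "x \<in> insert ''v'' inputs" for x
    using sameD[OF f, of x] that by (intro ext) (auto simp: vframe_def inputs_def)
  have "done_verts m'" unfolding done_verts_def
  proof (intro ballI impI)
    fix u assume u: "u \<in> verts D'" "u < N0 \<or> v < u"
    have "done_verts m" using s by (simp add: start_def)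
    with u have "finished m u" unfolding done_verts_def by blast
    then show "finished m' u"
    proof (rule finished_cong[OF _ f])
      show "reads n (u * n + p) \<inter> vframe n v = {}" if "p < n" for p
        using u(2) v(1) that by (intro reads_vframe) auto
      show "(''effect'', i) \<notin> vframe n v" if "i div 10 = u" for i using u(2) v(1) that by (auto simp: vframe_def)
    qed
  qed
  then show ?thesis using s eq by (simp add: start_def)
qed

lemma start_upd: "start m \<Longrightarrow> (x, i) \<in> vframe n v \<Longrightarrow> start (upd m x i y)"
  by (rule start_same, assumption, rule same_upd, rule same_refl)

lemma start_regs: "start m \<Longrightarrow> m ''Q'' 0 = n \<and> m ''v'' 0 = v"
  by (simp add: start_def n_cell inputs_def)

lemma slp_cell: "u \<in> verts D' \<Longrightarrow>
   case label D' u of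
          Sym a \<Rightarrow> m0 ''kind'' u = 0 \<and> m0 ''sym'' u = code a
        | SymStar a \<Rightarrow> m0 ''kind'' u = 1 \<and> m0 ''sym'' u = code a
        | HCat \<Rightarrow> m0 ''kind'' u = 2 \<and> (u, L, m0 ''left'' u) \<in> edges D' \<and> (u, R, m0 ''right'' u) \<in> edges D'
        | VComp \<Rightarrow> m0 ''kind'' u = 3 \<and> (u, L, m0 ''left'' u) \<in> edges D' \<and> (u, R, m0 ''right'' u) \<in> edges D'"
  using slp unfolding rep_slp_def by blast

lemma kind_less: "m0 ''kind'' v < 2 \<longleftrightarrow> is_leaf D' v"
  using slp_cell[OF vD'] new.leaf_iff[OF vD'] by (cases "label D' v") auto

lemma child_cells: "inner \<Longrightarrow> m0 ''left'' v = child D' v L \<and> m0 ''right'' v = child D' v R"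
  using slp_cell[OF vD'] new.inner_label[OF vD'] new.child_eq[of v L] new.child_eq[of v R] by auto

lemma size_cells: "u \<in> verts D' \<Longrightarrow> m0 ''type'' u = vtype D' u" "u \<in> verts D' \<Longrightarrow> m0 ''size'' u = leaf_size D' u"
  "u \<in> verts D' \<Longrightarrow> vtype D' u = 1 \<Longrightarrow> m0 ''lsize'' u = left_size D' u"
  using sizes by (auto simp: rep_sizes_def)

lemma small: "x \<le> n * n \<Longrightarrow> x < M" 
proof -
  assume "x \<le> n * n"
  also have "n * n < b * b" using n by (intro mult_strict_mono') auto
  also have "b * b \<le> M" using b_pow[of 2] by (simp add: power2_eq_square)
  finally show ?thesis .
qed

lemma n_less_M: "n < M"
  using small_less[of n] n by simp

definition cleared :: "mem \<Rightarrow> bool" where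
  "cleared m \<longleftrightarrow> start m \<and> (\<forall>q < n. m ''confU'' (v * n + q) = 0 \<and> m ''ordlen'' (v * n + q) = 0)"

lemma v_frame_mem: "q < n \<Longrightarrow> x \<in> {''confU'', ''ordlen''} \<Longrightarrow> (x, v * n + q) \<in> vframe n v"
  "q < n \<Longrightarrow> i < n * n \<Longrightarrow> x \<in> {''ordq1'', ''ordq2''} \<Longrightarrow> (x, (v * n + q) * (n * n) + i) \<in> vframe n v"
  "x \<in> {''q'', ''nb'', ''e'', ''e1'', ''e2'', ''h'', ''v1'', ''v2'', ''p1'', ''p2'', ''r''} \<Longrightarrow> (x, i) \<in> vframe n v"
  "c < 5 \<Longrightarrow> d < 2 \<Longrightarrow> (''effect'', 5 * (2 * v + d) + c) \<in> vframe n v"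
  using block_eq[of q n v] block_eq[of i "n * n" "v * n + q"] by (auto simp: vframe_def)

lemma clear_ht: "ht K M start (for_loop ''q'' (reg ''Q'') v_clear_body) (loop_time n (ctime v_clear_body)) cleared"
proof -
  define I where "I j m \<longleftrightarrow> start m \<and> m ''q'' 0 = j \<and> (\<forall>q < j. m ''confU'' (v * n + q) = 0 \<and> m ''ordlen'' (v * n + q) = 0)" for j m
  have sq: "start m \<Longrightarrow> start (upd m ''q'' 0 j)" for m j
    by (rule start_upd) (simp_all add: v_frame_mem(3))
  show ?thesis unfolding loop_time_def
  proof (rule ht_conseq[OF ht_for[OF M16, where Inv = I and l = n and T = "ctime v_clear_body" and i = "''q''" and e = "reg ''Q''" and P = start and c = v_clear_body and K = K]])
    show "aok K (reg ''Q'')" "2 \<le> K" using K by (auto simp: vok_defs)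
    show "n < M" by (rule n_less_M)
    show "start m \<Longrightarrow> I 0 (upd m ''q'' 0 0)" for m using sq[of m 0] by (simp add: I_def)
    show "I j m \<Longrightarrow> aval (reg ''Q'') m = n \<and> m ''q'' 0 = j" for j m using start_regs[of m] by (simp add: I_def reg_def)
    show "I n m \<Longrightarrow> cleared m" for m by (simp add: I_def cleared_def)
    fix j assume j: "j < n"
    show "ht K M (I j) v_clear_body (ctime v_clear_body) (\<lambda>m. m ''q'' 0 = j \<and> I (Suc j) (upd m ''q'' 0 (Suc j)))"
    proof (rule ht_wp[OF M16])
      show "straight K v_clear_body" using K by (simp add: vok_defs)
      fix m assume m: "bd M m" "I j m"
      let ?m = "upd (upd m ''confU'' (v * n + j) 0) ''ordlen'' (v * n + j) 0"
      have "start ?m" using m(2) v_frame_mem(1)[OF j] by (intro start_upd) (simp_all add: I_def)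
      then have "start (upd ?m ''q'' 0 (Suc j))" by (rule sq)
      then have "I (Suc j) (upd ?m ''q'' 0 (Suc j))" using m(2) by (auto simp: I_def less_Suc_eq)
      then show "wp M v_clear_body (\<lambda>m. m ''q'' 0 = j \<and> I (Suc j) (upd m ''q'' 0 (Suc j))) m"
        using m(2) start_regs[of m] M16 by (simp add: v_defs I_def)
    qed simp
  qed auto
qed

lemma type_v: "start m \<Longrightarrow> m ''type'' v = t"
  by (simp add: start_def inputs_def size_cells vD')

lemma leaf_ht: "is_leaf D' v \<Longrightarrow> ht K M cleared v_leaf (ctime v_leaf) (\<lambda>m. ready m \<and> start m)"
proof (rule ht_wp[OF M16])
  show "straight K v_leaf" using K by (simp add: vok_defs)
  fix m assume leaf: "is_leaf D' v" and bm: "bd M m" and m: "cleared m"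
  have st: "start m" using m by (simp add: cleared_def)
  note rg = start_regs[OF st]
  have cells: "m ''kind'' = m0 ''kind''" "m ''sym'' = m0 ''sym''" "m ''delta0'' = m0 ''delta0''" using st by (simp_all add: start_def inputs_def)
  have lt: "m x j < M" for x j using bm by (simp add: bd_def)
  from new.leaf_label[OF vD' leaf] obtain c where c: "label D' v = Sym c \<or> label D' v = SymStar c" by blast
  let ?i = "4 * m ''sym'' v + 2 * m ''kind'' v"
  have d: "m ''delta0'' ?i = delta0 B (label D' v) False" "m ''delta0'' (?i + 1) = delta0 B (label D' v) True"
    using c slp_cell[OF vD'] delta_cells(1)[of c False] delta_cells(1)[of c True] delta_cells(2)[of c False] delta_cells(2)[of c True]
    unfolding cells by auto
  let ?e = "delta0 B (label D' v) False" and ?u = "delta0 B (label D' v) True"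
  have eu: "?u < n" using new.delta0_states[OF new.leaf_Sigma0[OF vD' leaf]] by (simp add: state_less)
  let ?m = "upd (upd (upd m ''nb'' 0 0) ''e'' 0 ?e) ''confU'' (v * n + ?u) 1"
  have sm: "start ?m" using v_frame_mem(1)[OF eu, of "''confU''"] st
    by (intro start_upd) (simp_all add: v_frame_mem(3))
  have "m ''confU'' (v * n + q) = 0" if "q < n" for q using m that by (simp add: cleared_def)
  moreover have "done_verts ?m" using sm by (simp add: start_def)
  moreover note sm
  ultimately have "ready ?m \<and> start ?m" using rg leaf type_v[of ?m] new.ce_leaf[OF vD' leaf] new.conf_u_leaf[OF vD' leaf]
    by (auto simp: ready_def)
  then show "wp M v_leaf (\<lambda>m. ready m \<and> start m) m" using d rg lt M16 lt[of "''delta0''" ?i]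
    by (simp add: v_leaf_def leaf_code_def set_reg_def reg_def)
qed simp

text \<open>The share of one result state in the pairs visited so far; after all pairs it is
  \<open>quad_list\<close>.\<close>

definition flt :: "nat \<Rightarrow> (nat \<times> nat) list \<Rightarrow> (nat \<times> nat) list" where
  "flt q = filter (\<lambda>(q1, q2). (child D' v L, q1) \<in> conf_a D' B \<and> (child D' v R, q2) \<in> conf_a D' B \<and> delta2 B q1 q2 (label D' v) = q)"

definition set_up :: "mem \<Rightarrow> bool" where
  "set_up m \<longleftrightarrow> start m \<and> m ''nb'' 0 = n \<and> m ''v1'' 0 = child D' v L \<and> m ''v2'' 0 = child D' v R \<and>
     m ''h'' 0 = (if label D' v = HCat then 0 else 1) \<and>
     (\<forall>d. rep_effect (m ''effect'') (2 * v + dir_num d) t (edge_effect D' v d))"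

definition listed :: "mem \<Rightarrow> (nat \<times> nat) list \<Rightarrow> bool" where
  "listed m ps \<longleftrightarrow> (\<forall>q < n. m ''ordlen'' (v * n + q) = length (flt q ps) \<and> m ''confU'' (v * n + q) = of_bool (flt q ps \<noteq> []) \<and>
     (\<forall>i < length (flt q ps). flt q ps ! i = (m ''ordq1'' ((v * n + q) * (n * n) + i), m ''ordq2'' ((v * n + q) * (n * n) + i))))"

lemma setup_wp:
  assumes inn: inner and m: "bd M m" "cleared m"
  shows "wp M v_setup (\<lambda>m. set_up m \<and> listed m []) m"
proof -
  have st: "start m" using m by (simp add: cleared_def)
  note rg = start_regs[OF st]
  have cells: "m ''kind'' = m0 ''kind''" "m ''left'' = m0 ''left''" "m ''right'' = m0 ''right''" "m ''type'' = m0 ''type''"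
     "m ''size'' = m0 ''size''" "m ''lsize'' = m0 ''lsize''" using st by (simp_all add: start_def inputs_def)
  have lt: "m x j < M" for x j using m(1) by (simp add: bd_def)
  let ?l = "child D' v L" and ?r = "child D' v R"
  have c: "?l \<in> verts D'" "?r \<in> verts D'" using child_v[OF inn] by auto
  note lr = child_cells[OF inn]
  have kind: "m0 ''kind'' v = (if label D' v = HCat then 2 else 3)" using slp_cell[OF vD'] new.inner_label[OF vD' inn] by auto
  define h where "h = (if label D' v = HCat then 0 else 1 :: nat)"
  define m1 where "m1 = upd (upd (upd (upd m ''nb'' 0 n) ''v1'' 0 ?l) ''v2'' 0 ?r) ''h'' 0 h"
  have pre: "wp M (set_reg ''nb'' (reg ''Q'')) (wp M (set_reg ''v1'' (Cell ''left'' (reg ''v''))) (wp M (set_reg ''v2'' (Cell ''right'' (reg ''v'')))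
     (wp M (set_reg ''h'' (Sub (Cell ''kind'' (reg ''v'')) (Num 2))) Q))) m = Q m1" for Q
    using lt[of "''Q''" 0] lt[of "''left''" v] lt[of "''right''" v] lt[of "''kind''" v] rg lr kind M16
    by (simp add: set_reg_def reg_def cells m1_def h_def)
  have m1o: "m1 x = m x" if "x \<notin> {''nb'', ''v1'', ''v2'', ''h''}" for x using that by (simp add: m1_def upd_def)
  have m1r: "m1 ''v1'' 0 = ?l" "m1 ''v2'' 0 = ?r" by (simp_all add: m1_def)
  have fin: "set_up m2 \<and> listed m2 []"
    if m2: "m2 = set5 (set5 m1 ''effect'' (2 * v) x0 x1 x2 x3 x4) ''effect'' (2 * v + 1) y0 y1 y2 y3 y4"
      and e: "rep5 x0 x1 x2 x3 x4 t (edge_effect D' v L)" "rep5 y0 y1 y2 y3 y4 t (edge_effect D' v R)" for m2 x0 x1 x2 x3 x4 y0 y1 y2 y3 y4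
  proof -
    have "same (vframe n v) m m2" unfolding m2 m1_def
      using v_frame_mem(4)[of _ 0] v_frame_mem(4)[of _ 1]
      by (intro same_set5 same_upd same_refl) (simp_all add: v_frame_mem(3))
    then have "start m2" by (rule start_same[OF st])
    moreover have "rep_effect (m2 ''effect'') (2 * v + dir_num d) t (edge_effect D' v d)" for d
      using e by (cases d) (simp_all add: m2 rep_effect_set5)
    moreover have "listed m2 []" using m(2) by (simp add: listed_def flt_def m2 cleared_def m1o)
    ultimately show ?thesis by (simp add: set_up_def m2 m1_def h_def)
  qed
  have ls: "vtype D' ?l = 1 \<Longrightarrow> m0 ''lsize'' ?l = left_size D' ?l" by (rule size_cells(3)[OF c(1)])
  have tcell: "m0 ''type'' ?l = vtype D' ?l" "m0 ''type'' ?r = vtype D' ?r" "m0 ''size'' ?l = leaf_size D' ?l" "m0 ''size'' ?r = leaf_size D' ?r"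
    using size_cells(1,2) c by simp_all
  have ltc: "vtype D' ?l < M" "vtype D' ?r < M" "leaf_size D' ?l < M" "leaf_size D' ?r < M"
    using lt[of "''type''" ?l] lt[of "''type''" ?r] lt[of "''size''" ?l] lt[of "''size''" ?r] unfolding cells tcell by simp_all
  show ?thesis
  proof (cases "label D' v = HCat")
    case True
    have tt: "t = vtype D' ?l + vtype D' ?r" by (rule new.vtype_HCat[OF vD' True])
    then have cs: "vtype D' ?l = 0 \<and> vtype D' ?r = 0 \<or> vtype D' ?l = 0 \<and> vtype D' ?r = 1 \<or> vtype D' ?l = 1 \<and> vtype D' ?r = 0"
      using t_le new.vtype_cases[of ?l] new.vtype_cases[of ?r] by linarith
    have e: "rep5 (vtype D' ?l) 0 0 (vtype D' ?l) 0 t (edge_effect D' v L)"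
      "rep5 (vtype D' ?r) (vtype D' ?l) (leaf_size D' ?l) (vtype D' ?r) 0 t (edge_effect D' v R)"
      unfolding edge_effect_def Let_def tt True using cs by (auto simp: rep5_effect rep5_effect[unfolded One_nat_def])
    from fin[OF refl e] show ?thesis unfolding v_setup_def seq.simps wp.simps(3) pre
      using True kind ltc rg M16
      by (simp add: reg_def wp_put5 m1o m1r cells tcell)
  next
    case False
    then have f: "label D' v = VComp" using new.inner_label[OF vD' inn] by blast
    have tt: "vtype D' ?l = 1" "t = vtype D' ?r" by (rule new.vtype_VComp[OF vD' f])+
    have e: "rep5 1 0 0 (vtype D' ?r) (leaf_size D' ?r) t (edge_effect D' v L)"
      "rep5 (vtype D' ?r) 0 (left_size D' ?l) (vtype D' ?r) 0 t (edge_effect D' v R)"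
      unfolding edge_effect_def Let_def tt f using new.vtype_cases[of ?r] by (auto simp: rep5_effect rep5_effect[unfolded One_nat_def])
    have lsM: "left_size D' ?l < M" using lt[of "''lsize''" ?l] ls[OF tt(1)] by (simp add: cells)
    from fin[OF refl e] show ?thesis unfolding v_setup_def seq.simps wp.simps(3) pre
      using f kind ltc lsM rg M16 tt
      by (simp add: reg_def wp_put5 m1o m1r cells tcell ls)
  qed
qed

text \<open>Says nothing about a state that has not been inspected yet, because \<open>e1\<close>
  and \<open>e2\<close> hold arbitrary values until then.\<close>

definition found :: "mem \<Rightarrow> nat \<Rightarrow> bool" where
  "found m j \<longleftrightarrow> (ce D' B (child D' v L) < j \<longrightarrow> m ''e1'' 0 = ce D' B (child D' v L)) \<and>
     (ce D' B (child D' v R) < j \<longrightarrow> m ''e2'' 0 = ce D' B (child D' v R))"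

lemma set_up_upd: "x \<in> {''q'', ''e'', ''e1'', ''e2'', ''p1'', ''p2'', ''r''} \<Longrightarrow> set_up m \<Longrightarrow> set_up (upd m x 0 y)"
proof -
  assume x: "x \<in> {''q'', ''e'', ''e1'', ''e2'', ''p1'', ''p2'', ''r''}" and s: "set_up m"
  have ne: "x \<noteq> ''effect''" "x \<noteq> ''nb''" "x \<noteq> ''v1''" "x \<noteq> ''v2''" "x \<noteq> ''h''" using x by auto
  have "x \<in> {''q'', ''nb'', ''e'', ''e1'', ''e2'', ''h'', ''v1'', ''v2'', ''p1'', ''p2'', ''r''}" using x by auto
  then have st: "start (upd m x 0 y)" using s by (intro start_upd v_frame_mem(3)) (simp_all add: set_up_def)
  then show ?thesis using s st ne by (simp add: set_up_def upd_other)
qed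

lemma listed_upd: "x \<in> {''q'', ''e'', ''e1'', ''e2'', ''p1'', ''p2'', ''r''} \<Longrightarrow> listed (upd m x i y) ps \<longleftrightarrow> listed m ps"
proof -
  assume x: "x \<in> {''q'', ''e'', ''e1'', ''e2'', ''p1'', ''p2'', ''r''}"
  have ne: "x \<noteq> ''ordlen''" "x \<noteq> ''confU''" "x \<noteq> ''ordq1''" "x \<noteq> ''ordq2''" using x by auto
  show ?thesis unfolding listed_def upd_other[OF ne(1)] upd_other[OF ne(2)] upd_other[OF ne(3)] upd_other[OF ne(4)] ..
qed

lemma find_ht:
  assumes inn: inner
  shows "ht K M (\<lambda>m. set_up m \<and> listed m []) (for_loop ''q'' (reg ''Q'') find_body) (loop_time n (ctime find_body))
    (\<lambda>m. set_up m \<and> listed m [] \<and> found m n)"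
proof -
  define I where "I j m \<longleftrightarrow> set_up m \<and> listed m [] \<and> found m j \<and> m ''q'' 0 = j" for j m
  show ?thesis unfolding loop_time_def
  proof (rule ht_conseq[OF ht_for[OF M16, where Inv = I and l = n and T = "ctime find_body" and i = "''q''" and e = "reg ''Q''" and P = "\<lambda>m. set_up m \<and> listed m []" and c = find_body and K = K]])
    show "aok K (reg ''Q'')" "2 \<le> K" using K by (auto simp: vok_defs)
    show "n < M" by (rule n_less_M)
    show "set_up m \<and> listed m [] \<Longrightarrow> I 0 (upd m ''q'' 0 0)" for m by (simp add: I_def set_up_upd listed_upd found_def)
    show "I j m \<Longrightarrow> aval (reg ''Q'') m = n \<and> m ''q'' 0 = j" for j m using start_regs[of m] by (simp add: I_def reg_def set_up_def)
    show "I n m \<Longrightarrow> set_up m \<and> listed m [] \<and> found m n" for m by (simp add: I_def)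
    fix j assume j: "j < n"
    show "ht K M (I j) find_body (ctime find_body) (\<lambda>m. m ''q'' 0 = j \<and> I (Suc j) (upd m ''q'' 0 (Suc j)))"
    proof (rule ht_wp[OF M16])
      show "straight K find_body" using K by (simp add: vok_defs)
      fix m assume m: "bd M m" "I j m"
      then have su: "set_up m" and li: "listed m []" and fo: "found m j" and q: "m ''q'' 0 = j" by (simp_all add: I_def)
      have st: "start m" using su by (simp add: set_up_def)
      then have dv: "done_verts m" by (simp add: start_def)
      have v12: "m ''v1'' 0 = child D' v L" "m ''v2'' 0 = child D' v R" using su by (simp_all add: set_up_def)
      note ce = child_confA(2)[OF dv inn j]
      have jM: "j < M" using j n_less_M by simp
      show "wp M find_body (\<lambda>m. m ''q'' 0 = j \<and> I (Suc j) (upd m ''q'' 0 (Suc j))) m"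
        using su li fo q v12 start_regs[OF st] ce[of L] ce[of R] jM M16
        by (auto simp: find_body_def set_reg_def reg_def I_def set_up_upd listed_upd found_def less_Suc_eq)
    qed simp
  qed auto
qed

lemma delta2_cell: "inner \<Longrightarrow> set_up m \<Longrightarrow> p < n \<Longrightarrow> q < n \<Longrightarrow> m ''delta2'' (2 * (p * n + q) + m ''h'' 0) = delta2 B p q (label D' v)"
  using delta_cells(3,4)[of p q] new.inner_label[OF vD'] by (auto simp: set_up_def start_def inputs_def)

lemma ready_final:
  assumes inn: inner and s: "set_up m" "found m n" "m ''e'' 0 = ce D' B v" "listed m (List.product [0..<n] [0..<n])"
  shows "ready m"
proof -
  have st: "start m" using s(1) by (simp add: set_up_def)
  have ql: "flt q (List.product [0..<n] [0..<n]) = quad_list n D' B v q" for q by (simp add: flt_def quad_list_def)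
  have cu: "(v, q) \<in> conf_u D' B \<longleftrightarrow> quad_list n D' B v q \<noteq> []" for q
  proof
    assume "(v, q) \<in> conf_u D' B"
    then obtain q1 q2 where q: "(child D' v L, q1) \<in> conf_a D' B" "(child D' v R, q2) \<in> conf_a D' B" "delta2 B q1 q2 (label D' v) = q"
      unfolding new.conf_u_inner[OF vD' inn] by blast
    then have "(q1, q2) \<in> set (quad_list n D' B v q)" using conf_a_n[OF q(1)] conf_a_n[OF q(2)] by (simp add: quad_list_def)
    then show "quad_list n D' B v q \<noteq> []" by auto
  next
    assume "quad_list n D' B v q \<noteq> []"
    then obtain q1 q2 where "(q1, q2) \<in> set (quad_list n D' B v q)" by (metis last_in_set surj_pair)
    then show "(v, q) \<in> conf_u D' B" unfolding new.conf_u_inner[OF vD' inn] quad_list_def by auto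
  qed
  show ?thesis unfolding ready_def
  proof (intro conjI)
    show "\<forall>q < n. m ''confU'' (v * n + q) = of_bool ((v, q) \<in> conf_u D' B) \<and>
        (inner \<longrightarrow> m ''ordlen'' (v * n + q) = length (quad_list n D' B v q) \<and>
          (\<forall>i < length (quad_list n D' B v q). quad_list n D' B v q ! i =
             (m ''ordq1'' ((v * n + q) * (n * n) + i), m ''ordq2'' ((v * n + q) * (n * n) + i))))"
      using s(4) unfolding listed_def ql cu by blast
    show "inner \<longrightarrow> m ''v1'' 0 = child D' v L \<and> m ''v2'' 0 = child D' v R \<and>
        m ''e1'' 0 = ce D' B (child D' v L) \<and> m ''e2'' 0 = ce D' B (child D' v R) \<and>
        (\<forall>p < n. \<forall>q < n. m ''delta2'' (2 * (p * n + q) + m ''h'' 0) = delta2 B p q (label D' v)) \<and>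
        (\<forall>d. rep_effect (m ''effect'') (2 * v + dir_num d) t (edge_effect D' v d))"
      using s(1,2) ce_child[OF inn] delta2_cell[OF inn s(1)] unfolding set_up_def found_def by blast
  qed (use s st start_regs[OF st] type_v[OF st] inn in \<open>simp_all add: set_up_def start_def\<close>)
qed

definition PI :: "(nat \<times> nat) list \<Rightarrow> mem \<Rightarrow> bool" where
  "PI ps m \<longleftrightarrow> set_up m \<and> listed m ps \<and> found m n \<and> m ''e'' 0 = ce D' B v"

lemma PI_upd: "x \<in> {''p1'', ''p2''} \<Longrightarrow> PI ps m \<Longrightarrow> PI ps (upd m x 0 y)"
  by (elim insertE emptyE) (simp_all add: PI_def set_up_upd listed_upd found_def)

lemma pair_wp:
  assumes inn: inner and m: "bd M m" "PI ps m" and p: "m ''p1'' 0 = p1" "m ''p2'' 0 = p2" "p1 < n" "p2 < n" and len: "length ps < n * n"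
  shows "wp M pair_body (\<lambda>m'. PI (ps @ [(p1, p2)]) m' \<and> m' ''p1'' 0 = p1 \<and> m' ''p2'' 0 = p2) m"
proof -
  have su: "set_up m" and li: "listed m ps" and fo: "found m n" and e: "m ''e'' 0 = ce D' B v" using m(2) by (simp_all add: PI_def)
  have st: "start m" using su by (simp add: set_up_def)
  then have dv: "done_verts m" by (simp add: start_def)
  note rg = start_regs[OF st]
  have v12: "m ''v1'' 0 = child D' v L" "m ''v2'' 0 = child D' v R" using su by (simp_all add: set_up_def)
  note ca = child_confA(1)[OF dv inn p(3), of L] child_confA(1)[OF dv inn p(4), of R]
  have lt: "m x j < M" for x j using m(1) by (simp add: bd_def)
  show ?thesis
  proof (cases "(child D' v L, p1) \<in> conf_a D' B \<and> (child D' v R, p2) \<in> conf_a D' B")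
    case False
    then have "flt q (ps @ [(p1, p2)]) = flt q ps" for q by (auto simp: flt_def)
    then have "PI (ps @ [(p1, p2)]) m" using m(2) by (simp add: PI_def listed_def)
    then show ?thesis using False ca rg v12 p by (auto simp: pair_body_def reg_def)
  next
    case True
    define q where "q = delta2 B p1 p2 (label D' v)"
    have dq: "m ''delta2'' (2 * (p1 * n + p2) + m ''h'' 0) = q" using delta2_cell[OF inn su p(3,4)] by (simp add: q_def)
    have qn: "q < n" unfolding q_def using new.delta2_states[OF new.inner_Sigma2[OF vD' inn]] p(3,4) states state_less by simp
    define r where "r = v * n + q"
    define l where "l = length (flt q ps)"
    have ll: "l < n * n" using len length_filter_le[of _ ps] unfolding l_def flt_def by (meson le_less_trans)
    have ol: "m ''ordlen'' r = l" using li qn by (simp add: listed_def r_def l_def)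
    have f: "flt q' (ps @ [(p1, p2)]) = flt q' ps @ (if q' = q then [(p1, p2)] else [])" for q'
      using True by (auto simp: flt_def q_def)
    have rM: "r < M" unfolding r_def by (rule r_less[OF v(2) qn])
    define m1 where "m1 = upd (upd (upd (upd (upd m ''r'' 0 r) ''ordq1'' (r * (n * n) + l) p1) ''ordq2'' (r * (n * n) + l) p2) ''ordlen'' r (Suc l)) ''confU'' r 1"
    have "same (vframe n v) m m1" unfolding m1_def r_def
      using v_frame_mem(1)[OF qn] v_frame_mem(2)[OF qn ll]
      by (intro same_upd same_refl) (simp_all add: v_frame_mem(3))
    then have s1: "start m1" by (rule start_same[OF st])
    have m1o: "m1 x = m x" if "x \<notin> {''r'', ''ordq1'', ''ordq2'', ''ordlen'', ''confU''}" for x using that by (simp add: m1_def upd_def)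
    have "set_up m1" using su s1 by (simp add: set_up_def m1o)
    moreover have "listed m1 (ps @ [(p1, p2)])" unfolding listed_def
    proof (intro allI impI)
      fix q' assume q': "q' < n"
      have old: "m ''ordlen'' (v * n + q') = length (flt q' ps)" "m ''confU'' (v * n + q') = of_bool (flt q' ps \<noteq> [])"
        "\<And>i. i < length (flt q' ps) \<Longrightarrow> flt q' ps ! i = (m ''ordq1'' ((v * n + q') * (n * n) + i), m ''ordq2'' ((v * n + q') * (n * n) + i))"
        using li q' by (simp_all add: listed_def)
      have le: "length (flt q' ps) < n * n" using len length_filter_le[of _ ps] unfolding flt_def by (meson le_less_trans)
      show "m1 ''ordlen'' (v * n + q') = length (flt q' (ps @ [(p1, p2)])) \<and>
        m1 ''confU'' (v * n + q') = of_bool (flt q' (ps @ [(p1, p2)]) \<noteq> []) \<and>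
        (\<forall>i<length (flt q' (ps @ [(p1, p2)])). flt q' (ps @ [(p1, p2)]) ! i =
          (m1 ''ordq1'' ((v * n + q') * (n * n) + i), m1 ''ordq2'' ((v * n + q') * (n * n) + i)))"
      proof (cases "q' = q")
        case True
        then show ?thesis using old ol by (auto simp: f m1_def r_def[symmetric] l_def nth_append less_Suc_eq)
      next
        case False
        then have nr: "r \<noteq> v * n + q'" by (simp add: r_def)
        \<comment> \<open>The lists of two states lie in different blocks, so appending to one
          leaves the other intact.\<close>
        have ni: "r * (n * n) + l \<noteq> (v * n + q') * (n * n) + i" if "i < n * n" for i
          using nr block_eq[OF that, of "v * n + q'"] block_eq[OF ll, of r] by metis
        show ?thesis using False old le nr ni by (auto simp: f m1_def)
      qed
    qed
    moreover have "found m1 n" using fo by (simp add: found_def m1o)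
    ultimately have P: "PI (ps @ [(p1, p2)]) m1" using e by (simp add: PI_def m1o)
    have pM: "p1 < M" "p2 < M" "Suc l < M" using p(3,4) n_less_M small[of "Suc l"] ll by simp_all
    have c1: "bval (Conj (Eq (Cell ''confA'' (Add (Mul (reg ''v1'') (reg ''Q'')) (reg ''p1''))) (Num 1))
       (Eq (Cell ''confA'' (Add (Mul (reg ''v2'') (reg ''Q'')) (reg ''p2''))) (Num 1))) m"
      using True ca rg v12 p by (simp add: reg_def)
    have set_r: "wp M (set_reg ''r'' (Add (Mul (reg ''v'') (reg ''Q''))
          (Cell ''delta2'' (Add (Mul (Num 2) (Add (Mul (reg ''p1'') (reg ''Q'')) (reg ''p2''))) (reg ''h''))))) Q m = Q (upd m ''r'' 0 r)" for Q
    proof -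
      have "aval (Add (Mul (reg ''v'') (reg ''Q''))
          (Cell ''delta2'' (Add (Mul (Num 2) (Add (Mul (reg ''p1'') (reg ''Q'')) (reg ''p2''))) (reg ''h'')))) m = r"
        using rg p dq by (simp add: reg_def r_def del: mult_Suc distrib_left_numeral add_mult_distrib2)
      then show ?thesis using rM by (simp add: set_reg_def)
    qed
    show ?thesis unfolding pair_body_def seq.simps wp.simps(4) if_P[OF c1] wp.simps(3) set_r
      using P pM rg p ol M16 m1o[of "''p1''"] m1o[of "''p2''"]
      by (simp add: pair_index_def set_reg_def reg_def m1_def)
  qed
qed

lemma pairs_ht:
  assumes inn: inner
  shows "ht K M (PI []) (for_loop ''p1'' (reg ''Q'') (for_loop ''p2'' (reg ''Q'') pair_body)) (loop_time n (loop_time n (ctime pair_body))) (\<lambda>m. ready m \<and> start m)"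
proof -
  define I where "I i m \<longleftrightarrow> PI (List.product [0..<i] [0..<n]) m \<and> m ''p1'' 0 = i" for i m
  define J where "J i j m \<longleftrightarrow> PI (List.product [0..<i] [0..<n] @ map (Pair i) [0..<j]) m \<and> m ''p1'' 0 = i \<and> m ''p2'' 0 = j" for i j m
  have Q: "PI ps m \<Longrightarrow> aval (reg ''Q'') m = n" for ps m using start_regs[of m] by (simp add: PI_def set_up_def reg_def)
  have ok: "aok K (reg ''Q'')" "2 \<le> K" using K by (auto simp: vok_defs)
  have inner_loop: "ht K M (I i) (for_loop ''p2'' (reg ''Q'') pair_body) (loop_time n (ctime pair_body)) (J i n)" if i: "i < n" for i
    unfolding loop_time_def
  proof (rule ht_for[OF M16 ok n_less_M])
    show "I i m \<Longrightarrow> J i 0 (upd m ''p2'' 0 0)" for m by (simp add: I_def J_def PI_upd)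
    show "J i j m \<Longrightarrow> aval (reg ''Q'') m = n \<and> m ''p2'' 0 = j" for j m using Q by (auto simp: J_def)
    fix j assume j: "j < n"
    show "ht K M (J i j) pair_body (ctime pair_body) (\<lambda>m. m ''p2'' 0 = j \<and> J i (Suc j) (upd m ''p2'' 0 (Suc j)))"
    proof (rule ht_wp[OF M16])
      show "straight K pair_body" using K by (simp add: vok_defs)
      fix m assume m: "bd M m" "J i j m"
      \<comment> \<open>\<open>i * n + j\<close> pairs precede the pair \<open>(i, j)\<close> in the
        lexicographic order, so its list still has a free cell.\<close>
      have "i * n + j < Suc i * n" using j by simp
      also have "\<dots> \<le> n * n" using i by (intro mult_le_mono1) simp
      finally have len: "length (List.product [0..<i] [0..<n] @ map (Pair i) [0..<j]) < n * n" by simp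
      have "wp M pair_body (\<lambda>m'. PI ((List.product [0..<i] [0..<n] @ map (Pair i) [0..<j]) @ [(i, j)]) m' \<and> m' ''p1'' 0 = i \<and> m' ''p2'' 0 = j) m"
        using m i j by (intro pair_wp inn len) (auto simp: J_def)
      then show "wp M pair_body (\<lambda>m. m ''p2'' 0 = j \<and> J i (Suc j) (upd m ''p2'' 0 (Suc j))) m"
        by (rule wp_mono) (simp add: J_def PI_upd)
    qed simp
  qed
  have "ht K M (PI []) (for_loop ''p1'' (reg ''Q'') (for_loop ''p2'' (reg ''Q'') pair_body)) (loop_time n (loop_time n (ctime pair_body))) (I n)"
    unfolding loop_time_def[of n "loop_time n (ctime pair_body)"]
  proof (rule ht_for[OF M16 ok n_less_M])
    show "PI [] m \<Longrightarrow> I 0 (upd m ''p1'' 0 0)" for m by (simp add: I_def PI_upd)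
    show "I j m \<Longrightarrow> aval (reg ''Q'') m = n \<and> m ''p1'' 0 = j" for j m using Q by (auto simp: I_def)
    fix i assume i: "i < n"
    show "ht K M (I i) (for_loop ''p2'' (reg ''Q'') pair_body) (loop_time n (ctime pair_body)) (\<lambda>m. m ''p1'' 0 = i \<and> I (Suc i) (upd m ''p1'' 0 (Suc i)))"
      by (rule ht_conseq[OF inner_loop[OF i]]) (auto simp: I_def J_def PI_upd product_snoc)
  qed
  then show ?thesis
  proof (rule ht_conseq)
    show "ready m \<and> start m" if "I n m" for m
    proof
      show "ready m" using that unfolding I_def PI_def by (intro ready_final[OF inn]) blast+
      show "start m" using that by (simp add: I_def PI_def set_up_def)
    qed
  qed auto
qed

lemma inner_ht:
  assumes inn: inner
  shows "ht K M cleared v_inner (inner_time n) (\<lambda>m. ready m \<and> start m)"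
  unfolding v_inner_def inner_time_def
proof (intro ht_seq)
  show "ht K M cleared v_setup (ctime v_setup) (\<lambda>m. set_up m \<and> listed m [])"
  proof (rule ht_wp[OF M16])
    show "straight K v_setup" using K by (simp add: vok_defs)
  qed (use setup_wp[OF inn] in auto)
  show "ht K M (\<lambda>m. set_up m \<and> listed m []) (for_loop ''q'' (reg ''Q'') find_body) (loop_time n (ctime find_body))
    (\<lambda>m. set_up m \<and> listed m [] \<and> found m n)" by (rule find_ht[OF inn])
  show "ht K M (\<lambda>m. set_up m \<and> listed m [] \<and> found m n) v_state (ctime v_state) (PI [])"
  proof (rule ht_wp[OF M16])
    show "straight K v_state" using K by (simp add: vok_defs)
    fix m assume bm: "bd M m" and m: "set_up m \<and> listed m [] \<and> found m n"
    have st: "start m" using m by (simp add: set_up_def)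
    have e12: "m ''e1'' 0 = ce D' B (child D' v L)" "m ''e2'' 0 = ce D' B (child D' v R)"
      using m ce_child[OF inn] unfolding found_def by blast+
    have "aval (Cell ''delta2'' (Add (Mul (Num 2) (Add (Mul (reg ''e1'') (reg ''Q'')) (reg ''e2''))) (reg ''h''))) m = ce D' B v"
      using delta2_cell[OF inn, of m, OF _ ce_child[OF inn, of L] ce_child[OF inn, of R]] m e12 start_regs[OF st]
      by (simp add: reg_def new.ce_inner[OF vD' inn])
    moreover have "ce D' B v < M" using new.ce_states[OF vD'] state_less n_less_M less_trans by blast
    moreover have "PI [] (upd m ''e'' 0 (ce D' B v))" using m by (simp add: PI_def set_up_upd listed_upd found_def)
    ultimately show "wp M v_state (PI []) m" by (simp add: v_state_def set_reg_def)
  qed simp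
  show "ht K M (PI []) (for_loop ''p1'' (reg ''Q'') (for_loop ''p2'' (reg ''Q'') pair_body)) (loop_time n (loop_time n (ctime pair_body))) (\<lambda>m. ready m \<and> start m)"
    by (rule pairs_ht[OF inn])
qed

definition QI :: "nat \<Rightarrow> mem \<Rightarrow> bool" where
  "QI j m \<longleftrightarrow> ready m \<and> start m \<and> (\<forall>p < j. rep_at D' B X' n m v p) \<and> m ''q'' 0 = j"

lemma QI_upd:
  assumes "ready m" "start m" "\<And>p. p < j \<Longrightarrow> rep_at D' B X' n m v p"
  shows "QI j (upd m ''q'' 0 j)"
proof -
  have st: "start (upd m ''q'' 0 j)" using assms(2) by (rule start_upd) (simp add: v_frame_mem(3))
  then have "done_verts (upd m ''q'' 0 j)" by (simp add: start_def)
  then have "ready (upd m ''q'' 0 j)" using assms(1) by (simp add: ready_def upd_other)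
  moreover have "rep_at D' B X' n (upd m ''q'' 0 j) v p" if "p < j" for p
    by (rule rep_at_cong[OF assms(3)[OF that]]) (auto simp: reads_def)
  ultimately show ?thesis using st by (simp add: QI_def)
qed

lemma states_ht: "ht K M (\<lambda>m. ready m \<and> start m) (for_loop ''q'' (reg ''Q'') q_body) (loop_time n (q_time n)) (QI n)"
  unfolding loop_time_def
proof (rule ht_for[OF M16, where Inv = QI])
  show "aok K (reg ''Q'')" "2 \<le> K" using K by (auto simp: vok_defs)
  show "n < M" by (rule n_less_M)
  show "QI 0 (upd m ''q'' 0 0)" if "ready m \<and> start m" for m using that by (simp add: QI_upd)
  show "QI j m \<Longrightarrow> aval (reg ''Q'') m = n \<and> m ''q'' 0 = j" for j m using start_regs[of m] by (simp add: QI_def reg_def)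
  fix j assume j: "j < n"
  show "ht K M (QI j) q_body (q_time n) (\<lambda>m. m ''q'' 0 = j \<and> QI (Suc j) (upd m ''q'' 0 (Suc j)))"
  proof (rule ht_pointwise)
    fix m1 assume m1: "bd M m1" "QI j m1"
    interpret S: state_run D D' B n X ol code m0 b M K N0 N1 v j m1
      using m1 j by (intro state_run.intro state_run_axioms.intro vertex_run_axioms) (simp_all add: QI_def)
    show "ht K M (\<lambda>m. m = m1) q_body (q_time n) (\<lambda>m. m ''q'' 0 = j \<and> QI (Suc j) (upd m ''q'' 0 (Suc j)))"
    proof (rule ht_conseq[OF S.q_body_ht])
      fix m assume "S.final m"
      then have f: "same (qframe n (v * n + j)) m1 m" and sp: "spec_at m v j" by (simp_all add: S.final_def)
      have r: "ready m" using m1(2) by (intro ready_same[OF _ f j]) (simp add: QI_def)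
      have "m x = m1 x" if "x \<in> insert ''v'' inputs" for x
        using sameD[OF f, of x] that by (intro ext) (auto simp: qframe_def inputs_def)
      then have st: "start m" using m1(2) r by (simp add: QI_def start_def ready_def)
      have "rep_at D' B X' n m v p" if p: "p < Suc j" for p
      proof (cases "p = j")
        case True then show ?thesis using rep_at_new[OF vD' vD j sp] by simp
      next
        case False
        then have "p < j" using p by simp
        then have "rep_at D' B X' n m1 v p" using m1(2) by (simp add: QI_def)
        then show ?thesis
        proof (rule rep_at_cong)
          fix x i assume "(x, i) \<in> reads n (v * n + p)"
          then have "(x, i) \<notin> qframe n (v * n + j)" using reads_qframe[of "v * n + p" "v * n + j"] False by auto
          then show "m x i = m1 x i" by (rule sameD[OF f])
        qed
      qed
      then have "QI (Suc j) (upd m ''q'' 0 (Suc j))" by (rule QI_upd[OF r st])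
      moreover have "m ''q'' 0 = j" using sameD[OF f, of "''q''" 0] m1(2) by (simp add: qframe_def QI_def)
      ultimately show "m ''q'' 0 = j \<and> QI (Suc j) (upd m ''q'' 0 (Suc j))" by simp
    qed auto
  qed
qed

lemma vertex_ht: "ht K M start vertex_program (vertex_time n) (\<lambda>m. start m \<and> finished m v)"
proof -
  let ?g = "Less (Cell ''kind'' (reg ''v'')) (Num 2)"
  have g: "bval ?g m \<longleftrightarrow> is_leaf D' v" if "cleared m" for m
    using that kind_less by (simp add: cleared_def start_def inputs_def reg_def)
  have "ht K M cleared (Cond ?g v_leaf v_inner) (1 + bcost ?g + (ctime v_leaf + inner_time n)) (\<lambda>m. ready m \<and> start m)"
  proof (rule ht_cond[OF M16])
    show "bok K ?g" using K by (simp add: vok_defs)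
    show "ht K M (\<lambda>m. cleared m \<and> bval ?g m) v_leaf (ctime v_leaf) (\<lambda>m. ready m \<and> start m)"
    proof (cases "is_leaf D' v")
      case True
      from leaf_ht[OF this] show ?thesis by (rule ht_conseq) auto
    next
      case False then show ?thesis unfolding ht_def using g by blast
    qed
    show "ht K M (\<lambda>m. cleared m \<and> \<not> bval ?g m) v_inner (inner_time n) (\<lambda>m. ready m \<and> start m)"
    proof (cases "is_leaf D' v")
      case False
      from inner_ht[OF this] show ?thesis by (rule ht_conseq) auto
    next
      case True then show ?thesis unfolding ht_def using g by blast
    qed
  qed
  from ht_seq[OF clear_ht ht_seq[OF this states_ht]]
  have "ht K M start vertex_program (vertex_time n) (QI n)" unfolding vertex_program_def vertex_time_def .
  then show ?thesis
  proof (rule ht_conseq)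
    fix m assume m: "QI n m"
    then have "ready m" by (simp add: QI_def)
    then have "inner \<longrightarrow> (\<forall>d. rep_effect (m ''effect'') (2 * v + dir_num d) t (edge_effect D' v d))" by (simp add: ready_def)
    then show "start m \<and> finished m v" using m by (simp add: QI_def finished_def)
  qed auto
qed

end

section \<open>Processing all new vertices, and the running time\<close>

definition update_program :: com where
  "update_program = Seq (set_reg ''v'' (reg ''N''))
     (While (Less (reg ''N0'') (reg ''v'')) (Seq (set_reg ''v'' (Sub (reg ''v'') (Num 1))) vertex_program))"

definition update_time :: "nat \<Rightarrow> nat \<Rightarrow> nat" where
  "update_time n l = ctime (set_reg ''v'' (reg ''N'')) + (1 + bcost (Less (reg ''N0'') (reg ''v'')) +
     l * (1 + bcost (Less (reg ''N0'') (reg ''v'')) + (ctime (set_reg ''v'' (Sub (reg ''v'') (Num 1))) + vertex_time n)))"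

text \<open>A bound \<open>O(n ^ e)\<close> that holds from \<open>n = 1\<close> on, so that
  additive constants are absorbed; every automaton here has at least one state.\<close>

definition grows :: "nat \<Rightarrow> (nat \<Rightarrow> nat) \<Rightarrow> bool" where
  "grows e f \<longleftrightarrow> (\<exists>c. \<forall>n \<ge> 1. f n \<le> c * n ^ e)"

lemma grows_const: "grows e (\<lambda>_. k)"
  unfolding grows_def by (intro exI[of _ k]) simp

lemma grows_id: "grows (Suc e) (\<lambda>n. n)"
  unfolding grows_def by (intro exI[of _ 1]) simp

lemma grows_add: "grows e f \<Longrightarrow> grows e g \<Longrightarrow> grows e (\<lambda>n. f n + g n)"
  unfolding grows_def
proof (elim exE)
  fix c d assume "\<forall>n\<ge>1. f n \<le> c * n ^ e" "\<forall>n\<ge>1. g n \<le> d * n ^ e"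
  then show "\<exists>c. \<forall>n\<ge>1. f n + g n \<le> c * n ^ e"
    by (intro exI[of _ "c + d"]) (auto simp: add_mult_distrib intro: add_mono)
qed

lemma grows_mult: "grows d f \<Longrightarrow> grows e g \<Longrightarrow> grows (d + e) (\<lambda>n. f n * g n)"
  unfolding grows_def
proof (elim exE)
  fix c c' assume f: "\<forall>n\<ge>1. f n \<le> c * n ^ d" and g: "\<forall>n\<ge>1. g n \<le> c' * n ^ e"
  have "f n * g n \<le> (c * c') * n ^ (d + e)" if "1 \<le> n" for n
    using mult_le_mono[OF f[rule_format, OF that] g[rule_format, OF that]] by (simp add: power_add mult.assoc mult.left_commute)
  then show "\<exists>c. \<forall>n\<ge>1. f n * g n \<le> c * n ^ (d + e)" by blast
qed

lemma grows_linear: "grows 1 f \<Longrightarrow> grows 1 (\<lambda>n. f n * k)"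
  using grows_mult[OF _ grows_const[of 0 k], of 1 f] by simp

text \<open>One loop over the states raises the exponent by 1.\<close>

lemma grows_loop:
  assumes "grows e T"
  shows "grows (Suc e) (\<lambda>n. loop_time n (T n))"
proof -
  have 1: "grows e (\<lambda>n. 12 + acost (reg ''Q'') + T n)" by (intro grows_add grows_const assms)
  have 2: "grows (Suc e) (\<lambda>n. n * (12 + acost (reg ''Q'') + T n))" using grows_mult[OF grows_id[of 0] 1] by simp
  show ?thesis unfolding loop_time_def by (intro grows_add grows_const 2)
qed

lemma q_time_grows: "grows 1 q_time"
proof -
  have 2: "grows 1 (\<lambda>n. 2 * n)" using grows_linear[OF grows_id[of 0, folded One_nat_def], of 2] by (simp add: mult.commute)
  have "grows 1 (\<lambda>n. q_time n)"
    unfolding q_time_def finish_time_def comb_time_def gather_time_def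
    by (intro grows_add grows_const grows_linear grows_id[of 0, folded One_nat_def] 2)
  then show ?thesis .
qed

text \<open>The square has two sources: the nested loop over pairs of states, and the loop over the
  states with its linear body.\<close>

lemma vertex_time_grows: "grows 2 vertex_time"
proof -
  have 1: "grows 2 (\<lambda>n. loop_time n T)" for T
    using grows_loop[OF grows_const, of 1 T] by (simp add: numeral_2_eq_2)
  have 2: "grows 2 (\<lambda>n. loop_time n (loop_time n T))" for T
    using grows_loop[OF grows_loop[OF grows_const, of 0 T]] by (simp add: numeral_2_eq_2)
  have 3: "grows 2 (\<lambda>n. loop_time n (q_time n))"
    using grows_loop[OF q_time_grows] by (simp add: numeral_2_eq_2)
  have "grows 2 (\<lambda>n. vertex_time n)" unfolding vertex_time_def inner_time_def
    by (intro grows_add grows_const 1 2 3)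
  then show ?thesis .
qed

lemma update_time_le: "\<exists>c. \<forall>n l. 1 \<le> n \<longrightarrow> 1 \<le> l \<longrightarrow> update_time n l \<le> c * n\<^sup>2 * l"
proof -
  obtain c where c: "\<And>n. 1 \<le> n \<Longrightarrow> vertex_time n \<le> c * n\<^sup>2" using vertex_time_grows unfolding grows_def by blast
  define A B where "A = ctime (set_reg ''v'' (reg ''N'')) + (1 + bcost (Less (reg ''N0'') (reg ''v'')))"
    and "B = 1 + bcost (Less (reg ''N0'') (reg ''v'')) + ctime (set_reg ''v'' (Sub (reg ''v'') (Num 1)))"
  have "update_time n l \<le> (A + B + c) * n\<^sup>2 * l" if "1 \<le> n" "1 \<le> l" for n l
  proof -
    have n2: "1 \<le> n\<^sup>2" and l1: "1 \<le> n\<^sup>2 * l" using that by auto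
    have "update_time n l = A + l * (B + vertex_time n)" unfolding update_time_def A_def B_def by (simp only: add.assoc)
    also have "\<dots> \<le> A * (n\<^sup>2 * l) + l * (B * n\<^sup>2 + c * n\<^sup>2)"
      using c[OF that(1)] n2 l1 by (intro add_mono mult_le_mono2) (metis mult_le_mono2 mult.right_neutral)+
    also have "\<dots> = (A + B + c) * n\<^sup>2 * l" by (simp add: algebra_simps)
    finally show ?thesis .
  qed
  then show ?thesis by blast
qed

context enum_run
begin

lemma N1_cell: "m0 ''N'' 0 = N1"
  using slp verts_D' by (simp add: rep_slp_def)

lemma N0_le_N1: "N0 \<le> N1"
  using sub verts_D verts_D' by fastforce

lemma finished_upd: "finished m u \<Longrightarrow> finished (upd m ''v'' 0 y) u"
proof -
  assume f: "finished m u"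
  have "rep_at D' B X' n (upd m ''v'' 0 y) u p" if "p < n" for p
    by (rule rep_at_cong[of m u p]) (use f that in \<open>auto simp: finished_def reads_def\<close>)
  then show ?thesis using f by (simp add: finished_def upd_other)
qed

definition VI :: "nat \<Rightarrow> mem \<Rightarrow> bool" where
  "VI j m \<longleftrightarrow> (\<forall>x \<in> inputs. m x = m0 x) \<and> m ''v'' 0 = N1 - j \<and>
     (\<forall>u \<in> verts D'. u < N0 \<or> N1 - j \<le> u \<longrightarrow> finished m u)"

text \<open>Counting down from \<open>N\<close> establishes \<open>done_verts\<close> for each
  vertex in turn: the old vertices and the new ones with larger numbers are complete when it is
  processed.\<close>

lemma update_ht: "ht K M (\<lambda>m. m = m0) update_program (update_time n (N1 - N0)) (VI (N1 - N0))"
  unfolding update_program_def update_time_def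
proof (rule ht_seq[OF _ ht_while[where Inv = VI, OF M16]])
  have NM: "N1 < M" using small_less[of N1] N1 by simp
  have aok: "aok K (reg x)" "aok K (Num 0)" "aok K (Sub (reg x) (Num 1))" for x using K by (simp_all add: aok_def reg_def)
  show "ht K M (\<lambda>m. m = m0) (set_reg ''v'' (reg ''N'')) (ctime (set_reg ''v'' (reg ''N''))) (VI 0)"
  proof (rule ht_wp[OF M16])
    show "straight K (set_reg ''v'' (reg ''N''))" using aok by (simp add: set_reg_def)
    fix m assume m: "m = m0"
    have "VI 0 (upd m0 ''v'' 0 N1)"
      using finished_old finished_upd by (auto simp: VI_def verts_D' inputs_def upd_other)
    then show "wp M (set_reg ''v'' (reg ''N'')) (VI 0) m" using NM by (simp add: set_reg_def reg_def m N1_cell)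
  qed simp
  show "bok K (Less (reg ''N0'') (reg ''v''))" using aok by simp
  show "j \<le> N1 - N0 \<Longrightarrow> VI j m \<Longrightarrow> bval (Less (reg ''N0'') (reg ''v'')) m \<longleftrightarrow> j < N1 - N0" for j m
    using N0_cell N0_le_N1 by (auto simp: VI_def reg_def inputs_def)
  fix j assume j: "j < N1 - N0"
  let ?v = "N1 - Suc j"
  have v: "N0 \<le> ?v" "?v < N1" using j by auto
  interpret V: vertex_run D D' B n X ol code m0 b M K N0 N1 ?v
    using v by (intro vertex_run.intro enum_run_axioms vertex_run_axioms.intro)
  show "ht K M (VI j) (Seq (set_reg ''v'' (Sub (reg ''v'') (Num 1))) vertex_program)
     (ctime (set_reg ''v'' (Sub (reg ''v'') (Num 1))) + vertex_time n) (VI (Suc j))"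
  proof (rule ht_seq)
    show "ht K M (VI j) (set_reg ''v'' (Sub (reg ''v'') (Num 1))) (ctime (set_reg ''v'' (Sub (reg ''v'') (Num 1)))) V.start"
    proof (rule ht_wp[OF M16])
      show "straight K (set_reg ''v'' (Sub (reg ''v'') (Num 1)))" using aok by (simp add: set_reg_def)
      fix m assume m: "VI j m"
      have "V.done_verts (upd m ''v'' 0 ?v)" unfolding V.done_verts_def
        using m j by (auto simp: VI_def intro!: finished_upd)
      moreover have "upd m ''v'' 0 ?v x = m0 x" if "x \<in> inputs" for x
        using m that by (subst upd_other) (auto simp: VI_def inputs_def)
      ultimately have "V.start (upd m ''v'' 0 ?v)" by (simp add: V.start_def)
      then show "wp M (set_reg ''v'' (Sub (reg ''v'') (Num 1))) V.start m"
        using m NM by (simp add: set_reg_def reg_def VI_def)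
    qed simp
    show "ht K M V.start vertex_program (vertex_time n) (VI (Suc j))"
    proof (rule ht_conseq[OF V.vertex_ht])
      fix m assume m: "V.start m \<and> finished m ?v"
      have "finished m u" if u: "u \<in> verts D'" "u < N0 \<or> ?v \<le> u" for u
      proof (cases "u = ?v")
        case False
        then show ?thesis using u m unfolding V.start_def V.done_verts_def by (metis le_neq_implies_less)
      qed (use m in simp)
      then show "VI (Suc j) m" using m by (simp add: VI_def V.start_def)
    qed auto
  qed
qed

lemma VI_final:
  assumes m: "VI (N1 - N0) m"
  shows "rep_slp code D' m" "rep_dbuta code B m" "rep_enum_ds D' B X' m"
proof -
  have eq: "m x = m0 x" if "x \<in> inputs" for x using m that by (simp add: VI_def)
  have eqs: "m ''N'' = m0 ''N''" "m ''root'' = m0 ''root''" "m ''kind'' = m0 ''kind''" "m ''sym'' = m0 ''sym''"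
    "m ''left'' = m0 ''left''" "m ''right'' = m0 ''right''" "m ''Q'' = m0 ''Q''" "m ''delta0'' = m0 ''delta0''"
    "m ''delta2'' = m0 ''delta2''" "m ''final'' = m0 ''final''" by (simp_all add: eq inputs_def)
  show "rep_slp code D' m" using slp unfolding rep_slp_def eqs .
  show "rep_dbuta code B m" using dbuta_cells unfolding rep_dbuta_def eqs .
  have nc: "card (states B) = n" using states by simp
  have fin: "finished m u" if "u \<in> verts D'" for u
    using m that N0_le_N1 unfolding VI_def by (metis diff_diff_cancel not_less)
  have sub: "ds_conf_u X' \<subseteq> verts D' \<times> {..<card (states B)}"
    using new.conf_u_D new.conf_a_D states by (auto simp: conf_X nc dest!: new.conf_u_D new.conf_a_D)
  have eff: "\<forall>(u, d, v) \<in> edges D'. ds_effect X' u d = edge_effect D' u d" using enum' unfolding new.is_enum_ds_iff by blast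
  show "rep_enum_ds D' B X' m" unfolding rep_enum_ds_iff[OF sub] nc
  proof (intro conjI ballI allI impI)
    show "rep_at D' B X' n m v q" if "v \<in> verts D'" "q < n" for v q using fin[OF that(1)] that(2) by (simp add: finished_def)
    show "case e of (u, d, v) \<Rightarrow> rep_effect (m ''effect'') (2 * u + dir_num d) (vtype D' u) (ds_effect X' u d)" if e: "e \<in> edges D'" for e
    proof -
      obtain u d w where x: "e = (u, d, w)" by (cases e)
      then have u: "u \<in> verts D'" "\<not> is_leaf D' u" using e new.edge_verts[of u d w] by (auto simp: is_leaf_def)
      then show ?thesis using fin[OF u(1)] eff e by (auto simp: x finished_def)
    qed
  qed
qed

end

context relabelling_run
begin

text \<open>The first program leaves the arrays of the automaton and of the data structure alone, so
  its final memory meets the requirements of the second program.\<close>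

lemma enum_run_Post:
  assumes m: "Post m" and B: "is_dbuta B" "rep_dbuta code B m0" and X: "is_enum_ds D B X" "rep_enum_ds D B X m0"
    and ol: "lists_opts D B ol" "ds_nodes X = comb_nodes D B ol" "ds_edges X = comb_edges D B ol"
    and b: "N + len + 1 < b" "b ^ 8 \<le> M" "16 \<le> b" "60 \<le> K"
  shows "enum_run D D' B (m0 ''Q'' 0) X ol code m b M K N (N + len + 1)"
proof -
  have sm: "same touched' m0 m" and N0: "m ''N0'' 0 = N" using m by (auto simp: Post_def)
  have eq: "m x = m0 x" if "x \<in> {''Q'', ''delta0'', ''delta2'', ''final'', ''confE'', ''confA'', ''confU'', ''ordlen'', ''ordq1'', ''ordq2'',
      ''effect'', ''status'', ''tgtv'', ''tgtq'', ''tgtk'', ''dec'', ''omegav'', ''omegaq'', ''omegak'', ''gamma''}" for x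
    using sameD[OF sm, of x] that by (intro ext) (auto simp: touched'_def touched_def)
  have Q: "states B = {..<m0 ''Q'' 0}" using B(2) by (simp add: rep_dbuta_def Let_def)
  note eqs = eq[of "''Q''"] eq[of "''delta0''"] eq[of "''delta2''"] eq[of "''final''"] eq[of "''confE''"] eq[of "''confA''"] eq[of "''confU''"]
    eq[of "''ordlen''"] eq[of "''ordq1''"] eq[of "''ordq2''"] eq[of "''effect''"] eq[of "''status''"] eq[of "''tgtv''"] eq[of "''tgtq''"]
    eq[of "''tgtk''"] eq[of "''dec''"] eq[of "''omegav''"] eq[of "''omegaq''"] eq[of "''omegak''"] eq[of "''gamma''"]
  note eqs = eqs[simplified]
  show ?thesis
  proof (intro enum_run.intro enum_extension.intro enumeration.intro enumeration_axioms.intro enum_extension_axioms.intro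
      enum_run_axioms.intro fslp_axioms D'.fslp_axioms)
    show "rep_slp code D' m" "rep_sizes D' m" by (rule Post_rep[OF m])+
    show "rep_dbuta code B m" using B(2) unfolding rep_dbuta_def eqs .
    show "rep_enum_ds D B X m" using X(2) unfolding rep_enum_ds_def eqs .
    show "m0 ''Q'' 0 < b" by (rule cells)
    \<comment> \<open>A copy has the size of its original, so the stored sizes of old vertices bound
      all leaf sizes.\<close>
    show "leaf_size D' v \<le> b" if "v \<in> verts D'" for v
      using that
    proof (cases rule: vert_cases')
      case 1
      then have "v \<in> verts D" by (simp add: less_N)
      then show ?thesis using cells[of "''size''" v] by (simp add: sizes_old(2)[OF 1] size_cells)
    next
      case (2 i)
      then show ?thesis using cells[of "''size''" "pu i"] path_ok[OF 2(2)] by (simp add: sizes_new(2)[OF 2(2)] size_cells)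
    qed
    show "child D' v d < N \<or> v < child D' v d" if v: "v \<in> verts D'" "N \<le> v" "\<not> is_leaf D' v" for v d
      using v(1)
    proof (cases rule: vert_cases')
      case (2 i)
      then have i: "i < len" using v(3) by (simp add: leaf_new)
      then have "child D (pu i) d \<in> verts D" using path_ok[of i] not_leaf_less[OF i] by (simp add: child_verts)
      then show ?thesis by (simp add: 2(1) child_new[OF i] less_N)
    qed (use v(2) in simp)
    show "v \<in> verts D'" if "v \<in> verts D" for v using that by (simp add: verts' flip: less_N)
  qed (use B X ol b N0 Q verts_lessThan in \<open>auto simp: verts' leaf_old child_old label_old unfold_old less_N\<close>)
qed

end

text \<open>The summand 1 beside the logarithm covers an f-SLP with a single vertex, where the
  logarithm is 0 but constant work remains.\<close>

theorem theorem7p4: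
  fixes code :: "'a::finite \<Rightarrow> nat"
  assumes "inj code"
  shows "\<exists>P1 P2 :: com. \<forall>c1 c2 :: real. c1 > 0 \<longrightarrow> c2 > 0 \<longrightarrow>
    (\<exists>(C :: real) (K :: nat).
      \<forall>(F :: (nat, 'a label) rooted_bdag) (v :: vertex) (k :: nat) (a :: 'a) (w :: nat) (m :: mem).
        rooted_f_slp F \<longrightarrow> all_reachable F \<longrightarrow>
        log_height c1 c2 (height F) (card (verts F)) \<longrightarrow>
        v \<in> vertices (sem F (root_vertex F)) \<longrightarrow> is_preorder_number (sem F (root_vertex F)) v k \<longrightarrow>
        rep_slp code F m \<longrightarrow> rep_sizes F m \<longrightarrow> m ''k'' 0 = k \<longrightarrow> m ''a'' 0 = code a \<longrightarrow>
        slp_size F \<le> w \<longrightarrow> (\<forall>x i. m x i < 2 ^ w) \<longrightarrow>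
        (\<exists>(F' :: (nat, 'a label) rooted_bdag) W m' t.
          exec (2 ^ (K * w)) P1 m t m' \<and>
          real t \<le> C * (1 + log 2 (card (verts F))) \<and>
          rep_slp code F' m' \<and>
          rooted_f_slp F' \<and> is_extension F W F' \<and>
          sem F' (root_vertex F') = relabel (sem F (root_vertex F)) v (Some a) \<and>
          height F' = height F \<and> log_height c1 c2 (height F') (card (verts F)) \<and>
          finite W \<and> real (card W) \<le> C * (1 + log 2 (card (verts F))) \<and>
          (\<forall>(B :: (nat, 'a label) dbuta) X.
            is_dbuta B \<longrightarrow> rep_dbuta code B m \<longrightarrow>
            is_enum_ds F B X \<longrightarrow> rep_enum_ds F B X m \<longrightarrow>
            (\<exists>X' m'' t'.
              exec (2 ^ (K * w)) P2 m' t' m'' \<and>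
              real t' \<le> C * (real (card (states B)))\<^sup>2 * (1 + log 2 (card (verts F))) \<and>
              rep_slp code F' m'' \<and> rep_dbuta code B m'' \<and>
              is_enum_ds F' B X' \<and> rep_enum_ds F' B X' m''))))"
proof (rule exI[of _ extend_program], rule exI[of _ update_program], intro allI impI)
  fix c1 c2 :: real assume c12: "0 < c1" "0 < c2"
  obtain c where c: "\<And>n l. 1 \<le> n \<Longrightarrow> 1 \<le> l \<Longrightarrow> update_time n l \<le> c * n\<^sup>2 * l" using update_time_le by blast
  define g where "g = bcost (Less (Num 1) (Cell ''kind'' (reg ''u'')))"
  define A B where "A = ctime extend_init + (1 + g + ctime extend_final)" and "B = 1 + g + ctime descend_body"
  \<comment> \<open>The path length is at most the height, so \<open>1 + len\<close> is at most
    \<open>(1 + c2) * (1 + log N)\<close>. The constants \<open>A\<close>, \<open>B\<close> and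
    \<open>c\<close> stem from the fixed part of the first program, from one step of the descent,
    and from the update of one vertex relative to \<open>|Q|^2\<close>.\<close>
  define C where "C = real (A + B + c + 1) * (1 + c2)"
  show "\<exists>(C :: real) (K :: nat).
      \<forall>(F :: (nat, 'a label) rooted_bdag) (v :: vertex) (k :: nat) (a :: 'a) (w :: nat) (m :: mem).
        rooted_f_slp F \<longrightarrow> all_reachable F \<longrightarrow>
        log_height c1 c2 (height F) (card (verts F)) \<longrightarrow>
        v \<in> vertices (sem F (root_vertex F)) \<longrightarrow> is_preorder_number (sem F (root_vertex F)) v k \<longrightarrow>
        rep_slp code F m \<longrightarrow> rep_sizes F m \<longrightarrow> m ''k'' 0 = k \<longrightarrow> m ''a'' 0 = code a \<longrightarrow>
        slp_size F \<le> w \<longrightarrow> (\<forall>x i. m x i < 2 ^ w) \<longrightarrow>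
        (\<exists>(F' :: (nat, 'a label) rooted_bdag) W m' t.
          exec (2 ^ (K * w)) extend_program m t m' \<and>
          real t \<le> C * (1 + log 2 (card (verts F))) \<and>
          rep_slp code F' m' \<and>
          rooted_f_slp F' \<and> is_extension F W F' \<and>
          sem F' (root_vertex F') = relabel (sem F (root_vertex F)) v (Some a) \<and>
          height F' = height F \<and> log_height c1 c2 (height F') (card (verts F)) \<and>
          finite W \<and> real (card W) \<le> C * (1 + log 2 (card (verts F))) \<and>
          (\<forall>(B :: (nat, 'a label) dbuta) X.
            is_dbuta B \<longrightarrow> rep_dbuta code B m \<longrightarrow>
            is_enum_ds F B X \<longrightarrow> rep_enum_ds F B X m \<longrightarrow>
            (\<exists>X' m'' t'.
              exec (2 ^ (K * w)) update_program m' t' m'' \<and>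
              real t' \<le> C * (real (card (states B)))\<^sup>2 * (1 + log 2 (card (verts F))) \<and>
              rep_slp code F' m'' \<and> rep_dbuta code B m'' \<and>
              is_enum_ds F' B X' \<and> rep_enum_ds F' B X' m'')))"
  \<comment> \<open>\<open>2400 = 60 * 8 * 5\<close>: expressions have at most 60 leaves,
    \<open>M\<close> is the eighth power of \<open>b\<close>, and
    \<open>b = 2 ^ (5 * w)\<close>.\<close>
  proof (rule exI[of _ C], rule exI[of _ 2400], intro allI impI)
    fix F :: "(nat, 'a label) rooted_bdag" and v k a w and m :: mem
    assume F: "rooted_f_slp F" and h: "log_height c1 c2 (height F) (card (verts F))"
      and k: "is_preorder_number (sem F (root_vertex F)) v k"
      and slp: "rep_slp code F m" and sizes: "rep_sizes F m" and ka: "m ''k'' 0 = k" "m ''a'' 0 = code a"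
      and w: "slp_size F \<le> w" "\<forall>x i. m x i < 2 ^ w"
    have fs: "fslp F" and root: "root_vertex F \<in> verts F" and forest: "None \<notin> set (labs (sem F (root_vertex F)))"
      using F by (auto simp: rooted_f_slp_def fslp_iff is_forest_iff)
    have vl: "verts F = {..<m ''N'' 0}" using slp by (simp add: rep_slp_def)
    have k_less: "k < length (labs (sem F (root_vertex F)))" using k by (simp add: is_preorder_number_def length_preorder)
    \<comment> \<open>This \<open>b\<close> exceeds all cells of the input and, as \<open>w\<close>
      is at least 1, is at least 16 and larger than the number of vertices of the extension, which
      is at most \<open>2 * w\<close>.\<close>
    define b M where "b = (2 :: nat) ^ (5 * w)" and "M = b ^ 8"
    have Nw: "card (verts F) \<le> w" using w(1) by (simp add: slp_size_def)
    have N1: "1 \<le> card (verts F)" using root vl by auto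
    have w1: "1 \<le> w" using Nw N1 by linarith
    have wb: "2 ^ w \<le> b" unfolding b_def by (intro power_increasing) auto
    have b16: "16 \<le> b"
    proof -
      have "(2 :: nat) ^ 5 \<le> 2 ^ (5 * w)" using w1 by (intro power_increasing) auto
      then show ?thesis by (simp add: b_def)
    qed
    have M: "8 * b \<le> M" "16 \<le> M" "b ^ 8 \<le> M"
    proof -
      have "b * b ^ 1 \<le> b * b ^ 7" using b16 by (intro mult_le_mono2 power_increasing) auto
      then have "b * b \<le> M" by (simp add: M_def flip: power_Suc)
      moreover have "8 * b \<le> b * b" using b16 by (intro mult_le_mono1) simp
      ultimately show "8 * b \<le> M" "16 \<le> M" using b16 by linarith+
    qed (simp add: M_def)
    have MW: "M ^ 60 = 2 ^ (2400 * w)" unfolding M_def b_def power_mult[symmetric] by (rule arg_cong[of _ _ "(^) 2"]) simp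
    interpret R: relabelling_run F k a code m b M 60
    proof (intro relabelling_run.intro relabelling.intro relabelling_axioms.intro relabelling_run_axioms.intro fs slp sizes ka M root)
      show "verts F = {..<card (verts F)}" using vl by simp
      show "k < vlen F (root_vertex F)" using k_less by (simp add: vlen_def)
      show "labs (sem F (root_vertex F)) ! k \<noteq> None" using forest k_less by (metis nth_mem)
      show "m x i < b" for x i using w(2) wb less_le_trans by blast
    qed simp
    let ?F' = "copy_path F k a"
    let ?N = "card (verts F)"
    have log0: "0 \<le> log 2 ?N" using N1 by simp
    have "real R.len \<le> c2 * log 2 ?N" using R.len_le_height h by (simp add: log_height_def)
    moreover have "0 \<le> c2 * 1 + 1 * log 2 ?N" using c12 log0 by simp
    ultimately have len: "1 + real R.len \<le> (1 + c2) * (1 + log 2 ?N)" by (simp add: algebra_simps)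
    have rest: "real x * (1 + real R.len) \<le> C * (1 + log 2 ?N)" if "x \<le> A + B + c + 1" for x
    proof -
      have "real x * (1 + real R.len) \<le> real (A + B + c + 1) * ((1 + c2) * (1 + log 2 ?N))"
        using that len by (intro mult_mono) auto
      then show ?thesis by (simp add: C_def mult.assoc)
    qed
    have Nlen: "?N + R.len + 1 < b"
    proof -
      have "?N + R.len + 1 \<le> 2 * w" using R.len_less Nw by linarith
      also have "\<dots> < 2 * 2 ^ w" using less_exp[of w] by simp
      also have "\<dots> = 2 ^ Suc w" by simp
      also have "\<dots> \<le> b" unfolding b_def using w1 by (intro power_increasing) auto
      finally show ?thesis .
    qed
    have bm: "bd M m" unfolding bd_def
    proof (intro allI)
      fix x i
      have "m x i < 2 ^ w" using w(2) by blast
      then show "m x i < M" using wb M(1) by linarith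
    qed
    from R.extend_correct bm obtain t m' where
      run: "exec (M ^ 60) extend_program m t m'" and bm': "bd M m'" and post: "R.Post m'"
      and t: "t \<le> ctime extend_init + (1 + g + R.len * (1 + g + ctime descend_body) + ctime extend_final)"
      unfolding ht_def g_def by blast
    have "t \<le> A + R.len * B" using t by (simp add: A_def B_def)
    also have "\<dots> \<le> (A + B) * (1 + R.len)" by (simp add: algebra_simps)
    finally have "real t \<le> real ((A + B) * (1 + R.len))" by (rule of_nat_mono)
    also have "\<dots> = real (A + B) * (1 + real R.len)" by (simp only: of_nat_mult of_nat_add of_nat_1)
    also have "\<dots> \<le> C * (1 + log 2 ?N)" by (rule rest) simp
    finally have t: "real t \<le> C * (1 + log 2 ?N)" .
    have sem': "sem ?F' (root_vertex ?F') = relabel (sem F (root_vertex F)) v (Some a)"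
      using k relabel_preorder[OF k_less] by (simp add: R.sem_root' is_preorder_number_def)
    have rooted': "rooted_f_slp ?F'"
    proof -
      have "None \<notin> set (labs (sem ?F' (root_vertex ?F')))"
        unfolding R.sem_root' labs_relabel_nth using forest set_update_subset_insert by fastforce
      then show ?thesis using R.fslp' by (simp add: rooted_f_slp_def fslp_iff is_forest_iff R.verts' R.root')
    qed
    show "\<exists>(F' :: (nat, 'a label) rooted_bdag) W m' t.
          exec (2 ^ (2400 * w)) extend_program m t m' \<and>
          real t \<le> C * (1 + log 2 (card (verts F))) \<and>
          rep_slp code F' m' \<and>
          rooted_f_slp F' \<and> is_extension F W F' \<and>
          sem F' (root_vertex F') = relabel (sem F (root_vertex F)) v (Some a) \<and>
          height F' = height F \<and> log_height c1 c2 (height F') (card (verts F)) \<and>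
          finite W \<and> real (card W) \<le> C * (1 + log 2 (card (verts F))) \<and>
          (\<forall>(B :: (nat, 'a label) dbuta) X.
            is_dbuta B \<longrightarrow> rep_dbuta code B m \<longrightarrow>
            is_enum_ds F B X \<longrightarrow> rep_enum_ds F B X m \<longrightarrow>
            (\<exists>X' m'' t'.
              exec (2 ^ (2400 * w)) update_program m' t' m'' \<and>
              real t' \<le> C * (real (card (states B)))\<^sup>2 * (1 + log 2 (card (verts F))) \<and>
              rep_slp code F' m'' \<and> rep_dbuta code B m'' \<and>
              is_enum_ds F' B X' \<and> rep_enum_ds F' B X' m''))"
    proof (intro exI[of _ ?F'] exI[of _ "{?N..?N + R.len}"] exI[of _ m'] exI[of _ t] conjI allI impI)
      show "exec (2 ^ (2400 * w)) extend_program m t m'" using run by (simp only: MW)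
      show "rep_slp code ?F' m'" by (rule R.Post_rep(1)[OF post])
      show "log_height c1 c2 (height ?F') ?N" using h by (simp add: R.height')
      show "real (card {?N..?N + R.len}) \<le> C * (1 + log 2 ?N)" using rest[of 1] by simp
      fix Bu :: "(nat, 'a label) dbuta" and X
      assume Bu: "is_dbuta Bu" "rep_dbuta code Bu m" and X: "is_enum_ds F Bu X" "rep_enum_ds F Bu X m"
      interpret E0: enumeration F Bu using Bu(1) by unfold_locales
      obtain ol where ol: "lists_opts F Bu ol" "ds_nodes X = comb_nodes F Bu ol" "ds_edges X = comb_edges F Bu ol"
        using X(1) unfolding E0.is_enum_ds_iff by blast
      interpret E: enum_run F ?F' Bu "m ''Q'' 0" X ol code m' b M 60 ?N "?N + R.len + 1"
        using R.enum_run_Post[OF post Bu X ol Nlen M(3) b16] by simp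
      let ?n = "m ''Q'' 0"
      have n: "card (states Bu) = ?n" using E.states by simp
      \<comment> \<open>The transition for any letter yields a state, so the number of states is
        positive, as \<open>c\<close> requires.\<close>
      have "delta0 Bu (Sym undefined) False \<in> states Bu" using Bu(1) by (simp add: is_dbuta_def Sigma0_def)
      then have n1: "1 \<le> ?n" using E.states by auto
      from E.update_ht bm' obtain t' m'' where
        run': "exec (M ^ 60) update_program m' t' m''" and t': "t' \<le> update_time ?n (?N + R.len + 1 - ?N)"
        and fin: "E.VI (?N + R.len + 1 - ?N) m''"
        unfolding ht_def by blast
      have "t' \<le> c * ?n\<^sup>2 * (1 + R.len)" using t' c[OF n1, of "1 + R.len"] by simp
      then have "real t' \<le> real (c * ?n\<^sup>2 * (1 + R.len))" by (rule of_nat_mono)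
      also have "\<dots> = (real ?n)\<^sup>2 * (real c * (1 + real R.len))"
        by (simp only: of_nat_mult of_nat_power of_nat_add of_nat_1 mult_ac)
      also have "\<dots> \<le> (real ?n)\<^sup>2 * (C * (1 + log 2 ?N))" by (intro mult_left_mono rest) auto
      finally have t': "real t' \<le> C * (real (card (states Bu)))\<^sup>2 * (1 + log 2 ?N)" by (simp add: n mult_ac)
      show "\<exists>X' m'' t'. exec (2 ^ (2400 * w)) update_program m' t' m'' \<and>
              real t' \<le> C * (real (card (states Bu)))\<^sup>2 * (1 + log 2 ?N) \<and>
              rep_slp code ?F' m'' \<and> rep_dbuta code Bu m'' \<and>
              is_enum_ds ?F' Bu X' \<and> rep_enum_ds ?F' Bu X' m''"
        using run' t' E.VI_final[OF fin] E.enum' unfolding MW by blast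
    qed (use t sem' rooted' R.extension R.height' in auto)
  qed
qed

end
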